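(* Let $d\in\{1,2,3\}$ and consider the fourth-order parabolic setting described in the context, with an arbitrary sequence of positive integers $m_n\to\infty$. Assume that $b,\sigma:\mathbb R\to\mathbb R$ are continuously differentiable with bounded first derivatives and that $\sigma$ is nowhere zero. Then, for every $x_0\in\mathcal O$ and every fixed $n$, the family $\{u_{\varepsilon,n}(T,x_0)\}_{\varepsilon>0}$ satisfies as $\varepsilon\to0$ a large deviation principle on $\mathbb R$ (with speed $1/\varepsilon$) with good rate function $$I_d^{n,m_n}(y)=\inf_{\{h_n\in\mathcal X_n:\ \Upsilon_n(h_n)(T,x_0)=y\}}\tfrac12\|h_n\|_{L^2(\mathcal O_T)}^2,$$ and, for every $x_0\in\mathcal O$ and $y\in\mathbb R$, $I_d^{n,m_n}(y)\to I_d(y)$ as $n\to\infty$. In particular, let $y\in\mathbb R$ with $I_d(y)<+\infty$, let $\epsilon_n\ge0$, $\epsilon_n\to0$, and let $h_n\in\mathcal X_n$ satisfy $\Upsilon_n(h_n)(T,x_0)=y$ and $\frac12\|h_n\|_{L^2(\mathcal O_T)}^2\le I_d^{n,m_n}(y)+\epsilon_n$; put $u_n:=\Upsilon_n(h_n)$. Then there exist a subsequence $\{n_k\}$ and $h^*\in L^2(\mathcal O_T)$ such that, with $u^*:=\Upsilon(h^* )$, $h_{n_k}\to h^*$ in $L^2(\mathcal O_T)$, $u_{n_k}\to u^*$ in $C(\overline{\mathcal O_T})$, $u^*(T,x_0)=y$ and $\frac12\|h^*\|_{L^2(\mathcal O_T)}^2=I_d(y)$; consequently $h^*$ attains the infimum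 defining $I_d(y)$ and $u^*$ minimizes $\mathcal J_y$ over $C(\overline{\mathcal O_T})$. If the minimizer $h$ in the definition of $I_d(y)$ is unique, then the full sequences satisfy $h_n\to h^*$ in $L^2(\mathcal O_T)$ and $u_n\to u^*$ in $C(\overline{\mathcal O_T})$.
   Context: $\mathcal O=(0,\pi)^d$, $T>0$, $\mathcal O_T=(0,T)\times\mathcal O$, $\overline{\mathcal O_T}=[0,T]\times\overline{\mathcal O}$, $W$ a Brownian sheet on $\mathcal O_T$, $\mathbb N=\{1,2,\dots\}$, $\varphi_{\mathbf k}(x)=(2/\pi)^{d/2}\prod_{\ell=1}^d\sin(k_\ell x_\ell)$ for $\mathbf k\in\mathbb N^d$. Continuous problem (for $\partial_tu+\Delta^2u=b(u)+\sqrt\varepsilon\,\sigma(u)\dot W$, $u(0)=0$, $u=\Delta u=0$ on $\partial\mathcal O$): $G_r(x,z)=\sum_{\mathbf k\in\mathbb N^d}e^{-r|\mathbf k|^4}\varphi_{\mathbf k}(x)\varphi_{\mathbf k}(z)$, $r>0$. For $h\in L^2(\mathcal O_T)$, $\Upsilon(h)=u\in C(\overline{\mathcal O_T})$ is the unique solution of $u(t,x)=\int_0^t\int_{\mathcal O}G_{t-s}(x,z)[b(u(s,z))+\sigma(u(s,z))h(s,z)]dzds$. $I_d(y)=\inf\{\frac12\|h\|^2_{L^2(\mathcal O_T)}:h\in L^2(\mathcal O_T),\Upsilon(h)(T,x_0)=y\}$ and $\mathcal J_y(f)=\inf\{\frac12\|h\|^2_{L^2(\mathcal O_T)}:\Upsilon(h)=f,\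 f(T,x_0)=y\}$, with $\inf\emptyset=+\infty$. Discrete problem ($n\ge2$; spatial finite differences and implicit Euler in time): $\Delta x_n=\pi/n$, $\tau_n=T/m_n$, $t_j=j\tau_n$, $\lfloor s\rfloor_n=t_j$ for $s\in[t_j,t_{j+1})$; $\mathbb I_n=\{0,\dots,n-1\}^d$, $\mathbb J_n=\{1,\dots,n-1\}^d$; $C_{n,\mathbf k}=\prod_{\ell=1}^d[k_\ell\Delta x_n,(k_\ell+1)\Delta x_n)$ for $\mathbf k\in\mathbb I_n$ (intersected with $\mathcal O$), $\kappa_n(z)=\Delta x_n\mathbf k$ for $z\in C_{n,\mathbf k}$. $\mu_{\mathbf k,n}=\frac{4}{(\Delta x_n)^2}\sum_{\ell=1}^d\sin^2(\frac{k_\ell\pi}{2n})$. $\varphi^n_{\mathbf k}$ is the continuous function on $\overline{\mathcal O}$ that is, on each cell, the multilinear interpolation of the values of $\varphi_{\mathbf k}$ at the vertices of the cell. $\chi_n(\mu)=(1+\tau_n\mu^2)^{-1}$; $q_n(r,\mu)=\chi_n(\mu)$ for $0\le r\le\tau_n$, and $q_n(r,\mu)=(1-\theta)\chi_n(\mu)^\ell+\theta\chi_n(\mu)^{\ell+1}$ for $r\in[\ell\tau_n,(\ell+1)\tau_n]$, $\ell\ge1$, $\theta=r/\tau_n-\ell$. $$G_n(t,r;x,z)=\sum_{\mathbf k\in\mathbb J_n}q_n(t-r,\mu_{\mathbf k,n})\varphi^n_{\mathbf k}(x)\varphi_{\mathbf k}(\kappa_n(z)),\quad 0\le r<t\le T.$$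 The numerical solution is the random field defined (recursively over time steps) by $$u_{\varepsilon,n}(t,x)=\int_0^t\!\int_{\mathcal O}G_n(t,\lfloor s\rfloor_n;x,z)b(u_{\varepsilon,n}(\lfloor s\rfloor_n,\kappa_n(z)))dzds+\sqrt\varepsilon\int_0^t\!\int_{\mathcal O}G_n(t,\lfloor s\rfloor_n;x,z)\sigma(u_{\varepsilon,n}(\lfloor s\rfloor_n,\kappa_n(z)))W(ds,dz).$$ $\mathcal X_n\subset L^2(\mathcal O_T)$ is the space of functions constant on every cell $[t_j,t_{j+1})\times C_{n,\mathbf k}$, $0\le j<m_n$, $\mathbf k\in\mathbb I_n$. For $h_n\in\mathcal X_n$, $\Upsilon_n(h_n)=u_n\in C(\overline{\mathcal O_T})$ is the solution of $u_n(t,x)=\int_0^t\int_{\mathcal O}G_n(t,\lfloor s\rfloor_n;x,z)[b(u_n(\lfloor s\rfloor_n,\kappa_n(z)))+\sigma(u_n(\lfloor s\rfloor_n,\kappa_n(z)))h_n(s,z)]dzds$. *)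

theory Defs
  imports "HOL-Probability.Probability"
begin

text \<open>
  The spatial dimension is \<open>CARD('d)\<close>; points of space-time are pairs \<open>(t, x) :: real \<times> (real ^ 'd)\<close>
  and multi-indices are functions \<open>k :: 'd \<Rightarrow> nat\<close>.
\<close>

section \<open>Domains and function spaces\<close>

definition cube :: "(real ^ 'd) set" where
  "cube = {x. \<forall>l. 0 < x $ l \<and> x $ l < pi}"

definition cyl :: "real \<Rightarrow> (real \<times> (real ^ 'd)) set" where
  "cyl T = {0<..<T} \<times> cube"

definition closed_cyl :: "real \<Rightarrow> (real \<times> (real ^ 'd)) set" where
  "closed_cyl T = {0..T} \<times> closure cube"

text \<open>
  Elements of \<open>L\<^sup>2\<close> are represented by Borel functions; only the values on \<open>cyl T\<close> matter, and
  equality in \<open>L\<^sup>2\<close> is equality almost everywhere on \<open>cyl T\<close>.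
\<close>

definition L2_cyl :: "real \<Rightarrow> (real \<times> (real ^ 'd) \<Rightarrow> real) set" where
  "L2_cyl T = {h. set_borel_measurable lborel (cyl T) h \<and>
                  set_integrable lborel (cyl T) (\<lambda>p. (h p)\<^sup>2)}"

definition L2_norm_cyl :: "real \<Rightarrow> (real \<times> (real ^ 'd) \<Rightarrow> real) \<Rightarrow> real" where
  "L2_norm_cyl T h = sqrt (set_lebesgue_integral lborel (cyl T) (\<lambda>p. (h p)\<^sup>2))"

definition energy :: "real \<Rightarrow> (real \<times> (real ^ 'd) \<Rightarrow> real) \<Rightarrow> real" where
  "energy T h = (L2_norm_cyl T h)\<^sup>2 / 2"

definition C1_bounded_deriv :: "(real \<Rightarrow> real) \<Rightarrow> bool" where
  "C1_bounded_deriv f \<longleftrightarrow>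
     (\<forall>r. f differentiable (at r)) \<and> continuous_on UNIV (deriv f) \<and> bounded (range (deriv f))"

section \<open>The continuous problem\<close>

definition eigfun :: "('d::finite \<Rightarrow> nat) \<Rightarrow> real ^ 'd \<Rightarrow> real" where
  "eigfun k x = (2 / pi) powr (real CARD('d) / 2) * (\<Prod>l\<in>UNIV. sin (real (k l) * x $ l))"

definition green :: "real \<Rightarrow> real ^ 'd \<Rightarrow> real ^ 'd \<Rightarrow> real" where
  "green r x z =
     (\<Sum>\<^sub>\<infinity>k\<in>{k :: 'd::finite \<Rightarrow> nat. \<forall>l. 1 \<le> k l}.
        exp (- r * (\<Sum>l\<in>UNIV. (real (k l))\<^sup>2)\<^sup>2) * eigfun k x * eigfun k z)"

definition is_skeleton_solution ::
  "real \<Rightarrow> (real \<Rightarrow> real) \<Rightarrow> (real \<Rightarrow> real) \<Rightarrow> (real \<times> (real ^ 'd) \<Rightarrow> real)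
     \<Rightarrow> (real \<times> (real ^ 'd) \<Rightarrow> real) \<Rightarrow> bool" where
  "is_skeleton_solution T b \<sigma> h u \<longleftrightarrow>
     continuous_on (closed_cyl T) u \<and>
     (\<forall>(t, x)\<in>closed_cyl T.
        u (t, x) = set_lebesgue_integral lborel ({0<..<t} \<times> cube)
          (\<lambda>(s, z). green (t - s) x z * (b (u (s, z)) + \<sigma> (u (s, z)) * h (s, z))))"

text \<open>Extensionality only fixes the irrelevant values outside the closed cylinder.\<close>

definition Upsilon ::
  "real \<Rightarrow> (real \<Rightarrow> real) \<Rightarrow> (real \<Rightarrow> real) \<Rightarrow> (real \<times> (real ^ 'd) \<Rightarrow> real)
     \<Rightarrow> real \<times> (real ^ 'd) \<Rightarrow> real" where
  "Upsilon T b \<sigma> h =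
     (THE u. u \<in> extensional (closed_cyl T) \<and> is_skeleton_solution T b \<sigma> h u)"

definition rate ::
  "real \<Rightarrow> (real \<Rightarrow> real) \<Rightarrow> (real \<Rightarrow> real) \<Rightarrow> real ^ 'd \<Rightarrow> real \<Rightarrow> ereal" where
  "rate T b \<sigma> x0 y =
     Inf {ereal (energy T h) | h. h \<in> L2_cyl T \<and> Upsilon T b \<sigma> h (T, x0) = y}"

definition is_rate_minimizer ::
  "real \<Rightarrow> (real \<Rightarrow> real) \<Rightarrow> (real \<Rightarrow> real) \<Rightarrow> real ^ 'd \<Rightarrow> real
     \<Rightarrow> (real \<times> (real ^ 'd) \<Rightarrow> real) \<Rightarrow> bool" where
  "is_rate_minimizer T b \<sigma> x0 y h \<longleftrightarrow>
     h \<in> L2_cyl T \<and> Upsilon T b \<sigma> h (T, x0) = y \<and> ereal (energy T h) = rate T b \<sigma> x0 y"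

definition path_cost ::
  "real \<Rightarrow> (real \<Rightarrow> real) \<Rightarrow> (real \<Rightarrow> real) \<Rightarrow> real ^ 'd \<Rightarrow> real
     \<Rightarrow> (real \<times> (real ^ 'd) \<Rightarrow> real) \<Rightarrow> ereal" where
  "path_cost T b \<sigma> x0 y f =
     Inf {ereal (energy T h) | h. h \<in> L2_cyl T \<and>
            (\<forall>p\<in>closed_cyl T. Upsilon T b \<sigma> h p = f p) \<and> f (T, x0) = y}"

section \<open>The discretization\<close>

text \<open>Throughout, \<open>n\<close> is the spatial and \<open>m\<close> the temporal number of subdivisions.\<close>

definition dx :: "nat \<Rightarrow> real" where
  "dx n = pi / real n"

definition dt :: "real \<Rightarrow> nat \<Rightarrow> real" where
  "dt T m = T / real m"

definition time_floor :: "real \<Rightarrow> nat \<Rightarrow> real \<Rightarrow> real" where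
  "time_floor T m s = dt T m * of_int \<lfloor>s / dt T m\<rfloor>"

definition cell_idx :: "nat \<Rightarrow> ('d \<Rightarrow> nat) set" where
  "cell_idx n = {k. \<forall>l. k l < n}"

definition mode_idx :: "nat \<Rightarrow> ('d \<Rightarrow> nat) set" where
  "mode_idx n = {k. \<forall>l. 1 \<le> k l \<and> k l < n}"

definition grid_pt :: "nat \<Rightarrow> ('d::finite \<Rightarrow> nat) \<Rightarrow> real ^ 'd" where
  "grid_pt n k = (\<chi> l. dx n * real (k l))"

definition space_cell :: "nat \<Rightarrow> ('d::finite \<Rightarrow> nat) \<Rightarrow> (real ^ 'd) set" where
  "space_cell n k = {z\<in>cube. \<forall>l. real (k l) * dx n \<le> z $ l \<and> z $ l < (real (k l) + 1) * dx n}"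

definition kappa :: "nat \<Rightarrow> real ^ 'd \<Rightarrow> real ^ 'd" where
  "kappa n z = (\<chi> l. dx n * of_int \<lfloor>z $ l / dx n\<rfloor>)"

definition mu :: "nat \<Rightarrow> ('d::finite \<Rightarrow> nat) \<Rightarrow> real" where
  "mu n k = 4 / (dx n)\<^sup>2 * (\<Sum>l\<in>UNIV. (sin (real (k l) * pi / (2 * real n)))\<^sup>2)"

text \<open>
  Multilinear interpolation of \<open>eigfun k\<close>: \<open>base_idx n x\<close> is the index of a cell whose closure
  contains \<open>x\<close> (the minimum takes care of the faces \<open>x $ l = pi\<close>), and a set \<open>S\<close> of coordinates
  encodes the vertex of that cell whose index is raised by one in exactly the directions in \<open>S\<close>.
\<close>

definition base_idx :: "nat \<Rightarrow> real ^ 'd \<Rightarrow> 'd \<Rightarrow> nat" where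
  "base_idx n x l = min (nat \<lfloor>x $ l / dx n\<rfloor>) (n - 1)"

definition eigfun_interp :: "nat \<Rightarrow> ('d::finite \<Rightarrow> nat) \<Rightarrow> real ^ 'd \<Rightarrow> real" where
  "eigfun_interp n k x =
     (\<Sum>S\<in>(UNIV :: 'd set set).
        (\<Prod>l\<in>UNIV. if l \<in> S then x $ l / dx n - real (base_idx n x l)
                   else 1 - (x $ l / dx n - real (base_idx n x l))) *
        eigfun k (grid_pt n (\<lambda>l. base_idx n x l + (if l \<in> S then 1 else 0))))"

definition euler_factor :: "real \<Rightarrow> nat \<Rightarrow> real \<Rightarrow> real" where
  "euler_factor T m \<mu> = 1 / (1 + dt T m * \<mu>\<^sup>2)"

definition euler_interp :: "real \<Rightarrow> nat \<Rightarrow> real \<Rightarrow> real \<Rightarrow> real" where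
  "euler_interp T m r \<mu> =
     (if r \<le> dt T m then euler_factor T m \<mu>
      else let i = nat \<lfloor>r / dt T m\<rfloor>; \<theta> = r / dt T m - real i
           in (1 - \<theta>) * euler_factor T m \<mu> ^ i + \<theta> * euler_factor T m \<mu> ^ (i + 1))"

definition green_disc ::
  "real \<Rightarrow> nat \<Rightarrow> nat \<Rightarrow> real \<Rightarrow> real \<Rightarrow> real ^ 'd \<Rightarrow> real ^ 'd \<Rightarrow> real" where
  "green_disc T m n t r x z =
     (\<Sum>k\<in>mode_idx n. euler_interp T m (t - r) (mu n k) * eigfun_interp n k x * eigfun k (kappa n z))"

definition X_space :: "real \<Rightarrow> nat \<Rightarrow> nat \<Rightarrow> (real \<times> (real ^ 'd) \<Rightarrow> real) set" where
  "X_space T m n =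
     {h\<in>L2_cyl T. \<forall>j<m. \<forall>k\<in>cell_idx n.
        h constant_on (({real j * dt T m..<real (j + 1) * dt T m} \<times> space_cell n k) \<inter> cyl T)}"

definition is_disc_skeleton_solution ::
  "real \<Rightarrow> (real \<Rightarrow> real) \<Rightarrow> (real \<Rightarrow> real) \<Rightarrow> nat \<Rightarrow> nat \<Rightarrow> (real \<times> (real ^ 'd) \<Rightarrow> real)
     \<Rightarrow> (real \<times> (real ^ 'd) \<Rightarrow> real) \<Rightarrow> bool" where
  "is_disc_skeleton_solution T b \<sigma> m n h u \<longleftrightarrow>
     continuous_on (closed_cyl T) u \<and>
     (\<forall>(t, x)\<in>closed_cyl T.
        u (t, x) = set_lebesgue_integral lborel ({0<..<t} \<times> cube)
          (\<lambda>(s, z). green_disc T m n t (time_floor T m s) x z *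
             (b (u (time_floor T m s, kappa n z)) +
              \<sigma> (u (time_floor T m s, kappa n z)) * h (s, z))))"

definition Upsilon_disc ::
  "real \<Rightarrow> (real \<Rightarrow> real) \<Rightarrow> (real \<Rightarrow> real) \<Rightarrow> nat \<Rightarrow> nat \<Rightarrow> (real \<times> (real ^ 'd) \<Rightarrow> real)
     \<Rightarrow> real \<times> (real ^ 'd) \<Rightarrow> real" where
  "Upsilon_disc T b \<sigma> m n h =
     (THE u. u \<in> extensional (closed_cyl T) \<and> is_disc_skeleton_solution T b \<sigma> m n h u)"

definition rate_disc ::
  "real \<Rightarrow> (real \<Rightarrow> real) \<Rightarrow> (real \<Rightarrow> real) \<Rightarrow> nat \<Rightarrow> nat \<Rightarrow> real ^ 'd \<Rightarrow> real \<Rightarrow> ereal" where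
  "rate_disc T b \<sigma> m n x0 y =
     Inf {ereal (energy T h) | h. h \<in> X_space T m n \<and> Upsilon_disc T b \<sigma> m n h (T, x0) = y}"

section \<open>Brownian sheet and the numerical solution\<close>

text \<open>Gaussian laws may be degenerate.\<close>

definition gaussian_rv :: "'w measure \<Rightarrow> ('w \<Rightarrow> real) \<Rightarrow> bool" where
  "gaussian_rv M X \<longleftrightarrow> X \<in> borel_measurable M \<and>
     (\<exists>m s. (s = 0 \<and> (AE w in M. X w = m)) \<or>
            (s > 0 \<and> distributed M lborel X (\<lambda>r. ennreal (normal_density m s r))))"

definition brownian_sheet ::
  "'w measure \<Rightarrow> real \<Rightarrow> (real \<times> (real ^ 'd) \<Rightarrow> 'w \<Rightarrow> real) \<Rightarrow> bool" where
  "brownian_sheet M T W \<longleftrightarrow>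
     prob_space M \<and>
     (\<forall>A c. finite A \<and> A \<subseteq> closed_cyl T \<longrightarrow> gaussian_rv M (\<lambda>w. \<Sum>p\<in>A. c p * W p w)) \<and>
     (\<forall>p\<in>closed_cyl T. (\<integral>w. W p w \<partial>M) = 0) \<and>
     (\<forall>(s, x)\<in>closed_cyl T. \<forall>(t, y)\<in>closed_cyl T.
        (\<integral>w. W (s, x) w * W (t, y) w \<partial>M) = min s t * (\<Prod>l\<in>UNIV. min (x $ l) (y $ l))) \<and>
     (AE w in M. continuous_on (closed_cyl T) (\<lambda>p. W p w))"

text \<open>
  Noise assigned to the rectangle between times \<open>s \<le> t\<close> with opposite spatial corners \<open>p\<close> and \<open>q\<close>:
  the rectangular increment of the sheet, by inclusion-exclusion over the vertices (a set \<open>S\<close> of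
  coordinates encodes the vertex that agrees with \<open>p\<close> in the directions in \<open>S\<close> and with \<open>q\<close>
  elsewhere).
\<close>

definition sheet_increment ::
  "(real \<times> (real ^ 'd) \<Rightarrow> 'w \<Rightarrow> real) \<Rightarrow> real \<Rightarrow> real \<Rightarrow> real ^ 'd \<Rightarrow> real ^ 'd \<Rightarrow> 'w \<Rightarrow> real" where
  "sheet_increment W s t p q w =
     (\<Sum>S\<in>(UNIV :: 'd::finite set set). (- 1) ^ card S *
        (W (t, \<chi> l. if l \<in> S then p $ l else q $ l) w -
         W (s, \<chi> l. if l \<in> S then p $ l else q $ l) w))"

text \<open>
  Walsh integral over \<open>(0, t) \<times> cube\<close> of an elementary integrand that depends on \<open>(s, z)\<close> only through
  \<open>(time_floor T m s, kappa n z)\<close>; \<open>\<Phi>\<close> gives its values at the grid points.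
\<close>

definition elementary_stoch_integral ::
  "(real \<times> (real ^ 'd) \<Rightarrow> 'w \<Rightarrow> real) \<Rightarrow> real \<Rightarrow> nat \<Rightarrow> nat \<Rightarrow> real
     \<Rightarrow> (real \<Rightarrow> real ^ 'd \<Rightarrow> real) \<Rightarrow> 'w \<Rightarrow> real" where
  "elementary_stoch_integral W T m n t \<Phi> w =
     (\<Sum>j<m. \<Sum>k\<in>cell_idx n.
        \<Phi> (real j * dt T m) (grid_pt n k) *
        sheet_increment W (min (real j * dt T m) t) (min (real (j + 1) * dt T m) t)
          (grid_pt n k) (grid_pt n (\<lambda>l. k l + 1)) w)"

text \<open>
  The equation is solved pathwise; its right-hand side at time \<open>t\<close> only involves the values of \<open>u\<close> at
  grid times before \<open>t\<close>, so it is a recursion over the time steps.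
\<close>

definition is_numerical_solution ::
  "real \<Rightarrow> (real \<Rightarrow> real) \<Rightarrow> (real \<Rightarrow> real) \<Rightarrow> nat \<Rightarrow> nat \<Rightarrow> (real \<times> (real ^ 'd) \<Rightarrow> 'w \<Rightarrow> real)
     \<Rightarrow> real \<Rightarrow> 'w \<Rightarrow> (real \<times> (real ^ 'd) \<Rightarrow> real) \<Rightarrow> bool" where
  "is_numerical_solution T b \<sigma> m n W \<epsilon> w u \<longleftrightarrow>
     (\<forall>(t, x)\<in>closed_cyl T.
        u (t, x) =
          set_lebesgue_integral lborel ({0<..<t} \<times> cube)
            (\<lambda>(s, z). green_disc T m n t (time_floor T m s) x z *
               b (u (time_floor T m s, kappa n z))) +
          sqrt \<epsilon> * elementary_stoch_integral W T m n t
            (\<lambda>s z. green_disc T m n t s x z * \<sigma> (u (s, z))) w)"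

definition numerical_solution ::
  "real \<Rightarrow> (real \<Rightarrow> real) \<Rightarrow> (real \<Rightarrow> real) \<Rightarrow> nat \<Rightarrow> nat \<Rightarrow> (real \<times> (real ^ 'd) \<Rightarrow> 'w \<Rightarrow> real)
     \<Rightarrow> real \<Rightarrow> 'w \<Rightarrow> real \<times> (real ^ 'd) \<Rightarrow> real" where
  "numerical_solution T b \<sigma> m n W \<epsilon> w =
     (THE u. u \<in> extensional (closed_cyl T) \<and> is_numerical_solution T b \<sigma> m n W \<epsilon> w u)"

section \<open>Large deviations\<close>

text \<open>The convention \<open>log 0 = -\<infinity>\<close> is needed here, whereas \<open>ln 0 = 0\<close> on the reals.\<close>

definition elog :: "real \<Rightarrow> ereal" where
  "elog p = (if p = 0 then - \<infinity> else ereal (ln p))"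

text \<open>Compact sublevel sets are closed, so lower semicontinuity is included.\<close>

definition good_rate_function :: "(real \<Rightarrow> ereal) \<Rightarrow> bool" where
  "good_rate_function I \<longleftrightarrow> (\<forall>y. 0 \<le> I y) \<and> (\<forall>a :: real. compact {y. I y \<le> ereal a})"

text \<open>Large deviation principle on the reals with speed \<open>1 / \<epsilon>\<close> as \<open>\<epsilon> \<rightarrow> 0+\<close>.\<close>

definition satisfies_LDP ::
  "'w measure \<Rightarrow> (real \<Rightarrow> 'w \<Rightarrow> real) \<Rightarrow> (real \<Rightarrow> ereal) \<Rightarrow> bool" where
  "satisfies_LDP M X I \<longleftrightarrow>
     (\<forall>\<epsilon>>0. X \<epsilon> \<in> borel_measurable M) \<and>
     (\<forall>F. closed F \<longrightarrow>
        Limsup (at_right 0) (\<lambda>\<epsilon>. ereal \<epsilon> * elog (measure M {w\<in>space M. X \<epsilon> w \<in> F}))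
          \<le> - (INF y\<in>F. I y)) \<and>
     (\<forall>G. open G \<longrightarrow>
        - (INF y\<in>G. I y)
          \<le> Liminf (at_right 0) (\<lambda>\<epsilon>. ereal \<epsilon> * elog (measure M {w\<in>space M. X \<epsilon> w \<in> G})))"

end

theory Submission
  imports Defs "HOL-Complex_Analysis.Great_Picard"
begin

text \<open>For fixed \<open>n\<close>, the solution of the discrete skeleton equation at \<open>(T, x0)\<close> is a continuous function \<open>F\<close>
  of the finitely many normalized cell values \<open>c\<close> of the control, and the numerical solution is the same
  function \<open>F\<close> of \<open>sqrt \<epsilon>\<close> times the normalized sheet increments over the cells, which form a standard
  Gaussian vector.  Hence the discrete rate function is the infimum of \<open>\<bar>c\<bar>\<^sup>2 / 2\<close> over \<open>F c = y\<close>, and the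
  large deviation principle reduces to finite-dimensional Gaussian tail bounds.

  In dimension at most three the discrete Green kernels are bounded in \<open>L\<^sup>2\<close> and converge to the continuous
  ones, because the sum of the inverse fourth powers of the frequencies is finite.  Along controls of bounded
  energy the discrete solutions are therefore equicontinuous, and a subsequence converges uniformly to the
  solution driven by some control of no larger energy; this is the lower bound for the limit of the rates.
  For the upper bound a given control is discretized, and the endpoint is corrected exactly, which is
  possible because \<open>\<sigma>\<close> has no zeros.  Once the energies of near minimizers converge to that of their limit,
  the parallelogram law upgrades the convergence of the controls to norm convergence.\<close>

section \<open>Square integrable functions\<close>

text \<open>Bounded controls need not converge in norm, and no weak topology is used. Its place is
  taken by \<open>l2_nested_convex\<close>: the controls that drive a given path up to small errors
  form nested midpoint-convex sets, and elements of nearly minimal norm in them converge to a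
  control that drives the path exactly and is asymptotically no longer than the given ones.
  Uniformity in \<open>n\<close> rests on orthonormality, which holds for the modes on the cube and,
  exactly, for the modes sampled at grid points. The squared norm of either kernel is thus bounded
  by a sum over modes of integrals of squared time factors. These are compared with
  \<open>1 / (1 + (t - s) * wt k)\<close> and not with an exponential, since implicit Euler damps
  high modes only algebraically; the integral of the square is still at most
  \<open>1 / wt k\<close>. Kernel convergence is proved along moving base points, and compactness of
  the closed cylinder makes it uniform. Existence of continuous skeleton solutions is a by-product
  of the compactness of discrete solutions with a fixed control.\<close>

definition sq_int :: "'a measure \<Rightarrow> ('a \<Rightarrow> real) \<Rightarrow> bool" where
  "sq_int M f \<longleftrightarrow> f \<in> borel_measurable M \<and> integrable M (\<lambda>x. (f x)\<^sup>2)"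

definition l2 :: "'a measure \<Rightarrow> ('a \<Rightarrow> real) \<Rightarrow> real" where
  "l2 M f = sqrt (\<integral>x. (f x)\<^sup>2 \<partial>M)"

lemma sq_int_measurable [measurable_dest]: "sq_int M f \<Longrightarrow> f \<in> borel_measurable M"
  by (simp add: sq_int_def)

lemma sq_int_integrable_sq: "sq_int M f \<Longrightarrow> integrable M (\<lambda>x. (f x)\<^sup>2)"
  by (simp add: sq_int_def)

lemma sq_int_prod:
  assumes "sq_int M f" "sq_int M g"
  shows "integrable M (\<lambda>x. f x * g x)"
proof (rule Bochner_Integration.integrable_bound)
  show "integrable M (\<lambda>x. (f x)\<^sup>2 + (g x)\<^sup>2)"
    using assms by (simp add: sq_int_def)
  show "AE x in M. norm (f x * g x) \<le> norm ((f x)\<^sup>2 + (g x)\<^sup>2)"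
  proof (rule AE_I2)
    fix x
    have "2 * \<bar>f x\<bar> * \<bar>g x\<bar> \<le> (f x)\<^sup>2 + (g x)\<^sup>2"
      using sum_squares_bound[of "\<bar>f x\<bar>" "\<bar>g x\<bar>"] by simp
    moreover have "0 \<le> \<bar>f x\<bar> * \<bar>g x\<bar>" by simp
    ultimately have "\<bar>f x\<bar> * \<bar>g x\<bar> \<le> (f x)\<^sup>2 + (g x)\<^sup>2" by linarith
    then show "norm (f x * g x) \<le> norm ((f x)\<^sup>2 + (g x)\<^sup>2)"
      by (simp add: abs_mult)
  qed
qed (use assms in measurable)

lemma sq_int_add: "sq_int M f \<Longrightarrow> sq_int M g \<Longrightarrow> sq_int M (\<lambda>x. f x + g x)"
  using sq_int_prod[of M f g] by (auto simp: sq_int_def power2_sum mult.assoc)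

lemma sq_int_cmult: "sq_int M f \<Longrightarrow> sq_int M (\<lambda>x. c * f x)"
  by (auto simp: sq_int_def power_mult_distrib)

lemma sq_int_diff: "sq_int M f \<Longrightarrow> sq_int M g \<Longrightarrow> sq_int M (\<lambda>x. f x - g x)"
  using sq_int_add[of M f "\<lambda>x. (-1) * g x"] sq_int_cmult[of M g "-1"] by simp

lemma sq_int_abs: "sq_int M f \<Longrightarrow> sq_int M (\<lambda>x. \<bar>f x\<bar>)"
  by (auto simp: sq_int_def)

lemma sq_int_bound:
  assumes "sq_int M g" "f \<in> borel_measurable M" "AE x in M. \<bar>f x\<bar> \<le> \<bar>g x\<bar>"
  shows "sq_int M f"
  unfolding sq_int_def
proof
  show "integrable M (\<lambda>x. (f x)\<^sup>2)"
    by (rule Bochner_Integration.integrable_bound[OF sq_int_integrable_sq[OF assms(1)]])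
       (use assms(2,3) in \<open>auto simp: abs_le_square_iff\<close>)
qed (fact assms(2))

lemma (in finite_measure) sq_int_const: "sq_int M (\<lambda>_. c)"
  by (auto simp: sq_int_def)

lemma (in finite_measure) sq_int_bounded:
  assumes "f \<in> borel_measurable M" "\<And>x. x \<in> space M \<Longrightarrow> \<bar>f x\<bar> \<le> C"
  shows "sq_int M f"
  by (rule sq_int_bound[OF sq_int_const[of C] assms(1)])
     (rule AE_I2, use assms(2) in fastforce)

lemma (in finite_measure) sq_int_integrable: "sq_int M f \<Longrightarrow> integrable M f"
  by (rule square_integrable_imp_integrable) (simp_all add: sq_int_def)

lemma sq_int_bounded_mult:
  assumes "sq_int M f" "g \<in> borel_measurable M" "\<And>x. x \<in> space M \<Longrightarrow> \<bar>g x\<bar> \<le> C"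
  shows "sq_int M (\<lambda>x. g x * f x)"
proof (rule sq_int_bound[OF sq_int_cmult[OF assms(1), of C]])
  show "AE x in M. \<bar>g x * f x\<bar> \<le> \<bar>C * f x\<bar>"
  proof (rule AE_I2)
    fix x assume "x \<in> space M"
    then have "\<bar>g x\<bar> \<le> \<bar>C\<bar>" using assms(3)[of x] by linarith
    then show "\<bar>g x * f x\<bar> \<le> \<bar>C * f x\<bar>"
      unfolding abs_mult by (intro mult_right_mono) auto
  qed
qed (use assms in measurable)

lemma l2_nonneg [simp]: "0 \<le> l2 M f"
  by (simp add: l2_def)

lemma l2_sq: "(l2 M f)\<^sup>2 = (\<integral>x. (f x)\<^sup>2 \<partial>M)"
  by (simp add: l2_def)

lemma l2_le_iff: "0 \<le> c \<Longrightarrow> l2 M f \<le> c \<longleftrightarrow> (\<integral>x. (f x)\<^sup>2 \<partial>M) \<le> c\<^sup>2"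
  unfolding l2_def by (metis real_sqrt_le_iff real_sqrt_unique)

lemma l2_cmult: "l2 M (\<lambda>x. c * f x) = \<bar>c\<bar> * l2 M f"
  by (simp add: l2_def power_mult_distrib real_sqrt_mult)

lemma l2_commute: "l2 M (\<lambda>x. f x - g x) = l2 M (\<lambda>x. g x - f x)"
  by (simp add: l2_def power2_commute)

lemma l2_mono:
  assumes "sq_int M g" "f \<in> borel_measurable M" "AE x in M. \<bar>f x\<bar> \<le> \<bar>g x\<bar>"
  shows "l2 M f \<le> l2 M g"
  unfolding l2_def
proof (rule real_sqrt_le_mono, rule integral_mono_AE)
  show "integrable M (\<lambda>x. (f x)\<^sup>2)" using sq_int_bound[OF assms] by (simp add: sq_int_def)
  show "AE x in M. (f x)\<^sup>2 \<le> (g x)\<^sup>2"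
    using assms(3) by (simp add: abs_le_square_iff)
qed (use assms(1) in \<open>simp add: sq_int_def\<close>)

lemma l2_bounded_mult:
  assumes "sq_int M f" "g \<in> borel_measurable M" "\<And>x. x \<in> space M \<Longrightarrow> \<bar>g x\<bar> \<le> C" "0 \<le> C"
  shows "l2 M (\<lambda>x. g x * f x) \<le> C * l2 M f"
proof -
  have "l2 M (\<lambda>x. g x * f x) \<le> l2 M (\<lambda>x. C * f x)"
    by (rule l2_mono[OF sq_int_cmult[OF assms(1)]])
       (use assms in \<open>auto simp: abs_mult intro!: mult_right_mono AE_I2\<close>)
  then show ?thesis using assms(4) by (simp add: l2_cmult)
qed

lemma (in finite_measure) l2_const: "l2 M (\<lambda>_. c) = \<bar>c\<bar> * sqrt (measure M (space M))"
  by (simp add: l2_def real_sqrt_mult mult.commute)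

lemma l2_Cauchy_Schwarz:
  assumes f: "sq_int M f" and g: "sq_int M g"
  shows "\<bar>\<integral>x. f x * g x \<partial>M\<bar> \<le> l2 M f * l2 M g"
proof -
  let ?a = "\<integral>x. (f x)\<^sup>2 \<partial>M" and ?b = "\<integral>x. f x * g x \<partial>M" and ?c = "\<integral>x. (g x)\<^sup>2 \<partial>M"
  note [simp] = sq_int_integrable_sq[OF f] sq_int_integrable_sq[OF g] sq_int_prod[OF f g]
  have quad: "0 \<le> s\<^sup>2 * ?a - 2 * s * t * ?b + t\<^sup>2 * ?c" for s t
  proof -
    have "0 \<le> (\<integral>x. (s * f x - t * g x)\<^sup>2 \<partial>M)" by simp
    also have "\<dots> = (\<integral>x. s\<^sup>2 * (f x)\<^sup>2 - 2 * s * t * (f x * g x) + t\<^sup>2 * (g x)\<^sup>2 \<partial>M)"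
      by (intro Bochner_Integration.integral_cong) (auto simp: power2_eq_square algebra_simps)
    also have "\<dots> = s\<^sup>2 * ?a - 2 * s * t * ?b + t\<^sup>2 * ?c"
      by simp
    finally show ?thesis .
  qed
  have c0: "0 \<le> ?c" by simp
  have "?b\<^sup>2 \<le> ?a * ?c"
  proof (cases "?c = 0")
    case True
    have "?b = 0"
    proof (rule ccontr)
      assume "?b \<noteq> 0"
      \<comment> \<open>With vanishing \<open>?c\<close> the form is affine in the second parameter;
        this choice gives it the value -1.\<close>
      then show False using quad[of 1 "(?a + 1) / (2 * ?b)"] True by simp
    qed
    then show ?thesis using True by simp
  next
    case False
    then have "0 < ?c" using c0 by linarith
    have "0 \<le> ?c\<^sup>2 * ?a - 2 * ?c * ?b * ?b + ?b\<^sup>2 * ?c" by (rule quad)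
    also have "\<dots> = ?c * (?a * ?c - ?b\<^sup>2)" by (simp add: power2_eq_square algebra_simps)
    finally show ?thesis using \<open>0 < ?c\<close> by (simp add: zero_le_mult_iff)
  qed
  then have "sqrt (?b\<^sup>2) \<le> sqrt (?a * ?c)" by (rule real_sqrt_le_mono)
  then show ?thesis by (simp add: l2_def real_sqrt_mult)
qed

lemma l2_triangle:
  assumes f: "sq_int M f" and g: "sq_int M g"
  shows "l2 M (\<lambda>x. f x + g x) \<le> l2 M f + l2 M g"
proof -
  note [simp] = sq_int_integrable_sq[OF f] sq_int_integrable_sq[OF g] sq_int_prod[OF f g]
  have "(\<integral>x. (f x + g x)\<^sup>2 \<partial>M) = (\<integral>x. (f x)\<^sup>2 + 2 * (f x * g x) + (g x)\<^sup>2 \<partial>M)"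
    by (intro Bochner_Integration.integral_cong) (auto simp: power2_eq_square algebra_simps)
  also have "\<dots> = (l2 M f)\<^sup>2 + 2 * (\<integral>x. f x * g x \<partial>M) + (l2 M g)\<^sup>2"
    by (simp add: l2_sq)
  also have "\<dots> \<le> (l2 M f + l2 M g)\<^sup>2"
    using l2_Cauchy_Schwarz[OF f g] by (simp add: power2_sum)
  finally show ?thesis by (subst l2_le_iff) auto
qed

lemma l2_triangle_diff:
  assumes "sq_int M f" "sq_int M g" "sq_int M h"
  shows "l2 M (\<lambda>x. f x - h x) \<le> l2 M (\<lambda>x. f x - g x) + l2 M (\<lambda>x. g x - h x)"
  using l2_triangle[OF sq_int_diff[OF assms(1,2)] sq_int_diff[OF assms(2,3)]] by simp

lemma l2_diff_abs_le:
  assumes f: "sq_int M f" and g: "sq_int M g"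
  shows "\<bar>l2 M f - l2 M g\<bar> \<le> l2 M (\<lambda>x. f x - g x)"
  using l2_triangle[OF sq_int_diff[OF f g] g] l2_triangle[OF sq_int_diff[OF g f] f]
  by (simp add: l2_commute[of M f g])

lemma l2_parallelogram:
  assumes f: "sq_int M f" and g: "sq_int M g"
  shows "(l2 M (\<lambda>x. f x - g x))\<^sup>2 = 2 * (l2 M f)\<^sup>2 + 2 * (l2 M g)\<^sup>2 - 4 * (l2 M (\<lambda>x. (f x + g x) / 2))\<^sup>2"
proof -
  note [simp] = sq_int_integrable_sq[OF f] sq_int_integrable_sq[OF g] sq_int_prod[OF f g]
  have "(\<integral>x. (f x - g x)\<^sup>2 \<partial>M) = (\<integral>x. (f x)\<^sup>2 - 2 * (f x * g x) + (g x)\<^sup>2 \<partial>M)"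
    by (intro Bochner_Integration.integral_cong) (auto simp: power2_eq_square algebra_simps)
  moreover have "(\<integral>x. ((f x + g x) / 2)\<^sup>2 \<partial>M) = (\<integral>x. ((f x)\<^sup>2 + 2 * (f x * g x) + (g x)\<^sup>2) / 4 \<partial>M)"
    by (intro Bochner_Integration.integral_cong) (auto simp: power2_eq_square field_simps)
  ultimately show ?thesis by (simp add: l2_sq)
qed

text \<open>The limit inherits the bound \<open>w\<close>, so the squared difference is dominated by
  \<open>(2 * w)^2\<close> and the usual theorem applies to it.\<close>

lemma l2_dominated_convergence:
  assumes w: "sq_int M w" and f: "\<And>n. f n \<in> borel_measurable M" and g: "g \<in> borel_measurable M"
    and lim: "AE x in M. (\<lambda>n. f n x) \<longlonglongrightarrow> g x"
    and bd: "\<And>n. AE x in M. \<bar>f n x\<bar> \<le> w x"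
  shows "(\<lambda>n. l2 M (\<lambda>x. f n x - g x)) \<longlonglongrightarrow> 0"
proof -
  have "(\<lambda>n. \<integral>x. (f n x - g x)\<^sup>2 \<partial>M) \<longlonglongrightarrow> (\<integral>x. 0 \<partial>M)"
  proof (rule integral_dominated_convergence[where w = "\<lambda>x. (2 * w x)\<^sup>2"])
    show "integrable M (\<lambda>x. (2 * w x)\<^sup>2)"
      using sq_int_integrable_sq[OF sq_int_cmult[OF w]] .
    show "AE x in M. (\<lambda>n. (f n x - g x)\<^sup>2) \<longlonglongrightarrow> 0"
      using lim by eventually_elim (auto intro!: tendsto_eq_intros)
    have "AE x in M. \<bar>g x\<bar> \<le> w x"
    proof -
      have "AE x in M. \<forall>n. \<bar>f n x\<bar> \<le> w x" using bd by (simp add: AE_all_countable)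
      with lim show ?thesis
      proof eventually_elim
        case (elim x)
        then have "(\<lambda>n. \<bar>f n x\<bar>) \<longlonglongrightarrow> \<bar>g x\<bar>" by (intro tendsto_intros) auto
        then show ?case by (rule LIMSEQ_le_const2) (use elim in auto)
      qed
    qed
    then show "AE x in M. norm ((f n x - g x)\<^sup>2) \<le> (2 * w x)\<^sup>2" for n
      using bd[of n]
    proof eventually_elim
      case (elim x)
      then have "\<bar>f n x - g x\<bar> \<le> \<bar>2 * w x\<bar>" by linarith
      then show ?case by (simp add: abs_le_square_iff)
    qed
  qed (use f g in measurable)
  then show ?thesis unfolding l2_def
    by (auto intro!: tendsto_eq_intros)
qed

text \<open>Lower semicontinuity of the norm along almost everywhere convergence. It carries norm
  bounds for finite sums of modes over to the full kernel, and Cauchy bounds over to the limit in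
  \<open>l2_complete\<close>.\<close>

lemma l2_Fatou:
  assumes f: "\<And>n. sq_int M (f n)" and g: "g \<in> borel_measurable M"
    and lim: "AE x in M. (\<lambda>n. f n x) \<longlonglongrightarrow> g x"
    and bd: "eventually (\<lambda>n. l2 M (f n) \<le> C) sequentially"
  shows "sq_int M g" "l2 M g \<le> C"
proof -
  have C0: "0 \<le> C"
    using bd eventually_happens'[OF sequentially_bot] l2_nonneg order_trans by blast
  have m [measurable]: "\<And>n. f n \<in> borel_measurable M" using f by (simp add: sq_int_def)
  have "(\<integral>\<^sup>+x. ennreal ((g x)\<^sup>2) \<partial>M) = (\<integral>\<^sup>+x. liminf (\<lambda>n. ennreal ((f n x)\<^sup>2)) \<partial>M)"
    using lim
  proof (intro nn_integral_cong_AE, eventually_elim)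
    case (elim x)
    then have "(\<lambda>n. ennreal ((f n x)\<^sup>2)) \<longlonglongrightarrow> ennreal ((g x)\<^sup>2)"
      by (intro tendsto_ennrealI tendsto_intros)
    then show ?case by (intro lim_imp_Liminf[symmetric]) auto
  qed
  also have "\<dots> \<le> liminf (\<lambda>n. \<integral>\<^sup>+x. ennreal ((f n x)\<^sup>2) \<partial>M)"
    by (rule nn_integral_liminf) measurable
  also have "\<dots> = liminf (\<lambda>n. ennreal ((l2 M (f n))\<^sup>2))"
    unfolding l2_sq using f by (subst nn_integral_eq_integral) (auto simp: sq_int_def)
  also have "\<dots> \<le> ennreal (C\<^sup>2)"
  proof (rule Liminf_le)
    show "\<forall>\<^sub>F n in sequentially. ennreal ((l2 M (f n))\<^sup>2) \<le> ennreal (C\<^sup>2)"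
      using bd by eventually_elim (auto intro!: ennreal_leI power_mono)
  qed auto
  finally have *: "(\<integral>\<^sup>+x. ennreal ((g x)\<^sup>2) \<partial>M) \<le> ennreal (C\<^sup>2)" .
  show "sq_int M g" unfolding sq_int_def
  proof
    show "integrable M (\<lambda>x. (g x)\<^sup>2)"
      by (rule integrableI_bounded) (use g * in \<open>auto simp: top_unique less_top[symmetric]\<close>)
  qed (fact g)
  then have "ennreal (\<integral>x. (g x)\<^sup>2 \<partial>M) \<le> ennreal (C\<^sup>2)"
    using * by (subst nn_integral_eq_integral[symmetric]) (auto simp: sq_int_def)
  then show "l2 M g \<le> C" using C0 by (subst l2_le_iff) (auto simp: ennreal_le_iff)
qed

text \<open>Riesz-Fischer: along a subsequence with increments of norm below \<open>(1/2)^k\<close>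
  the functions converge almost everywhere, and Fatou turns the Cauchy estimate into convergence to
  the pointwise limit. Finiteness of the measure bounds the integral of an increment by a multiple
  of its norm.\<close>

lemma (in finite_measure) l2_complete:
  assumes f: "\<And>n. sq_int M (f n)"
    and cauchy: "\<And>e. 0 < e \<Longrightarrow> \<exists>N. \<forall>i\<ge>N. \<forall>j\<ge>N. l2 M (\<lambda>x. f i x - f j x) < e"
  obtains g where "sq_int M g" "(\<lambda>n. l2 M (\<lambda>x. f n x - g x)) \<longlonglongrightarrow> 0"
proof -
  have m [measurable]: "\<And>n. f n \<in> borel_measurable M" using f by (simp add: sq_int_def)
  have "\<exists>N. \<forall>i\<ge>N. \<forall>j\<ge>N. l2 M (\<lambda>x. f i x - f j x) < (1/2)^k" for k
    by (rule cauchy) simp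
  then obtain N where N: "\<And>k i j. i \<ge> N k \<Longrightarrow> j \<ge> N k \<Longrightarrow> l2 M (\<lambda>x. f i x - f j x) < (1/2)^k"
    by metis
  \<comment> \<open>The sum forces \<open>N k \<le> r k\<close>; the summand \<open>k\<close> makes
    \<open>r\<close> strictly increasing whatever \<open>N\<close> is.\<close>
  define r where "r k = (\<Sum>i\<le>k. N i) + k" for k
  have rN: "N k \<le> r k" for k
    using member_le_sum[of k "{..k}" N] by (simp add: r_def)
  have r_mono: "strict_mono r" by (rule strict_mono_Suc_iff[THEN iffD2]) (simp add: r_def)
  have rr: "r k \<le> r (Suc k)" for k using r_mono by (simp add: strict_mono_less_eq)
  define D where "D k x = \<bar>f (r (Suc k)) x - f (r k) x\<bar>" for k x
  have [measurable]: "\<And>k. D k \<in> borel_measurable M" unfolding D_def by measurable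
  have D_nn: "0 \<le> D k x" for k x by (simp add: D_def)
  define c where "c = sqrt (measure M (space M))"
  have c0: "0 \<le> c" by (simp add: c_def)
  have D_le: "(\<integral>\<^sup>+x. ennreal (D k x) \<partial>M) \<le> ennreal ((1/2)^k * c)" for k
  proof -
    have sq: "sq_int M (D k)" unfolding D_def by (intro sq_int_abs sq_int_diff f)
    have "(\<integral>x. D k x * 1 \<partial>M) \<le> l2 M (D k) * l2 M (\<lambda>_. 1)"
      using l2_Cauchy_Schwarz[OF sq sq_int_const[of 1]] by linarith
    also have "l2 M (D k) = l2 M (\<lambda>x. f (r (Suc k)) x - f (r k) x)"
      by (simp add: l2_def D_def)
    also have "\<dots> * l2 M (\<lambda>_. 1) \<le> (1/2)^k * c"
      using N[of k "r (Suc k)" "r k"] rN[of k] rr[of k]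
      by (intro mult_mono) (auto simp: l2_const c_def)
    finally show ?thesis
      using sq_int_integrable[OF sq] by (subst nn_integral_eq_integral) (auto intro!: ennreal_leI AE_I2 simp: D_nn)
  qed
  have "(\<integral>\<^sup>+x. (\<Sum>k. ennreal (D k x)) \<partial>M) = (\<Sum>k. \<integral>\<^sup>+x. ennreal (D k x) \<partial>M)"
    by (rule nn_integral_suminf) measurable
  also have "\<dots> \<le> (\<Sum>k. ennreal ((1/2)^k * c))"
    by (rule suminf_le) (use D_le in auto)
  also have "\<dots> = ennreal (\<Sum>k. (1/2)^k * c)"
    using c0 by (intro suminf_ennreal2 summable_mult2 summable_geometric) auto
  also have "\<dots> < \<infinity>" by simp
  finally have "(\<integral>\<^sup>+x. (\<Sum>k. ennreal (D k x)) \<partial>M) < \<infinity>" .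
  then have "AE x in M. (\<Sum>k. ennreal (D k x)) \<noteq> \<infinity>"
    by (intro nn_integral_noteq_infinite) auto
  then have conv: "AE x in M. convergent (\<lambda>k. f (r k) x)"
  proof eventually_elim
    case (elim x)
    then have "summable (\<lambda>k. D k x)"
      by (intro summable_suminf_not_top) (auto simp: D_def)
    then have "summable (\<lambda>k. f (r (Suc k)) x - f (r k) x)"
      unfolding D_def by (rule summable_rabs_cancel)
    then have "convergent (\<lambda>n. (\<Sum>k<n. f (r (Suc k)) x - f (r k) x) + f (r 0) x)"
      by (intro convergent_add convergent_const) (simp add: summable_iff_convergent)
    then show ?case
      by (simp add: sum_lessThan_telescope[of "\<lambda>k. f (r k) x"])
  qed
  define g where "g x = lim (\<lambda>k. f (r k) x)" for x
  have gm [measurable]: "g \<in> borel_measurable M" unfolding g_def by measurable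
  have lim: "AE x in M. (\<lambda>k. f (r k) x) \<longlonglongrightarrow> g x"
    using conv by eventually_elim (simp add: g_def convergent_LIMSEQ_iff)
  have *: "sq_int M (\<lambda>x. f n x - g x) \<and> l2 M (\<lambda>x. f n x - g x) \<le> e"
    if e: "0 < e" and n: "\<forall>i\<ge>K. \<forall>j\<ge>K. l2 M (\<lambda>x. f i x - f j x) < e" "n \<ge> K" for n e K
  proof -
    have lim': "AE x in M. (\<lambda>k. f n x - f (r k) x) \<longlonglongrightarrow> f n x - g x"
      using lim by eventually_elim (intro tendsto_intros)
    have ev: "eventually (\<lambda>k. l2 M (\<lambda>x. f n x - f (r k) x) \<le> e) sequentially"
      using eventually_ge_at_top[of K]
    proof eventually_elim
      case (elim k)
      then have "K \<le> r k" using seq_suble[OF r_mono, of k] by simp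
      then show ?case using n by (simp add: less_imp_le)
    qed
    show ?thesis
      using l2_Fatou[OF sq_int_diff[OF f f] _ lim' ev] gm m by simp
  qed
  obtain K where K: "\<forall>i\<ge>K. \<forall>j\<ge>K. l2 M (\<lambda>x. f i x - f j x) < 1" using cauchy[of 1] by auto
  have "sq_int M (\<lambda>x. f K x - (f K x - g x))"
    by (rule sq_int_diff[OF f]) (use *[OF _ K] in auto)
  then have "sq_int M g" by simp
  moreover have "(\<lambda>n. l2 M (\<lambda>x. f n x - g x)) \<longlonglongrightarrow> 0"
  proof (rule LIMSEQ_I)
    fix e :: real assume e: "0 < e"
    obtain K where K: "\<forall>i\<ge>K. \<forall>j\<ge>K. l2 M (\<lambda>x. f i x - f j x) < e/2"
      using cauchy[of "e/2"] e by auto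
    have "l2 M (\<lambda>x. f n x - g x) < e" if "n \<ge> K" for n
      using *[OF _ K that] e by auto
    then show "\<exists>no. \<forall>n\<ge>no. norm (l2 M (\<lambda>x. f n x - g x) - 0) < e"
      by (intro exI[of _ K]) auto
  qed
  ultimately show ?thesis by (rule that)
qed

text \<open>A substitute for weak compactness. The minimal norms \<open>d N\<close> of decreasing
  midpoint-convex sets increase to a finite limit \<open>D\<close>; near-minimizers \<open>G\<close>
  are Cauchy by the parallelogram law, because the midpoint of two elements of \<open>C N\<close>
  has norm at least \<open>d N\<close>. The limit \<open>g\<close> has norm exactly
  \<open>D\<close>, so deep in the sequence no element is much shorter than \<open>g\<close>.
  Membership of \<open>g\<close> in the sets is not claimed; the application recovers it from the
  convergence of \<open>G\<close>.\<close>

lemma (in finite_measure) l2_nested_convex: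
  fixes C :: "nat \<Rightarrow> ('a \<Rightarrow> real) set"
  assumes sq: "\<And>N h. h \<in> C N \<Longrightarrow> sq_int M h"
    and mid: "\<And>N g h. g \<in> C N \<Longrightarrow> h \<in> C N \<Longrightarrow> (\<lambda>x. (g x + h x) / 2) \<in> C N"
    and dec: "\<And>N. C (Suc N) \<subseteq> C N"
    and bd: "\<And>N. \<exists>h\<in>C N. l2 M h \<le> B"
  obtains g G where "sq_int M g" "\<And>N. G N \<in> C N" "(\<lambda>N. l2 M (\<lambda>x. G N x - g x)) \<longlonglongrightarrow> 0"
    "\<And>e. 0 < e \<Longrightarrow> \<exists>N. \<forall>h\<in>C N. l2 M g - e < l2 M h"
proof -
  define d where "d N = (INF h\<in>C N. l2 M h)" for N
  have bb: "bdd_below (l2 M ` C N)" for N by (rule bdd_belowI[of _ 0]) auto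
  have ne: "C N \<noteq> {}" for N using bd[of N] by auto
  have d_le: "d N \<le> l2 M h" if "h \<in> C N" for h N
    unfolding d_def by (rule cINF_lower[OF bb that])
  have d0: "0 \<le> d N" for N unfolding d_def by (rule cINF_greatest[OF ne]) auto
  have dB: "d N \<le> B" for N using bd[of N] d_le order_trans by blast
  have d_mono: "incseq d"
    by (rule incseq_SucI) (unfold d_def, rule cINF_superset_mono[OF ne bb dec], simp)
  obtain D where D: "d \<longlonglongrightarrow> D"
    using incseq_convergent[OF d_mono, of B] dB by blast
  have dD: "d N \<le> D" for N by (rule incseq_le[OF d_mono D])
  have "\<exists>h\<in>C N. l2 M h < d N + 1 / Suc N" for N
    using cINF_less_iff[OF ne bb, of N "d N + 1 / Suc N"] by (auto simp: d_def)
  then obtain G where G: "\<And>N. G N \<in> C N" "\<And>N. l2 M (G N) < d N + 1 / Suc N" by metis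
  have sub: "C j \<subseteq> C i" if "i \<le> j" for i j
    using that by (induction rule: dec_induct) (use dec in auto)
  have normG: "(\<lambda>N. l2 M (G N)) \<longlonglongrightarrow> D"
  proof (rule tendsto_sandwich[OF _ _ D])
    show "(\<lambda>N. d N + 1 / Suc N) \<longlonglongrightarrow> D"
      using tendsto_add[OF D LIMSEQ_inverse_real_of_nat] by (simp add: inverse_eq_divide)
  qed (use G d_le in \<open>auto intro!: always_eventually less_imp_le\<close>)
  \<comment> \<open>Both \<open>G i\<close> and \<open>G j\<close> lie in \<open>C N\<close> as soon
    as \<open>N\<close> is at most \<open>i\<close> and \<open>j\<close>, so the single lower bound
    \<open>d N\<close> serves for their midpoint.\<close>
  have est: "(l2 M (\<lambda>x. G i x - G j x))\<^sup>2 \<le> 2 * (l2 M (G i))\<^sup>2 + 2 * (l2 M (G j))\<^sup>2 - 4 * (d N)\<^sup>2"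
    if "N \<le> i" "N \<le> j" for i j N
  proof -
    have "(\<lambda>x. (G i x + G j x) / 2) \<in> C N"
      using mid sub[OF that(1)] sub[OF that(2)] G(1) by blast
    then have "(d N)\<^sup>2 \<le> (l2 M (\<lambda>x. (G i x + G j x) / 2))\<^sup>2"
      by (intro power_mono d_le d0)
    then show ?thesis using l2_parallelogram[OF sq[OF G(1)] sq[OF G(1)], of i j] by linarith
  qed
  have cauchy: "\<exists>N. \<forall>i\<ge>N. \<forall>j\<ge>N. l2 M (\<lambda>x. G i x - G j x) < e" if e: "0 < e" for e
  proof -
    have a: "(\<lambda>N. (l2 M (G N))\<^sup>2) \<longlonglongrightarrow> D\<^sup>2" by (intro tendsto_intros normG)
    have b: "(\<lambda>N. (d N)\<^sup>2) \<longlonglongrightarrow> D\<^sup>2" by (intro tendsto_intros D)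
    have e8: "0 < e\<^sup>2 / 8" using e by simp
    obtain N1 where N1: "\<And>N. N \<ge> N1 \<Longrightarrow> \<bar>(l2 M (G N))\<^sup>2 - D\<^sup>2\<bar> < e\<^sup>2/8"
      using LIMSEQ_D[OF a e8] by auto
    obtain N2 where N2: "\<And>N. N \<ge> N2 \<Longrightarrow> \<bar>(d N)\<^sup>2 - D\<^sup>2\<bar> < e\<^sup>2/8"
      using LIMSEQ_D[OF b e8] by auto
    show ?thesis
    proof (intro exI[of _ "max N1 N2"] allI impI)
      fix i j assume ij: "max N1 N2 \<le> i" "max N1 N2 \<le> j"
      have "(l2 M (\<lambda>x. G i x - G j x))\<^sup>2 < e\<^sup>2"
      proof -
        have "\<bar>(l2 M (G i))\<^sup>2 - D\<^sup>2\<bar> < e\<^sup>2/8" "\<bar>(l2 M (G j))\<^sup>2 - D\<^sup>2\<bar> < e\<^sup>2/8"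
          "\<bar>(d (max N1 N2))\<^sup>2 - D\<^sup>2\<bar> < e\<^sup>2/8"
          using N1[of i] N1[of j] N2[of "max N1 N2"] ij by auto
        moreover have "0 < e\<^sup>2" using e by simp
        ultimately show ?thesis using est[OF ij] by linarith
      qed
      then show "l2 M (\<lambda>x. G i x - G j x) < e" using e power_less_imp_less_base by fastforce
    qed
  qed
  obtain g where g: "sq_int M g" "(\<lambda>n. l2 M (\<lambda>x. G n x - g x)) \<longlonglongrightarrow> 0"
    using l2_complete[OF sq[OF G(1)] cauchy] by blast
  have "(\<lambda>N. l2 M (G N)) \<longlonglongrightarrow> l2 M g"
  proof (rule LIM_zero_cancel, rule Lim_null_comparison[OF _ g(2)])
    show "\<forall>\<^sub>F N in sequentially. norm (l2 M (G N) - l2 M g) \<le> l2 M (\<lambda>x. G N x - g x)"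
      using l2_diff_abs_le[OF sq[OF G(1)] g(1)] by (intro always_eventually) auto
  qed
  then have gD: "l2 M g = D" using normG LIMSEQ_unique by blast
  show ?thesis
  proof (rule that[OF g(1) G(1) g(2)])
    fix e :: real assume "0 < e"
    then have "eventually (\<lambda>N. D - e < d N) sequentially"
      using D by (intro order_tendstoD(1)) auto
    then obtain N where "D - e < d N" by (auto simp: eventually_sequentially)
    then show "\<exists>N. \<forall>h\<in>C N. l2 M g - e < l2 M h"
      using d_le gD by (intro exI[of _ N]) (auto intro: less_le_trans)
  qed
qed

section \<open>The space-time cylinder\<close>

lemma cube_eq_box: "cube = box 0 (\<chi> l. pi)"
  by (auto simp: cube_def mem_box_cart)

lemma closure_cube: "closure cube = cbox 0 (\<chi> l. pi)"
  unfolding cube_eq_box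
proof (rule closure_box)
  have "(\<chi> l. pi / 2) \<in> box 0 (\<chi> l. pi)" by (simp add: mem_box_cart)
  then show "box 0 (\<chi> l. pi) \<noteq> {}" by blast
qed

lemma mem_closure_cube: "x \<in> closure cube \<longleftrightarrow> (\<forall>l. 0 \<le> x $ l \<and> x $ l \<le> pi)"
  by (simp add: closure_cube mem_box_cart)

lemma mem_closed_cyl: "(t, x) \<in> closed_cyl T \<longleftrightarrow> 0 \<le> t \<and> t \<le> T \<and> (\<forall>l. 0 \<le> x $ l \<and> x $ l \<le> pi)"
  by (auto simp: closed_cyl_def mem_closure_cube)

lemma mem_cyl: "(t, x) \<in> cyl T \<longleftrightarrow> 0 < t \<and> t < T \<and> x \<in> cube"
  by (auto simp: cyl_def)

lemma cube_subset_closure: "x \<in> cube \<Longrightarrow> x \<in> closure cube"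
  by (rule set_mp[OF closure_subset])

lemma cyl_subset_closed_cyl: "cyl T \<subseteq> closed_cyl T"
  by (auto simp: cyl_def closed_cyl_def cube_subset_closure)

lemma compact_closed_cyl: "compact (closed_cyl T)"
  unfolding closed_cyl_def closure_cube by (intro compact_Times compact_Icc compact_cbox)

lemma sets_cube [measurable, simp]: "cube \<in> sets borel"
  by (simp add: cube_eq_box)

lemma sets_cyl [measurable, simp]: "cyl T \<in> sets borel"
  unfolding cyl_def cube_eq_box by (intro borel_open open_Times open_box open_greaterThanLessThan)

lemma emeasure_cyl_finite: "emeasure lborel (cyl T) < \<infinity>"
proof -
  have "bounded (cyl T)"
    using bounded_subset[OF compact_imp_bounded[OF compact_closed_cyl] cyl_subset_closed_cyl] .
  then show ?thesis by (rule emeasure_bounded_finite)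
qed

text \<open>Restricting the measure once turns every set integral over the cylinder into a plain
  integral over a finite measure, so that the results on \<open>l2\<close> apply directly.\<close>

definition cylM :: "real \<Rightarrow> (real \<times> (real ^ 'd)) measure" where
  "cylM T = restrict_space lborel (cyl T)"

lemma space_cylM [simp]: "space (cylM T) = cyl T"
  by (simp add: cylM_def space_restrict_space)

lemma finite_measure_cylM: "finite_measure (cylM T)"
  unfolding cylM_def
  by (rule finite_measureI)
     (simp add: emeasure_restrict_space space_restrict_space emeasure_cyl_finite[THEN less_imp_neq, simplified])

lemma measurable_cylM_restrict: "f \<in> borel_measurable borel \<Longrightarrow> f \<in> borel_measurable (cylM T)"
  unfolding cylM_def by (rule measurable_restrict_space1) simp

lemma measurable_cylM_iff:
  fixes f :: "_ \<Rightarrow> real"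
  shows "f \<in> borel_measurable (cylM T) \<longleftrightarrow> (\<lambda>p. indicator (cyl T) p * f p) \<in> borel_measurable borel"
  unfolding cylM_def by (subst borel_measurable_restrict_space_iff) (auto simp: mult.commute)

lemma integrable_cylM:
  fixes f :: "_ \<Rightarrow> real"
  shows "integrable (cylM T) f \<longleftrightarrow> set_integrable lborel (cyl T) f"
  unfolding cylM_def set_integrable_def by (subst integrable_restrict_space) auto

lemma integral_cylM:
  fixes f :: "_ \<Rightarrow> real"
  shows "(\<integral>p. f p \<partial>cylM T) = set_lebesgue_integral lborel (cyl T) f"
  unfolding cylM_def set_lebesgue_integral_def by (subst integral_restrict_space) auto

lemma AE_cylM: "(AE p in cylM T. P p) \<longleftrightarrow> (AE p in lborel. p \<in> cyl T \<longrightarrow> P p)"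
  unfolding cylM_def by (subst AE_restrict_space_iff) auto

lemma L2_cyl_iff: "h \<in> L2_cyl T \<longleftrightarrow> sq_int (cylM T) h"
  by (simp add: L2_cyl_def sq_int_def integrable_cylM measurable_cylM_iff set_borel_measurable_def)

lemma L2_norm_cyl_eq: "L2_norm_cyl T h = l2 (cylM T) h"
  by (simp add: L2_norm_cyl_def l2_def integral_cylM)

lemma energy_eq: "energy T h = (l2 (cylM T) h)\<^sup>2 / 2"
  by (simp add: energy_def L2_norm_cyl_eq)

text \<open>The varying domain \<open>{0<..<t} \<times> cube\<close> becomes a cutoff in the
  integrand; all kernels then live on the fixed space \<open>cylM T\<close>, where kernels with
  different end times can be compared.\<close>

lemma set_integral_time:
  fixes f :: "_ \<Rightarrow> real"
  assumes "t \<le> T"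
  shows "set_lebesgue_integral lborel ({0<..<t} \<times> cube) f = (\<integral>p. (if fst p < t then f p else 0) \<partial>cylM T)"
  unfolding integral_cylM set_lebesgue_integral_def
  by (rule Bochner_Integration.integral_cong)
     (use assms in \<open>auto simp: cyl_def indicator_def\<close>)

lemma measurable_cylM_continuous:
  fixes u :: "_ \<Rightarrow> real"
  assumes "continuous_on (closed_cyl T) u"
  shows "u \<in> borel_measurable (cylM T)"
  unfolding cylM_def
  using borel_measurable_continuous_on_restrict[OF continuous_on_subset[OF assms cyl_subset_closed_cyl]]
  by (simp add: measurable_def space_restrict_space sets_restrict_space)

lemma bounded_continuous_closed_cyl:
  fixes u :: "_ \<Rightarrow> real"
  assumes "continuous_on (closed_cyl T) u"
  obtains B where "0 \<le> B" "\<And>p. p \<in> closed_cyl T \<Longrightarrow> \<bar>u p\<bar> \<le> B"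
proof -
  have "bounded (u ` closed_cyl T)"
    by (rule compact_imp_bounded[OF compact_continuous_image[OF assms compact_closed_cyl]])
  then obtain B where "\<forall>y\<in>u ` closed_cyl T. norm y \<le> B" by (auto simp: bounded_iff)
  then show ?thesis by (intro that[of "max 0 B"]) (auto simp: le_max_iff_disj)
qed

text \<open>Lebesgue measurability supplies continuous functions converging almost everywhere, but
  without a common bound; truncating both \<open>f\<close> and the approximants at level
  \<open>R\<close> makes dominated convergence available.\<close>

lemma l2_dense_continuous:
  fixes f :: "real \<times> (real ^ 'd) \<Rightarrow> real"
  assumes f: "sq_int (cylM T) f" and e: "0 < e"
  obtains g where "continuous_on UNIV g" "sq_int (cylM T) g" "l2 (cylM T) (\<lambda>p. f p - g p) < e"
proof -
  interpret finite_measure "cylM T :: (real \<times> (real ^ 'd)) measure" by (rule finite_measure_cylM)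
  define cut where "cut R y = max (- R) (min R y)" for R y :: real
  have fm [measurable]: "f \<in> borel_measurable (cylM T)" using f by (simp add: sq_int_def)
  have cut_m: "(\<lambda>p. cut R (h p)) \<in> borel_measurable N" if "h \<in> borel_measurable N" for R h and N :: "(real \<times> (real ^ 'd)) measure"
    unfolding cut_def using that by measurable
  have "(\<lambda>n. l2 (cylM T) (\<lambda>p. cut (real n) (f p) - f p)) \<longlonglongrightarrow> 0"
  proof (rule l2_dominated_convergence[OF sq_int_abs[OF f]])
    show "AE p in cylM T. (\<lambda>n. cut (real n) (f p)) \<longlonglongrightarrow> f p"
    proof (rule AE_I2, rule tendsto_eventually)
      fix p
      obtain N :: nat where N: "\<bar>f p\<bar> \<le> real N" using real_arch_simple by blast
      show "\<forall>\<^sub>F n in sequentially. cut (real n) (f p) = f p"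
        using eventually_ge_at_top[of N] by eventually_elim (use N in \<open>auto simp: cut_def\<close>)
    qed
  qed (auto simp: cut_def)
  then have "eventually (\<lambda>n. l2 (cylM T) (\<lambda>p. cut (real n) (f p) - f p) < e/2) sequentially"
    by (rule order_tendstoD(2)) (use e in auto)
  then obtain R where R: "l2 (cylM T) (\<lambda>p. cut (real R) (f p) - f p) < e/2"
    by (auto simp: eventually_sequentially)
  define F where "F p = indicator (cyl T) p * cut (real R) (f p)" for p
  have "F \<in> borel_measurable borel"
    using cut_m[OF fm, of "real R"] unfolding measurable_cylM_iff F_def .
  then have "F \<in> borel_measurable lebesgue" by (intro measurable_completion) simp
  then have "F measurable_on UNIV" by (rule lebesgue_measurable_imp_measurable_on) simp
  then obtain N G where N: "negligible N" and G: "\<And>n. continuous_on UNIV (G n)"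
    and lim: "\<And>x. x \<notin> N \<Longrightarrow> (\<lambda>n. G n x) \<longlonglongrightarrow> F x"
    unfolding measurable_on_def by auto
  have "AE p in lebesgue. p \<notin> N"
    using N by (intro AE_not_in) (simp add: negligible_iff_null_sets)
  then have "AE p in lborel. p \<notin> N" by (simp add: AE_completion_iff)
  then have aeN: "AE p in cylM T. p \<notin> N" unfolding AE_cylM by eventually_elim simp
  have aec: "AE p in cylM T. (\<lambda>n. cut (real R) (G n p)) \<longlonglongrightarrow> cut (real R) (f p)"
    using aeN AE_space
  proof eventually_elim
    case (elim p)
    have "(\<lambda>n. cut (real R) (G n p)) \<longlonglongrightarrow> cut (real R) (F p)"
      unfolding cut_def by (intro tendsto_intros lim elim)
    then show ?case using elim by (simp add: F_def cut_def)
  qed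
  have cont: "continuous_on UNIV (\<lambda>p. cut (real R) (G n p))" for n
    unfolding cut_def by (intro continuous_intros G)
  have gm: "(\<lambda>p. cut (real R) (G n p)) \<in> borel_measurable (cylM T)" for n
    by (rule measurable_cylM_restrict[OF borel_measurable_continuous_onI[OF cont]])
  have gb: "\<bar>cut (real R) y\<bar> \<le> real R" for y by (auto simp: cut_def)
  have "(\<lambda>n. l2 (cylM T) (\<lambda>p. cut (real R) (G n p) - cut (real R) (f p))) \<longlonglongrightarrow> 0"
    by (rule l2_dominated_convergence[OF sq_int_const[of "real R"] gm cut_m[OF fm] aec]) (simp add: gb)
  then have "eventually (\<lambda>n. l2 (cylM T) (\<lambda>p. cut (real R) (G n p) - cut (real R) (f p)) < e/2) sequentially"
    by (rule order_tendstoD(2)) (use e in auto)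
  then obtain n where n: "l2 (cylM T) (\<lambda>p. cut (real R) (G n p) - cut (real R) (f p)) < e/2"
    by (auto simp: eventually_sequentially)
  have sqG: "sq_int (cylM T) (\<lambda>p. cut (real R) (G n p))"
    by (rule sq_int_bounded[OF gm gb])
  have sqf: "sq_int (cylM T) (\<lambda>p. cut (real R) (f p))"
    by (rule sq_int_bounded[OF cut_m[OF fm] gb])
  show ?thesis
  proof (rule that[OF cont sqG])
    show "l2 (cylM T) (\<lambda>p. f p - cut (real R) (G n p)) < e"
      using l2_triangle_diff[OF f sqf sqG] R n
        l2_commute[of "cylM T" f "\<lambda>p. cut (real R) (f p)"]
        l2_commute[of "cylM T" "\<lambda>p. cut (real R) (f p)" "\<lambda>p. cut (real R) (G n p)"]
      by linarith
  qed
qed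

text \<open>Fubini in coordinates. Lebesgue measure on \<open>real ^ 'd\<close> is the image of a
  product measure indexed by \<open>Basis\<close>; the injection \<open>ax\<close> re-indexes it by
  the coordinates.\<close>

lemma lborel_cart_integral_prod:
  fixes g :: "'d::finite \<Rightarrow> real \<Rightarrow> real"
  assumes g: "\<And>l. integrable lborel (g l)"
  shows "(\<integral>x. (\<Prod>l\<in>UNIV. g l (x $ l)) \<partial>(lborel :: (real^'d) measure)) = (\<Prod>l\<in>UNIV. integral\<^sup>L lborel (g l))"
proof -
  define ax where "ax = (\<lambda>l::'d. axis l (1::real))"
  have inj: "inj ax" by (rule injI) (simp add: ax_def axis_eq_axis)
  have Basis: "Basis = range ax" by (auto simp: Basis_vec_def ax_def)
  define h where "h b = g (inv ax b)" for b
  have h_ax [simp]: "h (ax l) = g l" for l by (simp add: h_def inj)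
  have [measurable]: "h b \<in> borel_measurable borel" for b
    using g[of "inv ax b"] by (simp add: h_def)
  interpret product_sigma_finite "\<lambda>_::real^'d. lborel :: real measure" by standard
  have "(\<integral>x. (\<Prod>l\<in>UNIV. g l (x $ l)) \<partial>(lborel :: (real^'d) measure)) = (\<integral>x. (\<Prod>b\<in>Basis. h b (x \<bullet> b)) \<partial>(lborel :: (real^'d) measure))"
    unfolding Basis by (subst prod.reindex[OF inj]) (simp add: ax_def[symmetric], simp add: ax_def inner_axis)
  also have "\<dots> = (\<integral>f. (\<Prod>b\<in>Basis. h b ((\<Sum>b\<in>Basis. f b *\<^sub>R b) \<bullet> b)) \<partial>(\<Pi>\<^sub>M b\<in>(Basis::(real^'d) set). lborel))"
    by (subst lborel_eq, rule integral_distr) measurable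
  also have "\<dots> = (\<integral>f. (\<Prod>b\<in>Basis. h b (f b)) \<partial>(\<Pi>\<^sub>M b\<in>(Basis::(real^'d) set). lborel))"
    by (intro Bochner_Integration.integral_cong prod.cong refl) simp
  also have "\<dots> = (\<Prod>b\<in>Basis. integral\<^sup>L lborel (h b))"
    by (rule product_integral_prod) (auto simp: h_def g)
  also have "\<dots> = (\<Prod>l\<in>UNIV. integral\<^sup>L lborel (g l))"
    unfolding Basis by (subst prod.reindex[OF inj]) simp
  finally show ?thesis .
qed

lemma cube_integral_prod:
  fixes g :: "'d::finite \<Rightarrow> real \<Rightarrow> real"
  assumes g: "\<And>l. g l \<in> borel_measurable borel" "\<And>l x. \<bar>g l x\<bar> \<le> B"
  shows "(\<integral>x. indicator cube x * (\<Prod>l\<in>UNIV. g l (x $ l)) \<partial>(lborel :: (real^'d) measure))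
    = (\<Prod>l\<in>UNIV. \<integral>x. indicator {0<..<pi} x * g l x \<partial>lborel)"
proof -
  have ind: "indicator cube x = (\<Prod>l\<in>UNIV. indicator {0<..<pi} (x $ l) :: real)" for x :: "real^'d"
    by (auto simp: cube_def indicator_def prod_eq_1_iff)
  have "integrable lborel (\<lambda>x. indicator {0<..<pi} x * g l x)" for l
  proof -
    have "integrable lborel (\<lambda>x::real. indicator {0<..<pi} x *\<^sub>R g l x)"
    proof (rule integrableI_bounded_set_indicator[where B = B])
      show "AE x in lborel. x \<in> {0<..<pi} \<longrightarrow> norm (g l x) \<le> B" using g(2) by simp
    qed (use g(1) in \<open>auto simp: ennreal_less_top\<close>)
    then show ?thesis by simp
  qed
  from lborel_cart_integral_prod[OF this] show ?thesis
    by (simp add: ind prod.distrib)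
qed

section \<open>Sine modes on the grid\<close>

lemma integral_open_pi:
  fixes f F :: "real \<Rightarrow> real"
  assumes "\<And>x. (F has_field_derivative f x) (at x)" "continuous_on UNIV f"
  shows "(\<integral>x. indicator {0<..<pi} x * f x \<partial>lborel) = F pi - F 0"
proof -
  have [measurable]: "f \<in> borel_measurable borel"
    using assms(2) by (rule borel_measurable_continuous_onI)
  have "(\<integral>x. indicator {0<..<pi} x * f x \<partial>lborel) = (\<integral>x. indicator {0..pi} x *\<^sub>R f x \<partial>lborel)"
  proof (rule integral_cong_AE)
    show "AE x in lborel. indicator {0<..<pi} x * f x = indicator {0..pi} x *\<^sub>R f x"
      using AE_lborel_singleton[of 0] AE_lborel_singleton[of pi]
      by eventually_elim (auto simp: indicator_def)
  qed auto
  also have "\<dots> = F pi - F 0"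
    by (rule integral_FTC_atLeastAtMost)
       (use assms continuous_on_subset[OF assms(2)] in \<open>auto intro: has_field_derivative_at_within
          simp: has_real_derivative_iff_has_vector_derivative[symmetric]\<close>)
  finally show ?thesis .
qed

lemma sin_orthogonal:
  assumes "1 \<le> j" "1 \<le> k"
  shows "(\<integral>x. indicator {0<..<pi} x * (sin (real j * x) * sin (real k * x)) \<partial>lborel) = (if j = k then pi / 2 else 0)"
proof (cases "j = k")
  case True
  have "(\<integral>x. indicator {0<..<pi} x * (sin (real j * x) * sin (real k * x)) \<partial>lborel)
     = (pi / 2 - sin (2 * real k * pi) / (4 * real k)) - (0 / 2 - sin (2 * real k * 0) / (4 * real k))"
  proof (rule integral_open_pi)
    fix x
    have "((\<lambda>x. x / 2 - sin (2 * real k * x) / (4 * real k)) has_field_derivative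
        (1 / 2 - (cos (2 * real k * x) * (2 * real k)) / (4 * real k))) (at x)"
      by (auto intro!: derivative_eq_intros)
    moreover have "1 / 2 - (cos (2 * real k * x) * (2 * real k)) / (4 * real k) = sin (real j * x) * sin (real k * x)"
      using assms True cos_double_sin[of "real k * x"] by (simp add: field_simps power2_eq_square)
    ultimately show "((\<lambda>x. x / 2 - sin (2 * real k * x) / (4 * real k)) has_field_derivative
        sin (real j * x) * sin (real k * x)) (at x)" by simp
  qed (intro continuous_intros)
  moreover have "sin (2 * real k * pi) = 0"
    using sin_npi[of "2 * k"] by (simp add: mult_ac)
  ultimately show ?thesis using True by simp
next
  case False
  define a b where "a = real j - real k" and "b = real j + real k"
  have ab: "a \<noteq> 0" "b \<noteq> 0" using assms False by (auto simp: a_def b_def)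
  have "(\<integral>x. indicator {0<..<pi} x * (sin (real j * x) * sin (real k * x)) \<partial>lborel)
     = (sin (a * pi) / (2 * a) - sin (b * pi) / (2 * b)) - (sin (a * 0) / (2 * a) - sin (b * 0) / (2 * b))"
  proof (rule integral_open_pi)
    fix x
    have "((\<lambda>x. sin (a * x) / (2 * a) - sin (b * x) / (2 * b)) has_field_derivative
        (cos (a * x) * a) / (2 * a) - (cos (b * x) * b) / (2 * b)) (at x)"
      by (auto intro!: derivative_eq_intros)
    moreover have "(cos (a * x) * a) / (2 * a) - (cos (b * x) * b) / (2 * b) = sin (real j * x) * sin (real k * x)"
      using ab by (simp add: sin_times_sin diff_divide_distrib) (simp add: a_def b_def algebra_simps)
    ultimately show "((\<lambda>x. sin (a * x) / (2 * a) - sin (b * x) / (2 * b)) has_field_derivative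
        sin (real j * x) * sin (real k * x)) (at x)" by simp
  qed (intro continuous_intros)
  moreover have "sin (a * pi) = 0" "sin (b * pi) = 0"
    using sin_npi_int[of "int j - int k"] sin_npi_int[of "int j + int k"]
    by (simp_all add: a_def b_def mult.commute)
  ultimately show ?thesis using False by simp
qed

text \<open>The Dirichlet kernel: multiplied by \<open>2 * sin (\<alpha> / 2)\<close>, the cosine
  sum telescopes.\<close>

lemma sum_cos_half_step:
  "2 * sin (\<alpha> / 2) * (\<Sum>i<n. cos (real i * \<alpha>)) = sin (real n * \<alpha> - \<alpha> / 2) + sin (\<alpha> / 2)"
proof (induction n)
  case 0
  show ?case by simp
next
  case (Suc n)
  have "2 * sin (\<alpha> / 2) * cos (real n * \<alpha>) = sin (real (Suc n) * \<alpha> - \<alpha> / 2) - sin (real n * \<alpha> - \<alpha> / 2)"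
    using sin_times_cos[of "\<alpha> / 2" "real n * \<alpha>"] sin_minus[of "real n * \<alpha> - \<alpha>/2"]
    by (simp add: algebra_simps)
  then show ?case using Suc by (simp add: algebra_simps)
qed

text \<open>The divisibility assumption says precisely that the sine of the half angle does not
  vanish, so the Dirichlet formula can be divided by it; as \<open>n\<close> times the angle is
  \<open>p * pi\<close>, the result depends on the parity of \<open>p\<close> alone.\<close>

lemma sum_cos_grid:
  fixes p :: int
  assumes "0 < n" "\<not> 2 * int n dvd p"
  shows "(\<Sum>i<n. cos (real i * (of_int p * pi / real n))) = (if even p then 0 else 1)"
proof -
  let ?a = "of_int p * pi / real n"
  have s0: "sin (?a / 2) \<noteq> 0"
  proof
    assume "sin (?a / 2) = 0"
    then obtain i :: int where "?a / 2 = of_int i * pi" using sin_zero_iff_int2 by blast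
    then have "of_int p = (of_int (2 * int n * i) :: real)" using assms by (simp add: field_simps)
    then have "p = 2 * int n * i" by (simp only: of_int_eq_iff)
    then show False using assms(2) by simp
  qed
  have "sin (real n * ?a - ?a / 2) = sin (of_int p * pi - ?a / 2)" using assms by simp
  also have "\<dots> = - cos (of_int p * pi) * sin (?a / 2)"
    using sin_npi_int[of p] by (simp add: sin_diff mult.commute)
  also have "cos (of_int p * pi) = (if even p then 1 else - 1)"
    using cos_npi_int[of p] by (simp add: mult.commute)
  finally have *: "2 * sin (?a / 2) * (\<Sum>i<n. cos (real i * ?a)) = (if even p then 0 else 2 * sin (?a / 2))"
    using sum_cos_half_step[of ?a n] by (auto split: if_splits)
  then show ?thesis using s0 by (auto split: if_splits)
qed

text \<open>After the product formula only cosine sums at the frequencies \<open>j - k\<close> and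
  \<open>j + k\<close> remain. These have equal parity, so for \<open>j \<noteq> k\<close> the two
  sums cancel; for \<open>j = k\<close> the first is \<open>n\<close> and the second zero. The
  bounds \<open>j < n\<close> and \<open>k < n\<close> exclude aliasing.\<close>

lemma sin_grid_orthogonal:
  assumes "1 \<le> j" "j < n" "1 \<le> k" "k < n"
  shows "(\<Sum>i<n. sin (real j * (dx n * real i)) * sin (real k * (dx n * real i))) = (if j = k then real n / 2 else 0)"
proof -
  let ?C = "\<lambda>p::int. \<Sum>i<n. cos (real i * (of_int p * pi / real n))"
  have "(\<Sum>i<n. sin (real j * (dx n * real i)) * sin (real k * (dx n * real i)))
     = (\<Sum>i<n. (cos (real i * (of_int (int j - int k) * pi / real n)) - cos (real i * (of_int (int j + int k) * pi / real n))) / 2)"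
  proof (rule sum.cong)
    fix i
    have "real j * (dx n * real i) - real k * (dx n * real i) = real i * (of_int (int j - int k) * pi / real n)"
         "real j * (dx n * real i) + real k * (dx n * real i) = real i * (of_int (int j + int k) * pi / real n)"
      by (simp_all add: dx_def algebra_simps diff_divide_distrib add_divide_distrib)
    then show "sin (real j * (dx n * real i)) * sin (real k * (dx n * real i)) =
       (cos (real i * (of_int (int j - int k) * pi / real n)) - cos (real i * (of_int (int j + int k) * pi / real n))) / 2"
      by (simp only: sin_times_sin)
  qed simp
  also have "\<dots> = (?C (int j - int k) - ?C (int j + int k)) / 2"
    by (simp add: sum_subtractf sum_divide_distrib[symmetric])
  finally have eq: "(\<Sum>i<n. sin (real j * (dx n * real i)) * sin (real k * (dx n * real i)))
      = (?C (int j - int k) - ?C (int j + int k)) / 2" .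
  have nd: "\<not> 2 * int n dvd int j + int k"
    using assms zdvd_not_zless[of "int j + int k" "2 * int n"] by simp
  have n0: "0 < n" using assms by simp
  show ?thesis
  proof (cases "j = k")
    case True
    then have "?C (int j + int k) = 0" using sum_cos_grid[OF n0 nd] by simp
    then show ?thesis unfolding eq using True by simp
  next
    case False
    have "\<not> 2 * int n dvd int j - int k"
    proof
      assume "2 * int n dvd int j - int k"
      then have "2 * int n \<le> \<bar>int j - int k\<bar>"
        using False dvd_imp_le_int[of "int j - int k" "2 * int n"] by simp
      then show False using assms by simp
    qed
    then show ?thesis unfolding eq using sum_cos_grid[OF n0 nd] sum_cos_grid[OF n0, of "int j - int k"] False by auto
  qed
qed

section \<open>Rounding to the grid and exact quadrature of step functions\<close>

definition grid_floor :: "nat \<Rightarrow> real \<Rightarrow> real" where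
  "grid_floor n x = dx n * of_int \<lfloor>x / dx n\<rfloor>"

lemma kappa_nth [simp]: "kappa n z $ l = grid_floor n (z $ l)"
  by (simp add: kappa_def grid_floor_def)

lemma dx_pos [simp]: "0 < n \<Longrightarrow> 0 < dx n"
  by (simp add: dx_def)

lemma n_dx: "0 < n \<Longrightarrow> real n * dx n = pi"
  by (simp add: dx_def)

lemma grid_floor_eq:
  assumes "0 < n" "real i * dx n \<le> x" "x < (real i + 1) * dx n"
  shows "grid_floor n x = dx n * real i"
proof -
  have "\<lfloor>x / dx n\<rfloor> = int i"
    using assms by (intro floor_unique) (auto simp: field_simps)
  then show ?thesis by (simp add: grid_floor_def)
qed

lemma grid_cell_ex:
  assumes "0 < n" "0 \<le> x" "x < pi"
  shows "\<exists>i<n. real i * dx n \<le> x \<and> x < (real i + 1) * dx n"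
proof (intro exI[of _ "nat \<lfloor>x / dx n\<rfloor>"] conjI)
  have d: "0 < dx n" using assms by simp
  have "0 \<le> x / dx n" using assms d by (intro divide_nonneg_pos)
  then have f0: "0 \<le> \<lfloor>x / dx n\<rfloor>" by simp
  have fl: "of_int \<lfloor>x / dx n\<rfloor> \<le> x / dx n" "x / dx n < of_int \<lfloor>x / dx n\<rfloor> + 1" by linarith+
  have "x / dx n < real n" using assms d n_dx[of n] by (simp add: field_simps)
  then show "nat \<lfloor>x / dx n\<rfloor> < n" using fl f0 by linarith
  have rn: "real (nat \<lfloor>x / dx n\<rfloor>) = of_int \<lfloor>x / dx n\<rfloor>" using f0 by simp
  show "real (nat \<lfloor>x / dx n\<rfloor>) * dx n \<le> x" "x < (real (nat \<lfloor>x / dx n\<rfloor>) + 1) * dx n"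
    unfolding rn using fl[unfolded pos_le_divide_eq[OF d] pos_divide_less_eq[OF d]] by auto
qed

lemma grid_cell_unique:
  assumes "0 < n" "real i * dx n \<le> x" "x < (real i + 1) * dx n" "real j * dx n \<le> x" "x < (real j + 1) * dx n"
  shows "i = j"
proof -
  have "\<lfloor>x / dx n\<rfloor> = int i" "\<lfloor>x / dx n\<rfloor> = int j"
    using assms by (intro floor_unique; simp add: field_simps)+
  then show ?thesis by simp
qed

lemma grid_floor_measurable [measurable]: "grid_floor n \<in> borel_measurable borel"
  unfolding grid_floor_def by measurable

lemma grid_floor_bounds:
  assumes "0 < n" shows "grid_floor n x \<le> x" "x < grid_floor n x + dx n"
proof -
  have d: "0 < dx n" using assms by simp
  have fl: "of_int \<lfloor>x / dx n\<rfloor> \<le> x / dx n" "x / dx n < of_int \<lfloor>x / dx n\<rfloor> + 1" by linarith+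
  show "grid_floor n x \<le> x" "x < grid_floor n x + dx n"
    using fl[unfolded pos_le_divide_eq[OF d] pos_divide_less_eq[OF d]] by (simp_all add: grid_floor_def algebra_simps)
qed

text \<open>Turns sums over grid points into integrals of step functions, so that discrete
  orthogonality becomes orthogonality on the interval.\<close>

lemma integral_grid_floor:
  fixes g :: "real \<Rightarrow> real"
  assumes n: "0 < n"
  shows "(\<integral>x. indicator {0<..<pi} x * g (grid_floor n x) \<partial>lborel) = dx n * (\<Sum>i<n. g (dx n * real i))"
proof -
  let ?I = "\<lambda>i. {real i * dx n ..< (real i + 1) * dx n}"
  have d: "0 < dx n" using n by simp
  have eq: "indicator {0..<pi} x * g (grid_floor n x) = (\<Sum>i<n. indicator (?I i) x * g (dx n * real i))" for x
  proof (cases "0 \<le> x \<and> x < pi")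
    case True
    then obtain i where i: "i < n" "real i * dx n \<le> x" "x < (real i + 1) * dx n"
      using grid_cell_ex[OF n] by blast
    have "(\<Sum>j<n. indicator (?I j) x * g (dx n * real j)) = (\<Sum>j<n. if j = i then g (dx n * real i) else 0)"
    proof (rule sum.cong)
      fix j assume "j \<in> {..<n}"
      show "indicator (?I j) x * g (dx n * real j) = (if j = i then g (dx n * real i) else 0)"
      proof (cases "j = i")
        case False
        then have "x \<notin> ?I j" using grid_cell_unique[OF n i(2,3), of j] by auto
        then show ?thesis using False by simp
      qed (use i in simp)
    qed simp
    then show ?thesis using True i grid_floor_eq[OF n i(2,3)] by simp
  next
    case False
    have "indicator (?I i) x * g (dx n * real i) = 0" if "i < n" for i
    proof -
      have "0 \<le> real i * dx n" using d by simp
      moreover have "(real i + 1) * dx n \<le> real n * dx n"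
        using that less_imp_le[OF d] by (intro mult_right_mono) auto
      ultimately show ?thesis using False n_dx[OF n] by (auto simp: indicator_def)
    qed
    then have "(\<Sum>i<n. indicator (?I i) x * g (dx n * real i)) = 0" by (intro sum.neutral) auto
    then show ?thesis using False by (auto simp: indicator_def)
  qed
  have [measurable]: "(\<lambda>x. indicator {0..<pi} x * g (grid_floor n x)) \<in> borel_measurable borel"
    unfolding eq by measurable
  have "(\<lambda>x. indicator {0<..<pi} x * g (grid_floor n x)) = (\<lambda>x. indicator {0<..<pi} x * (indicator {0..<pi} x * g (grid_floor n x)))"
    by (auto simp: indicator_def)
  then have [measurable]: "(\<lambda>x. indicator {0<..<pi} x * g (grid_floor n x)) \<in> borel_measurable borel"
    by simp
  have "(\<integral>x. indicator {0<..<pi} x * g (grid_floor n x) \<partial>lborel) = (\<integral>x. indicator {0..<pi} x * g (grid_floor n x) \<partial>lborel)"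
  proof (rule integral_cong_AE)
    show "AE x in lborel. indicator {0<..<pi} x * g (grid_floor n x) = indicator {0..<pi} x * g (grid_floor n x)"
      using AE_lborel_singleton[of 0] by eventually_elim (auto simp: indicator_def)
  qed auto
  also have "\<dots> = (\<Sum>i<n. \<integral>x. indicator (?I i) x * g (dx n * real i) \<partial>lborel)"
    unfolding eq by (rule Bochner_Integration.integral_sum) (intro integrable_mult_left integrable_real_indicator emeasure_bounded_finite; simp)
  also have "\<dots> = (\<Sum>i<n. dx n * g (dx n * real i))"
    using less_imp_le[OF d] by (intro sum.cong refl) (simp add: measure_lborel_Ico algebra_simps)
  finally show ?thesis by (simp add: sum_distrib_left)
qed

text \<open>Concavity of sine through the mean value theorem: the chord slopes on the two sides of
  \<open>x\<close> are \<open>cos u\<close> and \<open>cos v\<close> with \<open>u < x < v\<close>,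
  and comparing them puts \<open>sin x\<close> above the chord from \<open>0\<close> to
  \<open>pi / 2\<close>.\<close>

lemma Jordan_sin:
  assumes "0 \<le> x" "x \<le> pi / 2"
  shows "2 * x / pi \<le> sin x"
proof (cases "x = 0 \<or> x = pi / 2")
  case False
  then have x: "0 < x" "x < pi / 2" using assms by auto
  have D: "(sin has_field_derivative cos z) (at z)" for z :: real by (rule DERIV_sin)
  obtain u where u: "0 < u" "u < x" "sin x - sin 0 = (x - 0) * cos u"
    using MVT2[OF x(1), of sin cos] D by blast
  obtain v where v: "x < v" "v < pi / 2" "sin (pi/2) - sin x = (pi/2 - x) * cos v"
    using MVT2[OF x(2), of sin cos] D by blast
  have "cos v \<le> cos u" using u v x by (intro cos_monotone_0_pi_le) auto
  then have "(x * (pi/2 - x)) * cos v \<le> (x * (pi/2 - x)) * cos u"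
    using x by (intro mult_left_mono) auto
  moreover have "x * (1 - sin x) = (x * (pi/2 - x)) * cos v" using v by simp
  moreover have "(pi/2 - x) * sin x = (x * (pi/2 - x)) * cos u" using u by simp
  ultimately have "x * (1 - sin x) \<le> (pi/2 - x) * sin x" by linarith
  then show ?thesis by (simp add: field_simps)
next
  case True
  then show ?thesis
  proof
    assume "x = pi / 2"
    then show ?thesis by (simp only: sin_pi_half) simp
  qed simp
qed

section \<open>Frequencies and eigenvalues of the discrete Laplacian\<close>

definition ksq :: "('d::finite \<Rightarrow> nat) \<Rightarrow> real" where
  "ksq k = (\<Sum>l\<in>UNIV. (real (k l))\<^sup>2)"

definition modes :: "('d \<Rightarrow> nat) set" where
  "modes = {k. \<forall>l. 1 \<le> k l}"

lemma mode_idx_subset: "mode_idx n \<subseteq> modes"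
  by (auto simp: mode_idx_def modes_def)

lemma ksq_ge_1:
  assumes "k \<in> modes"
  shows "1 \<le> ksq k"
proof -
  obtain l :: 'a where True by simp
  have "1 \<le> (real (k l))\<^sup>2" using assms by (simp add: modes_def)
  also have "\<dots> \<le> ksq k" unfolding ksq_def by (rule member_le_sum) auto
  finally show ?thesis .
qed

lemma finite_mode_idx [simp]: "finite (mode_idx n :: ('d::finite \<Rightarrow> nat) set)"
proof -
  have "mode_idx n \<subseteq> PiE (UNIV::'d set) (\<lambda>_. {..<n})" by (auto simp: mode_idx_def)
  then show ?thesis by (rule finite_subset) (intro finite_PiE; simp)
qed

lemma finite_cell_idx [simp]: "finite (cell_idx n :: ('d::finite \<Rightarrow> nat) set)"
proof -
  have "cell_idx n \<subseteq> PiE (UNIV::'d set) (\<lambda>_. {..<n})" by (auto simp: cell_idx_def)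
  then show ?thesis by (rule finite_subset) (intro finite_PiE; simp)
qed

text \<open>Jordan's inequality applies since \<open>k l < n\<close> keeps every argument below
  \<open>pi / 2\<close>. The factor does not depend on \<open>n\<close>, which is what makes the
  later kernel bounds uniform in the grid.\<close>

lemma mu_lower:
  assumes "0 < n" "k \<in> mode_idx n"
  shows "4 / pi\<^sup>2 * ksq k \<le> mu n k"
proof -
  have "(real (k l) / real n)\<^sup>2 \<le> (sin (real (k l) * pi / (2 * real n)))\<^sup>2" for l
  proof (rule power_mono)
    have "real (k l) < real n" using assms by (simp add: mode_idx_def)
    then have "real (k l) * pi \<le> real n * pi" by simp
    then have "real (k l) * pi / (2 * real n) \<le> pi / 2" using assms by (simp add: field_simps)
    then show "real (k l) / real n \<le> sin (real (k l) * pi / (2 * real n))"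
      using Jordan_sin[of "real (k l) * pi / (2 * real n)"] by simp
  qed simp
  then have "(\<Sum>l\<in>UNIV. (real (k l) / real n)\<^sup>2) \<le> (\<Sum>l\<in>UNIV. (sin (real (k l) * pi / (2 * real n)))\<^sup>2)"
    by (intro sum_mono)
  then have "4 / (dx n)\<^sup>2 * (\<Sum>l\<in>UNIV. (real (k l) / real n)\<^sup>2) \<le> mu n k"
    unfolding mu_def by (rule mult_left_mono) simp
  moreover have "4 / (dx n)\<^sup>2 * (\<Sum>l\<in>UNIV. (real (k l) / real n)\<^sup>2) = 4 / pi\<^sup>2 * ksq k"
    using assms(1) by (simp add: ksq_def dx_def power_divide sum_divide_distrib[symmetric])
  ultimately show ?thesis by simp
qed

lemma filterlim_nat_ge:
  fixes r :: "nat \<Rightarrow> nat"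
  assumes "filterlim r at_top sequentially"
  shows "eventually (\<lambda>j. N \<le> r j) sequentially"
  using assms by (simp add: filterlim_at_top)

lemma mu_tendsto:
  assumes r: "filterlim r at_top sequentially"
  shows "(\<lambda>j. mu (r j) k) \<longlonglongrightarrow> ksq k"
proof -
  have "(\<lambda>j. 4 / (dx (r j))\<^sup>2 * (sin (real (k l) * pi / (2 * real (r j))))\<^sup>2) \<longlonglongrightarrow> (real (k l))\<^sup>2" for l
  proof (cases "k l = 0")
    case False
    define y where "y j = real (k l) * pi / (2 * real (r j))" for j
    have rr: "filterlim (\<lambda>j. real (r j)) at_top sequentially"
      by (rule filterlim_compose[OF filterlim_real_sequentially r])
    have y0: "y \<longlonglongrightarrow> 0" unfolding y_def
      by (rule real_tendsto_divide_at_top[OF tendsto_const filterlim_tendsto_pos_mult_at_top[OF tendsto_const _ rr]]) simp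
    have ev: "eventually (\<lambda>j. 0 < r j) sequentially"
      using filterlim_nat_ge[OF r, of 1] by eventually_elim simp
    then have yn: "eventually (\<lambda>j. y j \<noteq> 0) sequentially"
      by eventually_elim (use False in \<open>simp add: y_def\<close>)
    have "filterlim y (at 0) sequentially" using y0 yn by (simp add: filterlim_at)
    then have "(\<lambda>j. sin (y j) / y j) \<longlonglongrightarrow> 1" by (rule filterlim_compose[OF sinc_at_0])
    then have "(\<lambda>j. (real (k l))\<^sup>2 * (sin (y j) / y j)\<^sup>2) \<longlonglongrightarrow> (real (k l))\<^sup>2 * 1\<^sup>2"
      by (intro tendsto_intros)
    moreover have "eventually (\<lambda>j. (real (k l))\<^sup>2 * (sin (y j) / y j)\<^sup>2 =
        4 / (dx (r j))\<^sup>2 * (sin (real (k l) * pi / (2 * real (r j))))\<^sup>2) sequentially"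
      using ev by eventually_elim (use False in \<open>simp add: y_def dx_def power_divide power_mult_distrib field_simps\<close>)
    ultimately show ?thesis using Lim_transform_eventually by fastforce
  qed simp
  then have "(\<lambda>j. \<Sum>l\<in>UNIV. 4 / (dx (r j))\<^sup>2 * (sin (real (k l) * pi / (2 * real (r j))))\<^sup>2) \<longlonglongrightarrow> ksq k"
    unfolding ksq_def by (intro tendsto_sum)
  then show ?thesis by (simp add: mu_def sum_distrib_left)
qed

section \<open>The implicit Euler factors and their exponential limit\<close>

lemma dt_pos [simp]: "0 < T \<Longrightarrow> 0 < M \<Longrightarrow> 0 < dt T M"
  by (simp add: dt_def)

lemma euler_factor_bounds:
  assumes "0 < T" "0 < M"
  shows "0 < euler_factor T M \<mu>" "euler_factor T M \<mu> \<le> 1"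
proof -
  have "0 \<le> dt T M * \<mu>\<^sup>2" using assms by (simp add: dt_def)
  then show "0 < euler_factor T M \<mu>" "euler_factor T M \<mu> \<le> 1" by (auto simp: euler_factor_def)
qed

lemma euler_interp_between:
  assumes "0 < T" "0 < M" "dt T M < r"
  defines "i \<equiv> nat \<lfloor>r / dt T M\<rfloor>"
  shows "euler_factor T M \<mu> ^ Suc i \<le> euler_interp T M r \<mu>" "euler_interp T M r \<mu> \<le> euler_factor T M \<mu> ^ i"
    "1 \<le> i" "real i \<le> r / dt T M" "r / dt T M < real i + 1"
proof -
  let ?c = "euler_factor T M \<mu>"
  have d: "0 < dt T M" using assms by simp
  have "1 < r / dt T M" using assms(3) d by simp
  then have fl: "1 \<le> \<lfloor>r / dt T M\<rfloor>" by simp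
  then show i1: "1 \<le> i" unfolding i_def by linarith
  have ri: "real i = of_int \<lfloor>r / dt T M\<rfloor>" using fl by (simp add: i_def)
  show i2: "real i \<le> r / dt T M" "r / dt T M < real i + 1" unfolding ri by linarith+
  define \<theta> where "\<theta> = r / dt T M - real i"
  have th: "0 \<le> \<theta>" "\<theta> \<le> 1" using i2 by (auto simp: \<theta>_def)
  have e: "euler_interp T M r \<mu> = (1 - \<theta>) * ?c ^ i + \<theta> * ?c ^ Suc i"
    using assms(3) by (simp add: euler_interp_def Let_def i_def[symmetric] \<theta>_def)
  have le: "?c ^ Suc i \<le> ?c ^ i"
    using euler_factor_bounds[OF assms(1,2), of \<mu>] by (intro power_decreasing) auto
  have "(1 - \<theta>) * ?c ^ Suc i \<le> (1 - \<theta>) * ?c ^ i" "\<theta> * ?c ^ Suc i \<le> \<theta> * ?c ^ i"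
    using th le by (auto intro: mult_left_mono simp del: power_Suc)
  then show "?c ^ Suc i \<le> euler_interp T M r \<mu>" "euler_interp T M r \<mu> \<le> ?c ^ i"
    unfolding e by (simp_all add: algebra_simps del: power_Suc)
qed

text \<open>Bernoulli's inequality bounds a power of the Euler factor by a resolvent. Beyond the
  first step the interpolation is at most the power at the floor of \<open>r / dt T M\<close>; the
  factor 1/2 pays for this rounding.\<close>

lemma euler_interp_bound:
  assumes "0 < T" "0 < M" "0 \<le> r"
  shows "0 \<le> euler_interp T M r \<mu>" "euler_interp T M r \<mu> \<le> 1 / (1 + r * \<mu>\<^sup>2 / 2)"
proof -
  let ?c = "euler_factor T M \<mu>" and ?x = "dt T M * \<mu>\<^sup>2"
  have d: "0 < dt T M" using assms by simp
  have x0: "0 \<le> ?x" using d by simp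
  have "0 \<le> euler_interp T M r \<mu> \<and> euler_interp T M r \<mu> \<le> 1 / (1 + r * \<mu>\<^sup>2 / 2)"
  proof (cases "r \<le> dt T M")
    case True
    have "r * \<mu>\<^sup>2 \<le> ?x" using True by (intro mult_right_mono) auto
    then have "r * \<mu>\<^sup>2 / 2 \<le> ?x" using x0 by linarith
    then have "1 / (1 + ?x) \<le> 1 / (1 + r * \<mu>\<^sup>2 / 2)"
      using assms x0 by (intro divide_left_mono mult_pos_pos add_pos_nonneg) auto
    then show ?thesis using True euler_factor_bounds[OF assms(1,2), of \<mu>]
      by (simp add: euler_interp_def euler_factor_def)
  next
    case False
    define i where "i = nat \<lfloor>r / dt T M\<rfloor>"
    have b: "?c ^ Suc i \<le> euler_interp T M r \<mu>" "euler_interp T M r \<mu> \<le> ?c ^ i"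
       "1 \<le> i" "real i \<le> r / dt T M" "r / dt T M < real i + 1"
      using euler_interp_between[OF assms(1,2)] False by (auto simp: i_def simp del: power_Suc)
    define y where "y = r / dt T M"
    have "1 \<le> real i" using b(3) by simp
    \<comment> \<open>From \<open>y < i + 1\<close> and \<open>1 \<le> i\<close>: rounding down
      loses at most half of \<open>y\<close>.\<close>
    then have "y / 2 \<le> real i" using b(5) unfolding y_def[symmetric] by linarith
    then have "y / 2 * ?x \<le> real i * ?x" using x0 by (intro mult_right_mono)
    then have "r * \<mu>\<^sup>2 / 2 \<le> real i * ?x" using d by (simp add: y_def)
    then have "1 + r * \<mu>\<^sup>2 / 2 \<le> 1 + real i * ?x" by simp
    also have "\<dots> \<le> (1 + ?x) ^ i" by (rule Bernoulli_inequality) (use x0 in linarith)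
    finally have "1 / (1 + ?x) ^ i \<le> 1 / (1 + r * \<mu>\<^sup>2 / 2)"
      using assms x0 by (intro divide_left_mono mult_pos_pos add_pos_nonneg zero_less_power) auto
    moreover have "?c ^ i = 1 / (1 + ?x) ^ i" by (simp add: euler_factor_def power_divide)
    moreover have "0 \<le> ?c ^ Suc i" using euler_factor_bounds[OF assms(1,2), of \<mu>] by (intro zero_le_power) auto
    ultimately show ?thesis using b by linarith
  qed
  then show "0 \<le> euler_interp T M r \<mu>" "euler_interp T M r \<mu> \<le> 1 / (1 + r * \<mu>\<^sup>2 / 2)" by auto
qed

text \<open>The classical limit of \<open>(1 + x)^(-i)\<close> with \<open>x\<close> tending to zero
  and \<open>i * x\<close> tending to \<open>r * \<mu>^2\<close>, where all parameters may vary with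
  \<open>j\<close>. The value is squeezed between two consecutive powers, whose quotient tends to
  one.\<close>

lemma euler_interp_tendsto:
  assumes T: "0 < T" and M: "filterlim M at_top sequentially"
    and r: "\<rho> \<longlonglongrightarrow> r" "0 < r" and mu: "\<nu> \<longlonglongrightarrow> \<mu>"
  shows "(\<lambda>j. euler_interp T (M j) (\<rho> j) (\<nu> j)) \<longlonglongrightarrow> exp (- r * \<mu>\<^sup>2)"
proof -
  define \<tau> where "\<tau> j = dt T (M j)" for j
  define x where "x j = \<tau> j * (\<nu> j)\<^sup>2" for j
  define i where "i j = nat \<lfloor>\<rho> j / \<tau> j\<rfloor>" for j
  have evM: "eventually (\<lambda>j. 0 < M j) sequentially"
    using filterlim_nat_ge[OF M, of 1] by eventually_elim simp
  have tau0: "\<tau> \<longlonglongrightarrow> 0" unfolding \<tau>_def dt_def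
    by (rule real_tendsto_divide_at_top[OF tendsto_const filterlim_compose[OF filterlim_real_sequentially M]])
  have x0: "x \<longlonglongrightarrow> 0" unfolding x_def using tendsto_mult[OF tau0 tendsto_power[OF mu, of 2]] by simp
  have "(\<lambda>j. \<rho> j - \<tau> j) \<longlonglongrightarrow> r - 0" by (intro tendsto_intros r tau0)
  then have ev1: "eventually (\<lambda>j. 0 < \<rho> j - \<tau> j) sequentially"
    using r(2) by (intro order_tendstoD(1)) auto
  have evx: "eventually (\<lambda>j. x j < 1) sequentially" using x0 by (rule order_tendstoD(2)) simp
  have ev: "eventually (\<lambda>j. 0 < M j \<and> \<tau> j < \<rho> j \<and> 0 < \<tau> j \<and> 0 \<le> x j \<and> x j < 1) sequentially"
    using evM ev1 evx
  proof eventually_elim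
    case (elim j)
    then have "0 < \<tau> j" using T by (simp add: \<tau>_def)
    then show ?case using elim by (auto simp: x_def)
  qed
  have tau_i: "(\<lambda>j. real (i j) * \<tau> j) \<longlonglongrightarrow> r"
  proof (rule tendsto_sandwich)
    show "\<forall>\<^sub>F j in sequentially. \<rho> j - \<tau> j \<le> real (i j) * \<tau> j"
      using ev
    proof eventually_elim
      case (elim j)
      then have "\<rho> j / \<tau> j < real (i j) + 1"
        using euler_interp_between(5)[OF T, of "M j" "\<rho> j"] by (auto simp: i_def \<tau>_def)
      then show ?case using elim by (simp add: field_simps)
    qed
    show "\<forall>\<^sub>F j in sequentially. real (i j) * \<tau> j \<le> \<rho> j"
      using ev
    proof eventually_elim
      case (elim j)
      then have "real (i j) \<le> \<rho> j / \<tau> j"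
        using euler_interp_between(4)[OF T, of "M j" "\<rho> j"] by (auto simp: i_def \<tau>_def)
      then show ?case using elim by (simp add: field_simps)
    qed
    show "(\<lambda>j. \<rho> j - \<tau> j) \<longlonglongrightarrow> r" using tendsto_diff[OF r(1) tau0] by simp
  qed (rule r(1))
  have ix: "(\<lambda>j. real (i j) * x j) \<longlonglongrightarrow> r * \<mu>\<^sup>2"
    using tendsto_mult[OF tau_i tendsto_power[OF mu, of 2]] by (simp add: x_def mult.assoc)
  \<comment> \<open>\<open>x - x^2 \<le> ln (1 + x) \<le> x\<close>: the quadratic error vanishes
    because \<open>i * x\<close> stays bounded while \<open>x\<close> tends to zero.\<close>
  have il: "(\<lambda>j. real (i j) * ln (1 + x j)) \<longlonglongrightarrow> r * \<mu>\<^sup>2"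
  proof (rule tendsto_sandwich)
    show "(\<lambda>j. real (i j) * x j - real (i j) * x j * x j) \<longlonglongrightarrow> r * \<mu>\<^sup>2"
      using tendsto_diff[OF ix tendsto_mult[OF ix x0]] by simp
    show "\<forall>\<^sub>F j in sequentially. real (i j) * x j - real (i j) * x j * x j \<le> real (i j) * ln (1 + x j)"
      using ev
    proof eventually_elim
      case (elim j)
      then have "x j - (x j)\<^sup>2 \<le> ln (1 + x j)" by (intro ln_one_plus_pos_lower_bound) auto
      then have "real (i j) * (x j - (x j)\<^sup>2) \<le> real (i j) * ln (1 + x j)" by (rule mult_left_mono) simp
      then show ?case by (simp add: algebra_simps power2_eq_square)
    qed
    show "\<forall>\<^sub>F j in sequentially. real (i j) * ln (1 + x j) \<le> real (i j) * x j"
      using ev by eventually_elim (intro mult_left_mono ln_add_one_self_le_self, auto)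
  qed (rule ix)
  have pw: "(\<lambda>j. euler_factor T (M j) (\<nu> j) ^ i j) \<longlonglongrightarrow> exp (- (r * \<mu>\<^sup>2))"
  proof (rule Lim_transform_eventually)
    show "(\<lambda>j. exp (- (real (i j) * ln (1 + x j)))) \<longlonglongrightarrow> exp (- (r * \<mu>\<^sup>2))"
      by (intro tendsto_intros il)
    show "\<forall>\<^sub>F j in sequentially. exp (- (real (i j) * ln (1 + x j))) = euler_factor T (M j) (\<nu> j) ^ i j"
      using ev
    proof eventually_elim
      case (elim j)
      have "exp (real (i j) * ln (1 + x j)) = (1 + x j) ^ i j"
        using elim by (simp add: exp_of_nat_mult)
      then show ?case using elim
        by (simp add: exp_minus euler_factor_def x_def \<tau>_def power_divide field_simps)
    qed
  qed
  have ef1: "(\<lambda>j. euler_factor T (M j) (\<nu> j)) \<longlonglongrightarrow> 1"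
  proof -
    have "(\<lambda>j. 1 / (1 + x j)) \<longlonglongrightarrow> 1 / (1 + 0)" by (intro tendsto_intros x0) simp
    then show ?thesis by (simp add: euler_factor_def x_def \<tau>_def)
  qed
  show ?thesis
  proof (rule tendsto_sandwich)
    show "(\<lambda>j. euler_factor T (M j) (\<nu> j) ^ Suc (i j)) \<longlonglongrightarrow> exp (- r * \<mu>\<^sup>2)"
      using tendsto_mult[OF ef1 pw] by simp
    show "(\<lambda>j. euler_factor T (M j) (\<nu> j) ^ i j) \<longlonglongrightarrow> exp (- r * \<mu>\<^sup>2)" using pw by simp
    show "\<forall>\<^sub>F j in sequentially. euler_factor T (M j) (\<nu> j) ^ Suc (i j) \<le> euler_interp T (M j) (\<rho> j) (\<nu> j)"
      using ev by eventually_elim (unfold i_def \<tau>_def, intro euler_interp_between(1) T, auto)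
    show "\<forall>\<^sub>F j in sequentially. euler_interp T (M j) (\<rho> j) (\<nu> j) \<le> euler_factor T (M j) (\<nu> j) ^ i j"
      using ev by eventually_elim (unfold i_def \<tau>_def, intro euler_interp_between(2) T, auto)
  qed
qed

section \<open>Eigenfunctions and their interpolation\<close>

text \<open>The normalization of the sine products depends on the dimension only, hence the type
  argument.\<close>

definition amp :: "'d::finite itself \<Rightarrow> real" where
  "amp _ = (2 / pi) powr (real CARD('d) / 2)"

lemma amp_bounds: "0 < amp TYPE('d::finite)" "amp TYPE('d) \<le> 1"
proof -
  have "2 / pi \<le> 1" using pi_gt3 by simp
  then show "amp TYPE('d) \<le> 1" unfolding amp_def by (intro powr_le1) auto
qed (simp add: amp_def)

lemma amp_sq: "(amp TYPE('d::finite))\<^sup>2 = (2 / pi) ^ CARD('d)"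
proof -
  have "(amp TYPE('d))\<^sup>2 = (2 / pi) powr (real CARD('d) / 2 + real CARD('d) / 2)"
    unfolding powr_add by (simp add: amp_def power2_eq_square)
  also have "\<dots> = (2 / pi) ^ CARD('d)" by (simp add: powr_realpow)
  finally show ?thesis .
qed

lemma eigfun_amp: "eigfun k x = amp TYPE('d) * (\<Prod>l\<in>UNIV. sin (real (k l) * x $ l))"
  for x :: "real ^ 'd"
  by (simp add: eigfun_def amp_def)

lemma abs_prod_le_1:
  fixes f :: "'a \<Rightarrow> real"
  assumes "\<And>l. \<bar>f l\<bar> \<le> 1"
  shows "\<bar>\<Prod>l\<in>A. f l\<bar> \<le> 1"
  unfolding abs_prod by (rule prod_le_1) (use assms in auto)

lemma eigfun_bound: "\<bar>eigfun k x\<bar> \<le> 1"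
proof -
  have "\<bar>\<Prod>l\<in>UNIV. sin (real (k l) * x $ l)\<bar> \<le> 1" by (rule abs_prod_le_1) simp
  then have "amp TYPE('a) * \<bar>\<Prod>l\<in>UNIV. sin (real (k l) * x $ l)\<bar> \<le> 1 * 1"
    using amp_bounds[where 'd='a] by (intro mult_mono) auto
  then show ?thesis using amp_bounds[where 'd='a] by (simp add: eigfun_amp abs_mult)
qed

lemma eigfun_continuous: "continuous_on UNIV (eigfun k)"
  unfolding eigfun_amp by (intro continuous_intros)

lemma borel_measurable_vec_nth_cart [measurable]: "(\<lambda>x::real^'d. x $ l) \<in> borel_measurable borel"
  by (intro borel_measurable_continuous_onI continuous_intros)

lemma eigfun_measurable [measurable]: "eigfun k \<in> borel_measurable borel"
  by (rule borel_measurable_continuous_onI[OF eigfun_continuous])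

lemma kappa_measurable [measurable]: "kappa n \<in> borel \<rightarrow>\<^sub>M (borel :: (real^'d) measure)"
proof -
  have e: "kappa n z = (\<Sum>l\<in>UNIV. axis l (grid_floor n (z $ l)))" for z :: "real^'d"
    by (simp add: vec_eq_iff axis_def)
  have "(\<lambda>z. axis l (grid_floor n (z $ l))) = (\<lambda>z::real^'d. grid_floor n (z $ l) *\<^sub>R axis l 1)" for l
    by (auto simp: vec_eq_iff axis_def)
  then have "(\<lambda>z::real^'d. axis l (grid_floor n (z $ l))) \<in> borel_measurable borel" for l :: 'd
    by simp
  then show ?thesis unfolding e[abs_def] by (rule borel_measurable_sum)
qed

text \<open>Stated for abstract one-dimensional factors \<open>s\<close> so that it serves both the
  modes and the modes sampled at grid points. The value \<open>pi / 2\<close> in each coordinate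
  cancels against the square of \<open>amp\<close>.\<close>

lemma product_orthonormal:
  fixes s :: "nat \<Rightarrow> real \<Rightarrow> real" and j k :: "'d::finite \<Rightarrow> nat"
  assumes m: "\<And>i. s i \<in> borel_measurable borel" and b: "\<And>i x. \<bar>s i x\<bar> \<le> 1"
    and orth: "\<And>l. (\<integral>x. indicator {0<..<pi} x * (s (j l) x * s (k l) x) \<partial>lborel) = (if j l = k l then pi / 2 else 0)"
  shows "(\<integral>z. indicator cube z * ((amp TYPE('d) * (\<Prod>l\<in>UNIV. s (j l) (z $ l))) * (amp TYPE('d) * (\<Prod>l\<in>UNIV. s (k l) (z $ l)))) \<partial>(lborel :: (real ^ 'd) measure))
    = (if j = k then 1 else 0)"
proof -
  have "(\<integral>z. indicator cube z * ((amp TYPE('d) * (\<Prod>l\<in>UNIV. s (j l) (z $ l))) * (amp TYPE('d) * (\<Prod>l\<in>UNIV. s (k l) (z $ l)))) \<partial>(lborel :: (real ^ 'd) measure))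
     = (\<integral>z. (amp TYPE('d))\<^sup>2 * (indicator cube z * (\<Prod>l\<in>UNIV. s (j l) (z $ l) * s (k l) (z $ l))) \<partial>(lborel :: (real ^ 'd) measure))"
    by (intro Bochner_Integration.integral_cong) (simp_all add: prod.distrib power2_eq_square)
  also have "\<dots> = (amp TYPE('d))\<^sup>2 * (\<Prod>l\<in>UNIV. \<integral>x. indicator {0<..<pi} x * (s (j l) x * s (k l) x) \<partial>lborel)"
  proof -
    have "\<bar>s (j l) x * s (k l) x\<bar> \<le> 1" for l x
      unfolding abs_mult using b[of "j l" x] b[of "k l" x] by (intro mult_le_one) auto
    then show ?thesis using m
      by (subst integral_mult_right_zero, subst cube_integral_prod[where B = 1]) (auto intro: borel_measurable_times)
  qed
  also have "\<dots> = (2 / pi) ^ CARD('d) * (\<Prod>l\<in>(UNIV::'d set). if j l = k l then pi / 2 else 0)"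
    by (simp add: amp_sq orth)
  also have "\<dots> = (if j = k then 1 else 0)"
  proof (cases "j = k")
    case True
    then show ?thesis by (simp add: power_mult_distrib[symmetric])
  next
    case False
    then obtain l where "j l \<noteq> k l" by auto
    then have "(\<Prod>l\<in>(UNIV::'d set). if j l = k l then pi / 2 else 0) = 0"
      by (intro prod_zero) auto
    then show ?thesis using False by simp
  qed
  finally show ?thesis .
qed

lemma eigfun_orthonormal:
  fixes j k :: "'d::finite \<Rightarrow> nat"
  assumes "j \<in> modes" "k \<in> modes"
  shows "(\<integral>z. indicator cube z * (eigfun j z * eigfun k z) \<partial>lborel) = (if j = k then 1 else 0)"
  unfolding eigfun_amp
  by (rule product_orthonormal[where s = "\<lambda>i x. sin (real i * x)"])
     (use assms sin_orthogonal in \<open>auto simp: modes_def\<close>)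

text \<open>Sampling preserves orthonormality exactly: the grid sums have the value
  \<open>n / 2\<close>, and \<open>dx n * n / 2 = pi / 2\<close> is the continuous value.\<close>

lemma eigfun_kappa_orthonormal:
  fixes j k :: "'d::finite \<Rightarrow> nat"
  assumes "j \<in> mode_idx n" "k \<in> mode_idx n"
  shows "(\<integral>z. indicator cube z * (eigfun j (kappa n z) * eigfun k (kappa n z)) \<partial>lborel) = (if j = k then 1 else 0)"
  unfolding eigfun_amp kappa_nth
proof (rule product_orthonormal[where s = "\<lambda>i x. sin (real i * grid_floor n x)"])
  fix l
  have jk: "1 \<le> j l" "j l < n" "1 \<le> k l" "k l < n" using assms by (auto simp: mode_idx_def)
  then have n: "0 < n" by simp
  show "(\<integral>x. indicator {0<..<pi} x * (sin (real (j l) * grid_floor n x) * sin (real (k l) * grid_floor n x)) \<partial>lborel) = (if j l = k l then pi / 2 else 0)"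
    using integral_grid_floor[OF n, of "\<lambda>y. sin (real (j l) * y) * sin (real (k l) * y)"]
      sin_grid_orthogonal[OF jk] n_dx[OF n]
    by (simp add: mult.commute)
qed auto

section \<open>Multilinear interpolation of the modes\<close>

definition lin_interp :: "nat \<Rightarrow> nat \<Rightarrow> real \<Rightarrow> real" where
  "lin_interp n k x = (let i = min (nat \<lfloor>x / dx n\<rfloor>) (n - 1); \<theta> = x / dx n - real i in
     (1 - \<theta>) * sin (real k * (dx n * real i)) + \<theta> * sin (real k * (dx n * real (i + 1))))"

text \<open>Expanding a product of two-term sums over subsets of coordinates gives exactly the sum
  over the vertices of a cell. Multilinear interpolation of a product is therefore the product of
  linear interpolations, and its properties reduce to one dimension.\<close>

lemma eigfun_interp_prod:
  "eigfun_interp n k x = amp TYPE('d) * (\<Prod>l\<in>UNIV. lin_interp n (k l) (x $ l))"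
  for x :: "real ^ 'd"
proof -
  define \<theta> where "\<theta> l = x $ l / dx n - real (base_idx n x l)" for l
  define a where "a l = \<theta> l * sin (real (k l) * (dx n * real (base_idx n x l + 1)))" for l
  define b where "b l = (1 - \<theta> l) * sin (real (k l) * (dx n * real (base_idx n x l)))" for l
  have *: "(\<Prod>l\<in>UNIV. if l \<in> S then \<theta> l else 1 - \<theta> l) *
        eigfun k (grid_pt n (\<lambda>l. base_idx n x l + (if l \<in> S then 1 else 0)))
      = amp TYPE('d) * ((\<Prod>l\<in>S. a l) * (\<Prod>l\<in>UNIV - S. b l))" for S :: "'d set"
  proof -
    have "(\<Prod>l\<in>UNIV. if l \<in> S then \<theta> l else 1 - \<theta> l) *
        eigfun k (grid_pt n (\<lambda>l. base_idx n x l + (if l \<in> S then 1 else 0)))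
       = amp TYPE('d) * (\<Prod>l\<in>UNIV. (if l \<in> S then \<theta> l else 1 - \<theta> l) *
           sin (real (k l) * (dx n * real (base_idx n x l + (if l \<in> S then 1 else 0)))))"
      by (simp add: eigfun_amp grid_pt_def prod.distrib)
    also have "\<dots> = amp TYPE('d) * (\<Prod>l\<in>UNIV. if l \<in> S then a l else b l)"
      by (intro arg_cong2[where f = "(*)"] prod.cong refl) (auto simp: a_def b_def add.commute)
    also have "(\<Prod>l\<in>UNIV. if l \<in> S then a l else b l) = (\<Prod>l\<in>S. a l) * (\<Prod>l\<in>UNIV - S. b l)"
      by (subst prod.If_cases) (auto simp: Compl_eq_Diff_UNIV intro!: arg_cong2[where f = "(*)"] prod.cong)
    finally show ?thesis .
  qed
  have "eigfun_interp n k x = (\<Sum>S\<in>UNIV. amp TYPE('d) * ((\<Prod>l\<in>S. a l) * (\<Prod>l\<in>UNIV - S. b l)))"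
    unfolding eigfun_interp_def \<theta>_def[symmetric] * ..
  also have "\<dots> = amp TYPE('d) * (\<Prod>l\<in>UNIV. a l + b l)"
    by (subst prod_add) (simp_all add: sum_distrib_left)
  also have "(\<Prod>l\<in>UNIV. a l + b l) = (\<Prod>l\<in>UNIV. lin_interp n (k l) (x $ l))"
    by (intro prod.cong) (simp_all add: lin_interp_def a_def b_def \<theta>_def base_idx_def Let_def add.commute)
  finally show ?thesis .
qed

lemma interp_cell:
  assumes "0 < n" "0 \<le> x" "x \<le> pi"
  defines "i \<equiv> min (nat \<lfloor>x / dx n\<rfloor>) (n - 1)"
  shows "i < n" "0 \<le> x / dx n - real i" "x / dx n - real i \<le> 1"
    "dx n * real i \<le> x" "x \<le> dx n * real (i + 1)"
proof -
  have d: "0 < dx n" using assms by simp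
  show "i < n" using assms(1) min.cobounded2[of "nat \<lfloor>x / dx n\<rfloor>" "n - 1"] unfolding i_def by linarith
  define y where "y = x / dx n"
  have y0: "0 \<le> y" using assms(2) less_imp_le[OF d] by (simp add: y_def)
  have yn: "y \<le> real n" using assms(3) d n_dx[OF assms(1)] unfolding y_def pos_divide_le_eq[OF d] by simp
  have f: "of_int \<lfloor>y\<rfloor> \<le> y" "y < of_int \<lfloor>y\<rfloor> + 1" by linarith+
  have r: "real (nat \<lfloor>y\<rfloor>) = of_int \<lfloor>y\<rfloor>" using y0 by simp
  have "real i \<le> real (nat \<lfloor>y\<rfloor>)" by (simp add: i_def y_def)
  then have i1: "real i \<le> y" using f r by linarith
  have i2: "y \<le> real i + 1"
  proof (cases "nat \<lfloor>y\<rfloor> \<le> n - 1")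
    case True
    then have "i = nat \<lfloor>y\<rfloor>" by (simp add: i_def y_def)
    then show ?thesis using f r by simp
  next
    \<comment> \<open>The minimum acts only at \<open>x = pi\<close>, a point that belongs to the
      closure of the last cell.\<close>
    case False
    then have "i = n - 1" by (simp add: i_def y_def)
    then show ?thesis using yn assms(1) by (simp add: of_nat_diff)
  qed
  show "0 \<le> x / dx n - real i" "x / dx n - real i \<le> 1" using i1 i2 by (auto simp: y_def)
  show "dx n * real i \<le> x" "x \<le> dx n * real (i + 1)"
    using i1 i2 unfolding y_def pos_le_divide_eq[OF d] pos_divide_le_eq[OF d] by (simp_all add: mult.commute add.commute)
qed

lemma convex_comb_abs_le:
  fixes a b c \<theta> :: real
  assumes "0 \<le> \<theta>" "\<theta> \<le> 1" "\<bar>a - c\<bar> \<le> e" "\<bar>b - c\<bar> \<le> e"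
  shows "\<bar>(1 - \<theta>) * a + \<theta> * b - c\<bar> \<le> e"
proof -
  have "(1 - \<theta>) * a + \<theta> * b - c = (1 - \<theta>) * (a - c) + \<theta> * (b - c)" by (simp add: algebra_simps)
  also have "\<bar>\<dots>\<bar> \<le> (1 - \<theta>) * \<bar>a - c\<bar> + \<theta> * \<bar>b - c\<bar>"
    using assms abs_triangle_ineq[of "(1 - \<theta>) * (a - c)" "\<theta> * (b - c)"] by (simp add: abs_mult)
  also have "\<dots> \<le> (1 - \<theta>) * e + \<theta> * e"
    using assms by (intro add_mono mult_left_mono) auto
  finally show ?thesis by (simp add: algebra_simps)
qed

lemma abs_sin_diff_le: "\<bar>sin a - sin b\<bar> \<le> \<bar>a - b\<bar>" for a b :: real
proof -
  have "\<bar>sin a - sin b\<bar> = 2 * \<bar>sin ((a - b) / 2)\<bar> * \<bar>cos ((a + b) / 2)\<bar>"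
    by (simp add: sin_diff_sin abs_mult)
  also have "\<dots> \<le> 2 * \<bar>(a - b) / 2\<bar> * 1"
    by (intro mult_mono abs_sin_x_le_abs_x) auto
  finally show ?thesis by simp
qed

lemma lin_interp_error:
  assumes "0 < n" "0 \<le> x" "x \<le> pi"
  shows "\<bar>lin_interp n k x - sin (real k * x)\<bar> \<le> real k * dx n"
proof -
  define i where "i = min (nat \<lfloor>x / dx n\<rfloor>) (n - 1)"
  note i = interp_cell[OF assms, folded i_def]
  have e: "\<bar>sin (real k * y) - sin (real k * x)\<bar> \<le> real k * dx n" if "\<bar>y - x\<bar> \<le> dx n" for y
  proof -
    have "\<bar>sin (real k * y) - sin (real k * x)\<bar> \<le> \<bar>real k * (y - x)\<bar>"
      using abs_sin_diff_le[of "real k * y" "real k * x"] by (simp add: algebra_simps)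
    also have "\<dots> \<le> real k * dx n" using that by (simp add: abs_mult mult_left_mono)
    finally show ?thesis .
  qed
  have "\<bar>dx n * real i - x\<bar> \<le> dx n" "\<bar>dx n * real (i + 1) - x\<bar> \<le> dx n"
    using i(4,5) by (auto simp: algebra_simps abs_le_iff)
  then show ?thesis unfolding lin_interp_def i_def[symmetric] Let_def
    by (intro convex_comb_abs_le i(2,3) e)
qed

lemma lin_interp_bound:
  assumes "0 < n" "0 \<le> x" "x \<le> pi"
  shows "\<bar>lin_interp n k x\<bar> \<le> 1"
proof -
  define i where "i = min (nat \<lfloor>x / dx n\<rfloor>) (n - 1)"
  note i = interp_cell[OF assms, folded i_def]
  show ?thesis unfolding lin_interp_def i_def[symmetric] Let_def
    using convex_comb_abs_le[OF i(2,3), of "sin (real k * (dx n * real i))" 0 1 "sin (real k * (dx n * real (i+1)))"]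
    by simp
qed

text \<open>A cell-by-cell formula is continuous only if the pieces match at the nodes. Writing the
  interpolant as a constant plus a sum of clamped ramps, one for each cell, makes continuity
  evident; below the current cell the ramps telescope.\<close>

lemma lin_interp_continuous:
  assumes n: "0 < n"
  shows "continuous_on {0..pi} (lin_interp n k)"
proof -
  define s where "s i = sin (real k * (dx n * real i))" for i
  define L where "L x = (\<Sum>i<n. (s (i + 1) - s i) * max 0 (min 1 (x / dx n - real i))) + s 0" for x
  have "lin_interp n k x = L x" if x: "x \<in> {0..pi}" for x
  proof -
    define i where "i = min (nat \<lfloor>x / dx n\<rfloor>) (n - 1)"
    have i: "i < n" "0 \<le> x / dx n - real i" "x / dx n - real i \<le> 1"
      using interp_cell[OF n, of x] x by (auto simp: i_def)
    have "(\<Sum>j<n. (s (j + 1) - s j) * max 0 (min 1 (x / dx n - real j)))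
       = (\<Sum>j<n. if j < i then s (j + 1) - s j else if j = i then (s (i + 1) - s i) * (x / dx n - real i) else 0)"
    proof (rule sum.cong)
      fix j
      consider "j < i" | "j = i" | "i < j" by linarith
      then show "(s (j + 1) - s j) * max 0 (min 1 (x / dx n - real j)) =
        (if j < i then s (j + 1) - s j else if j = i then (s (i + 1) - s i) * (x / dx n - real i) else 0)"
      proof cases
        case 1
        then have "real j + 1 \<le> real i" by simp
        then have "1 \<le> x / dx n - real j" using i by linarith
        then show ?thesis using 1 by simp
      next
        case 2
        then show ?thesis using i by simp
      next
        case 3
        then have "real i + 1 \<le> real j" by simp
        then have "x / dx n - real j \<le> 0" using i by linarith
        then show ?thesis using 3 by simp
      qed
    qed simp
    also have "\<dots> = (\<Sum>j<n. (if j < i then s (j + 1) - s j else 0) + (if j = i then (s (i + 1) - s i) * (x / dx n - real i) else 0))"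
      by (intro sum.cong) auto
    also have "\<dots> = (\<Sum>j<i. s (j + 1) - s j) + (s (i + 1) - s i) * (x / dx n - real i)"
    proof -
      have "(\<Sum>j<n. if j < i then s (j + 1) - s j else 0) = (\<Sum>j<i. s (j + 1) - s j)"
        using i(1) sum.inter_restrict[of "{..<n}" "\<lambda>j. s (j + 1) - s j" "{..<i}"]
        by (simp add: Int_absorb1)
      then show ?thesis using i(1) by (simp add: sum.distrib)
    qed
    also have "(\<Sum>j<i. s (j + 1) - s j) = s i - s 0"
      using sum_lessThan_telescope[of s i] by simp
    finally have "L x = s i + (s (i + 1) - s i) * (x / dx n - real i)" by (simp add: L_def)
    moreover have "lin_interp n k x = (1 - (x / dx n - real i)) * s i + (x / dx n - real i) * s (i + 1)"
      unfolding lin_interp_def Let_def i_def s_def ..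
    ultimately show ?thesis by (simp add: algebra_simps)
  qed
  moreover have "continuous_on {0..pi} L"
  proof -
    have "dx n \<noteq> 0" using n by (simp add: dx_def)
    then show ?thesis unfolding L_def by (intro continuous_intros) auto
  qed
  ultimately show ?thesis using continuous_on_cong by metis
qed

lemma eigfun_interp_bound:
  fixes x :: "real ^ 'd"
  assumes "0 < n" "x \<in> closure cube"
  shows "\<bar>eigfun_interp n k x\<bar> \<le> 1"
proof -
  have "\<bar>\<Prod>l\<in>UNIV. lin_interp n (k l) (x $ l)\<bar> \<le> 1"
    by (rule abs_prod_le_1) (use assms lin_interp_bound in \<open>auto simp: mem_closure_cube\<close>)
  then have "amp TYPE('d) * \<bar>\<Prod>l\<in>UNIV. lin_interp n (k l) (x $ l)\<bar> \<le> 1 * 1"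
    using amp_bounds[where 'd='d] by (intro mult_mono) auto
  then show ?thesis using amp_bounds[where 'd='d] by (simp add: eigfun_interp_prod abs_mult)
qed

lemma eigfun_interp_continuous:
  assumes "0 < n"
  shows "continuous_on (closure cube) (eigfun_interp n k :: real ^ 'd::finite \<Rightarrow> real)"
proof -
  have "continuous_on (closure cube) (\<lambda>x::real^'d. lin_interp n (k l) (x $ l))" for l
    by (rule continuous_on_compose2[OF lin_interp_continuous[OF assms, of "k l"]])
       (auto intro!: continuous_intros simp: mem_closure_cube)
  then have "continuous_on (closure cube) (\<lambda>x::real^'d. amp TYPE('d) * (\<Prod>l\<in>UNIV. lin_interp n (k l) (x $ l)))"
    by (intro continuous_intros) auto
  then show ?thesis by (simp add: eigfun_interp_prod[abs_def])
qed

lemma dx_tendsto: "filterlim r at_top sequentially \<Longrightarrow> (\<lambda>j. dx (r j)) \<longlonglongrightarrow> 0"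
  unfolding dx_def
  by (rule real_tendsto_divide_at_top[OF tendsto_const filterlim_compose[OF filterlim_real_sequentially]])

lemma eigfun_interp_tendsto:
  fixes x :: "nat \<Rightarrow> real ^ 'd"
  assumes r: "filterlim r at_top sequentially" and x: "x \<longlonglongrightarrow> a" and xc: "\<And>j. x j \<in> closure cube"
  shows "(\<lambda>j. eigfun_interp (r j) k (x j)) \<longlonglongrightarrow> eigfun k a"
proof -
  have "(\<lambda>j. lin_interp (r j) (k l) (x j $ l)) \<longlonglongrightarrow> sin (real (k l) * a $ l)" for l
  proof -
    have "(\<lambda>j. lin_interp (r j) (k l) (x j $ l) - sin (real (k l) * x j $ l)) \<longlonglongrightarrow> 0"
    proof (rule Lim_null_comparison)
      show "(\<lambda>j. real (k l) * dx (r j)) \<longlonglongrightarrow> 0"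
        using tendsto_mult[OF tendsto_const dx_tendsto[OF r], of "real (k l)"] by simp
      show "\<forall>\<^sub>F j in sequentially. norm (lin_interp (r j) (k l) (x j $ l) - sin (real (k l) * x j $ l)) \<le> real (k l) * dx (r j)"
        using filterlim_nat_ge[OF r, of 1]
      proof eventually_elim
        case (elim j)
        then show ?case using lin_interp_error[of "r j" "x j $ l" "k l"] xc[of j] by (simp add: mem_closure_cube)
      qed
    qed
    moreover have "(\<lambda>j. sin (real (k l) * x j $ l)) \<longlonglongrightarrow> sin (real (k l) * a $ l)"
      by (intro tendsto_intros x)
    ultimately show ?thesis using tendsto_add by fastforce
  qed
  then show ?thesis unfolding eigfun_interp_prod eigfun_amp by (intro tendsto_intros)
qed

lemma kappa_tendsto:
  fixes z :: "real ^ 'd"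
  assumes r: "filterlim r at_top sequentially"
  shows "(\<lambda>j. kappa (r j) z) \<longlonglongrightarrow> z"
proof (rule vec_tendstoI)
  fix l
  show "(\<lambda>j. kappa (r j) z $ l) \<longlonglongrightarrow> z $ l"
  proof (rule LIM_zero_cancel, rule Lim_null_comparison[OF _ dx_tendsto[OF r]])
    show "\<forall>\<^sub>F j in sequentially. norm (kappa (r j) z $ l - z $ l) \<le> dx (r j)"
      using filterlim_nat_ge[OF r, of 1]
    proof eventually_elim
      case (elim j)
      then show ?case using grid_floor_bounds[of "r j" "z $ l"] by simp
    qed
  qed
qed

section \<open>Kernels with orthonormal modes\<close>

text \<open>One decay rate below both problems: it is half the square of the lower bound
  \<open>4 / pi^2 * ksq k\<close> for the discrete eigenvalues, the half coming from
  \<open>euler_interp_bound\<close>, and it is also below the continuous rate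
  \<open>(ksq k)^2\<close>.\<close>

definition wt :: "('d::finite \<Rightarrow> nat) \<Rightarrow> real" where
  "wt k = 8 / pi ^ 4 * (ksq k)\<^sup>2"

lemma wt_pos: "k \<in> modes \<Longrightarrow> 0 < wt k"
  using ksq_ge_1[of k] by (simp add: wt_def)

text \<open>The inverse fourth power of the frequency is distributed over the coordinates: each
  \<open>k l\<close> is at most the square root of \<open>ksq k\<close>, so three factors with
  exponent 4/3 use up the full power. With fewer coordinates the missing factors
  \<open>ksq k powr (2/3)\<close> are at least one. The exponent 4/3 exceeds one, so the bound is
  summable coordinate by coordinate.\<close>

lemma inverse_ksq_sq_le:
  fixes k :: "'d::finite \<Rightarrow> nat"
  assumes d: "CARD('d) \<le> 3" and k: "k \<in> modes"
  shows "1 / (ksq k)\<^sup>2 \<le> (\<Prod>l\<in>UNIV. real (k l) powr (- (4/3)))"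
proof -
  have q1: "1 \<le> ksq k" by (rule ksq_ge_1[OF k])
  have kl: "1 \<le> real (k l)" for l using k by (simp add: modes_def)
  have "real (k l) powr (4/3) \<le> ksq k powr (2/3)" for l
  proof -
    have "(real (k l))\<^sup>2 \<le> ksq k" unfolding ksq_def by (rule member_le_sum) auto
    then have "((real (k l))\<^sup>2) powr (2/3) \<le> ksq k powr (2/3)" by (intro powr_mono2) auto
    moreover have "((real (k l))\<^sup>2) powr (2/3) = real (k l) powr (4/3)"
    proof -
      have "(real (k l))\<^sup>2 = real (k l) powr 2" using kl[of l] by simp
      then show ?thesis by (simp only: powr_powr) simp
    qed
    ultimately show ?thesis by simp
  qed
  then have "(\<Prod>l\<in>UNIV. real (k l) powr (4/3)) \<le> (\<Prod>l\<in>(UNIV::'d set). ksq k powr (2/3))"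
    by (intro prod_mono) auto
  also have "\<dots> = (ksq k powr (2/3)) ^ CARD('d)" by simp
  also have "\<dots> \<le> (ksq k powr (2/3)) ^ 3"
    using q1 d by (intro power_increasing) (auto intro: ge_one_powr_ge_zero)
  also have "\<dots> = ksq k powr 2" using q1 by (simp add: powr_power)
  also have "\<dots> = (ksq k)\<^sup>2" using q1 by simp
  finally have le: "(\<Prod>l\<in>UNIV. real (k l) powr (4/3)) \<le> (ksq k)\<^sup>2" .
  have pos: "0 < (\<Prod>l\<in>UNIV. real (k l) powr (4/3))"
    by (rule prod_pos) (use kl in \<open>auto simp: less_le_trans[OF zero_less_one]\<close>)
  have "1 / (ksq k)\<^sup>2 \<le> 1 / (\<Prod>l\<in>UNIV. real (k l) powr (4/3))"
    using le pos q1 by (intro divide_left_mono) auto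
  also have "\<dots> = (\<Prod>l\<in>UNIV. real (k l) powr (- (4/3)))"
    unfolding powr_minus_divide prod_dividef by simp
  finally show ?thesis .
qed

lemma finite_subset_mode_idx:
  fixes F :: "('d::finite \<Rightarrow> nat) set"
  assumes "finite F" "F \<subseteq> modes"
  obtains N where "\<And>n. N \<le> n \<Longrightarrow> F \<subseteq> mode_idx n"
proof -
  define N where "N = Suc (Max (insert 0 ((\<lambda>(k, l). k l) ` (F \<times> UNIV))))"
  have fin: "finite (insert 0 ((\<lambda>(k, l). k l) ` (F \<times> (UNIV::'d set))))" using assms by simp
  have "k l < N" if "k \<in> F" for k l
  proof -
    have "k l \<le> Max (insert 0 ((\<lambda>(k, l). k l) ` (F \<times> UNIV)))"
      by (rule Max_ge[OF fin]) (use that in force)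
    then show ?thesis by (simp add: N_def)
  qed
  then have "F \<subseteq> mode_idx n" if "N \<le> n" for n
    using assms(2) that less_le_trans unfolding mode_idx_def modes_def by blast
  then show ?thesis by (rule that)
qed

text \<open>A finite set of modes lies in a box, and over a box the sum of products is a product of
  partial sums of a convergent one-dimensional series.\<close>

lemma sum_inverse_wt_bounded:
  assumes d: "CARD('d::finite) \<le> 3"
  obtains W where "\<And>S. finite S \<Longrightarrow> S \<subseteq> (modes :: ('d \<Rightarrow> nat) set) \<Longrightarrow> (\<Sum>k\<in>S. 1 / wt k) \<le> W"
proof -
  define Z where "Z = (\<Sum>i. real i powr (- (4/3)))"
  have sumZ: "summable (\<lambda>i. real i powr (- (4/3)))" by (simp add: summable_real_powr_iff)
  show ?thesis
  proof (rule that[of "pi ^ 4 / 8 * Z ^ CARD('d)"])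
    fix S :: "('d \<Rightarrow> nat) set" assume S: "finite S" "S \<subseteq> modes"
    obtain n where "\<And>j. n \<le> j \<Longrightarrow> S \<subseteq> mode_idx j" by (rule finite_subset_mode_idx[OF S]) rule
    then have n: "S \<subseteq> mode_idx n" by simp
    have mi: "mode_idx n = PiE (UNIV :: 'd set) (\<lambda>_. {1..<n})" by (simp add: set_eq_iff PiE_iff mode_idx_def)
    have "(\<Sum>k\<in>S. 1 / wt k) = pi ^ 4 / 8 * (\<Sum>k\<in>S. 1 / (ksq k)\<^sup>2)"
      unfolding sum_distrib_left by (intro sum.cong refl) (simp add: wt_def)
    also have "(\<Sum>k\<in>S. 1 / (ksq k)\<^sup>2) \<le> (\<Sum>k\<in>S. \<Prod>l\<in>UNIV. real (k l) powr (- (4/3)))"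
      using S inverse_ksq_sq_le[OF d] by (intro sum_mono) auto
    also have "\<dots> \<le> (\<Sum>k\<in>(mode_idx n :: ('d \<Rightarrow> nat) set). \<Prod>l\<in>UNIV. real (k l) powr (- (4/3)))"
      using n by (intro sum_mono2) (auto intro: prod_nonneg)
    also have "\<dots> = (\<Prod>l\<in>(UNIV::'d set). \<Sum>i\<in>{1..<n}. real i powr (- (4/3)))"
      unfolding mi by (subst prod_sum_PiE) auto
    also have "\<dots> \<le> (\<Prod>l\<in>(UNIV::'d set). Z)"
      unfolding Z_def by (intro prod_mono conjI sum_nonneg sum_le_suminf sumZ) auto
    finally show "(\<Sum>k\<in>S. 1 / wt k) \<le> pi ^ 4 / 8 * Z ^ CARD('d)" by simp
  qed
qed

text \<open>\<open>F\<close> comes within \<open>e\<close> of the supremum of all finite sums; a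
  disjoint finite set that added more than \<open>e\<close> would exceed the supremum.\<close>

lemma sum_inverse_wt_tail:
  assumes d: "CARD('d::finite) \<le> 3" and e: "0 < e"
  obtains F where "finite F" "F \<subseteq> (modes :: ('d \<Rightarrow> nat) set)"
    "\<And>S. finite S \<Longrightarrow> S \<subseteq> modes - F \<Longrightarrow> (\<Sum>k\<in>S. 1 / wt k) \<le> e"
proof -
  obtain W where W: "\<And>S. finite S \<Longrightarrow> S \<subseteq> (modes :: ('d \<Rightarrow> nat) set) \<Longrightarrow> (\<Sum>k\<in>S. 1 / wt k) \<le> W"
    using sum_inverse_wt_bounded[OF d] by blast
  let ?A = "(\<lambda>S. \<Sum>k\<in>S. 1 / wt k) ` {S. finite S \<and> S \<subseteq> (modes :: ('d \<Rightarrow> nat) set)}"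
  have bdd: "bdd_above ?A" by (rule bdd_aboveI[of _ W]) (use W in auto)
  have ne: "?A \<noteq> {}" by auto
  obtain y where y: "y \<in> ?A" "Sup ?A - e < y"
  proof -
    have "Sup ?A - e < Sup ?A" using e by simp
    then have "\<exists>y\<in>?A. Sup ?A - e < y" by (simp only: less_cSup_iff[OF ne bdd])
    then show thesis using that by blast
  qed
  from y(1) obtain F :: "('d \<Rightarrow> nat) set" where F': "y = (\<Sum>k\<in>F. 1 / wt k)" "F \<in> {S. finite S \<and> S \<subseteq> modes}"
    by (rule imageE)
  then have F: "finite F" "F \<subseteq> modes" "y = (\<Sum>k\<in>F. 1 / wt k)" by simp_all
  show ?thesis
  proof (rule that[OF F(1,2)])
    fix S :: "('d \<Rightarrow> nat) set" assume S: "finite S" "S \<subseteq> modes - F"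
    have "(\<Sum>k\<in>F \<union> S. 1 / wt k) \<le> Sup ?A"
      by (rule cSup_upper[OF _ bdd]) (use S F in auto)
    moreover have "(\<Sum>k\<in>F \<union> S. 1 / wt k) = (\<Sum>k\<in>F. 1 / wt k) + (\<Sum>k\<in>S. 1 / wt k)"
      using S F by (intro sum.union_disjoint) auto
    ultimately show "(\<Sum>k\<in>S. 1 / wt k) \<le> e" using y F by simp
  qed
qed

text \<open>The antiderivative is \<open>1 / (w * (1 + (t - s) * w))\<close>. Its increment is
  bounded by \<open>1 / w\<close> however long the time interval is, so integration in time gains
  one inverse power of \<open>w\<close>.\<close>

lemma nn_integral_resolvent_sq:
  assumes w: "0 < w" and t: "0 \<le> t"
  shows "(\<integral>\<^sup>+s. ennreal (indicator {0<..<t} s * (1 / (1 + (t - s) * w))\<^sup>2) \<partial>lborel) \<le> ennreal (1 / w)"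
proof -
  let ?f = "\<lambda>s. (1 / (1 + (t - s) * w))\<^sup>2" and ?F = "\<lambda>s. 1 / (w * (1 + (t - s) * w))"
  have pos: "0 < 1 + (t - s) * w" if "s \<le> t" for s using w that by (intro add_pos_nonneg) auto
  have cont: "continuous_on {0..t} ?f"
    using pos by (intro continuous_intros) (auto simp: less_imp_neq[symmetric])
  have "(\<integral>\<^sup>+s. ennreal (indicator {0<..<t} s * ?f s) \<partial>lborel) \<le> (\<integral>\<^sup>+s. ennreal (indicator {0..t} s *\<^sub>R ?f s) \<partial>lborel)"
    by (intro nn_integral_mono ennreal_leI) (auto simp: indicator_def)
  also have "\<dots> = ennreal (\<integral>s. indicator {0..t} s *\<^sub>R ?f s \<partial>lborel)"
    using borel_integrable_atLeastAtMost'[OF cont]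
    by (intro nn_integral_eq_integral) (auto simp: set_integrable_def)
  also have "(\<integral>s. indicator {0..t} s *\<^sub>R ?f s \<partial>lborel) = ?F t - ?F 0"
  proof (rule integral_FTC_atLeastAtMost[OF t _ cont])
    fix s assume s: "0 \<le> s" "s \<le> t"
    define D where "D = 1 + (t - s) * w"
    have D: "0 < D" using pos[OF s(2)] by (simp add: D_def)
    have "((\<lambda>s. w * (1 + (t - s) * w)) has_field_derivative - (w * w)) (at s within {0..t})"
      by (auto intro!: derivative_eq_intros)
    then have "(?F has_field_derivative - (- (w * w) * inverse ((w * D) ^ Suc (Suc 0)))) (at s within {0..t})"
      unfolding D_def inverse_eq_divide[symmetric] using D w by (intro DERIV_inverse_fun) (auto simp: D_def)
    moreover have "- (- (w * w) * inverse ((w * D) ^ Suc (Suc 0))) = (1 / D)\<^sup>2"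
      using D w by (simp add: field_simps power2_eq_square)
    ultimately have "(?F has_field_derivative ?f s) (at s within {0..t})" by (simp add: D_def)
    then show "(?F has_vector_derivative ?f s) (at s within {0..t})"
      by (simp add: has_real_derivative_iff_has_vector_derivative)
  qed
  also have "ennreal (?F t - ?F 0) \<le> ennreal (1 / w)"
    using w pos[of 0] t by (intro ennreal_leI) simp
  finally show ?thesis .
qed

lemma integrable_cube_bounded:
  fixes f :: "real ^ 'd \<Rightarrow> real"
  assumes "f \<in> borel_measurable borel" "\<And>z. \<bar>f z\<bar> \<le> B"
  shows "integrable lborel (\<lambda>z. indicator cube z * f z)"
proof -
  have "integrable lborel (\<lambda>z. indicator cube z *\<^sub>R f z)"
  proof (rule integrableI_bounded_set_indicator[where B = B])
    show "emeasure lborel (cube :: (real ^ 'd) set) < \<infinity>"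
      unfolding cube_eq_box by (rule emeasure_lborel_box_finite)
  qed (use assms in auto)
  then show ?thesis by simp
qed

text \<open>Parseval in space at each fixed time, followed by Tonelli in time. An identity rather
  than a bound, because it also yields monotonicity of the norm in the set of modes.\<close>

lemma orthonormal_kernel_nn_integral:
  fixes a :: "'k \<Rightarrow> real \<Rightarrow> real" and e :: "'k \<Rightarrow> real ^ 'd::finite \<Rightarrow> real"
  assumes S: "finite S" and t: "t \<le> T"
    and am: "\<And>k. a k \<in> borel_measurable borel" and em: "\<And>k. e k \<in> borel_measurable borel"
    and eb: "\<And>k z. \<bar>e k z\<bar> \<le> 1"
    and orth: "\<And>j k. j \<in> S \<Longrightarrow> k \<in> S \<Longrightarrow> (\<integral>z. indicator cube z * (e j z * e k z) \<partial>lborel) = (if j = k then 1 else 0)"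
  shows "(\<integral>\<^sup>+q. ennreal ((if fst q < t then \<Sum>k\<in>S. a k (fst q) * e k (snd q) else 0)\<^sup>2) \<partial>cylM T)
    = (\<integral>\<^sup>+s. ennreal (indicator {0<..<t} s) * ennreal (\<Sum>k\<in>S. (a k s)\<^sup>2) \<partial>lborel)"
proof -
  note [measurable] = am em
  let ?K = "\<lambda>q. if fst q < t then \<Sum>k\<in>S. a k (fst q) * e k (snd q) else 0"
  have fs: "(fst :: real \<times> (real ^ 'd) \<Rightarrow> real) \<in> borel_measurable borel" "(snd :: real \<times> (real ^ 'd) \<Rightarrow> _) \<in> borel_measurable borel"
    by (intro borel_measurable_continuous_onI continuous_intros)+
  note [measurable] = fs
  have inner: "(\<integral>\<^sup>+z. ennreal (indicator cube z * (\<Sum>k\<in>S. a k s * e k z)\<^sup>2) \<partial>lborel) = ennreal (\<Sum>k\<in>S. (a k s)\<^sup>2)" for s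
  proof -
    have int: "integrable lborel (\<lambda>z. indicator cube z * (e j z * e k z))" for j k
    proof (rule integrable_cube_bounded[where B = 1])
      show "\<bar>e j z * e k z\<bar> \<le> 1" for z
        unfolding abs_mult using eb[of j z] eb[of k z] by (intro mult_le_one) auto
    qed measurable
    have ex: "indicator cube z * (\<Sum>k\<in>S. a k s * e k z)\<^sup>2
        = (\<Sum>j\<in>S. \<Sum>k\<in>S. a j s * a k s * (indicator cube z * (e j z * e k z)))" for z
      by (simp add: power2_eq_square sum_product sum_distrib_left mult_ac)
    have "(\<integral>\<^sup>+z. ennreal (indicator cube z * (\<Sum>k\<in>S. a k s * e k z)\<^sup>2) \<partial>lborel)
       = ennreal (\<integral>z. indicator cube z * (\<Sum>k\<in>S. a k s * e k z)\<^sup>2 \<partial>lborel)"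
    proof (rule nn_integral_eq_integral)
      show "integrable lborel (\<lambda>z. indicator cube z * (\<Sum>k\<in>S. a k s * e k z)\<^sup>2)"
        unfolding ex by (intro Bochner_Integration.integrable_sum integrable_mult_right int)
    qed auto
    also have "(\<integral>z. indicator cube z * (\<Sum>k\<in>S. a k s * e k z)\<^sup>2 \<partial>lborel)
       = (\<Sum>j\<in>S. \<Sum>k\<in>S. a j s * a k s * (\<integral>z. indicator cube z * (e j z * e k z) \<partial>lborel))"
      unfolding ex using int
      by (subst Bochner_Integration.integral_sum, force)
         (intro sum.cong refl, subst Bochner_Integration.integral_sum, auto)
    also have "\<dots> = (\<Sum>j\<in>S. \<Sum>k\<in>S. if k = j then (a j s)\<^sup>2 else 0)"
      by (intro sum.cong refl) (auto simp: orth power2_eq_square)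
    also have "\<dots> = (\<Sum>k\<in>S. (a k s)\<^sup>2)" using S by simp
    finally show ?thesis .
  qed
  have "(\<integral>\<^sup>+q. ennreal ((?K q)\<^sup>2) \<partial>cylM T) = (\<integral>\<^sup>+q. ennreal ((?K q)\<^sup>2) * indicator (cyl T) q \<partial>lborel)"
    unfolding cylM_def by (subst nn_integral_restrict_space) auto
  also have "\<dots> = (\<integral>\<^sup>+q. ennreal (indicator {0<..<t} (fst q) * (indicator cube (snd q) * (\<Sum>k\<in>S. a k (fst q) * e k (snd q))\<^sup>2)) \<partial>lborel)"
    using t by (intro nn_integral_cong) (auto simp: indicator_def cyl_def split: if_splits)
  also have "\<dots> = (\<integral>\<^sup>+q. ennreal (indicator {0<..<t} (fst q) * (indicator cube (snd q) * (\<Sum>k\<in>S. a k (fst q) * e k (snd q))\<^sup>2)) \<partial>(lborel \<Otimes>\<^sub>M lborel))"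
    by (simp add: lborel_prod)
  also have "\<dots> = (\<integral>\<^sup>+s. \<integral>\<^sup>+z. ennreal (indicator {0<..<t} s * (indicator cube z * (\<Sum>k\<in>S. a k s * e k z)\<^sup>2)) \<partial>lborel \<partial>lborel)"
    by (subst lborel.nn_integral_fst[symmetric]) auto
  also have "\<dots> = (\<integral>\<^sup>+s. ennreal (indicator {0<..<t} s) * ennreal (\<Sum>k\<in>S. (a k s)\<^sup>2) \<partial>lborel)"
    unfolding inner[symmetric]
    by (intro nn_integral_cong) (subst nn_integral_cmult[symmetric], auto simp: ennreal_mult'')
  finally show ?thesis .
qed

text \<open>Common to both kernels: the time factor and the mode at the target point are absorbed in
  \<open>a\<close>, the modes at the source point are \<open>e\<close>, and the size of the kernel
  is controlled by the resolvent bound on \<open>a\<close>.\<close>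

lemma orthonormal_kernel_bound:
  fixes a :: "'k \<Rightarrow> real \<Rightarrow> real" and e :: "'k \<Rightarrow> real ^ 'd::finite \<Rightarrow> real"
  assumes S: "finite S" and t: "0 \<le> t" "t \<le> T"
    and am: "\<And>k. a k \<in> borel_measurable borel" and em: "\<And>k. e k \<in> borel_measurable borel"
    and eb: "\<And>k z. \<bar>e k z\<bar> \<le> 1"
    and w: "\<And>k. k \<in> S \<Longrightarrow> 0 < w k"
    and ab: "\<And>k s. k \<in> S \<Longrightarrow> 0 < s \<Longrightarrow> s < t \<Longrightarrow> \<bar>a k s\<bar> \<le> 1 / (1 + (t - s) * w k)"
    and orth: "\<And>j k. j \<in> S \<Longrightarrow> k \<in> S \<Longrightarrow> (\<integral>z. indicator cube z * (e j z * e k z) \<partial>lborel) = (if j = k then 1 else 0)"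
  shows "sq_int (cylM T) (\<lambda>q. if fst q < t then \<Sum>k\<in>S. a k (fst q) * e k (snd q) else 0)"
    and "(l2 (cylM T) (\<lambda>q. if fst q < t then \<Sum>k\<in>S. a k (fst q) * e k (snd q) else 0))\<^sup>2 \<le> (\<Sum>k\<in>S. 1 / w k)"
proof -
  interpret finite_measure "cylM T :: (real \<times> (real ^ 'd)) measure" by (rule finite_measure_cylM)
  note [measurable] = am em
  let ?K = "\<lambda>q. if fst q < t then \<Sum>k\<in>S. a k (fst q) * e k (snd q) else 0"
  have fs: "(fst :: real \<times> (real ^ 'd) \<Rightarrow> real) \<in> borel_measurable borel" "(snd :: real \<times> (real ^ 'd) \<Rightarrow> _) \<in> borel_measurable borel"
    by (intro borel_measurable_continuous_onI continuous_intros)+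
  note [measurable] = fs
  have Km [measurable]: "?K \<in> borel_measurable borel" by measurable
  have psi1: "1 / (1 + (t - s) * w k) \<le> 1" if "k \<in> S" "s < t" for k s
  proof -
    have "0 \<le> (t - s) * w k" using less_imp_le[OF w[OF that(1)]] that(2) by (intro mult_nonneg_nonneg) auto
    then show ?thesis by simp
  qed
  show sq: "sq_int (cylM T) ?K"
  proof (rule sq_int_bounded[OF measurable_cylM_restrict[OF Km], of "real (card S)"])
    fix q assume "q \<in> space (cylM T :: (real \<times> (real ^ 'd)) measure)"
    then have q: "0 < fst q" by (auto simp: cyl_def)
    show "\<bar>?K q\<bar> \<le> real (card S)"
    proof (cases "fst q < t")
      case True
      have "\<bar>\<Sum>k\<in>S. a k (fst q) * e k (snd q)\<bar> \<le> (\<Sum>k\<in>S. 1)"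
      proof (rule order_trans[OF sum_abs sum_mono])
        fix k assume k: "k \<in> S"
        have "\<bar>a k (fst q)\<bar> \<le> 1" using ab[OF k q True] psi1[OF k True] by linarith
        then show "\<bar>a k (fst q) * e k (snd q)\<bar> \<le> 1"
          unfolding abs_mult using eb[of k "snd q"] by (intro mult_le_one) auto
      qed
      then show ?thesis using True by simp
    qed simp
  qed
  have "(\<integral>\<^sup>+q. ennreal ((?K q)\<^sup>2) \<partial>cylM T) = (\<integral>\<^sup>+s. ennreal (indicator {0<..<t} s) * ennreal (\<Sum>k\<in>S. (a k s)\<^sup>2) \<partial>lborel)"
    by (rule orthonormal_kernel_nn_integral[OF S t(2) am em eb orth])
  also have "\<dots> \<le> (\<integral>\<^sup>+s. (\<Sum>k\<in>S. ennreal (indicator {0<..<t} s * (1 / (1 + (t - s) * w k))\<^sup>2)) \<partial>lborel)"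
  proof (rule nn_integral_mono)
    fix s
    show "ennreal (indicator {0<..<t} s) * ennreal (\<Sum>k\<in>S. (a k s)\<^sup>2)
       \<le> (\<Sum>k\<in>S. ennreal (indicator {0<..<t} s * (1 / (1 + (t - s) * w k))\<^sup>2))"
    proof (cases "s \<in> {0<..<t}")
      case True
      have "(\<Sum>k\<in>S. (a k s)\<^sup>2) \<le> (\<Sum>k\<in>S. (1 / (1 + (t - s) * w k))\<^sup>2)"
      proof (rule sum_mono)
        fix k assume k: "k \<in> S"
        have "\<bar>a k s\<bar> \<le> 1 / (1 + (t - s) * w k)" using ab[OF k, of s] True by simp
        also have "\<dots> \<le> \<bar>1 / (1 + (t - s) * w k)\<bar>" by (rule abs_ge_self)
        finally have "\<bar>a k s\<bar> \<le> \<bar>1 / (1 + (t - s) * w k)\<bar>" .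
        then show "(a k s)\<^sup>2 \<le> (1 / (1 + (t - s) * w k))\<^sup>2" by (simp only: abs_le_square_iff)
      qed
      then show ?thesis using True by (simp add: ennreal_leI sum_ennreal)
    qed simp
  qed
  also have "\<dots> = (\<Sum>k\<in>S. \<integral>\<^sup>+s. ennreal (indicator {0<..<t} s * (1 / (1 + (t - s) * w k))\<^sup>2) \<partial>lborel)"
    by (rule nn_integral_sum) measurable
  also have "\<dots> \<le> (\<Sum>k\<in>S. ennreal (1 / w k))"
    by (intro sum_mono nn_integral_resolvent_sq w t)
  also have "\<dots> = ennreal (\<Sum>k\<in>S. 1 / w k)" by (rule sum_ennreal) (simp add: less_imp_le w)
  finally have "(\<integral>\<^sup>+q. ennreal ((?K q)\<^sup>2) \<partial>cylM T) \<le> ennreal (\<Sum>k\<in>S. 1 / w k)" .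
  moreover have "(\<integral>\<^sup>+q. ennreal ((?K q)\<^sup>2) \<partial>cylM T) = ennreal ((l2 (cylM T) ?K)\<^sup>2)"
    unfolding l2_sq using sq by (intro nn_integral_eq_integral) (auto simp: sq_int_def)
  moreover have "0 \<le> (\<Sum>k\<in>S. 1 / w k)" by (intro sum_nonneg) (simp add: less_imp_le w)
  ultimately show "(l2 (cylM T) ?K)\<^sup>2 \<le> (\<Sum>k\<in>S. 1 / w k)" by (simp add: ennreal_le_iff)
qed

section \<open>Convergence of the Green kernels\<close>

text \<open>Kernels are functions of two space-time points, with the causality cutoff built in, and
  restricted to a set of modes: splitting off a fixed finite set leaves a tail that is small
  uniformly in all other parameters.\<close>

definition gkS :: "('d::finite \<Rightarrow> nat) set \<Rightarrow> real \<times> (real ^ 'd) \<Rightarrow> real \<times> (real ^ 'd) \<Rightarrow> real" where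
  "gkS S p q = (if fst q < fst p then \<Sum>k\<in>S. exp (- (fst p - fst q) * (ksq k)\<^sup>2) * eigfun k (snd p) * eigfun k (snd q) else 0)"

definition gk :: "real \<times> (real ^ 'd::finite) \<Rightarrow> real \<times> (real ^ 'd) \<Rightarrow> real" where
  "gk p q = (if fst q < fst p then green (fst p - fst q) (snd p) (snd q) else 0)"

definition gdS :: "real \<Rightarrow> nat \<Rightarrow> nat \<Rightarrow> ('d::finite \<Rightarrow> nat) set \<Rightarrow> real \<times> (real ^ 'd) \<Rightarrow> real \<times> (real ^ 'd) \<Rightarrow> real" where
  "gdS T M n S p q = (if fst q < fst p then \<Sum>k\<in>S. euler_interp T M (fst p - time_floor T M (fst q)) (mu n k) *
      eigfun_interp n k (snd p) * eigfun k (kappa n (snd q)) else 0)"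

abbreviation gd :: "real \<Rightarrow> nat \<Rightarrow> nat \<Rightarrow> real \<times> (real ^ 'd::finite) \<Rightarrow> real \<times> (real ^ 'd) \<Rightarrow> real" where
  "gd T M n \<equiv> gdS T M n (mode_idx n)"

lemma borel_measurable_fst_snd [measurable]:
  "(fst :: real \<times> (real ^ 'd) \<Rightarrow> real) \<in> borel_measurable borel"
  "(snd :: real \<times> (real ^ 'd) \<Rightarrow> real ^ 'd) \<in> borel_measurable borel"
  by (intro borel_measurable_continuous_onI continuous_intros)+

lemma time_floor_bounds:
  assumes "0 < T" "0 < M"
  shows "time_floor T M s \<le> s" "s < time_floor T M s + dt T M"
proof -
  have d: "0 < dt T M" using assms by simp
  have fl: "of_int \<lfloor>s / dt T M\<rfloor> \<le> s / dt T M" "s / dt T M < of_int \<lfloor>s / dt T M\<rfloor> + 1" by linarith+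
  show "time_floor T M s \<le> s" "s < time_floor T M s + dt T M"
    using fl[unfolded pos_le_divide_eq[OF d] pos_divide_less_eq[OF d]] by (simp_all add: time_floor_def algebra_simps)
qed

lemma time_floor_nonneg: "0 < T \<Longrightarrow> 0 < M \<Longrightarrow> 0 \<le> s \<Longrightarrow> 0 \<le> time_floor T M s"
  by (simp add: time_floor_def dt_def)

lemma time_floor_measurable [measurable]: "time_floor T M \<in> borel_measurable borel"
  unfolding time_floor_def by measurable

lemma euler_interp_measurable [measurable]: "(\<lambda>r. euler_interp T M r \<mu>) \<in> borel_measurable borel"
proof -
  have e: "euler_interp T M r \<mu> = (if r \<le> dt T M then euler_factor T M \<mu>
      else (1 - (r / dt T M - real (nat \<lfloor>r / dt T M\<rfloor>))) * euler_factor T M \<mu> ^ nat \<lfloor>r / dt T M\<rfloor> +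
        (r / dt T M - real (nat \<lfloor>r / dt T M\<rfloor>)) * euler_factor T M \<mu> ^ (nat \<lfloor>r / dt T M\<rfloor> + 1))" for r
    by (simp add: euler_interp_def Let_def)
  have "(\<lambda>r. (\<lambda>i::nat. euler_factor T M \<mu> ^ i) (nat \<lfloor>r / dt T M\<rfloor>)) \<in> borel_measurable borel"
    "(\<lambda>r. (\<lambda>i::nat. euler_factor T M \<mu> ^ (i + 1)) (nat \<lfloor>r / dt T M\<rfloor>)) \<in> borel_measurable borel"
    by (rule measurable_compose_countable'[where I = UNIV]; simp)+
  then show ?thesis unfolding e by measurable
qed

lemma dt_tendsto:
  assumes "filterlim M at_top sequentially"
  shows "(\<lambda>j. dt T (M j)) \<longlonglongrightarrow> 0"
  unfolding dt_def
  by (rule real_tendsto_divide_at_top[OF tendsto_const filterlim_compose[OF filterlim_real_sequentially assms]])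

lemma time_floor_tendsto:
  assumes "0 < T" "filterlim M at_top sequentially"
  shows "(\<lambda>j. time_floor T (M j) s) \<longlonglongrightarrow> s"
proof (rule LIM_zero_cancel, rule Lim_null_comparison[OF _ dt_tendsto[OF assms(2)]])
  show "\<forall>\<^sub>F j in sequentially. norm (time_floor T (M j) s - s) \<le> dt T (M j)"
    using filterlim_nat_ge[OF assms(2), of 1]
  proof eventually_elim
    case (elim j)
    then show ?case using time_floor_bounds[OF assms(1), of "M j" s] by simp
  qed
qed

lemma c0_sq: "wt k = (4 / pi\<^sup>2 * ksq k)\<^sup>2 / 2"
  by (simp add: wt_def power_mult_distrib power_divide)

lemma wt_le_ksq: "wt k \<le> (ksq k)\<^sup>2"
proof -
  have "(8::real) \<le> 3 ^ 4" by simp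
  also have "\<dots> \<le> pi ^ 4" using pi_gt3 by (intro power_mono) auto
  finally have "8 / pi ^ 4 \<le> 1" by simp
  then show ?thesis unfolding wt_def using mult_right_mono[of "8 / pi ^ 4" 1 "(ksq k)\<^sup>2"] by simp
qed

lemma exp_neg_le_resolvent:
  assumes "0 \<le> (x::real)" shows "exp (- x) \<le> 1 / (1 + x)"
proof -
  have "1 + x \<le> exp x" by (rule exp_ge_add_one_self)
  then have "1 / exp x \<le> 1 / (1 + x)" using assms by (intro divide_left_mono) auto
  then show ?thesis by (simp add: exp_minus inverse_eq_divide)
qed

lemma gkS_l2:
  fixes p :: "real \<times> (real ^ 'd::finite)"
  assumes S: "finite S" "S \<subseteq> modes" and p: "0 \<le> fst p" "fst p \<le> T"
  shows "sq_int (cylM T) (gkS S p)" "(l2 (cylM T) (gkS S p))\<^sup>2 \<le> (\<Sum>k\<in>S. 1 / wt k)"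
proof -
  define a where "a k s = exp (- (fst p - s) * (ksq k)\<^sup>2) * eigfun k (snd p)" for k s
  have a: "gkS S p = (\<lambda>q. if fst q < fst p then \<Sum>k\<in>S. a k (fst q) * eigfun k (snd q) else 0)"
    by (simp add: gkS_def a_def fun_eq_iff)
  have ab: "\<bar>a k s\<bar> \<le> 1 / (1 + (fst p - s) * wt k)" if "k \<in> S" "0 < s" "s < fst p" for k s
  proof -
    have w0: "0 < wt k" using wt_pos S that by auto
    have h: "(fst p - s) * wt k \<le> (fst p - s) * (ksq k)\<^sup>2"
      using that wt_le_ksq[of k] by (intro mult_left_mono) auto
    have "\<bar>a k s\<bar> \<le> exp (- (fst p - s) * (ksq k)\<^sup>2) * 1"
      unfolding a_def abs_mult using eigfun_bound[of k "snd p"] by (intro mult_mono) auto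
    also have "\<dots> \<le> exp (- ((fst p - s) * wt k))"
      using h by (simp only: mult_1_right exp_le_cancel_iff minus_mult_left[symmetric] neg_le_iff_le)
    also have "\<dots> \<le> 1 / (1 + (fst p - s) * wt k)"
      using that w0 by (intro exp_neg_le_resolvent mult_nonneg_nonneg) auto
    finally show ?thesis .
  qed
  have am: "a k \<in> borel_measurable borel" for k unfolding a_def[abs_def] by measurable
  have w: "0 < wt k" if "k \<in> S" for k using that S(2) by (intro wt_pos) blast
  have orth: "(\<integral>z. indicator cube z * (eigfun j z * eigfun k z) \<partial>lborel) = (if j = k then 1 else 0)"
    if "j \<in> S" "k \<in> S" for j k :: "'d \<Rightarrow> nat"
    using S(2) that by (intro eigfun_orthonormal) blast+
  show "sq_int (cylM T) (gkS S p)" "(l2 (cylM T) (gkS S p))\<^sup>2 \<le> (\<Sum>k\<in>S. 1 / wt k)"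
    unfolding a
    by (rule orthonormal_kernel_bound[where w = wt, OF S(1) p am eigfun_measurable eigfun_bound w ab orth]; assumption)+
qed

text \<open>By Parseval each mode contributes a nonnegative amount. Needed for the lower bound on
  the norm in \<open>gk_norm_pos\<close>.\<close>

lemma gkS_l2_mono:
  fixes p :: "real \<times> (real ^ 'd::finite)"
  assumes F: "F \<subseteq> S" and S: "finite S" "S \<subseteq> modes" and p: "0 \<le> fst p" "fst p \<le> T"
  shows "l2 (cylM T) (gkS F p) \<le> l2 (cylM T) (gkS S p)"
proof -
  define a where "a k s = exp (- (fst p - s) * (ksq k)\<^sup>2) * eigfun k (snd p)" for k s
  have a: "gkS R p q = (if fst q < fst p then \<Sum>k\<in>R. a k (fst q) * eigfun k (snd q) else 0)" for R q
    by (simp add: gkS_def a_def)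
  have am: "a k \<in> borel_measurable borel" for k unfolding a_def[abs_def] by measurable
  have eq: "ennreal ((l2 (cylM T) (gkS R p))\<^sup>2) = (\<integral>\<^sup>+s. ennreal (indicator {0<..<fst p} s) * ennreal (\<Sum>k\<in>R. (a k s)\<^sup>2) \<partial>lborel)"
    if R: "R \<subseteq> S" for R
  proof -
    have fR: "finite R" using finite_subset[OF R S(1)] .
    have orth: "(\<integral>z. indicator cube z * (eigfun j z * eigfun k z) \<partial>lborel) = (if j = k then 1 else 0)"
      if "j \<in> R" "k \<in> R" for j k :: "'d \<Rightarrow> nat"
      using R S(2) that by (intro eigfun_orthonormal) blast+
    have "ennreal ((l2 (cylM T) (gkS R p))\<^sup>2) = (\<integral>\<^sup>+q. ennreal ((gkS R p q)\<^sup>2) \<partial>cylM T)"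
      unfolding l2_sq using gkS_l2(1)[OF fR subset_trans[OF R S(2)] p]
      by (intro nn_integral_eq_integral[symmetric]) (auto simp: sq_int_def)
    also have "\<dots> = (\<integral>\<^sup>+s. ennreal (indicator {0<..<fst p} s) * ennreal (\<Sum>k\<in>R. (a k s)\<^sup>2) \<partial>lborel)"
      unfolding a by (rule orthonormal_kernel_nn_integral[OF fR p(2) am eigfun_measurable eigfun_bound orth])
    finally show ?thesis .
  qed
  have "ennreal ((l2 (cylM T) (gkS F p))\<^sup>2) \<le> ennreal ((l2 (cylM T) (gkS S p))\<^sup>2)"
    unfolding eq[OF F] eq[OF order_refl]
    by (intro nn_integral_mono mult_left_mono ennreal_leI sum_mono2 S(1) F) auto
  then have "(l2 (cylM T) (gkS F p))\<^sup>2 \<le> (l2 (cylM T) (gkS S p))\<^sup>2" by (simp add: ennreal_le_iff)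
  then show ?thesis using l2_nonneg power2_le_imp_le by blast
qed

lemma gdS_l2:
  fixes p :: "real \<times> (real ^ 'd::finite)"
  assumes S: "S \<subseteq> mode_idx n" and n: "0 < n" and T: "0 < T" "0 < M" and p: "p \<in> closed_cyl T"
  shows "sq_int (cylM T) (gdS T M n S p)" "(l2 (cylM T) (gdS T M n S p))\<^sup>2 \<le> (\<Sum>k\<in>S. 1 / wt k)"
proof -
  obtain t x where px: "p = (t, x)" by (cases p)
  then have t: "0 \<le> t" "t \<le> T" and x: "x \<in> closure cube"
    using p by (auto simp: mem_closed_cyl mem_closure_cube)
  define a where "a k s = euler_interp T M (t - time_floor T M s) (mu n k) * eigfun_interp n k x" for k s
  have a: "gdS T M n S p = (\<lambda>q. if fst q < t then \<Sum>k\<in>S. a k (fst q) * eigfun k (kappa n (snd q)) else 0)"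
    by (simp add: gdS_def a_def px fun_eq_iff)
  have S': "finite S" using finite_subset[OF S] by simp
  have km: "k \<in> modes" if "k \<in> S" for k using that S mode_idx_subset by blast
  have ab: "\<bar>a k s\<bar> \<le> 1 / (1 + (t - s) * wt k)" if "k \<in> S" "0 < s" "s < t" for k s
  proof -
    have w0: "0 < wt k" using wt_pos km that by auto
    let ?r = "t - time_floor T M s"
    \<comment> \<open>Rounding the source time down only lengthens the elapsed time, so decay in
      \<open>t - s\<close> is a valid bound.\<close>
    have r: "t - s \<le> ?r" using time_floor_bounds[OF T, of s] by simp
    have r0: "0 \<le> ?r" using r that by simp
    have mu: "0 \<le> 4 / pi\<^sup>2 * ksq k" "4 / pi\<^sup>2 * ksq k \<le> mu n k"
      using mu_lower[OF n, of k] that S ksq_ge_1[OF km[OF that(1)]] by auto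
    then have "(4 / pi\<^sup>2 * ksq k)\<^sup>2 \<le> (mu n k)\<^sup>2" by (intro power_mono)
    then have w: "wt k \<le> (mu n k)\<^sup>2 / 2" unfolding c0_sq by simp
    have "(t - s) * wt k \<le> ?r * ((mu n k)\<^sup>2 / 2)"
      using r that w0 w by (intro mult_mono) auto
    then have le: "1 + (t - s) * wt k \<le> 1 + ?r * (mu n k)\<^sup>2 / 2" by simp
    have "0 \<le> (t - s) * wt k" using w0 that by (intro mult_nonneg_nonneg) auto
    then have le2: "1 / (1 + ?r * (mu n k)\<^sup>2 / 2) \<le> 1 / (1 + (t - s) * wt k)"
      using le by (intro divide_left_mono mult_pos_pos) auto
    have "\<bar>a k s\<bar> \<le> \<bar>euler_interp T M ?r (mu n k)\<bar> * 1"
      unfolding a_def abs_mult using eigfun_interp_bound[OF n x, of k] by (intro mult_mono) auto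
    also have "\<dots> = euler_interp T M ?r (mu n k)" using euler_interp_bound(1)[OF T r0] by simp
    also have "\<dots> \<le> 1 / (1 + ?r * (mu n k)\<^sup>2 / 2)" by (rule euler_interp_bound(2)[OF T r0])
    finally show ?thesis using le2 by linarith
  qed
  have am: "a k \<in> borel_measurable borel" for k unfolding a_def[abs_def] by measurable
  have em: "(\<lambda>z. eigfun k (kappa n z)) \<in> borel_measurable borel" for k :: "'d \<Rightarrow> nat" by measurable
  have orth: "(\<integral>z. indicator cube z * (eigfun j (kappa n z) * eigfun k (kappa n z)) \<partial>lborel) = (if j = k then 1 else 0)"
    if "j \<in> S" "k \<in> S" for j k :: "'d \<Rightarrow> nat"
    using eigfun_kappa_orthonormal S that by blast
  have w: "0 < wt k" if "k \<in> S" for k using that by (intro wt_pos km)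
  show "sq_int (cylM T) (gdS T M n S p)" "(l2 (cylM T) (gdS T M n S p))\<^sup>2 \<le> (\<Sum>k\<in>S. 1 / wt k)"
    unfolding a
    by (rule orthonormal_kernel_bound[where w = wt, OF S' t am em eigfun_bound w ab orth]; assumption)+
qed

text \<open>For a fixed positive time the exponential is below \<open>1 / (r * wt k)\<close>, which
  reduces summability to that of the inverse weights.\<close>

lemma green_summable:
  fixes x z :: "real ^ 'd::finite"
  assumes d: "CARD('d) \<le> 3" and r: "0 < r"
  shows "(\<lambda>k. exp (- r * (ksq k)\<^sup>2) * eigfun k x * eigfun k z) summable_on modes"
proof -
  obtain W where W: "\<And>S. finite S \<Longrightarrow> S \<subseteq> (modes :: ('d \<Rightarrow> nat) set) \<Longrightarrow> (\<Sum>k\<in>S. 1 / wt k) \<le> W"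
    using sum_inverse_wt_bounded[OF d] by blast
  have bd: "\<bar>exp (- r * (ksq k)\<^sup>2) * eigfun k x * eigfun k z\<bar> \<le> 1 / r * (1 / wt k)" if k: "k \<in> modes" for k
  proof -
    have w0: "0 < wt k" by (rule wt_pos[OF k])
    have "\<bar>exp (- r * (ksq k)\<^sup>2) * eigfun k x * eigfun k z\<bar> \<le> exp (- (r * (ksq k)\<^sup>2)) * 1 * 1"
      unfolding abs_mult using eigfun_bound[of k x] eigfun_bound[of k z] by (intro mult_mono) auto
    also have "\<dots> \<le> exp (- (r * wt k))" using r wt_le_ksq[of k] by (simp add: mult_left_mono)
    also have "\<dots> \<le> 1 / (1 + r * wt k)" using r w0 by (intro exp_neg_le_resolvent) auto
    also have "\<dots> \<le> 1 / (r * wt k)" using r w0 by (intro divide_left_mono) (auto intro!: mult_pos_pos add_pos_pos)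
    finally show ?thesis by simp
  qed
  have "(\<lambda>k. norm (exp (- r * (ksq k)\<^sup>2) * eigfun k x * eigfun k z)) summable_on modes"
  proof (rule nonneg_bdd_above_summable_on)
    show "bdd_above (sum (\<lambda>k. norm (exp (- r * (ksq k)\<^sup>2) * eigfun k x * eigfun k z)) ` {F. F \<subseteq> modes \<and> finite F})"
    proof (rule bdd_aboveI2)
      fix F :: "('d \<Rightarrow> nat) set" assume F: "F \<in> {F. F \<subseteq> modes \<and> finite F}"
      have "(\<Sum>k\<in>F. norm (exp (- r * (ksq k)\<^sup>2) * eigfun k x * eigfun k z)) \<le> (\<Sum>k\<in>F. 1 / r * (1 / wt k))"
        using F bd by (intro sum_mono) auto
      also have "\<dots> = 1 / r * (\<Sum>k\<in>F. 1 / wt k)" by (simp only: sum_distrib_left)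
      also have "\<dots> \<le> 1 / r * W" using F r W by (intro mult_left_mono) auto
      finally show "(\<Sum>k\<in>F. norm (exp (- r * (ksq k)\<^sup>2) * eigfun k x * eigfun k z)) \<le> 1 / r * W" .
    qed
  qed simp
  then show ?thesis by (rule Infinite_Sum.abs_summable_summable)
qed

text \<open>The boxes \<open>mode_idx j\<close> exhaust all modes, so the unordered sum is the limit
  of a sequence of finite sums; measurability of \<open>gk\<close> and the Fatou argument for its
  tail rely on this form.\<close>

lemma gkS_tendsto_gk:
  fixes p q :: "real \<times> (real ^ 'd::finite)"
  assumes d: "CARD('d) \<le> 3"
  shows "(\<lambda>j. gkS (mode_idx j) p q) \<longlonglongrightarrow> gk p q"
proof (cases "fst q < fst p")
  case True
  let ?f = "\<lambda>k. exp (- (fst p - fst q) * (ksq k)\<^sup>2) * eigfun k (snd p) * eigfun k (snd q)"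
  have "?f summable_on modes" by (rule green_summable[OF d]) (use True in simp)
  then have "(?f has_sum infsum ?f modes) modes" by (rule has_sum_infsum)
  then have lim: "(sum ?f \<longlongrightarrow> infsum ?f modes) (finite_subsets_at_top modes)" by (simp add: has_sum_def)
  have "filterlim mode_idx (finite_subsets_at_top (modes :: ('d \<Rightarrow> nat) set)) sequentially"
    unfolding filterlim_finite_subsets_at_top
  proof (intro allI impI)
    fix X :: "('d \<Rightarrow> nat) set" assume X: "finite X \<and> X \<subseteq> modes"
    obtain N where "\<And>n. N \<le> n \<Longrightarrow> X \<subseteq> mode_idx n"
      using X by (elim conjE) (rule finite_subset_mode_idx, auto)
    then show "\<forall>\<^sub>F y in sequentially. finite (mode_idx y :: ('d \<Rightarrow> nat) set) \<and> X \<subseteq> mode_idx y \<and> mode_idx y \<subseteq> modes"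
      by (auto simp: eventually_sequentially mode_idx_subset)
  qed
  from filterlim_compose[OF lim this] show ?thesis
    using True by (simp add: gkS_def gk_def green_def ksq_def modes_def)
qed (simp add: gkS_def gk_def)

lemma gkS_measurable [measurable]: "gkS S p \<in> borel_measurable borel"
  unfolding gkS_def[abs_def] by measurable

lemma gk_measurable:
  assumes "CARD('d::finite) \<le> 3"
  shows "(gk p :: real \<times> (real ^ 'd) \<Rightarrow> real) \<in> borel_measurable borel"
  by (rule borel_measurable_LIMSEQ_real[OF gkS_tendsto_gk[OF assms] gkS_measurable])

lemma gdS_measurable [measurable]: "gdS T M n S p \<in> borel_measurable borel"
  unfolding gdS_def[abs_def] by measurable

lemma gkS_diff:
  assumes "finite S" "F \<subseteq> S"
  shows "gkS S p q - gkS F p q = gkS (S - F) p q"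
  using assms by (simp add: gkS_def sum_diff)

lemma gdS_diff:
  assumes "finite S" "F \<subseteq> S"
  shows "gdS T M n S p q - gdS T M n F p q = gdS T M n (S - F) p q"
  using assms by (simp add: gdS_def sum_diff)

text \<open>The difference is the pointwise limit of finite sums over modes outside
  \<open>F\<close>, each of squared norm at most \<open>e\<close>; Fatou passes the bound to the
  limit.\<close>

lemma gk_tail:
  fixes p :: "real \<times> (real ^ 'd::finite)"
  assumes d: "CARD('d) \<le> 3" and p: "0 \<le> fst p" "fst p \<le> T"
    and F: "finite F" "F \<subseteq> modes" "\<And>S. finite S \<Longrightarrow> S \<subseteq> modes - F \<Longrightarrow> (\<Sum>k\<in>S. 1 / wt k) \<le> e"
  shows "sq_int (cylM T) (\<lambda>q. gk p q - gkS F p q)" "l2 (cylM T) (\<lambda>q. gk p q - gkS F p q) \<le> sqrt e"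
proof -
  have e0: "0 \<le> e" using F(3)[of "{}"] by simp
  obtain N where N: "\<And>n. N \<le> n \<Longrightarrow> F \<subseteq> mode_idx n"
    using finite_subset_mode_idx[OF F(1,2)] by metis
  have lim: "AE q in cylM T. (\<lambda>j. gkS (mode_idx (j + N) - F) p q) \<longlonglongrightarrow> gk p q - gkS F p q"
  proof (rule AE_I2)
    fix q
    have "(\<lambda>j. gkS (mode_idx (j + N)) p q - gkS F p q) \<longlonglongrightarrow> gk p q - gkS F p q"
      by (intro tendsto_intros LIMSEQ_ignore_initial_segment gkS_tendsto_gk d)
    then show "(\<lambda>j. gkS (mode_idx (j + N) - F) p q) \<longlonglongrightarrow> gk p q - gkS F p q"
      using N by (simp add: gkS_diff)
  qed
  have bd: "l2 (cylM T) (gkS (mode_idx (j + N) - F) p) \<le> sqrt e" for j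
  proof -
    have "(l2 (cylM T) (gkS (mode_idx (j + N) - F) p))\<^sup>2 \<le> (\<Sum>k\<in>mode_idx (j + N) - F. 1 / wt k)"
      using mode_idx_subset by (intro gkS_l2 p) auto
    also have "\<dots> \<le> e" using mode_idx_subset by (intro F(3)) auto
    finally show ?thesis by (rule real_le_rsqrt)
  qed
  have sq: "sq_int (cylM T) (gkS (mode_idx (j + N) - F) p)" for j
    using mode_idx_subset by (intro gkS_l2 p) auto
  have m: "(\<lambda>q. gk p q - gkS F p q) \<in> borel_measurable (cylM T)"
    by (intro borel_measurable_diff measurable_cylM_restrict gk_measurable[OF d] gkS_measurable)
  show "sq_int (cylM T) (\<lambda>q. gk p q - gkS F p q)" "l2 (cylM T) (\<lambda>q. gk p q - gkS F p q) \<le> sqrt e"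
    using l2_Fatou[OF sq m lim, of "sqrt e"] bd by auto
qed

lemma gk_sq_int:
  fixes p :: "real \<times> (real ^ 'd::finite)"
  assumes d: "CARD('d) \<le> 3" and p: "0 \<le> fst p" "fst p \<le> T"
  shows "sq_int (cylM T) (gk p)"
proof -
  obtain F where F: "finite F" "F \<subseteq> (modes :: ('d \<Rightarrow> nat) set)" "\<And>S. finite S \<Longrightarrow> S \<subseteq> modes - F \<Longrightarrow> (\<Sum>k\<in>S. 1 / wt k) \<le> 1"
    using sum_inverse_wt_tail[OF d, of 1] by auto
  have "sq_int (cylM T) (\<lambda>q. (gk p q - gkS F p q) + gkS F p q)"
    by (rule sq_int_add[OF gk_tail(1)[OF d p F] gkS_l2(1)[OF F(1,2) p]])
  then show ?thesis by simp
qed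

text \<open>Kernels with finitely many modes jump where source and target time coincide. This null
  hyperplane is excluded when pointwise convergence along moving target points is claimed.\<close>

lemma AE_fst_neq: "AE q in cylM T. fst (q :: real \<times> (real ^ 'd)) \<noteq> t"
proof -
  have b: "((1, 0) :: real \<times> (real ^ 'd)) \<in> Basis" by (simp add: Basis_prod_def)
  have "negligible {q :: real \<times> (real ^ 'd). q \<bullet> (1, 0) = t}"
    by (rule negligible_standard_hyperplane[OF b])
  then have "{q :: real \<times> (real ^ 'd). fst q = t} \<in> null_sets lebesgue"
    by (simp add: negligible_iff_null_sets inner_prod_def)
  then have "AE q in lebesgue. q \<notin> {q :: real \<times> (real ^ 'd). fst q = t}" by (rule AE_not_in)
  then have "AE q in lborel. fst (q :: real \<times> (real ^ 'd)) \<noteq> t" by (simp add: AE_completion_iff)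
  then show ?thesis unfolding AE_cylM by eventually_elim simp
qed

lemma gkS_bound:
  fixes p :: "real \<times> (real ^ 'd::finite)"
  assumes "fst p \<le> T"
  shows "\<bar>gkS S p q\<bar> \<le> real (card S)"
proof (cases "fst q < fst p")
  case True
  have "\<bar>\<Sum>k\<in>S. exp (- (fst p - fst q) * (ksq k)\<^sup>2) * eigfun k (snd p) * eigfun k (snd q)\<bar> \<le> (\<Sum>k\<in>S. 1)"
  proof (rule order_trans[OF sum_abs sum_mono])
    fix k :: "'d \<Rightarrow> nat"
    have "(fst q - fst p) * (ksq k)\<^sup>2 \<le> 0" using True by (intro mult_nonpos_nonneg) auto
    then have "\<bar>exp (- (fst p - fst q) * (ksq k)\<^sup>2) * eigfun k (snd p)\<bar> \<le> 1"
      unfolding abs_mult using eigfun_bound[of k "snd p"] by (intro mult_le_one) auto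
    then show "\<bar>exp (- (fst p - fst q) * (ksq k)\<^sup>2) * eigfun k (snd p) * eigfun k (snd q)\<bar> \<le> 1"
      unfolding abs_mult[of _ "eigfun k (snd q)"] using eigfun_bound[of k "snd q"] by (intro mult_le_one) auto
  qed
  then show ?thesis using True by (simp add: gkS_def)
qed (simp add: gkS_def)

lemma gdS_bound:
  fixes p :: "real \<times> (real ^ 'd::finite)"
  assumes T: "0 < T" "0 < M" "0 < n" and p: "p \<in> closed_cyl T"
  shows "\<bar>gdS T M n S p q\<bar> \<le> real (card S)"
proof (cases "fst q < fst p")
  case True
  have x: "snd p \<in> closure cube" using p by (auto simp: closed_cyl_def)
  have "\<bar>\<Sum>k\<in>S. euler_interp T M (fst p - time_floor T M (fst q)) (mu n k) *
      eigfun_interp n k (snd p) * eigfun k (kappa n (snd q))\<bar> \<le> (\<Sum>k\<in>S. 1)"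
  proof (rule order_trans[OF sum_abs sum_mono])
    fix k :: "'d \<Rightarrow> nat"
    have r: "0 \<le> fst p - time_floor T M (fst q)" using True time_floor_bounds(1)[OF T(1,2), of "fst q"] by linarith
    have "0 \<le> (fst p - time_floor T M (fst q)) * (mu n k)\<^sup>2 / 2" using r by simp
    then have "1 / (1 + (fst p - time_floor T M (fst q)) * (mu n k)\<^sup>2 / 2) \<le> 1" by simp
    then have "\<bar>euler_interp T M (fst p - time_floor T M (fst q)) (mu n k)\<bar> \<le> 1"
      using euler_interp_bound[OF T(1,2) r, of "mu n k"] by linarith
    then have "\<bar>euler_interp T M (fst p - time_floor T M (fst q)) (mu n k) * eigfun_interp n k (snd p)\<bar> \<le> 1"
      unfolding abs_mult using eigfun_interp_bound[OF T(3) x, of k] by (intro mult_le_one) auto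
    then show "\<bar>euler_interp T M (fst p - time_floor T M (fst q)) (mu n k) * eigfun_interp n k (snd p) * eigfun k (kappa n (snd q))\<bar> \<le> 1"
      unfolding abs_mult[of _ "eigfun k (kappa n (snd q))"] using eigfun_bound[of k "kappa n (snd q)"] by (intro mult_le_one) auto
  qed
  then show ?thesis using True by (simp add: gdS_def)
qed (simp add: gdS_def)

lemma fst_less_tendsto:
  fixes t :: "nat \<Rightarrow> real"
  assumes "t \<longlonglongrightarrow> a" "s \<noteq> a"
  shows "eventually (\<lambda>j. s < t j \<longleftrightarrow> s < a) sequentially"
proof (cases "s < a")
  case True
  show ?thesis using order_tendstoD(1)[OF assms(1) True] by eventually_elim (use True in simp)
next
  case False
  then have "a < s" using assms(2) by simp
  from order_tendstoD(2)[OF assms(1) this] show ?thesis by eventually_elim (use False in simp)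
qed

lemma gkS_converges:
  fixes p :: "nat \<Rightarrow> real \<times> (real ^ 'd::finite)"
  assumes p: "p \<longlonglongrightarrow> a" "\<And>j. p j \<in> closed_cyl T"
  shows "(\<lambda>j. l2 (cylM T) (\<lambda>q. gkS F (p j) q - gkS F a q)) \<longlonglongrightarrow> 0"
proof -
  interpret finite_measure "cylM T :: (real \<times> (real ^ 'd)) measure" by (rule finite_measure_cylM)
  have t: "(\<lambda>j. fst (p j)) \<longlonglongrightarrow> fst a" and x: "(\<lambda>j. snd (p j)) \<longlonglongrightarrow> snd a"
    using p(1) by (intro tendsto_intros; simp)+
  show ?thesis
  proof (rule l2_dominated_convergence[OF sq_int_const[of "real (card F)"]])
    show "AE q in cylM T. (\<lambda>j. gkS F (p j) q) \<longlonglongrightarrow> gkS F a q"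
      using AE_fst_neq[where T = T and t = "fst a"]
    proof eventually_elim
      case (elim q)
      let ?g = "\<lambda>b. \<Sum>k\<in>F. exp (- (fst b - fst q) * (ksq k)\<^sup>2) * eigfun k (snd b) * eigfun k (snd q)"
      have cont: "(\<lambda>j. eigfun k (snd (p j))) \<longlonglongrightarrow> eigfun k (snd a)" for k
        using continuous_on_tendsto_compose[OF eigfun_continuous x] by simp
      have "(\<lambda>j. if fst q < fst a then ?g (p j) else 0) \<longlonglongrightarrow> (if fst q < fst a then ?g a else 0)"
        by (auto intro!: tendsto_intros t cont)
      moreover have "eventually (\<lambda>j. (if fst q < fst a then ?g (p j) else 0) = gkS F (p j) q) sequentially"
        using fst_less_tendsto[OF t elim] by eventually_elim (simp add: gkS_def)
      ultimately have "(\<lambda>j. gkS F (p j) q) \<longlonglongrightarrow> (if fst q < fst a then ?g a else 0)"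
        by (rule Lim_transform_eventually)
      then show ?case by (simp only: gkS_def)
    qed
    show "AE q in cylM T. \<bar>gkS F (p j) q\<bar> \<le> real (card F)" for j
      using p(2)[of j] by (intro AE_I2 gkS_bound[of _ T]) (auto simp: closed_cyl_def)
  qed (auto intro: measurable_cylM_restrict)
qed

text \<open>With finitely many modes the kernel is bounded by their number, and every factor
  converges for almost every source point even while the target \<open>p j\<close> moves.\<close>

lemma gdS_converges:
  fixes p :: "nat \<Rightarrow> real \<times> (real ^ 'd::finite)"
  assumes T: "0 < T" and M: "filterlim M at_top sequentially" "\<And>j. 0 < M j"
    and n: "filterlim n at_top sequentially" "\<And>j. 0 < n j"
    and p: "p \<longlonglongrightarrow> a" "\<And>j. p j \<in> closed_cyl T"
  shows "(\<lambda>j. l2 (cylM T) (\<lambda>q. gdS T (M j) (n j) F (p j) q - gkS F a q)) \<longlonglongrightarrow> 0"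
proof -
  interpret finite_measure "cylM T :: (real \<times> (real ^ 'd)) measure" by (rule finite_measure_cylM)
  have t: "(\<lambda>j. fst (p j)) \<longlonglongrightarrow> fst a" and x: "(\<lambda>j. snd (p j)) \<longlonglongrightarrow> snd a"
    using p(1) by (intro tendsto_intros; simp)+
  have xc: "snd (p j) \<in> closure cube" for j using p(2)[of j] by (auto simp: closed_cyl_def)
  show ?thesis
  proof (rule l2_dominated_convergence[OF sq_int_const[of "real (card F)"]])
    show "AE q in cylM T. (\<lambda>j. gdS T (M j) (n j) F (p j) q) \<longlonglongrightarrow> gkS F a q"
      using AE_fst_neq[where T = T and t = "fst a"]
    proof eventually_elim
      case (elim q)
      let ?g = "\<lambda>j. \<Sum>k\<in>F. euler_interp T (M j) (fst (p j) - time_floor T (M j) (fst q)) (mu (n j) k) *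
          eigfun_interp (n j) k (snd (p j)) * eigfun k (kappa (n j) (snd q))"
      let ?h = "\<Sum>k\<in>F. exp (- (fst a - fst q) * (ksq k)\<^sup>2) * eigfun k (snd a) * eigfun k (snd q)"
      have "?g \<longlonglongrightarrow> ?h" if less: "fst q < fst a"
      proof (intro tendsto_sum tendsto_mult)
        fix k :: "'d \<Rightarrow> nat"
        show "(\<lambda>j. euler_interp T (M j) (fst (p j) - time_floor T (M j) (fst q)) (mu (n j) k)) \<longlonglongrightarrow> exp (- (fst a - fst q) * (ksq k)\<^sup>2)"
          by (rule euler_interp_tendsto[OF T M(1) tendsto_diff[OF t time_floor_tendsto[OF T M(1)]] _ mu_tendsto[OF n(1)]])
             (use less in simp)
        show "(\<lambda>j. eigfun_interp (n j) k (snd (p j))) \<longlonglongrightarrow> eigfun k (snd a)"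
          by (rule eigfun_interp_tendsto[OF n(1) x xc])
        show "(\<lambda>j. eigfun k (kappa (n j) (snd q))) \<longlonglongrightarrow> eigfun k (snd q)"
          using continuous_on_tendsto_compose[OF eigfun_continuous kappa_tendsto[OF n(1)]] by simp
      qed
      then have "(\<lambda>j. if fst q < fst a then ?g j else 0) \<longlonglongrightarrow> (if fst q < fst a then ?h else 0)"
        by auto
      moreover have "eventually (\<lambda>j. (if fst q < fst a then ?g j else 0) = gdS T (M j) (n j) F (p j) q) sequentially"
        using fst_less_tendsto[OF t elim] by eventually_elim (simp add: gdS_def)
      ultimately have "(\<lambda>j. gdS T (M j) (n j) F (p j) q) \<longlonglongrightarrow> (if fst q < fst a then ?h else 0)"
        by (rule Lim_transform_eventually)
      then show ?case by (simp only: gkS_def)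
    qed
    show "AE q in cylM T. \<bar>gdS T (M j) (n j) F (p j) q\<bar> \<le> real (card F)" for j
      by (intro AE_I2 gdS_bound T M n p)
  qed (auto intro: measurable_cylM_restrict)
qed

lemma gk_converges:
  fixes p :: "nat \<Rightarrow> real \<times> (real ^ 'd::finite)"
  assumes d: "CARD('d) \<le> 3" and p: "p \<longlonglongrightarrow> a" "\<And>j. p j \<in> closed_cyl T" and a: "a \<in> closed_cyl T"
  shows "(\<lambda>j. l2 (cylM T) (\<lambda>q. gk (p j) q - gk a q)) \<longlonglongrightarrow> 0"
proof (rule LIMSEQ_I)
  fix e :: real assume e: "0 < e"
  define e' where "e' = (e / 3)\<^sup>2"
  have e': "0 < e'" "sqrt e' = e / 3" using e by (auto simp: e'_def)
  obtain F where F: "finite F" "F \<subseteq> (modes :: ('d \<Rightarrow> nat) set)" "\<And>S. finite S \<Longrightarrow> S \<subseteq> modes - F \<Longrightarrow> (\<Sum>k\<in>S. 1 / wt k) \<le> e'"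
    using sum_inverse_wt_tail[OF d e'(1)] by auto
  have pt: "0 \<le> fst b \<and> fst b \<le> T" if "b \<in> closed_cyl T" for b :: "real \<times> (real ^ 'd)"
    using that by (auto simp: closed_cyl_def)
  have sqk: "sq_int (cylM T) (gk b)" "sq_int (cylM T) (gkS F b)" if "b \<in> closed_cyl T" for b :: "real \<times> (real ^ 'd)"
    using pt[OF that] gk_sq_int[OF d] gkS_l2(1)[OF F(1,2)] by auto
  have tail: "l2 (cylM T) (\<lambda>q. gk b q - gkS F b q) \<le> e / 3" if "b \<in> closed_cyl T" for b :: "real \<times> (real ^ 'd)"
    using gk_tail(2)[OF d _ _ F] pt[OF that] e' by auto
  have "eventually (\<lambda>j. l2 (cylM T) (\<lambda>q. gkS F (p j) q - gkS F a q) < e / 3) sequentially"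
    by (rule order_tendstoD(2)[OF gkS_converges[OF p]]) (use e in simp)
  then obtain N where N: "\<And>j. N \<le> j \<Longrightarrow> l2 (cylM T) (\<lambda>q. gkS F (p j) q - gkS F a q) < e / 3"
    by (auto simp: eventually_sequentially)
  have "l2 (cylM T) (\<lambda>q. gk (p j) q - gk a q) < e" if "N \<le> j" for j
  proof -
    note sq = sqk[OF p(2)[of j]] sqk[OF a]
    have "l2 (cylM T) (\<lambda>q. gkS F a q - gk a q) \<le> e / 3"
      using tail[OF a] l2_commute[of "cylM T" "gk a" "gkS F a"] by simp
    then show ?thesis
      using l2_triangle_diff[OF sq(1) sq(2) sq(3)] l2_triangle_diff[OF sq(2) sq(4) sq(3)]
        tail[OF p(2)[of j]] N[OF that] by linarith
  qed
  then show "\<exists>N. \<forall>j\<ge>N. norm (l2 (cylM T) (\<lambda>q. gk (p j) q - gk a q) - 0) < e" by auto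
qed

text \<open>A three-epsilon argument: the same finite set \<open>F\<close> controls the tails of
  both kernels, because both are estimated by the same weights, and eventually \<open>F\<close> is
  contained in the modes of the grid. On \<open>F\<close> itself the convergence is
  \<open>gdS_converges\<close>.\<close>

lemma gd_converges:
  fixes p :: "nat \<Rightarrow> real \<times> (real ^ 'd::finite)"
  assumes d: "CARD('d) \<le> 3" and T: "0 < T" and M: "filterlim M at_top sequentially" "\<And>j. 0 < M j"
    and n: "filterlim n at_top sequentially" "\<And>j. 0 < n j"
    and p: "p \<longlonglongrightarrow> a" "\<And>j. p j \<in> closed_cyl T" and a: "a \<in> closed_cyl T"
  shows "(\<lambda>j. l2 (cylM T) (\<lambda>q. gd T (M j) (n j) (p j) q - gk a q)) \<longlonglongrightarrow> 0"
proof (rule LIMSEQ_I)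
  fix e :: real assume e: "0 < e"
  define e' where "e' = (e / 3)\<^sup>2"
  have e': "0 < e'" "sqrt e' = e / 3" using e by (auto simp: e'_def)
  obtain F where F: "finite F" "F \<subseteq> (modes :: ('d \<Rightarrow> nat) set)" "\<And>S. finite S \<Longrightarrow> S \<subseteq> modes - F \<Longrightarrow> (\<Sum>k\<in>S. 1 / wt k) \<le> e'"
    using sum_inverse_wt_tail[OF d e'(1)] by auto
  obtain K where K: "\<And>i. K \<le> i \<Longrightarrow> F \<subseteq> mode_idx i" using finite_subset_mode_idx[OF F(1,2)] by metis
  have ta: "0 \<le> fst a" "fst a \<le> T" using a by (auto simp: closed_cyl_def)
  have sqa: "sq_int (cylM T) (gk a)" "sq_int (cylM T) (gkS F a)"
    using gk_sq_int[OF d ta] gkS_l2(1)[OF F(1,2) ta] by auto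
  have taila: "l2 (cylM T) (\<lambda>q. gkS F a q - gk a q) \<le> e / 3"
    using gk_tail(2)[OF d ta F] e' l2_commute[of "cylM T" "gk a" "gkS F a"] by simp
  have ev: "eventually (\<lambda>j. l2 (cylM T) (\<lambda>q. gdS T (M j) (n j) F (p j) q - gkS F a q) < e / 3 \<and> K \<le> n j) sequentially"
    by (intro eventually_conj order_tendstoD(2)[OF gdS_converges[OF T M n p]] filterlim_nat_ge[OF n(1)]) (use e in simp)
  then obtain N where N: "\<And>j. N \<le> j \<Longrightarrow> l2 (cylM T) (\<lambda>q. gdS T (M j) (n j) F (p j) q - gkS F a q) < e / 3"
      "\<And>j. N \<le> j \<Longrightarrow> K \<le> n j"
    unfolding eventually_sequentially by blast
  have "l2 (cylM T) (\<lambda>q. gd T (M j) (n j) (p j) q - gk a q) < e" if j: "N \<le> j" for j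
  proof -
    have FS: "F \<subseteq> mode_idx (n j)" by (rule K[OF N(2)[OF j]])
    have sq: "sq_int (cylM T) (gd T (M j) (n j) (p j))" "sq_int (cylM T) (gdS T (M j) (n j) F (p j))"
      by (intro gdS_l2 n T M p FS; simp)+
    have "(l2 (cylM T) (gdS T (M j) (n j) (mode_idx (n j) - F) (p j)))\<^sup>2 \<le> (\<Sum>k\<in>mode_idx (n j) - F. 1 / wt k)"
      by (intro gdS_l2 n T M p) auto
    also have "\<dots> \<le> e'" using mode_idx_subset by (intro F(3)) auto
    finally have "l2 (cylM T) (gdS T (M j) (n j) (mode_idx (n j) - F) (p j)) \<le> sqrt e'" by (rule real_le_rsqrt)
    then have "l2 (cylM T) (\<lambda>q. gd T (M j) (n j) (p j) q - gdS T (M j) (n j) F (p j) q) \<le> e / 3"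
      using e' by (simp add: gdS_diff FS)
    then show ?thesis
      using l2_triangle_diff[OF sq(1) sq(2) sqa(1)] l2_triangle_diff[OF sq(2) sqa(2) sqa(1)]
        taila N(1)[OF j] by linarith
  qed
  then show "\<exists>N. \<forall>j\<ge>N. norm (l2 (cylM T) (\<lambda>q. gd T (M j) (n j) (p j) q - gk a q) - 0) < e" by auto
qed

section \<open>Lipschitz sources\<close>

lemma C1_bounded_deriv_lipschitz:
  assumes "C1_bounded_deriv f"
  obtains L where "0 < L" "\<And>x y. \<bar>f x - f y\<bar> \<le> L * \<bar>x - y\<bar>" "\<And>y. \<bar>f y\<bar> \<le> L * (1 + \<bar>y\<bar>)"
proof -
  have diff: "\<And>r. f differentiable (at r)" and bd: "bounded (range (deriv f))"
    using assms by (auto simp: C1_bounded_deriv_def)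
  obtain K where K: "\<And>r. \<bar>deriv f r\<bar> \<le> K" using bd by (auto simp: bounded_iff)
  define L where "L = \<bar>f 0\<bar> + \<bar>K\<bar> + 1"
  have D: "(f has_field_derivative deriv f r) (at r)" for r
    using diff[of r] by (simp add: DERIV_deriv_iff_real_differentiable)
  have lip: "\<bar>f x - f y\<bar> \<le> \<bar>K\<bar> * \<bar>x - y\<bar>" for x y
  proof -
    have "norm (f x - f y) \<le> \<bar>K\<bar> * norm (x - y)"
    proof (rule field_differentiable_bound[where S = UNIV and f' = "deriv f"])
      show "norm (deriv f z) \<le> \<bar>K\<bar>" for z using K[of z] unfolding real_norm_def by linarith
    qed (use D in auto)
    then show ?thesis by simp
  qed
  show ?thesis
  proof (rule that)
    show "0 < L" by (simp add: L_def add_nonneg_pos)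
    show "\<bar>f x - f y\<bar> \<le> L * \<bar>x - y\<bar>" for x y
      by (rule order_trans[OF lip]) (auto simp: L_def intro!: mult_right_mono)
    show "\<bar>f y\<bar> \<le> L * (1 + \<bar>y\<bar>)" for y
    proof -
      have "\<bar>f y\<bar> \<le> \<bar>f 0\<bar> + \<bar>K\<bar> * \<bar>y\<bar>" using lip[of y 0] by simp
      also have "\<dots> \<le> L * 1 + L * \<bar>y\<bar>" by (intro add_mono mult_right_mono) (auto simp: L_def)
      finally show ?thesis by (simp add: algebra_simps)
    qed
  qed
qed

lemma C1_bounded_deriv_continuous:
  assumes "C1_bounded_deriv f" shows "continuous_on UNIV f"
  using assms by (auto simp: C1_bounded_deriv_def continuous_on_eq_continuous_within
      intro: differentiable_imp_continuous_within)

locale spde =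
  fixes T :: real and b \<sigma> :: "real \<Rightarrow> real" and m :: "nat \<Rightarrow> nat" and x0 :: "real ^ 'd::finite"
  assumes dim: "CARD('d) \<le> 3"
    and T_pos: "0 < T"
    and m_pos: "\<And>n. 2 \<le> n \<Longrightarrow> 0 < m n"
    and m_lim: "filterlim m at_top sequentially"
    and b_C1: "C1_bounded_deriv b"
    and sigma_C1: "C1_bounded_deriv \<sigma>"
    and sigma_nz: "\<And>r. \<sigma> r \<noteq> 0"
    and x0: "x0 \<in> cube"
begin

abbreviation N :: "(real \<times> (real ^ 'd)) measure" where "N \<equiv> cylM T"
abbreviation Q :: "(real \<times> (real ^ 'd)) set" where "Q \<equiv> closed_cyl T"
abbreviation kd :: "nat \<Rightarrow> real \<times> (real ^ 'd) \<Rightarrow> real \<times> (real ^ 'd) \<Rightarrow> real" where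
  "kd n \<equiv> gd T (m n) n"
abbreviation \<tau> :: "nat \<Rightarrow> real" where "\<tau> n \<equiv> dt T (m n)"

definition proj :: "nat \<Rightarrow> real \<times> (real ^ 'd) \<Rightarrow> real \<times> (real ^ 'd)" where
  "proj n q = (time_floor T (m n) (fst q), kappa n (snd q))"

text \<open>With the source separated, both equations read \<open>u = G (src u h)\<close> with a
  linear operator \<open>G\<close>, where the discrete one samples \<open>u\<close> at grid points
  inside \<open>src\<close>. The source is Lipschitz in the path and affine in the control.\<close>

definition src :: "(real \<times> (real ^ 'd) \<Rightarrow> real) \<Rightarrow> (real \<times> (real ^ 'd) \<Rightarrow> real) \<Rightarrow> real \<times> (real ^ 'd) \<Rightarrow> real" where
  "src v h q = b (v q) + \<sigma> (v q) * h q"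

definition Gk :: "(real \<times> (real ^ 'd) \<Rightarrow> real) \<Rightarrow> real \<times> (real ^ 'd) \<Rightarrow> real" where
  "Gk f p = (\<integral>q. gk p q * f q \<partial>N)"

definition Gd :: "nat \<Rightarrow> (real \<times> (real ^ 'd) \<Rightarrow> real) \<Rightarrow> real \<times> (real ^ 'd) \<Rightarrow> real" where
  "Gd n f p = (\<integral>q. kd n p q * f q \<partial>N)"

sublocale finite_measure N by (rule finite_measure_cylM)

definition lip :: real where
  "lip = (SOME L. 0 < L \<and> (\<forall>x y. \<bar>b x - b y\<bar> \<le> L * \<bar>x - y\<bar>) \<and> (\<forall>y. \<bar>b y\<bar> \<le> L * (1 + \<bar>y\<bar>)) \<and>
     (\<forall>x y. \<bar>\<sigma> x - \<sigma> y\<bar> \<le> L * \<bar>x - y\<bar>) \<and> (\<forall>y. \<bar>\<sigma> y\<bar> \<le> L * (1 + \<bar>y\<bar>)))"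

lemma lip: "0 < lip" "\<bar>b x - b y\<bar> \<le> lip * \<bar>x - y\<bar>" "\<bar>b y\<bar> \<le> lip * (1 + \<bar>y\<bar>)"
    "\<bar>\<sigma> x - \<sigma> y\<bar> \<le> lip * \<bar>x - y\<bar>" "\<bar>\<sigma> y\<bar> \<le> lip * (1 + \<bar>y\<bar>)"
proof -
  obtain K where K: "0 < K" "\<And>x y. \<bar>b x - b y\<bar> \<le> K * \<bar>x - y\<bar>" "\<And>y. \<bar>b y\<bar> \<le> K * (1 + \<bar>y\<bar>)"
    using C1_bounded_deriv_lipschitz[OF b_C1] by blast
  obtain K' where K': "0 < K'" "\<And>x y. \<bar>\<sigma> x - \<sigma> y\<bar> \<le> K' * \<bar>x - y\<bar>" "\<And>y. \<bar>\<sigma> y\<bar> \<le> K' * (1 + \<bar>y\<bar>)"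
    using C1_bounded_deriv_lipschitz[OF sigma_C1] by blast
  have mono: "a \<le> (K + K') * y" if "a \<le> K * y \<or> a \<le> K' * y" "0 \<le> y" for a y
  proof -
    have "0 \<le> K * y" "0 \<le> K' * y" using K(1) K'(1) that by auto
    then show ?thesis using that by (auto simp: distrib_right)
  qed
  have "\<exists>L. 0 < L \<and> (\<forall>x y. \<bar>b x - b y\<bar> \<le> L * \<bar>x - y\<bar>) \<and> (\<forall>y. \<bar>b y\<bar> \<le> L * (1 + \<bar>y\<bar>)) \<and>
     (\<forall>x y. \<bar>\<sigma> x - \<sigma> y\<bar> \<le> L * \<bar>x - y\<bar>) \<and> (\<forall>y. \<bar>\<sigma> y\<bar> \<le> L * (1 + \<bar>y\<bar>))"
    by (intro exI[of _ "K + K'"] conjI allI add_pos_pos K(1) K'(1) mono) (use K K' in auto)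
  from someI_ex[OF this, folded lip_def]
  show "0 < lip" "\<bar>b x - b y\<bar> \<le> lip * \<bar>x - y\<bar>" "\<bar>b y\<bar> \<le> lip * (1 + \<bar>y\<bar>)"
    "\<bar>\<sigma> x - \<sigma> y\<bar> \<le> lip * \<bar>x - y\<bar>" "\<bar>\<sigma> y\<bar> \<le> lip * (1 + \<bar>y\<bar>)" by auto
qed

lemma b_cont: "continuous_on UNIV b" and sigma_cont: "continuous_on UNIV \<sigma>"
  by (rule C1_bounded_deriv_continuous[OF b_C1], rule C1_bounded_deriv_continuous[OF sigma_C1])

lemma b_measurable [measurable]: "b \<in> borel_measurable borel" and sigma_measurable [measurable]: "\<sigma> \<in> borel_measurable borel"
  by (rule borel_measurable_continuous_onI[OF b_cont], rule borel_measurable_continuous_onI[OF sigma_cont])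

lemma src_bound: "\<bar>src v h q\<bar> \<le> lip * ((1 + \<bar>v q\<bar>) * (1 + \<bar>h q\<bar>))"
proof -
  have "\<bar>src v h q\<bar> \<le> \<bar>b (v q)\<bar> + \<bar>\<sigma> (v q)\<bar> * \<bar>h q\<bar>"
    unfolding src_def using abs_triangle_ineq[of "b (v q)" "\<sigma> (v q) * h q"] by (simp add: abs_mult)
  also have "\<dots> \<le> lip * (1 + \<bar>v q\<bar>) + lip * (1 + \<bar>v q\<bar>) * \<bar>h q\<bar>"
    by (intro add_mono mult_right_mono lip) auto
  finally show ?thesis by (simp add: algebra_simps)
qed

lemma src_lipschitz: "\<bar>src v h q - src w h q\<bar> \<le> lip * (\<bar>v q - w q\<bar> * (1 + \<bar>h q\<bar>))"
proof -
  have "src v h q - src w h q = (b (v q) - b (w q)) + (\<sigma> (v q) - \<sigma> (w q)) * h q"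
    by (simp add: src_def algebra_simps)
  also have "\<bar>\<dots>\<bar> \<le> \<bar>b (v q) - b (w q)\<bar> + \<bar>\<sigma> (v q) - \<sigma> (w q)\<bar> * \<bar>h q\<bar>"
    using abs_triangle_ineq[of "b (v q) - b (w q)" "(\<sigma> (v q) - \<sigma> (w q)) * h q"] by (simp add: abs_mult)
  also have "\<dots> \<le> lip * \<bar>v q - w q\<bar> + lip * \<bar>v q - w q\<bar> * \<bar>h q\<bar>"
    by (intro add_mono mult_right_mono lip) auto
  finally show ?thesis by (simp add: algebra_simps)
qed

lemma one_plus_abs_sq_int: "sq_int N h \<Longrightarrow> sq_int N (\<lambda>q. 1 + \<bar>h q\<bar>)"
  by (intro sq_int_add sq_int_const sq_int_abs)

lemma one_plus_abs_l2: "sq_int N h \<Longrightarrow> l2 N (\<lambda>q. 1 + \<bar>h q\<bar>) \<le> l2 N (\<lambda>_. 1) + l2 N h"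
  using l2_triangle[OF sq_int_const[of 1] sq_int_abs, of h] by (simp add: l2_def)

lemma src_measurable:
  assumes "v \<in> borel_measurable N" "sq_int N h"
  shows "src v h \<in> borel_measurable N"
proof -
  note [measurable] = assms(1) sq_int_measurable[OF assms(2)]
  show ?thesis unfolding src_def[abs_def] by measurable
qed

lemma src_sq_int:
  assumes v: "v \<in> borel_measurable N" and vb: "\<And>q. q \<in> cyl T \<Longrightarrow> \<bar>v q\<bar> \<le> R" and h: "sq_int N h"
  shows "sq_int N (src v h)" "0 \<le> R \<Longrightarrow> l2 N (src v h) \<le> lip * (1 + R) * (l2 N (\<lambda>_. 1) + l2 N h)"
proof -
  have ae: "AE q in N. \<bar>src v h q\<bar> \<le> \<bar>lip * (1 + R) * (1 + \<bar>h q\<bar>)\<bar>"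
  proof (rule AE_I2)
    fix q assume "q \<in> space N"
    then have q: "\<bar>v q\<bar> \<le> R" using vb by simp
    have "\<bar>src v h q\<bar> \<le> lip * ((1 + \<bar>v q\<bar>) * (1 + \<bar>h q\<bar>))" by (rule src_bound)
    also have "\<dots> \<le> lip * ((1 + R) * (1 + \<bar>h q\<bar>))"
      using q lip(1) by (intro mult_left_mono mult_right_mono) auto
    finally show "\<bar>src v h q\<bar> \<le> \<bar>lip * (1 + R) * (1 + \<bar>h q\<bar>)\<bar>" by (simp add: mult.assoc)
  qed
  have sq: "sq_int N (\<lambda>q. lip * (1 + R) * (1 + \<bar>h q\<bar>))"
    by (intro sq_int_cmult one_plus_abs_sq_int h)
  show "sq_int N (src v h)" by (rule sq_int_bound[OF sq src_measurable[OF v h] ae])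
  assume R: "0 \<le> R"
  have "l2 N (src v h) \<le> l2 N (\<lambda>q. lip * (1 + R) * (1 + \<bar>h q\<bar>))"
    by (rule l2_mono[OF sq src_measurable[OF v h] ae])
  also have "\<dots> = lip * (1 + R) * l2 N (\<lambda>q. 1 + \<bar>h q\<bar>)" using lip(1) R by (simp add: l2_cmult abs_mult)
  also have "\<dots> \<le> lip * (1 + R) * (l2 N (\<lambda>_. 1) + l2 N h)"
    using lip(1) R one_plus_abs_l2[OF h] by (intro mult_left_mono) auto
  finally show "l2 N (src v h) \<le> lip * (1 + R) * (l2 N (\<lambda>_. 1) + l2 N h)" .
qed

lemma n_pos: "2 \<le> n \<Longrightarrow> 0 < n" for n :: nat by simp

lemma tau_pos: "2 \<le> n \<Longrightarrow> 0 < \<tau> n" using T_pos m_pos by simp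

lemma m_tau: "2 \<le> n \<Longrightarrow> real (m n) * \<tau> n = T" using m_pos[of n] by (simp add: dt_def)

lemma Q_time: "p \<in> Q \<Longrightarrow> 0 \<le> fst p \<and> fst p \<le> T" by (auto simp: closed_cyl_def)

lemma kd_sq_int: "2 \<le> n \<Longrightarrow> p \<in> Q \<Longrightarrow> sq_int N (kd n p)"
  by (intro gdS_l2 T_pos m_pos) auto

lemma gk_sq_int': "p \<in> Q \<Longrightarrow> sq_int N (gk p)"
  using gk_sq_int[OF dim] Q_time by auto

text \<open>A bound for all kernels at once, uniform in the grid and in the target point; fixing it
  as a constant keeps it out of later statements.\<close>

definition kb :: real where
  "kb = (SOME A. 0 < A \<and> (\<forall>n\<ge>2. \<forall>p\<in>Q. l2 N (kd n p) \<le> A) \<and> (\<forall>p\<in>Q. l2 N (gk p) \<le> A))"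

lemma kb: "0 < kb" "2 \<le> n \<Longrightarrow> p \<in> Q \<Longrightarrow> l2 N (kd n p) \<le> kb" "p \<in> Q \<Longrightarrow> l2 N (gk p) \<le> kb"
proof -
  obtain W where W: "\<And>S. finite S \<Longrightarrow> S \<subseteq> (modes :: ('d \<Rightarrow> nat) set) \<Longrightarrow> (\<Sum>k\<in>S. 1 / wt k) \<le> W"
    using sum_inverse_wt_bounded[OF dim] by blast
  have W0: "0 \<le> W" using W[of "{}"] by simp
  have 1: "l2 N (kd n p) \<le> sqrt W + 1" if n: "2 \<le> n" and p: "p \<in> Q" for n p
  proof -
    have "(l2 N (kd n p))\<^sup>2 \<le> (\<Sum>k\<in>(mode_idx n :: ('d \<Rightarrow> nat) set). 1 / wt k)"
      using n p by (intro gdS_l2 T_pos m_pos) auto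
    also have "\<dots> \<le> W" by (intro W mode_idx_subset) simp
    finally have "l2 N (kd n p) \<le> sqrt W" by (rule real_le_rsqrt)
    then show ?thesis by simp
  qed
  have 2: "l2 N (gk p) \<le> sqrt W + 1" if p: "p \<in> Q" for p
  proof -
    have "l2 N (\<lambda>q. gk p q - gkS {} p q) \<le> sqrt W"
      using Q_time[OF p] by (intro gk_tail(2)[OF dim]) (auto intro: W)
    moreover have "gkS {} p q = 0" for q by (simp add: gkS_def)
    ultimately show ?thesis by simp
  qed
  have "0 < sqrt W + 1" using W0 by (simp add: add_nonneg_pos)
  then have "\<exists>A. 0 < A \<and> (\<forall>n\<ge>2. \<forall>p\<in>Q. l2 N (kd n p) \<le> A) \<and> (\<forall>p\<in>Q. l2 N (gk p) \<le> A)"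
    using 1 2 by (intro exI[of _ "sqrt W + 1"]) auto
  from someI_ex[OF this, folded kb_def]
  show "0 < kb" "2 \<le> n \<Longrightarrow> p \<in> Q \<Longrightarrow> l2 N (kd n p) \<le> kb" "p \<in> Q \<Longrightarrow> l2 N (gk p) \<le> kb" by auto
qed

text \<open>A violation on arbitrarily fine grids would give target points \<open>p j\<close>; along
  a convergent subsequence both kernels tend to the same kernel at the limit point, contradicting
  the gap \<open>e\<close>.\<close>

lemma kd_uniform:
  assumes e: "0 < e"
  obtains K where "\<And>n p. K \<le> n \<Longrightarrow> p \<in> Q \<Longrightarrow> l2 N (\<lambda>q. kd n p q - gk p q) < e"
proof (rule ccontr)
  assume "\<not> thesis"
  then have "\<forall>K. \<exists>n p. K \<le> n \<and> p \<in> Q \<and> e \<le> l2 N (\<lambda>q. kd n p q - gk p q)"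
    using that by (meson not_le)
  then have "\<forall>j. \<exists>n p. max 2 j \<le> n \<and> p \<in> Q \<and> e \<le> l2 N (\<lambda>q. kd n p q - gk p q)" by blast
  then obtain n p where np: "\<And>j. max 2 j \<le> n j" "\<And>j. p j \<in> Q" "\<And>j. e \<le> l2 N (\<lambda>q. kd (n j) (p j) q - gk (p j) q)"
    by metis
  obtain a r where a: "a \<in> Q" and r: "strict_mono r" and lim: "(p \<circ> r) \<longlonglongrightarrow> a"
    using compact_closed_cyl[of T] np(2) unfolding compact_def by metis
  have nlim: "filterlim (\<lambda>j. n (r j)) at_top sequentially"
    unfolding filterlim_at_top
  proof (intro allI)
    fix Z
    show "\<forall>\<^sub>F j in sequentially. Z \<le> n (r j)"
      using eventually_ge_at_top[of Z]
    proof eventually_elim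
      case (elim j)
      then show ?case using seq_suble[OF r, of j] np(1)[of "r j"] by linarith
    qed
  qed
  have n2: "2 \<le> n j" for j using np(1)[of j] by simp
  have lim': "(\<lambda>j. p (r j)) \<longlonglongrightarrow> a" using lim by (simp add: o_def)
  have l1: "(\<lambda>j. l2 N (\<lambda>q. kd (n (r j)) (p (r j)) q - gk a q)) \<longlonglongrightarrow> 0"
    by (rule gd_converges[OF dim T_pos filterlim_compose[OF m_lim nlim] _ nlim _ lim' _ a])
       (use n2 np(2) m_pos in \<open>auto intro: n_pos\<close>)
  have l2: "(\<lambda>j. l2 N (\<lambda>q. gk (p (r j)) q - gk a q)) \<longlonglongrightarrow> 0"
    by (rule gk_converges[OF dim lim' _ a]) (use np(2) in auto)
  have "(\<lambda>j. l2 N (\<lambda>q. kd (n (r j)) (p (r j)) q - gk a q) + l2 N (\<lambda>q. gk (p (r j)) q - gk a q)) \<longlonglongrightarrow> 0 + 0"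
    by (rule tendsto_add[OF l1 l2])
  moreover have "e \<le> l2 N (\<lambda>q. kd (n (r j)) (p (r j)) q - gk a q) + l2 N (\<lambda>q. gk (p (r j)) q - gk a q)" for j
    using np(3)[of "r j"] l2_triangle_diff[OF kd_sq_int[OF n2[of "r j"] np(2)[of "r j"]] gk_sq_int'[OF a] gk_sq_int'[OF np(2)[of "r j"]]]
      l2_commute[of N "gk a" "gk (p (r j))"] by linarith
  ultimately have "e \<le> 0" by (intro LIMSEQ_le_const) auto
  then show False using e by simp
qed

text \<open>Continuity of the kernel in its target point, in the \<open>l2\<close> norm; by
  Cauchy-Schwarz it yields equicontinuity of \<open>Gk f\<close> over any bounded family of
  sources.\<close>

lemma gk_equicontinuous:
  assumes a: "a \<in> Q" and e: "0 < e"
  obtains d where "0 < d" "\<And>p. p \<in> Q \<Longrightarrow> norm (a - p) < d \<Longrightarrow> l2 N (\<lambda>q. gk a q - gk p q) < e"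
proof (rule ccontr)
  assume "\<not> thesis"
  then have "\<forall>d>0. \<exists>p. p \<in> Q \<and> norm (a - p) < d \<and> e \<le> l2 N (\<lambda>q. gk a q - gk p q)"
    using that by (meson not_le)
  then have "\<forall>j. \<exists>p. p \<in> Q \<and> norm (a - p) < inverse (real (Suc j)) \<and> e \<le> l2 N (\<lambda>q. gk a q - gk p q)"
    by (metis inverse_positive_iff_positive of_nat_0_less_iff zero_less_Suc)
  then obtain p where p: "\<And>j. p j \<in> Q" "\<And>j. norm (a - p j) < inverse (real (Suc j))" "\<And>j. e \<le> l2 N (\<lambda>q. gk a q - gk (p j) q)"
    by metis
  have "p \<longlonglongrightarrow> a"
    by (rule LIM_zero_cancel, rule Lim_null_comparison[OF _ LIMSEQ_inverse_real_of_nat])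
       (use less_imp_le[OF p(2)] in \<open>auto simp: norm_minus_commute intro!: always_eventually\<close>)
  then have "(\<lambda>j. l2 N (\<lambda>q. gk (p j) q - gk a q)) \<longlonglongrightarrow> 0"
    by (rule gk_converges[OF dim _ p(1) a])
  then have "e \<le> 0"
    by (rule LIMSEQ_le_const) (use p(3) l2_commute[of N "gk a"] in auto)
  then show False using e by simp
qed

lemma Gk_bound: "p \<in> Q \<Longrightarrow> sq_int N f \<Longrightarrow> \<bar>Gk f p\<bar> \<le> kb * l2 N f"
  unfolding Gk_def
  by (rule order_trans[OF l2_Cauchy_Schwarz[OF gk_sq_int']]) (auto intro: mult_right_mono kb)

lemma Gd_bound: "2 \<le> n \<Longrightarrow> p \<in> Q \<Longrightarrow> sq_int N f \<Longrightarrow> \<bar>Gd n f p\<bar> \<le> kb * l2 N f"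
  unfolding Gd_def
  by (rule order_trans[OF l2_Cauchy_Schwarz[OF kd_sq_int]]) (auto intro: mult_right_mono kb)

lemma Gk_diff: "p \<in> Q \<Longrightarrow> sq_int N f \<Longrightarrow> sq_int N g \<Longrightarrow> Gk (\<lambda>q. f q - g q) p = Gk f p - Gk g p"
  unfolding Gk_def using sq_int_prod[OF gk_sq_int'] by (simp add: right_diff_distrib)

lemma Gd_diff: "2 \<le> n \<Longrightarrow> p \<in> Q \<Longrightarrow> sq_int N f \<Longrightarrow> sq_int N g \<Longrightarrow> Gd n (\<lambda>q. f q - g q) p = Gd n f p - Gd n g p"
  unfolding Gd_def using sq_int_prod[OF kd_sq_int] by (simp add: right_diff_distrib)

lemma Gk_diff_le: "p \<in> Q \<Longrightarrow> sq_int N f \<Longrightarrow> sq_int N g \<Longrightarrow> \<bar>Gk f p - Gk g p\<bar> \<le> kb * l2 N (\<lambda>q. f q - g q)"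
  by (subst Gk_diff[symmetric]) (auto intro: Gk_bound sq_int_diff)

lemma Gd_diff_le: "2 \<le> n \<Longrightarrow> p \<in> Q \<Longrightarrow> sq_int N f \<Longrightarrow> sq_int N g \<Longrightarrow> \<bar>Gd n f p - Gd n g p\<bar> \<le> kb * l2 N (\<lambda>q. f q - g q)"
  by (subst Gd_diff[symmetric]) (auto intro: Gd_bound sq_int_diff)

lemma Gk_point_diff: "p \<in> Q \<Longrightarrow> p' \<in> Q \<Longrightarrow> sq_int N f \<Longrightarrow> \<bar>Gk f p - Gk f p'\<bar> \<le> l2 N (\<lambda>q. gk p q - gk p' q) * l2 N f"
proof -
  assume a: "p \<in> Q" "p' \<in> Q" "sq_int N f"
  have "Gk f p - Gk f p' = (\<integral>q. (gk p q - gk p' q) * f q \<partial>N)"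
    unfolding Gk_def using sq_int_prod[OF gk_sq_int' a(3)] a by (simp add: left_diff_distrib)
  then show ?thesis using l2_Cauchy_Schwarz[OF sq_int_diff[OF gk_sq_int'[OF a(1)] gk_sq_int'[OF a(2)]] a(3)] by simp
qed

lemma Gd_Gk_diff: "2 \<le> n \<Longrightarrow> p \<in> Q \<Longrightarrow> sq_int N f \<Longrightarrow> \<bar>Gd n f p - Gk f p\<bar> \<le> l2 N (\<lambda>q. kd n p q - gk p q) * l2 N f"
proof -
  assume a: "2 \<le> n" "p \<in> Q" "sq_int N f"
  have "Gd n f p - Gk f p = (\<integral>q. (kd n p q - gk p q) * f q \<partial>N)"
    unfolding Gk_def Gd_def using sq_int_prod[OF gk_sq_int' a(3)] sq_int_prod[OF kd_sq_int a(3)] a by (simp add: left_diff_distrib)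
  then show ?thesis using l2_Cauchy_Schwarz[OF sq_int_diff[OF kd_sq_int[OF a(1,2)] gk_sq_int'[OF a(2)]] a(3)] by simp
qed

lemma skeleton_iff:
  "is_skeleton_solution T b \<sigma> h u \<longleftrightarrow> continuous_on Q u \<and> (\<forall>p\<in>Q. u p = Gk (src u h) p)"
proof -
  have "set_lebesgue_integral lborel ({0<..<t} \<times> cube) (\<lambda>(s, z). green (t - s) x z * (b (u (s, z)) + \<sigma> (u (s, z)) * h (s, z)))
      = Gk (src u h) (t, x)" if "(t, x) \<in> Q" for t and x :: "real ^ 'd"
  proof -
    have "t \<le> T" using that by (auto simp: mem_closed_cyl)
    then show ?thesis
      unfolding Gk_def by (subst set_integral_time) (auto intro!: Bochner_Integration.integral_cong simp: gk_def src_def split: prod.splits)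
  qed
  then show ?thesis unfolding is_skeleton_solution_def by (auto split: prod.splits)
qed

lemma disc_skeleton_iff:
  "is_disc_skeleton_solution T b \<sigma> (m n) n h u \<longleftrightarrow> continuous_on Q u \<and> (\<forall>p\<in>Q. u p = Gd n (src (u \<circ> proj n) h) p)"
proof -
  have "set_lebesgue_integral lborel ({0<..<t} \<times> cube) (\<lambda>(s, z). green_disc T (m n) n t (time_floor T (m n) s) x z *
         (b (u (time_floor T (m n) s, kappa n z)) + \<sigma> (u (time_floor T (m n) s, kappa n z)) * h (s, z)))
      = Gd n (src (u \<circ> proj n) h) (t, x)" if "(t, x) \<in> Q" for t and x :: "real ^ 'd"
  proof -
    have "t \<le> T" using that by (auto simp: mem_closed_cyl)
    then show ?thesis
      unfolding Gd_def by (subst set_integral_time) (auto intro!: Bochner_Integration.integral_cong simp: gdS_def green_disc_def src_def proj_def split: prod.splits)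
  qed
  then show ?thesis unfolding is_disc_skeleton_solution_def by (auto split: prod.splits)
qed

end

section \<open>The discrete skeleton equation\<close>

text \<open>\<open>\<Psi>\<close> on the stage \<open>A (Suc i)\<close> sees only values on
  \<open>A i\<close>, so two fixed points agree stage by stage. Used for the discrete skeleton
  equation and for the numerical scheme alike.\<close>

lemma causal_fixpoint_unique:
  fixes \<Psi> :: "('p \<Rightarrow> 'y) \<Rightarrow> 'p \<Rightarrow> 'y"
  assumes mono: "\<And>i. A i \<subseteq> A (Suc i)"
    and C0: "\<And>v w p. p \<in> A 0 \<Longrightarrow> \<Psi> v p = \<Psi> w p"
    and CS: "\<And>v w i p. (\<And>q. q \<in> A i \<Longrightarrow> v q = w q) \<Longrightarrow> p \<in> A (Suc i) \<Longrightarrow> \<Psi> v p = \<Psi> w p"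
    and u: "\<And>p. p \<in> A M \<Longrightarrow> u p = \<Psi> u p" and v: "\<And>p. p \<in> A M \<Longrightarrow> v p = \<Psi> v p"
  shows "p \<in> A M \<Longrightarrow> u p = v p"
proof -
  have sub: "A i \<subseteq> A M" if "i \<le> M" for i
    using lift_Suc_mono_le[of A, OF mono that] .
  have "i \<le> M \<Longrightarrow> p \<in> A i \<Longrightarrow> u p = v p" for i p
  proof (induction i arbitrary: p)
    case 0
    then show ?case using C0[of p u v] u[of p] v[of p] sub[of 0] by auto
  next
    case (Suc i)
    then show ?case using CS[of i u v p] u[of p] v[of p] sub[of "Suc i"] by auto
  qed
  then show "p \<in> A M \<Longrightarrow> u p = v p" by blast
qed

text \<open>Values on \<open>A i\<close> are final after \<open>i + 1\<close> applications, whatever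
  the start; hence \<open>Suc M\<close> applications produce a fixed point on \<open>A M\<close>.
  This gives existence together with an explicit finite composition.\<close>

lemma causal_fixpoint_iterate:
  fixes \<Psi> :: "('p \<Rightarrow> 'y) \<Rightarrow> 'p \<Rightarrow> 'y"
  assumes C0: "\<And>v w p. p \<in> A 0 \<Longrightarrow> \<Psi> v p = \<Psi> w p"
    and CS: "\<And>v w i p. (\<And>q. q \<in> A i \<Longrightarrow> v q = w q) \<Longrightarrow> p \<in> A (Suc i) \<Longrightarrow> \<Psi> v p = \<Psi> w p"
    and p: "p \<in> A M"
  shows "(\<Psi> ^^ Suc M) u p = \<Psi> ((\<Psi> ^^ Suc M) u) p"
proof -
  have "p \<in> A i \<Longrightarrow> (\<Psi> ^^ (Suc i + k)) u p = (\<Psi> ^^ (Suc (Suc i + k))) u p" for i k p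
  proof (induction i arbitrary: p)
    case 0
    then show ?case by (simp add: C0[of p "(\<Psi> ^^ k) u"])
  next
    case (Suc i)
    have "\<Psi> ((\<Psi> ^^ (Suc i + k)) u) p = \<Psi> ((\<Psi> ^^ (Suc (Suc i + k))) u) p"
      by (rule CS[OF Suc.IH Suc.prems])
    then show ?case by simp
  qed
  from this[of p M 0, OF p] show ?thesis by simp
qed

text \<open>As for \<open>lin_interp\<close>, the piecewise formula is rewritten with clamped ramps.
  \<open>K\<close> lies beyond \<open>r / dt T M\<close>, so near \<open>r\<close> finitely many
  ramps suffice.\<close>

lemma euler_interp_isCont:
  assumes "0 < T" "0 < M"
  shows "isCont (\<lambda>r. euler_interp T M r \<mu>) r"
proof -
  let ?c = "euler_factor T M \<mu>"
  have d: "0 < dt T M" using assms by simp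
  obtain K :: nat where K: "r / dt T M < real K" using reals_Archimedean2 by blast
  define L where "L r = ?c + (\<Sum>i\<in>{1..<Suc K}. (?c ^ Suc i - ?c ^ i) * max 0 (min 1 (r / dt T M - real i)))" for r
  have eq: "euler_interp T M r \<mu> = L r" if r: "r < real K * dt T M" for r
  proof (cases "r \<le> dt T M")
    case True
    then have "r / dt T M \<le> 1" using d by simp
    then have "max 0 (min 1 (r / dt T M - real i)) = 0" if "1 \<le> i" for i
    proof -
      have "1 \<le> real i" using that by simp
      then show ?thesis using \<open>r / dt T M \<le> 1\<close> by linarith
    qed
    then have "L r = ?c" unfolding L_def by (simp del: power_Suc)
    then show ?thesis using True by (simp add: euler_interp_def)
  next
    case False
    define i where "i = nat \<lfloor>r / dt T M\<rfloor>"
    define y where "y = r / dt T M"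
    have i: "1 \<le> i" "real i \<le> y" "y < real i + 1"
      using euler_interp_between[OF assms] False by (auto simp: i_def y_def)
    have yK: "y < real K" using r d by (simp add: y_def pos_divide_less_eq)
    then have iK: "i < K" using i by linarith
    have "(\<Sum>j\<in>{1..<Suc K}. (?c ^ Suc j - ?c ^ j) * max 0 (min 1 (y - real j)))
       = (\<Sum>j\<in>{1..<Suc K}. (if j \<in> {1..<i} then ?c ^ Suc j - ?c ^ j else 0) + (if j = i then (?c ^ Suc i - ?c ^ i) * (y - real i) else 0))"
    proof (rule sum.cong)
      fix j assume j: "j \<in> {1..<Suc K}"
      consider "j < i" | "j = i" | "i < j" by linarith
      then show "(?c ^ Suc j - ?c ^ j) * max 0 (min 1 (y - real j)) =
        (if j \<in> {1..<i} then ?c ^ Suc j - ?c ^ j else 0) + (if j = i then (?c ^ Suc i - ?c ^ i) * (y - real i) else 0)"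
      proof cases
        case 1
        then have "real j + 1 \<le> real i" by simp
        then have "max 0 (min 1 (y - real j)) = 1" using i by linarith
        then show ?thesis using 1 j by simp
      next
        case 2
        then have "max 0 (min 1 (y - real j)) = y - real i" using i by simp
        then show ?thesis using 2 by simp
      next
        case 3
        then have "real i + 1 \<le> real j" by simp
        then have "max 0 (min 1 (y - real j)) = 0" using i by linarith
        then show ?thesis using 3 by simp
      qed
    qed simp
    also have "\<dots> = (\<Sum>j\<in>{1..<i}. ?c ^ Suc j - ?c ^ j) + (?c ^ Suc i - ?c ^ i) * (y - real i)"
    proof -
      have "{1..<Suc K} \<inter> {1..<i} = {1..<i}" using iK by auto
      then have "(\<Sum>j\<in>{1..<Suc K}. (if j \<in> {1..<i} then ?c ^ Suc j - ?c ^ j else 0)) = (\<Sum>j\<in>{1..<i}. ?c ^ Suc j - ?c ^ j)"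
        using sum.inter_restrict[of "{1..<Suc K}" "\<lambda>j. ?c ^ Suc j - ?c ^ j" "{1..<i}"] by (simp only: finite_atLeastLessThan)
      moreover have "i \<in> {1..<Suc K}" using i iK by simp
      ultimately show ?thesis by (simp add: sum.distrib del: power_Suc)
    qed
    also have "(\<Sum>j\<in>{1..<i}. ?c ^ Suc j - ?c ^ j) = ?c ^ i - ?c"
      using sum_Suc_diff'[OF i(1), of "\<lambda>j. ?c ^ j"] by simp
    finally have "L r = ?c ^ i + (?c ^ Suc i - ?c ^ i) * (y - real i)" by (simp add: L_def y_def)
    moreover have "euler_interp T M r \<mu> = (1 - (y - real i)) * ?c ^ i + (y - real i) * ?c ^ Suc i"
      using False by (simp add: euler_interp_def Let_def i_def[symmetric] y_def)
    ultimately show ?thesis by (simp add: algebra_simps)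
  qed
  have "continuous_on UNIV L" unfolding L_def using d by (intro continuous_intros) auto
  then have "isCont L r" by (simp add: continuous_on_eq_continuous_at)
  moreover have "eventually (\<lambda>r. L r = euler_interp T M r \<mu>) (nhds r)"
  proof -
    have "r < real K * dt T M" using K d by (simp add: pos_divide_less_eq)
    then have "eventually (\<lambda>r. r < real K * dt T M) (nhds r)"
      using eventually_nhds_in_open[of "{..<real K * dt T M}" r] by simp
    then show ?thesis by eventually_elim (simp add: eq)
  qed
  ultimately show ?thesis using isCont_cong[of L "\<lambda>r. euler_interp T M r \<mu>" r] by simp
qed

context spde begin

lemma kd_continuous:
  assumes n: "2 \<le> n" and p: "p \<longlonglongrightarrow> a" "\<And>j. p j \<in> Q" and a: "a \<in> Q"
  shows "(\<lambda>j. l2 N (\<lambda>q. kd n (p j) q - kd n a q)) \<longlonglongrightarrow> 0"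
proof -
  have t: "(\<lambda>j. fst (p j)) \<longlonglongrightarrow> fst a" and x: "(\<lambda>j. snd (p j)) \<longlonglongrightarrow> snd a"
    using p(1) by (intro tendsto_intros; simp)+
  have xc: "snd (p j) \<in> closure cube" for j using p(2)[of j] by (auto simp: closed_cyl_def)
  have xa: "snd a \<in> closure cube" using a by (auto simp: closed_cyl_def)
  let ?S = "mode_idx n :: ('d \<Rightarrow> nat) set"
  show ?thesis
  proof (rule l2_dominated_convergence[OF sq_int_const[of "real (card ?S)"]])
    show "AE q in N. (\<lambda>j. kd n (p j) q) \<longlonglongrightarrow> kd n a q"
      using AE_fst_neq[where T = T and t = "fst a"]
    proof eventually_elim
      case (elim q)
      let ?g = "\<lambda>p. \<Sum>k\<in>?S. euler_interp T (m n) (fst p - time_floor T (m n) (fst q)) (mu n k) *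
          eigfun_interp n k (snd p) * eigfun k (kappa n (snd q))"
      have "(\<lambda>j. ?g (p j)) \<longlonglongrightarrow> ?g a"
      proof (intro tendsto_sum tendsto_mult tendsto_const)
        fix k :: "'d \<Rightarrow> nat"
        show "(\<lambda>j. euler_interp T (m n) (fst (p j) - time_floor T (m n) (fst q)) (mu n k))
            \<longlonglongrightarrow> euler_interp T (m n) (fst a - time_floor T (m n) (fst q)) (mu n k)"
          by (rule isCont_tendsto_compose[OF euler_interp_isCont[OF T_pos m_pos[OF n]]]) (intro tendsto_intros t)
        show "(\<lambda>j. eigfun_interp n k (snd (p j))) \<longlonglongrightarrow> eigfun_interp n k (snd a)"
          by (rule continuous_on_tendsto_compose[OF eigfun_interp_continuous[OF n_pos[OF n]] x xa])
             (simp add: xc)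
      qed
      then have "(\<lambda>j. if fst q < fst a then ?g (p j) else 0) \<longlonglongrightarrow> (if fst q < fst a then ?g a else 0)"
        by auto
      moreover have "eventually (\<lambda>j. (if fst q < fst a then ?g (p j) else 0) = kd n (p j) q) sequentially"
        using fst_less_tendsto[OF t elim] by eventually_elim (simp add: gdS_def)
      ultimately have "(\<lambda>j. kd n (p j) q) \<longlonglongrightarrow> (if fst q < fst a then ?g a else 0)"
        by (rule Lim_transform_eventually)
      then show ?case by (simp only: gdS_def)
    qed
    show "AE q in N. \<bar>kd n (p j) q\<bar> \<le> real (card ?S)" for j
      by (intro AE_I2 gdS_bound T_pos m_pos n_pos n p)
  qed (auto intro: measurable_cylM_restrict)
qed

lemma Gd_continuous:
  assumes n: "2 \<le> n" and f: "sq_int N f"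
  shows "continuous_on Q (Gd n f)"
  unfolding continuous_on_sequentially
proof (intro ballI allI impI)
  fix p a assume a: "a \<in> Q" and p: "(\<forall>j. p j \<in> Q) \<and> p \<longlonglongrightarrow> a"
  show "(Gd n f \<circ> p) \<longlonglongrightarrow> Gd n f a"
  proof (rule LIM_zero_cancel, rule Lim_null_comparison)
    show "(\<lambda>j. l2 N (\<lambda>q. kd n (p j) q - kd n a q) * l2 N f) \<longlonglongrightarrow> 0"
      using tendsto_mult[OF kd_continuous[OF n _ _ a, of p] tendsto_const[of "l2 N f"]] p by simp
    have "norm ((Gd n f \<circ> p) j - Gd n f a) \<le> l2 N (\<lambda>q. kd n (p j) q - kd n a q) * l2 N f" for j
    proof -
      have pj: "p j \<in> Q" using p by simp
      have "Gd n f (p j) - Gd n f a = (\<integral>q. (kd n (p j) q - kd n a q) * f q \<partial>N)"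
        unfolding Gd_def using sq_int_prod[OF kd_sq_int[OF n pj] f] sq_int_prod[OF kd_sq_int[OF n a] f]
        by (simp add: left_diff_distrib)
      then show ?thesis using l2_Cauchy_Schwarz[OF sq_int_diff[OF kd_sq_int[OF n pj] kd_sq_int[OF n a]] f] by simp
    qed
    then show "\<forall>\<^sub>F j in sequentially. norm ((Gd n f \<circ> p) j - Gd n f a) \<le> l2 N (\<lambda>q. kd n (p j) q - kd n a q) * l2 N f"
      by simp
  qed
qed

lemma grid_floor_nonneg: "0 < n \<Longrightarrow> 0 \<le> x \<Longrightarrow> 0 \<le> grid_floor n x"
  by (simp add: grid_floor_def dx_def)

lemma proj_in_Q:
  assumes n: "2 \<le> n" and q: "q \<in> cyl T"
  shows "proj n q \<in> Q"
proof -
  obtain s z where sz: "q = (s, z)" by (cases q)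
  then have s: "0 < s" "s < T" and z: "\<And>l. 0 < z $ l \<and> z $ l < pi" using q by (auto simp: mem_cyl cube_def)
  have "0 \<le> grid_floor n (z $ l) \<and> grid_floor n (z $ l) \<le> pi" for l
    using grid_floor_nonneg[of n "z $ l"] grid_floor_bounds(1)[of n "z $ l"] n z[of l] by (auto intro: order_trans less_imp_le)
  moreover have "0 \<le> time_floor T (m n) s" "time_floor T (m n) s \<le> T"
    using time_floor_nonneg[OF T_pos m_pos[OF n], of s] time_floor_bounds(1)[OF T_pos m_pos[OF n], of s] s by auto
  ultimately show ?thesis by (simp add: proj_def sz mem_closed_cyl)
qed

lemma proj_measurable: "proj n \<in> borel_measurable borel"
  unfolding proj_def[abs_def] by (intro borel_measurable_Pair) measurable

lemma comp_proj_measurable: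
  assumes n: "2 \<le> n" and v: "continuous_on Q v"
  shows "(v \<circ> proj n) \<in> borel_measurable N"
proof -
  have "proj n \<in> N \<rightarrow>\<^sub>M restrict_space borel Q"
    by (rule measurable_restrict_space2) (use proj_in_Q[OF n] in \<open>auto intro: measurable_cylM_restrict proj_measurable\<close>)
  moreover have "v \<in> borel_measurable (restrict_space borel Q)"
    by (rule borel_measurable_continuous_on_restrict[OF v])
  ultimately show ?thesis by (rule measurable_comp)
qed

lemma src_proj_sq_int:
  assumes n: "2 \<le> n" and v: "continuous_on Q v" and h: "sq_int N h"
  shows "sq_int N (src (v \<circ> proj n) h)"
proof -
  obtain R where R: "0 \<le> R" "\<And>p. p \<in> Q \<Longrightarrow> \<bar>v p\<bar> \<le> R" using bounded_continuous_closed_cyl[OF v] by blast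
  show ?thesis
    by (rule src_sq_int(1)[OF comp_proj_measurable[OF n v] _ h, of R]) (use R proj_in_Q[OF n] in auto)
qed

definition stage :: "nat \<Rightarrow> nat \<Rightarrow> (real \<times> (real ^ 'd)) set" where
  "stage n i = {p \<in> Q. fst p \<le> real i * \<tau> n}"

lemma stage_m: "2 \<le> n \<Longrightarrow> stage n (m n) = Q"
  using Q_time m_tau[of n] by (auto simp: stage_def)

lemma stage_mono: "2 \<le> n \<Longrightarrow> stage n i \<subseteq> stage n (Suc i)"
  using tau_pos[of n] by (auto simp: stage_def algebra_simps)

text \<open>One application of the equation advances by one stage. The strict inequality matters,
  since a source time equal to the next grid time would not be rounded below it; strictness is
  supplied by the cutoff in the kernel.\<close>

lemma time_floor_stage:
  assumes n: "2 \<le> n" and s: "s < real (Suc i) * \<tau> n"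
  shows "time_floor T (m n) s \<le> real i * \<tau> n"
proof -
  have d: "0 < \<tau> n" by (rule tau_pos[OF n])
  have "s / \<tau> n < real (Suc i)" using s d by (simp add: pos_divide_less_eq)
  then have "\<lfloor>s / \<tau> n\<rfloor> < int (Suc i)" by (simp add: floor_less_iff)
  then have "\<lfloor>s / \<tau> n\<rfloor> \<le> int i" by simp
  then have "real_of_int \<lfloor>s / \<tau> n\<rfloor> \<le> real i" by linarith
  then have "real_of_int \<lfloor>s / \<tau> n\<rfloor> * \<tau> n \<le> real i * \<tau> n" using d by (intro mult_right_mono) auto
  then show ?thesis by (simp add: time_floor_def mult.commute)
qed

lemma kd_zero: "fst p \<le> fst q \<Longrightarrow> kd n p q = 0" by (simp add: gdS_def)

lemma disc_causal_0:
  assumes "p \<in> stage n 0"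
  shows "Gd n (src (v \<circ> proj n) h) p = Gd n (src (w \<circ> proj n) h) p"
  unfolding Gd_def
  by (rule Bochner_Integration.integral_cong) (use assms in \<open>auto simp: stage_def kd_zero cyl_def\<close>)

lemma disc_causal_Suc:
  assumes n: "2 \<le> n" and vw: "\<And>q. q \<in> stage n i \<Longrightarrow> v q = w q" and p: "p \<in> stage n (Suc i)"
  shows "Gd n (src (v \<circ> proj n) h) p = Gd n (src (w \<circ> proj n) h) p"
  unfolding Gd_def
proof (rule Bochner_Integration.integral_cong)
  fix q assume "q \<in> space N"
  then have q: "q \<in> cyl T" by simp
  show "kd n p q * src (v \<circ> proj n) h q = kd n p q * src (w \<circ> proj n) h q"
  proof (cases "fst q < fst p")
    case True
    then have "fst q < real (Suc i) * \<tau> n" using p by (auto simp: stage_def)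
    then have "proj n q \<in> stage n i"
      using proj_in_Q[OF n q] time_floor_stage[OF n] by (auto simp: stage_def proj_def)
    then show ?thesis using vw by (simp add: src_def)
  qed (simp add: kd_zero)
qed simp

lemma disc_unique:
  assumes n: "2 \<le> n" and u: "is_disc_skeleton_solution T b \<sigma> (m n) n h u"
    and v: "is_disc_skeleton_solution T b \<sigma> (m n) n h v" and p: "p \<in> Q"
  shows "u p = v p"
  by (rule causal_fixpoint_unique[where A = "stage n" and M = "m n" and \<Psi> = "\<lambda>v. Gd n (src (v \<circ> proj n) h)",
        OF stage_mono[OF n] disc_causal_0 disc_causal_Suc[OF n]])
     (use u v p in \<open>auto simp: stage_m[OF n] disc_skeleton_iff\<close>)

lemma disc_exists:
  assumes n: "2 \<le> n" and h: "sq_int N h"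
  shows "\<exists>u. is_disc_skeleton_solution T b \<sigma> (m n) n h u"
proof -
  let ?P = "\<lambda>v. Gd n (src (v \<circ> proj n) h)"
  have cont: "continuous_on Q ((?P ^^ i) (\<lambda>_. 0))" for i
  proof (induction i)
    case (Suc i)
    have e: "(?P ^^ Suc i) (\<lambda>_. 0) = ?P ((?P ^^ i) (\<lambda>_. 0))" by simp
    show ?case unfolding e by (rule Gd_continuous[OF n src_proj_sq_int[OF n Suc h]])
  qed simp
  show ?thesis unfolding disc_skeleton_iff
    by (intro exI[of _ "(?P ^^ Suc (m n)) (\<lambda>_. 0)"] conjI ballI cont
        causal_fixpoint_iterate[where A = "stage n" and \<Psi> = ?P, OF disc_causal_0 disc_causal_Suc[OF n]])
       (simp_all add: stage_m[OF n])
qed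

text \<open>Common to the three solution operators defined by \<open>THE\<close>: solutions are
  unique on \<open>A\<close> only, and extensionality singles out one representative, the
  restriction to \<open>A\<close>.\<close>

lemma the_extensional:
  fixes S :: "('p \<Rightarrow> real) \<Rightarrow> bool"
  assumes ex: "S u" and uniq: "\<And>v w. S v \<Longrightarrow> S w \<Longrightarrow> \<forall>p\<in>A. v p = w p"
    and cong: "\<And>v w. S v \<Longrightarrow> (\<forall>p\<in>A. v p = w p) \<Longrightarrow> S w"
  shows "S (THE u. u \<in> extensional A \<and> S u)"
proof -
  have "(THE u. u \<in> extensional A \<and> S u) \<in> extensional A \<and> S (THE u. u \<in> extensional A \<and> S u)"
  proof (rule theI[of _ "restrict u A"])
    show "restrict u A \<in> extensional A \<and> S (restrict u A)" using cong[OF ex] by simp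
    fix v assume v: "v \<in> extensional A \<and> S v"
    show "v = restrict u A"
    proof (rule extensionalityI)
      fix p assume "p \<in> A"
      then show "v p = restrict u A p" using uniq[OF ex, of v] v by simp
    qed (use v in auto)
  qed
  then show ?thesis by simp
qed

lemma disc_cong:
  assumes n: "2 \<le> n" and v: "is_disc_skeleton_solution T b \<sigma> (m n) n h v" and vw: "\<forall>p\<in>Q. v p = w p"
  shows "is_disc_skeleton_solution T b \<sigma> (m n) n h w"
proof -
  have "Gd n (src (v \<circ> proj n) h) p = Gd n (src (w \<circ> proj n) h) p" for p
    unfolding Gd_def
    by (rule Bochner_Integration.integral_cong) (use vw proj_in_Q[OF n] in \<open>auto simp: src_def\<close>)
  moreover have "continuous_on Q w" using v vw continuous_on_cong unfolding disc_skeleton_iff by metis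
  ultimately show ?thesis using v vw unfolding disc_skeleton_iff by metis
qed

lemma Upsilon_disc_solution:
  assumes n: "2 \<le> n" and h: "sq_int N h"
  shows "is_disc_skeleton_solution T b \<sigma> (m n) n h (Upsilon_disc T b \<sigma> (m n) n h)"
proof -
  obtain u where u: "is_disc_skeleton_solution T b \<sigma> (m n) n h u" using disc_exists[OF n h] by blast
  show ?thesis unfolding Upsilon_disc_def
    by (rule the_extensional[where S = "is_disc_skeleton_solution T b \<sigma> (m n) n h", OF u])
       (use disc_unique[OF n] disc_cong[OF n] in blast)+
qed

lemma Upsilon_disc_eq:
  assumes n: "2 \<le> n" and h: "sq_int N h" and u: "is_disc_skeleton_solution T b \<sigma> (m n) n h u" and p: "p \<in> Q"
  shows "Upsilon_disc T b \<sigma> (m n) n h p = u p"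
  by (rule disc_unique[OF n Upsilon_disc_solution[OF n h] u p])

lemma skeleton_cong:
  assumes v: "is_skeleton_solution T b \<sigma> h v" and vw: "\<forall>p\<in>Q. v p = w p"
  shows "is_skeleton_solution T b \<sigma> h w"
proof -
  have "Gk (src v h) p = Gk (src w h) p" for p
    unfolding Gk_def
  proof (rule Bochner_Integration.integral_cong)
    fix q assume "q \<in> space N"
    then have "q \<in> Q" using cyl_subset_closed_cyl by auto
    then show "gk p q * src v h q = gk p q * src w h q" using vw by (simp add: src_def)
  qed simp
  moreover have "continuous_on Q w" using v vw continuous_on_cong unfolding skeleton_iff by metis
  ultimately show ?thesis using v vw unfolding skeleton_iff by metis
qed

text \<open>Cauchy-Schwarz on the past of \<open>t\<close> only. Keeping the time restriction on the
  right-hand side is what allows both the Gronwall argument and the local uniqueness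
  argument.\<close>

lemma kernel_restrict_bound:
  assumes k: "sq_int N k" "l2 N k \<le> kb" and kz: "\<And>q. t \<le> fst q \<Longrightarrow> k q = 0" and f: "sq_int N f"
  shows "(\<integral>q. k q * f q \<partial>N)\<^sup>2 \<le> kb\<^sup>2 * (\<integral>q. indicator {..<t} (fst q) * (f q)\<^sup>2 \<partial>N)"
proof -
  have im: "(\<lambda>q. indicator {..<t} (fst q)) \<in> borel_measurable N"
    by (rule measurable_cylM_restrict) measurable
  have g: "sq_int N (\<lambda>q. indicator {..<t} (fst q) * f q)"
    by (rule sq_int_bounded_mult[OF f im, of 1]) (auto simp: indicator_def)
  have "(\<integral>q. k q * f q \<partial>N) = (\<integral>q. k q * (indicator {..<t} (fst q) * f q) \<partial>N)"
    by (rule Bochner_Integration.integral_cong) (auto simp: indicator_def kz)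
  then have "\<bar>\<integral>q. k q * f q \<partial>N\<bar> \<le> l2 N k * l2 N (\<lambda>q. indicator {..<t} (fst q) * f q)"
    using l2_Cauchy_Schwarz[OF k(1) g] by simp
  also have "\<dots> \<le> kb * l2 N (\<lambda>q. indicator {..<t} (fst q) * f q)"
    using k(2) by (intro mult_right_mono) auto
  finally have "\<bar>\<integral>q. k q * f q \<partial>N\<bar>\<^sup>2 \<le> (kb * l2 N (\<lambda>q. indicator {..<t} (fst q) * f q))\<^sup>2"
    by (intro power_mono) auto
  also have "(\<lambda>q. (indicator {..<t} (fst q) * f q)\<^sup>2) = (\<lambda>q. indicator {..<t} (fst q) * (f q)\<^sup>2)"
    by (auto simp: indicator_def fun_eq_iff)
  then have "(kb * l2 N (\<lambda>q. indicator {..<t} (fst q) * f q))\<^sup>2 = kb\<^sup>2 * (\<integral>q. indicator {..<t} (fst q) * (f q)\<^sup>2 \<partial>N)"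
    by (simp add: power_mult_distrib l2_sq)
  finally show ?thesis by simp
qed

text \<open>A discrete Gronwall argument: on the time level \<open>j\<close> the weight is the energy of \<open>h\<close> there, and the
  product bound stays uniform in \<open>n\<close> because these weights sum up to the total energy.\<close>

lemma disc_gronwall:
  assumes n: "2 \<le> n" and h: "sq_int N h" and u: "is_disc_skeleton_solution T b \<sigma> (m n) n h u" and p: "p \<in> Q"
  shows "(1 + \<bar>u p\<bar>)\<^sup>2 \<le> (2 + 2 * kb\<^sup>2 * lip\<^sup>2) * exp ((2 + 2 * kb\<^sup>2 * lip\<^sup>2) * (l2 N (\<lambda>q. 1 + \<bar>h q\<bar>))\<^sup>2)"
proof -
  define K where "K = 2 + 2 * kb\<^sup>2 * lip\<^sup>2"
  define w where "w q = (1 + \<bar>h q\<bar>)\<^sup>2" for q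
  define lv where "lv q = nat \<lfloor>fst q / \<tau> n\<rfloor>" for q :: "real \<times> (real ^ 'd)"
  define \<gamma> where "\<gamma> j = (\<integral>q. (if lv q = j then w q else 0) \<partial>N)" for j
  \<comment> \<open>The product solves \<open>A i = K + (\<Sum>j<i. A j * (K * \<gamma> j))\<close>,
    the equality case of the recursive estimate.\<close>
  define A where "A i = K * (\<Prod>j<i. 1 + K * \<gamma> j)" for i
  have K: "0 < K" unfolding K_def by (intro add_pos_nonneg) auto
  have d: "0 < \<tau> n" by (rule tau_pos[OF n])
  have uc: "continuous_on Q u" and ue: "\<And>p. p \<in> Q \<Longrightarrow> u p = Gd n (src (u \<circ> proj n) h) p"
    using u by (auto simp: disc_skeleton_iff)
  have w_int: "integrable N w"
    using sq_int_integrable_sq[OF one_plus_abs_sq_int[OF h]] unfolding w_def[abs_def] .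
  have lvm [measurable]: "lv \<in> N \<rightarrow>\<^sub>M count_space UNIV"
  proof -
    have "lv \<in> borel \<rightarrow>\<^sub>M count_space UNIV" unfolding lv_def[abs_def] by measurable
    then show ?thesis unfolding cylM_def by (intro measurable_restrict_space1) simp
  qed
  have wm [measurable]: "w \<in> borel_measurable N" using w_int by simp
  have lv_int: "integrable N (\<lambda>q. if lv q = j then w q else 0)" for j
    by (rule Bochner_Integration.integrable_bound[OF w_int]) auto
  have w0: "0 \<le> w q" for q by (simp add: w_def)
  have g0: "0 \<le> \<gamma> j" for j unfolding \<gamma>_def by (rule integral_nonneg_AE) (simp add: w0)
  have A_Suc: "A (Suc i) = A i + A i * (K * \<gamma> i)" for i by (simp add: A_def algebra_simps)
  have A_sum: "A i = K + (\<Sum>j<i. A j * (K * \<gamma> j))" for i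
    by (induction i) (simp_all add: A_Suc, simp add: A_def)
  have A_nonneg: "0 \<le> A i" for i unfolding A_def using K g0 by (intro mult_nonneg_nonneg prod_nonneg) auto
  have lv_time: "time_floor T (m n) (fst q) = real (lv q) * \<tau> n" if "q \<in> cyl T" for q
  proof -
    have "0 < fst q" using that by (auto simp: cyl_def)
    then have "0 \<le> \<lfloor>fst q / \<tau> n\<rfloor>" using d by simp
    then show ?thesis by (simp add: time_floor_def lv_def mult.commute)
  qed
  have lv_less: "lv q < i" if q: "q \<in> cyl T" "fst q < real i * \<tau> n" for q i
  proof -
    have "fst q / \<tau> n < real i" using q(2) d by (simp add: pos_divide_less_eq)
    moreover have "0 < fst q" using q(1) by (auto simp: cyl_def)
    moreover have "0 \<le> fst q / \<tau> n" using d \<open>0 < fst q\<close> by (intro divide_nonneg_pos) auto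
    ultimately show ?thesis unfolding lv_def by linarith
  qed
  have main: "\<forall>p\<in>stage n i. (1 + \<bar>u p\<bar>)\<^sup>2 \<le> A i" for i
  proof (induction i rule: less_induct)
    case (less i)
    show ?case
    proof
      fix p assume p: "p \<in> stage n i"
      then have pQ: "p \<in> Q" and pt: "fst p \<le> real i * \<tau> n" by (auto simp: stage_def)
      let ?f = "src (u \<circ> proj n) h"
      have f: "sq_int N ?f" by (rule src_proj_sq_int[OF n uc h])
      have "(u p)\<^sup>2 \<le> kb\<^sup>2 * (\<integral>q. indicator {..<fst p} (fst q) * (?f q)\<^sup>2 \<partial>N)"
        unfolding ue[OF pQ] Gd_def
        by (rule kernel_restrict_bound[OF kd_sq_int[OF n pQ] kb(2)[OF n pQ] kd_zero f])
      also have "(\<integral>q. indicator {..<fst p} (fst q) * (?f q)\<^sup>2 \<partial>N) \<le> (\<integral>q. lip\<^sup>2 * (\<Sum>j<i. A j * (if lv q = j then w q else 0)) \<partial>N)"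
      proof (rule integral_mono_AE)
        have im: "(\<lambda>q. indicator {..<fst p} (fst q)) \<in> borel_measurable N"
          by (rule measurable_cylM_restrict) measurable
        show "integrable N (\<lambda>q. indicator {..<fst p} (fst q) * (?f q)\<^sup>2)"
        proof (rule Bochner_Integration.integrable_bound[OF sq_int_integrable_sq[OF f]])
          show "(\<lambda>q. indicator {..<fst p} (fst q) * (?f q)\<^sup>2) \<in> borel_measurable N"
            by (intro borel_measurable_times borel_measurable_power im sq_int_measurable[OF f])
        qed (auto simp: indicator_def)
        show "integrable N (\<lambda>q. lip\<^sup>2 * (\<Sum>j<i. A j * (if lv q = j then w q else 0)))"
          by (intro integrable_mult_right Bochner_Integration.integrable_sum lv_int)
        show "AE q in N. indicator {..<fst p} (fst q) * (?f q)\<^sup>2 \<le> lip\<^sup>2 * (\<Sum>j<i. A j * (if lv q = j then w q else 0))"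
        proof (rule AE_I2)
          fix q assume "q \<in> space N"
          then have q: "q \<in> cyl T" by simp
          show "indicator {..<fst p} (fst q) * (?f q)\<^sup>2 \<le> lip\<^sup>2 * (\<Sum>j<i. A j * (if lv q = j then w q else 0))"
          proof (cases "fst q < fst p")
            case True
            then have l: "lv q < i" using lv_less[OF q] pt by simp
            have "proj n q \<in> stage n (lv q)"
              using proj_in_Q[OF n q] lv_time[OF q] by (simp add: stage_def proj_def)
            then have Al: "(1 + \<bar>u (proj n q)\<bar>)\<^sup>2 \<le> A (lv q)" using less[OF l] by blast
            have "\<bar>?f q\<bar>\<^sup>2 \<le> (lip * ((1 + \<bar>u (proj n q)\<bar>) * (1 + \<bar>h q\<bar>)))\<^sup>2"
              using src_bound[of "u \<circ> proj n" h q] by (intro power_mono) auto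
            also have "\<dots> = lip\<^sup>2 * ((1 + \<bar>u (proj n q)\<bar>)\<^sup>2 * w q)" by (simp add: power_mult_distrib w_def)
            also have "\<dots> \<le> lip\<^sup>2 * (A (lv q) * w q)"
              using Al w0 by (intro mult_left_mono mult_right_mono) auto
            also have "A (lv q) * w q = (\<Sum>j<i. if j = lv q then A (lv q) * w q else 0)" using l by simp
            also have "\<dots> = (\<Sum>j<i. A j * (if lv q = j then w q else 0))" by (intro sum.cong) auto
            finally show ?thesis using True by (simp add: comp_def)
          next
            case False
            then show ?thesis using A_nonneg w0[of q] by (auto intro!: mult_nonneg_nonneg sum_nonneg)
          qed
        qed
      qed
      also have "(\<integral>q. lip\<^sup>2 * (\<Sum>j<i. A j * (if lv q = j then w q else 0)) \<partial>N) = lip\<^sup>2 * (\<Sum>j<i. A j * \<gamma> j)"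
        unfolding \<gamma>_def using lv_int by simp
      finally have "(u p)\<^sup>2 \<le> kb\<^sup>2 * (lip\<^sup>2 * (\<Sum>j<i. A j * \<gamma> j))" by (simp add: mult_left_mono)
      moreover have "(1 + \<bar>u p\<bar>)\<^sup>2 \<le> 2 + 2 * (u p)\<^sup>2"
        using sum_squares_bound[of 1 "\<bar>u p\<bar>"] by (simp add: power2_sum)
      moreover have "2 \<le> K" by (simp add: K_def)
      moreover have "2 * (kb\<^sup>2 * (lip\<^sup>2 * (\<Sum>j<i. A j * \<gamma> j))) \<le> K * (\<Sum>j<i. A j * \<gamma> j)"
      proof -
        have "2 * kb\<^sup>2 * lip\<^sup>2 * (\<Sum>j<i. A j * \<gamma> j) \<le> K * (\<Sum>j<i. A j * \<gamma> j)"
          using A_nonneg g0 by (intro mult_right_mono sum_nonneg mult_nonneg_nonneg) (auto simp: K_def)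
        then show ?thesis by (simp add: mult.assoc)
      qed
      moreover have "K * (\<Sum>j<i. A j * \<gamma> j) = (\<Sum>j<i. A j * (K * \<gamma> j))"
        by (simp add: sum_distrib_left mult_ac)
      ultimately show "(1 + \<bar>u p\<bar>)\<^sup>2 \<le> A i" unfolding A_sum[of i] by linarith
    qed
  qed
  have "(1 + \<bar>u p\<bar>)\<^sup>2 \<le> A (m n)" using main[of "m n"] p by (simp add: stage_m[OF n])
  \<comment> \<open>\<open>1 + x \<le> exp x\<close> replaces the product, whose length grows with
    \<open>m n\<close>, by the exponential of the total weight.\<close>
  also have "\<dots> \<le> K * (\<Prod>j<m n. exp (K * \<gamma> j))"
    unfolding A_def using K g0 by (intro mult_left_mono prod_mono) (auto simp: exp_ge_add_one_self intro: add_nonneg_nonneg)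
  also have "\<dots> = K * exp (K * (\<Sum>j<m n. \<gamma> j))" by (simp add: exp_sum sum_distrib_left)
  also have "(\<Sum>j<m n. \<gamma> j) \<le> (l2 N (\<lambda>q. 1 + \<bar>h q\<bar>))\<^sup>2"
  proof -
    have "(\<Sum>j<m n. \<gamma> j) = (\<integral>q. (\<Sum>j<m n. if lv q = j then w q else 0) \<partial>N)"
      unfolding \<gamma>_def by (rule Bochner_Integration.integral_sum[symmetric]) (rule lv_int)
    also have "\<dots> \<le> (\<integral>q. w q \<partial>N)"
    proof (rule integral_mono_AE)
      show "integrable N (\<lambda>q. \<Sum>j<m n. if lv q = j then w q else 0)" by (intro Bochner_Integration.integrable_sum lv_int)
      show "AE q in N. (\<Sum>j<m n. if lv q = j then w q else 0) \<le> w q" using w0 by (intro AE_I2) simp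
    qed (rule w_int)
    finally show ?thesis by (simp add: l2_sq w_def)
  qed
  finally show ?thesis unfolding K_def[symmetric] using K by simp
qed

lemma apriori_bound:
  obtains R where "0 \<le> R" "\<And>n h u p. 2 \<le> n \<Longrightarrow> sq_int N h \<Longrightarrow> l2 N h \<le> B \<Longrightarrow> is_disc_skeleton_solution T b \<sigma> (m n) n h u \<Longrightarrow> p \<in> Q \<Longrightarrow> \<bar>u p\<bar> \<le> R"
proof -
  define K where "K = 2 + 2 * kb\<^sup>2 * lip\<^sup>2"
  have K: "0 < K" unfolding K_def by (intro add_pos_nonneg) auto
  define R where "R = K * exp (K * (l2 N (\<lambda>_. 1) + B)\<^sup>2)"
  show ?thesis
  proof (rule that[of R])
    show "0 \<le> R" using K by (simp add: R_def)
    fix n h u p assume a: "2 \<le> n" "sq_int N h" "l2 N h \<le> B" "is_disc_skeleton_solution T b \<sigma> (m n) n h u" "p \<in> Q"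
    have "(l2 N (\<lambda>q. 1 + \<bar>h q\<bar>))\<^sup>2 \<le> (l2 N (\<lambda>_. 1) + B)\<^sup>2"
      using one_plus_abs_l2[OF a(2)] a(3) by (intro power_mono) auto
    then have "K * exp (K * (l2 N (\<lambda>q. 1 + \<bar>h q\<bar>))\<^sup>2) \<le> R" unfolding R_def using K by simp
    moreover have "(1 + \<bar>u p\<bar>)\<^sup>2 \<le> K * exp (K * (l2 N (\<lambda>q. 1 + \<bar>h q\<bar>))\<^sup>2)"
      unfolding K_def by (rule disc_gronwall[OF a(1,2,4,5)])
    moreover have "\<bar>u p\<bar> \<le> (1 + \<bar>u p\<bar>)\<^sup>2" by (simp add: power2_sum)
    ultimately show "\<bar>u p\<bar> \<le> R" by linarith
  qed
qed

end

section \<open>The continuous skeleton equation and weak limits of controls\<close>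

lemma abs_midpoint_le: "\<bar>a - x\<bar> \<le> e \<Longrightarrow> \<bar>a - y\<bar> \<le> e \<Longrightarrow> \<bar>a - (x + y) / 2\<bar> \<le> e"
  for a x y e :: real
  by (auto simp: abs_le_iff field_simps)

context spde begin

lemma indicator_time_measurable: "(\<lambda>q. indicator {a..<c} (fst q)) \<in> borel_measurable N"
  by (rule measurable_cylM_restrict) measurable

text \<open>The slabs shrink to a null hyperplane, so dominated convergence makes their weight
  vanish. This provides a step length for continuing uniqueness in time, adapted to \<open>w\<close>
  because the control is merely square integrable.\<close>

lemma time_slab_small:
  fixes w :: "real \<times> (real ^ 'd) \<Rightarrow> real"
  assumes w: "integrable N w" and e: "0 < e"
  obtains \<delta> where "0 < \<delta>" "(\<integral>q. indicator {t..<t + \<delta>} (fst q) * w q \<partial>N) < e"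
proof -
  note [measurable] = borel_measurable_integrable[OF w]
  have "(\<lambda>j. \<integral>q. indicator {t..<t + inverse (real (Suc j))} (fst q) * w q \<partial>N) \<longlonglongrightarrow> (\<integral>q. 0 \<partial>N)"
  proof (rule integral_dominated_convergence[where w = "\<lambda>q. \<bar>w q\<bar>"])
    show "AE q in N. (\<lambda>j. indicator {t..<t + inverse (real (Suc j))} (fst q) * w q) \<longlonglongrightarrow> 0"
      using AE_fst_neq[where T = T and t = t]
    proof eventually_elim
      case (elim q)
      have "eventually (\<lambda>j. indicator {t..<t + inverse (real (Suc j))} (fst q) * w q = 0) sequentially"
      proof (cases "fst q < t")
        case False
        then have "0 < fst q - t" using elim by simp
        then have "eventually (\<lambda>j. inverse (real (Suc j)) < fst q - t) sequentially"
          by (rule order_tendstoD(2)[OF LIMSEQ_inverse_real_of_nat])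
        then show ?thesis by eventually_elim (auto simp: indicator_def)
      qed (simp add: indicator_def)
      then show ?case by (rule tendsto_eventually)
    qed
    show "(\<lambda>q. indicator {t..<t + inverse (real (Suc j))} (fst q) * w q) \<in> borel_measurable N" for j
      by (intro borel_measurable_times indicator_time_measurable borel_measurable_integrable[OF w])
  qed (use w in \<open>auto simp: indicator_def\<close>)
  then have "eventually (\<lambda>j. (\<integral>q. indicator {t..<t + inverse (real (Suc j))} (fst q) * w q \<partial>N) < e) sequentially"
    by (rule order_tendstoD(2)) (use e in simp)
  then obtain j where "(\<integral>q. indicator {t..<t + inverse (real (Suc j))} (fst q) * w q \<partial>N) < e"
    by (auto simp: eventually_sequentially)
  then show ?thesis by (intro that[of "inverse (real (Suc j))"]) auto
qed

lemma continuous_src_sq_int: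
  assumes u: "continuous_on Q u" and h: "sq_int N h"
  shows "sq_int N (src u h)"
proof -
  obtain R where R: "0 \<le> R" "\<And>p. p \<in> Q \<Longrightarrow> \<bar>u p\<bar> \<le> R" using bounded_continuous_closed_cyl[OF u] by blast
  show ?thesis
    by (rule src_sq_int(1)[OF measurable_cylM_continuous[OF u] _ h, of R])
       (use R cyl_subset_closed_cyl in auto)
qed

text \<open>On a slab whose weight is below \<open>1 / (2 * K)\<close> the equation contracts: at a
  point where the difference of the two solutions is largest, its square is at most half of itself.
  Compactness of \<open>D\<close> provides such a point.\<close>

lemma skeleton_unique_extend:
  assumes h: "sq_int N h" and u: "is_skeleton_solution T b \<sigma> h u" and v: "is_skeleton_solution T b \<sigma> h v"
    and t: "0 \<le> t" and agree: "\<And>q. q \<in> Q \<Longrightarrow> fst q < t \<Longrightarrow> u q = v q"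
  shows "\<exists>\<delta>>0. \<forall>p\<in>Q. fst p \<le> t + \<delta> \<longrightarrow> u p = v p"
proof -
  have uc: "continuous_on Q u" and ue: "\<And>p. p \<in> Q \<Longrightarrow> u p = Gk (src u h) p"
    and vc: "continuous_on Q v" and ve: "\<And>p. p \<in> Q \<Longrightarrow> v p = Gk (src v h) p"
    using u v by (auto simp: skeleton_iff)
  define w where "w q = (1 + \<bar>h q\<bar>)\<^sup>2" for q
  have w: "integrable N w"
    using sq_int_integrable_sq[OF one_plus_abs_sq_int[OF h]] unfolding w_def[abs_def] .
  have w0: "0 \<le> w q" for q by (simp add: w_def)
  define K where "K = 1 + kb\<^sup>2 * lip\<^sup>2"
  have K: "0 < K" unfolding K_def by (intro add_pos_nonneg) auto
  obtain \<delta> where \<delta>: "0 < \<delta>" and small: "(\<integral>q. indicator {t..<t + \<delta>} (fst q) * w q \<partial>N) < 1 / (2 * K)"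
    using time_slab_small[OF w, of "1 / (2 * K)" t] K by auto
  define I where "I = (\<integral>q. indicator {t..<t + \<delta>} (fst q) * w q \<partial>N)"
  have I0: "0 \<le> I" unfolding I_def by (rule integral_nonneg_AE) (auto simp: w0)
  define D where "D = Q \<inter> {p. fst p \<le> t + \<delta>}"
  have cD: "compact D" unfolding D_def
    by (intro compact_Int_closed compact_closed_cyl closed_Collect_le continuous_intros)
  show ?thesis
  proof (cases "D = {}")
    case True
    then show ?thesis using \<delta> by (intro exI[of _ \<delta>]) (auto simp: D_def)
  next
    case False
    have "continuous_on D (\<lambda>p. \<bar>u p - v p\<bar>)"
      by (intro continuous_intros continuous_on_subset[OF uc] continuous_on_subset[OF vc]) (auto simp: D_def)
    then obtain p where p: "p \<in> D" and pmax: "\<And>q. q \<in> D \<Longrightarrow> \<bar>u q - v q\<bar> \<le> \<bar>u p - v p\<bar>"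
      using continuous_attains_sup[OF cD False] by blast
    have pQ: "p \<in> Q" and pt: "fst p \<le> t + \<delta>" using p by (auto simp: D_def)
    let ?g = "\<lambda>q. src u h q - src v h q"
    have g: "sq_int N ?g" by (intro sq_int_diff continuous_src_sq_int uc vc h)
    have "(u p - v p)\<^sup>2 = (\<integral>q. gk p q * ?g q \<partial>N)\<^sup>2"
      using Gk_diff[OF pQ continuous_src_sq_int[OF uc h] continuous_src_sq_int[OF vc h]] ue[OF pQ] ve[OF pQ]
      by (simp add: Gk_def)
    also have "\<dots> \<le> kb\<^sup>2 * (\<integral>q. indicator {..<fst p} (fst q) * (?g q)\<^sup>2 \<partial>N)"
      by (rule kernel_restrict_bound[OF gk_sq_int'[OF pQ] kb(3)[OF pQ] _ g]) (simp add: gk_def)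
    also have "(\<integral>q. indicator {..<fst p} (fst q) * (?g q)\<^sup>2 \<partial>N)
        \<le> (\<integral>q. (lip\<^sup>2 * (u p - v p)\<^sup>2) * (indicator {t..<t + \<delta>} (fst q) * w q) \<partial>N)"
    proof (rule integral_mono_AE)
      have im: "(\<lambda>q. indicator {..<fst p} (fst q)) \<in> borel_measurable N"
        by (rule measurable_cylM_restrict) measurable
      show "integrable N (\<lambda>q. indicator {..<fst p} (fst q) * (?g q)\<^sup>2)"
      proof (rule Bochner_Integration.integrable_bound[OF sq_int_integrable_sq[OF g]])
        show "(\<lambda>q. indicator {..<fst p} (fst q) * (?g q)\<^sup>2) \<in> borel_measurable N"
          by (intro borel_measurable_times borel_measurable_power im sq_int_measurable[OF g])
      qed (auto simp: indicator_def)
      have "integrable N (\<lambda>q. indicator {t..<t + \<delta>} (fst q) * w q)"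
        by (rule Bochner_Integration.integrable_bound[OF w borel_measurable_times[OF indicator_time_measurable borel_measurable_integrable[OF w]]])
           (auto simp: indicator_def)
      then show "integrable N (\<lambda>q. (lip\<^sup>2 * (u p - v p)\<^sup>2) * (indicator {t..<t + \<delta>} (fst q) * w q))"
        by (rule integrable_mult_right)
      show "AE q in N. indicator {..<fst p} (fst q) * (?g q)\<^sup>2 \<le> (lip\<^sup>2 * (u p - v p)\<^sup>2) * (indicator {t..<t + \<delta>} (fst q) * w q)"
      proof (rule AE_I2)
        fix q assume "q \<in> space N"
        then have q: "q \<in> Q" using cyl_subset_closed_cyl by auto
        have rhs: "0 \<le> (lip\<^sup>2 * (u p - v p)\<^sup>2) * (indicator {t..<t + \<delta>} (fst q) * w q)"
          using w0[of q] by (intro mult_nonneg_nonneg) auto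
        consider "fst q < t" | "t \<le> fst q" "fst q < fst p" | "fst p \<le> fst q" by linarith
        then show "indicator {..<fst p} (fst q) * (?g q)\<^sup>2 \<le> (lip\<^sup>2 * (u p - v p)\<^sup>2) * (indicator {t..<t + \<delta>} (fst q) * w q)"
        proof cases
          case 1
          then have "?g q = 0" using agree[OF q] by (simp add: src_def)
          then show ?thesis using rhs by simp
        next
          case 2
          then have qD: "q \<in> D" using q pt by (simp add: D_def)
          have "\<bar>?g q\<bar> \<le> lip * (\<bar>u q - v q\<bar> * (1 + \<bar>h q\<bar>))" by (rule src_lipschitz)
          also have "\<dots> \<le> lip * (\<bar>u p - v p\<bar> * (1 + \<bar>h q\<bar>))"
            using pmax[OF qD] lip(1) by (intro mult_left_mono mult_right_mono) auto
          finally have "\<bar>?g q\<bar>\<^sup>2 \<le> (lip * (\<bar>u p - v p\<bar> * (1 + \<bar>h q\<bar>)))\<^sup>2" by (intro power_mono) auto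
          then have "(?g q)\<^sup>2 \<le> (lip\<^sup>2 * (u p - v p)\<^sup>2) * w q" by (simp add: power_mult_distrib w_def mult.assoc)
          then show ?thesis using 2 pt by simp
        next
          case 3
          then show ?thesis using rhs by simp
        qed
      qed
    qed
    finally have "(u p - v p)\<^sup>2 \<le> kb\<^sup>2 * (lip\<^sup>2 * (u p - v p)\<^sup>2 * I)" by (simp add: mult_left_mono I_def)
    also have "\<dots> = (kb\<^sup>2 * lip\<^sup>2) * ((u p - v p)\<^sup>2 * I)" by simp
    also have "\<dots> \<le> K * ((u p - v p)\<^sup>2 * I)" using I0 by (intro mult_right_mono) (auto simp: K_def)
    also have "\<dots> \<le> K * ((u p - v p)\<^sup>2 * (1 / (2 * K)))"
      using small K by (intro mult_left_mono) (auto simp: I_def)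
    also have "\<dots> = (u p - v p)\<^sup>2 / 2" using K by simp
    finally have "(u p - v p)\<^sup>2 = 0" using zero_le_power2[of "u p - v p"] by linarith
    then have "\<bar>u p - v p\<bar> = 0" by simp
    then have "u q = v q" if "q \<in> D" for q using pmax[OF that] by simp
    then show ?thesis using \<delta> by (intro exI[of _ \<delta>]) (auto simp: D_def)
  qed
qed

text \<open>Agreement holds before the supremum \<open>t\<close> of all times of agreement, and
  \<open>skeleton_unique_extend\<close> would push it beyond \<open>t\<close> unless the end time is
  reached.\<close>

lemma skeleton_unique:
  assumes h: "sq_int N h" and u: "is_skeleton_solution T b \<sigma> h u" and v: "is_skeleton_solution T b \<sigma> h v"
    and p: "p \<in> Q"
  shows "u p = v p"
proof -
  define S where "S = {t \<in> {0..T}. \<forall>q\<in>Q. fst q < t \<longrightarrow> u q = v q}"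
  have S0: "0 \<in> S" using T_pos Q_time by (fastforce simp: S_def)
  have bd: "bdd_above S" by (rule bdd_aboveI[of _ T]) (auto simp: S_def)
  define t where "t = Sup S"
  have t0: "0 \<le> t" unfolding t_def by (rule cSup_upper[OF S0 bd])
  have tT: "t \<le> T" unfolding t_def using S0 by (intro cSup_least) (auto simp: S_def)
  have agree: "u q = v q" if "q \<in> Q" "fst q < t" for q
  proof -
    obtain s where "s \<in> S" "fst q < s" using \<open>fst q < t\<close> less_cSup_iff[OF _ bd, of "fst q"] S0 unfolding t_def by auto
    then show ?thesis using that by (auto simp: S_def)
  qed
  obtain \<delta> where \<delta>: "0 < \<delta>" "\<forall>p\<in>Q. fst p \<le> t + \<delta> \<longrightarrow> u p = v p"
    using skeleton_unique_extend[OF h u v t0 agree] by blast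
  have "T \<le> t + \<delta>"
  proof (rule ccontr)
    assume "\<not> T \<le> t + \<delta>"
    then have "t + \<delta> \<in> S" using \<delta> t0 by (auto simp: S_def)
    then have "t + \<delta> \<le> t" unfolding t_def by (rule cSup_upper[OF _ bd])
    then show False using \<delta> by simp
  qed
  then show ?thesis using \<delta> p Q_time[OF p] by auto
qed

section \<open>Compactness of discrete solutions with bounded controls\<close>

lemma proj_close:
  assumes \<rho>: "filterlim \<rho> at_top sequentially" and e: "0 < e"
  shows "eventually (\<lambda>k. 2 \<le> \<rho> k \<and> (\<forall>q\<in>cyl T. dist (proj (\<rho> k) q) q < e)) sequentially"
proof -
  have "(\<lambda>k. \<tau> (\<rho> k) + real CARD('d) * dx (\<rho> k)) \<longlonglongrightarrow> 0 + real CARD('d) * 0"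
    by (intro tendsto_intros dt_tendsto filterlim_compose[OF m_lim \<rho>] dx_tendsto \<rho>)
  then have "eventually (\<lambda>k. \<tau> (\<rho> k) + real CARD('d) * dx (\<rho> k) < e) sequentially"
    by (intro order_tendstoD(2)) (use e in auto)
  then show ?thesis using filterlim_nat_ge[OF \<rho>, of 2]
  proof eventually_elim
    case (elim k)
    have "dist (proj (\<rho> k) q) q \<le> \<tau> (\<rho> k) + real CARD('d) * dx (\<rho> k)" if "q \<in> cyl T" for q
    proof -
      have "dist (proj (\<rho> k) q) q \<le> dist (fst (proj (\<rho> k) q)) (fst q) + dist (snd (proj (\<rho> k) q)) (snd q)"
        unfolding dist_prod_def by (rule sqrt_sum_squares_le_sum) auto
      also have "dist (fst (proj (\<rho> k) q)) (fst q) \<le> \<tau> (\<rho> k)"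
        using time_floor_bounds[OF T_pos m_pos[OF elim(2)], of "fst q"] by (simp add: proj_def dist_real_def)
      also have "dist (snd (proj (\<rho> k) q)) (snd q) \<le> (\<Sum>l\<in>(UNIV::'d set). \<bar>(snd (proj (\<rho> k) q) - snd q) $ l\<bar>)"
        unfolding dist_norm by (rule norm_le_l1_cart)
      also have "\<dots> \<le> (\<Sum>l\<in>(UNIV::'d set). dx (\<rho> k))"
      proof (rule sum_mono)
        fix l
        show "\<bar>(snd (proj (\<rho> k) q) - snd q) $ l\<bar> \<le> dx (\<rho> k)"
          using grid_floor_bounds[OF n_pos[OF elim(2)], of "snd q $ l"] by (simp add: proj_def)
      qed
      finally show ?thesis by simp
    qed
    then show ?case using elim by (auto intro: le_less_trans)
  qed
qed

lemma comp_proj_uniform: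
  fixes u :: "real \<times> (real ^ 'd) \<Rightarrow> real"
  assumes \<rho>: "filterlim \<rho> at_top sequentially" and u: "continuous_on Q u"
    and U: "uniform_limit Q U u sequentially" and e: "0 < e"
  shows "eventually (\<lambda>k. \<forall>q\<in>cyl T. \<bar>U k (proj (\<rho> k) q) - u q\<bar> < e) sequentially"
proof -
  have "uniformly_continuous_on Q u" by (rule compact_uniformly_continuous[OF u compact_closed_cyl])
  then obtain d where d: "0 < d" "\<And>p q. p \<in> Q \<Longrightarrow> q \<in> Q \<Longrightarrow> dist p q < d \<Longrightarrow> dist (u p) (u q) < e / 2"
    unfolding uniformly_continuous_on_def using e by (metis half_gt_zero)
  have "eventually (\<lambda>k. \<forall>p\<in>Q. dist (U k p) (u p) < e / 2) sequentially"
    using uniform_limitD[OF U, of "e/2"] e by simp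
  then show ?thesis using proj_close[OF \<rho> d(1)]
  proof eventually_elim
    case (elim k)
    show ?case
    proof
      fix q :: "real \<times> (real ^ 'd)" assume q: "q \<in> cyl T"
      have pq: "proj (\<rho> k) q \<in> Q" "q \<in> Q" using proj_in_Q[of "\<rho> k" q] elim q cyl_subset_closed_cyl by auto
      have "dist (U k (proj (\<rho> k) q)) (u (proj (\<rho> k) q)) < e / 2" using elim pq by blast
      moreover have "dist (u (proj (\<rho> k) q)) (u q) < e / 2" using elim q by (intro d(2) pq) blast
      ultimately show "\<bar>U k (proj (\<rho> k) q) - u q\<bar> < e" unfolding dist_real_def by linarith
    qed
  qed
qed

lemma src_diff_l2:
  assumes v: "v \<in> borel_measurable N" and w: "w \<in> borel_measurable N" and h: "sq_int N h"
    and e: "0 \<le> e" and vw: "\<And>q. q \<in> cyl T \<Longrightarrow> \<bar>v q - w q\<bar> \<le> e"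
  shows "l2 N (\<lambda>q. src v h q - src w h q) \<le> lip * e * (l2 N (\<lambda>_. 1) + l2 N h)"
proof -
  have "l2 N (\<lambda>q. src v h q - src w h q) \<le> l2 N (\<lambda>q. (lip * e) * (1 + \<bar>h q\<bar>))"
  proof (rule l2_mono[OF sq_int_cmult[OF one_plus_abs_sq_int[OF h]]])
    show "(\<lambda>q. src v h q - src w h q) \<in> borel_measurable N"
      by (intro borel_measurable_diff src_measurable v w h)
    show "AE q in N. \<bar>src v h q - src w h q\<bar> \<le> \<bar>(lip * e) * (1 + \<bar>h q\<bar>)\<bar>"
    proof (rule AE_I2)
      fix q assume "q \<in> space N"
      then have "\<bar>v q - w q\<bar> \<le> e" using vw by simp
      then have "lip * (\<bar>v q - w q\<bar> * (1 + \<bar>h q\<bar>)) \<le> lip * (e * (1 + \<bar>h q\<bar>))"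
        using lip(1) by (intro mult_left_mono mult_right_mono) auto
      also have "\<dots> \<le> \<bar>(lip * e) * (1 + \<bar>h q\<bar>)\<bar>" by (simp add: mult.assoc)
      finally show "\<bar>src v h q - src w h q\<bar> \<le> \<bar>(lip * e) * (1 + \<bar>h q\<bar>)\<bar>"
        using src_lipschitz[of v h q w] by linarith
    qed
  qed
  also have "\<dots> = lip * e * l2 N (\<lambda>q. 1 + \<bar>h q\<bar>)" using lip(1) e by (simp add: l2_cmult abs_mult)
  also have "\<dots> \<le> lip * e * (l2 N (\<lambda>_. 1) + l2 N h)"
    using lip(1) e one_plus_abs_l2[OF h] by (intro mult_left_mono) auto
  finally show ?thesis .
qed

lemma Gd_uniform:
  assumes \<rho>: "filterlim \<rho> at_top sequentially" and f: "\<And>k. sq_int N (f k)" "\<And>k. l2 N (f k) \<le> F" and e: "0 < e"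
  shows "eventually (\<lambda>k. 2 \<le> \<rho> k \<and> (\<forall>p\<in>Q. \<bar>Gd (\<rho> k) (f k) p - Gk (f k) p\<bar> < e)) sequentially"
proof -
  have F0: "0 \<le> F" using f(2)[of 0] l2_nonneg order_trans by blast
  then have e': "0 < e / (F + 1)" using e by simp
  obtain K where K: "\<And>n p. K \<le> n \<Longrightarrow> p \<in> Q \<Longrightarrow> l2 N (\<lambda>q. kd n p q - gk p q) < e / (F + 1)"
    using kd_uniform[OF e'] by blast
  show ?thesis using filterlim_nat_ge[OF \<rho>, of 2] filterlim_nat_ge[OF \<rho>, of K]
  proof eventually_elim
    case (elim k)
    have "\<bar>Gd (\<rho> k) (f k) p - Gk (f k) p\<bar> < e" if p: "p \<in> Q" for p
    proof -
      have "\<bar>Gd (\<rho> k) (f k) p - Gk (f k) p\<bar> \<le> l2 N (\<lambda>q. kd (\<rho> k) p q - gk p q) * l2 N (f k)"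
        by (rule Gd_Gk_diff[OF elim(1) p f(1)])
      also have "\<dots> \<le> e / (F + 1) * F"
        using K[OF elim(2) p] f(2)[of k] e' by (intro mult_mono) auto
      also have "\<dots> < e / (F + 1) * (F + 1)" by (rule mult_strict_left_mono[OF _ e']) simp
      also have "\<dots> = e" using F0 by simp
      finally show ?thesis .
    qed
    then show ?case using elim by simp
  qed
qed

abbreviation Ud :: "nat \<Rightarrow> (real \<times> (real ^ 'd) \<Rightarrow> real) \<Rightarrow> real \<times> (real ^ 'd) \<Rightarrow> real" where
  "Ud n h \<equiv> Upsilon_disc T b \<sigma> (m n) n h"

text \<open>The a priori bound makes the sources \<open>f k\<close> bounded in \<open>l2\<close>;
  the functions \<open>Gk (f k)\<close> are then bounded and equicontinuous, and Arzela-Ascoli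
  applies to them rather than to the discrete solutions, which differ from them by a uniformly
  vanishing error. No limit of the controls is claimed: the last conclusion says only that
  \<open>u\<close> solves the equation driven by \<open>h (r k)\<close> up to a small
  residual.\<close>

theorem compactness:
  assumes \<rho>: "filterlim \<rho> at_top sequentially" "\<And>k. 2 \<le> \<rho> k"
    and h: "\<And>k. sq_int N (h k)" "\<And>k. l2 N (h k) \<le> B"
  obtains r u where "strict_mono (r :: nat \<Rightarrow> nat)" "continuous_on Q u"
    "uniform_limit Q (\<lambda>k. Ud (\<rho> (r k)) (h (r k))) u sequentially"
    "\<And>e. 0 < e \<Longrightarrow> \<exists>K. \<forall>k\<ge>K. \<forall>p\<in>Q. \<bar>u p - Gk (src u (h (r k))) p\<bar> \<le> e"
proof -
  define U where "U k = Ud (\<rho> k) (h k)" for k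
  have U: "is_disc_skeleton_solution T b \<sigma> (m (\<rho> k)) (\<rho> k) (h k) (U k)" for k
    unfolding U_def by (rule Upsilon_disc_solution[OF \<rho>(2) h(1)])
  obtain R where R: "0 \<le> R" "\<And>k p. p \<in> Q \<Longrightarrow> \<bar>U k p\<bar> \<le> R"
    using apriori_bound[of B] \<rho>(2) h U by metis
  have Uc: "continuous_on Q (U k)" for k using U[of k] unfolding disc_skeleton_iff by blast
  define f where "f k = src (U k \<circ> proj (\<rho> k)) (h k)" for k
  define F where "F = lip * (1 + R) * (l2 N (\<lambda>_. 1) + B)"
  have f: "sq_int N (f k)" for k unfolding f_def by (rule src_proj_sq_int[OF \<rho>(2) Uc h(1)])
  have fF: "l2 N (f k) \<le> F" for k
  proof -
    have "l2 N (f k) \<le> lip * (1 + R) * (l2 N (\<lambda>_. 1) + l2 N (h k))"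
      unfolding f_def
      by (rule src_sq_int(2)[OF comp_proj_measurable[OF \<rho>(2) Uc] _ h(1) R(1)])
         (use R(2) proj_in_Q[OF \<rho>(2)] in auto)
    also have "\<dots> \<le> F" unfolding F_def using lip(1) R(1) h(2) by (intro mult_left_mono) auto
    finally show ?thesis .
  qed
  have F0: "0 \<le> F" using fF[of 0] l2_nonneg order_trans by blast
  have eqU: "U k p = Gd (\<rho> k) (f k) p" if "p \<in> Q" for k p
    using U[of k] that unfolding disc_skeleton_iff f_def by blast
  have bnd: "norm (Gk (f k) p) \<le> kb * F" if "p \<in> Q" for k p
  proof -
    have "\<bar>Gk (f k) p\<bar> \<le> kb * l2 N (f k)" by (rule Gk_bound[OF that f])
    also have "\<dots> \<le> kb * F" using fF kb(1) by (intro mult_left_mono) auto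
    finally show ?thesis by simp
  qed
  have equi: "\<exists>d. 0 < d \<and> (\<forall>k y. y \<in> Q \<and> norm (a - y) < d \<longrightarrow> norm (Gk (f k) a - Gk (f k) y) < e)"
    if a: "a \<in> Q" and e: "0 < e" for a e
  proof -
    have e': "0 < e / (F + 1)" using e F0 by simp
    obtain d where d: "0 < d" "\<And>p. p \<in> Q \<Longrightarrow> norm (a - p) < d \<Longrightarrow> l2 N (\<lambda>q. gk a q - gk p q) < e / (F + 1)"
      using gk_equicontinuous[OF a e'] by blast
    have "norm (Gk (f k) a - Gk (f k) y) < e" if "y \<in> Q" "norm (a - y) < d" for k y
    proof -
      have "\<bar>Gk (f k) a - Gk (f k) y\<bar> \<le> l2 N (\<lambda>q. gk a q - gk y q) * l2 N (f k)"
        by (rule Gk_point_diff[OF a that(1) f])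
      also have "\<dots> \<le> e / (F + 1) * F" using d(2)[OF that] fF[of k] e' by (intro mult_mono) auto
      also have "\<dots> < e / (F + 1) * (F + 1)" by (rule mult_strict_left_mono[OF _ e']) simp
      also have "\<dots> = e" using F0 by simp
      finally show ?thesis by simp
    qed
    then show ?thesis using d(1) by blast
  qed
  obtain u r where u: "continuous_on Q u" and r: "strict_mono (r :: nat \<Rightarrow> nat)"
    and conv: "\<And>e. 0 < e \<Longrightarrow> \<exists>K. \<forall>k p. K \<le> k \<and> p \<in> Q \<longrightarrow> norm (Gk (f (r k)) p - u p) < e"
    using Arzela_Ascoli[OF compact_closed_cyl bnd equi] by metis
  have \<rho>r: "filterlim (\<lambda>k. \<rho> (r k)) at_top sequentially"
    using filterlim_compose[OF \<rho>(1) filterlim_subseq[OF r]] .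
  have V: "eventually (\<lambda>k. \<forall>p\<in>Q. \<bar>Gk (f (r k)) p - u p\<bar> < e) sequentially" if "0 < e" for e
    using conv[OF that] unfolding eventually_sequentially real_norm_def by blast
  have ul: "uniform_limit Q (\<lambda>k. U (r k)) u sequentially"
  proof (rule uniform_limitI)
    fix e :: real assume "0 < e"
    then have e: "0 < e / 2" by simp
    show "\<forall>\<^sub>F k in sequentially. \<forall>p\<in>Q. dist (U (r k) p) (u p) < e"
      using V[OF e] Gd_uniform[of "\<lambda>k. \<rho> (r k)" "\<lambda>k. f (r k)", OF \<rho>r f fF e]
    proof eventually_elim
      case (elim k)
      show ?case
      proof
        fix p assume p: "p \<in> Q"
        have "\<bar>Gk (f (r k)) p - u p\<bar> < e / 2" "\<bar>Gd (\<rho> (r k)) (f (r k)) p - Gk (f (r k)) p\<bar> < e / 2"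
          using elim p by blast+
        then show "dist (U (r k) p) (u p) < e" unfolding dist_real_def eqU[OF p] by linarith
      qed
    qed
  qed
  have res: "\<exists>K. \<forall>k\<ge>K. \<forall>p\<in>Q. \<bar>u p - Gk (src u (h (r k))) p\<bar> \<le> e" if e: "0 < e" for e
  proof -
    \<comment> \<open>\<open>c - 1\<close> bounds the factor by which a uniform error in the path
      enters \<open>Gk\<close>; the summand 1 keeps \<open>c\<close> positive.\<close>
    define c where "c = kb * (lip * (l2 N (\<lambda>_. 1) + B)) + 1"
    have B0: "0 \<le> B" using h(2)[of 0] l2_nonneg order_trans by blast
    have c: "0 < c" unfolding c_def using kb(1) lip(1) B0 by (intro add_nonneg_pos mult_nonneg_nonneg add_nonneg_nonneg) auto
    define e1 where "e1 = e / (2 * c)"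
    have e1: "0 < e1" using e c by (simp add: e1_def)
    have e2: "0 < e / 2" using e by simp
    have "eventually (\<lambda>k. \<forall>p\<in>Q. \<bar>u p - Gk (src u (h (r k))) p\<bar> \<le> e) sequentially"
      using V[OF e2] comp_proj_uniform[OF \<rho>r u ul e1]
    proof eventually_elim
      case (elim k)
      show ?case
      proof
        fix p assume p: "p \<in> Q"
        have su: "sq_int N (src u (h (r k)))" by (rule continuous_src_sq_int[OF u h(1)])
        have "l2 N (\<lambda>q. f (r k) q - src u (h (r k)) q) \<le> lip * e1 * (l2 N (\<lambda>_. 1) + l2 N (h (r k)))"
          unfolding f_def
          by (rule src_diff_l2[OF comp_proj_measurable[OF \<rho>(2) Uc] measurable_cylM_continuous[OF u] h(1)])
             (use elim(2) e1 in \<open>auto intro: less_imp_le\<close>)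
        also have "\<dots> \<le> lip * e1 * (l2 N (\<lambda>_. 1) + B)" using lip(1) e1 h(2) by (intro mult_left_mono) auto
        finally have "kb * l2 N (\<lambda>q. f (r k) q - src u (h (r k)) q) \<le> kb * (lip * e1 * (l2 N (\<lambda>_. 1) + B))"
          using kb(1) by (intro mult_left_mono) auto
        also have "\<dots> = e1 * (c - 1)" by (simp add: c_def)
        also have "\<dots> \<le> e1 * c" using e1 by (intro mult_left_mono) auto
        also have "\<dots> = e / 2" using c by (simp add: e1_def)
        finally have "\<bar>Gk (f (r k)) p - Gk (src u (h (r k))) p\<bar> \<le> e / 2"
          using Gk_diff_le[OF p f su] by (rule order_trans[rotated])
        moreover have "\<bar>Gk (f (r k)) p - u p\<bar> < e / 2" using elim(1) p by blast
        ultimately show "\<bar>u p - Gk (src u (h (r k))) p\<bar> \<le> e" by linarith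
      qed
    qed
    then show ?thesis by (simp add: eventually_sequentially)
  qed
  show ?thesis by (rule that[OF r u ul[unfolded U_def] res])
qed

text \<open>With a constant sequence of controls the residual in \<open>compactness\<close> does not
  depend on the index, so it is below every \<open>e\<close> and vanishes. Existence thus comes from
  the scheme itself.\<close>

lemma skeleton_exists:
  assumes h: "sq_int N h"
  shows "\<exists>u. is_skeleton_solution T b \<sigma> h u"
proof -
  have fl: "filterlim (\<lambda>k::nat. k + 2) at_top sequentially" by (rule filterlim_add_const_nat_at_top)
  obtain u where u: "continuous_on Q u"
    and res: "\<And>e. 0 < e \<Longrightarrow> \<exists>K::nat. \<forall>k\<ge>K. \<forall>p\<in>Q. \<bar>u p - Gk (src u h) p\<bar> \<le> e"
  proof (rule compactness[OF fl, of "\<lambda>_. h" "l2 N h"])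
    fix r :: "nat \<Rightarrow> nat" and u assume A: "continuous_on Q u"
      and B: "\<And>e. 0 < e \<Longrightarrow> \<exists>K::nat. \<forall>k\<ge>K. \<forall>p\<in>Q. \<bar>u p - Gk (src u h) p\<bar> \<le> e"
    show thesis by (rule that[OF A B])
  qed (use h in auto)
  have "u p = Gk (src u h) p" if p: "p \<in> Q" for p
  proof -
    have "\<bar>u p - Gk (src u h) p\<bar> \<le> 0"
    proof (rule field_le_epsilon)
      fix e :: real assume "0 < e"
      then show "\<bar>u p - Gk (src u h) p\<bar> \<le> 0 + e" using res[of e] p by auto
    qed
    then show ?thesis by simp
  qed
  then show ?thesis using u unfolding skeleton_iff by blast
qed

abbreviation Uk :: "(real \<times> (real ^ 'd) \<Rightarrow> real) \<Rightarrow> real \<times> (real ^ 'd) \<Rightarrow> real" where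
  "Uk h \<equiv> Upsilon T b \<sigma> h"

lemma Upsilon_solution:
  assumes h: "sq_int N h"
  shows "is_skeleton_solution T b \<sigma> h (Uk h)"
proof -
  obtain u where u: "is_skeleton_solution T b \<sigma> h u" using skeleton_exists[OF h] by blast
  show ?thesis unfolding Upsilon_def
    by (rule the_extensional[where S = "is_skeleton_solution T b \<sigma> h", OF u])
       (use skeleton_unique[OF h] skeleton_cong in blast)+
qed

lemma Upsilon_eq:
  assumes "sq_int N h" "is_skeleton_solution T b \<sigma> h u" "p \<in> Q"
  shows "Uk h p = u p"
  by (rule skeleton_unique[OF assms(1) Upsilon_solution[OF assms(1)] assms(2,3)])

lemma sigma_comp_bound:
  assumes u: "continuous_on Q u"
  obtains C where "0 \<le> C" "\<And>q. q \<in> cyl T \<Longrightarrow> \<bar>\<sigma> (u q)\<bar> \<le> C"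
proof -
  obtain R where R: "0 \<le> R" "\<And>p. p \<in> Q \<Longrightarrow> \<bar>u p\<bar> \<le> R" using bounded_continuous_closed_cyl[OF u] by blast
  show ?thesis
  proof (rule that[of "lip * (1 + R)"])
    show "0 \<le> lip * (1 + R)" using lip(1) R(1) by simp
    fix q :: "real \<times> (real ^ 'd)" assume "q \<in> cyl T"
    then have "\<bar>u q\<bar> \<le> R" using R(2) cyl_subset_closed_cyl by blast
    then show "\<bar>\<sigma> (u q)\<bar> \<le> lip * (1 + R)"
      using lip(5)[of "u q"] lip(1) mult_left_mono[of "1 + \<bar>u q\<bar>" "1 + R" lip] by linarith
  qed
qed

lemma Gk_src_diff_le:
  assumes u: "continuous_on Q u" and C: "0 \<le> C" "\<And>q. q \<in> cyl T \<Longrightarrow> \<bar>\<sigma> (u q)\<bar> \<le> C"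
    and g: "sq_int N g" "sq_int N h" and p: "p \<in> Q"
  shows "\<bar>Gk (src u g) p - Gk (src u h) p\<bar> \<le> kb * (C * l2 N (\<lambda>q. g q - h q))"
proof -
  have "\<bar>Gk (src u g) p - Gk (src u h) p\<bar> \<le> kb * l2 N (\<lambda>q. src u g q - src u h q)"
    by (intro Gk_diff_le p continuous_src_sq_int u g)
  also have "(\<lambda>q. src u g q - src u h q) = (\<lambda>q. \<sigma> (u q) * (g q - h q))"
    by (simp add: src_def algebra_simps)
  also have "l2 N (\<lambda>q. \<sigma> (u q) * (g q - h q)) \<le> C * l2 N (\<lambda>q. g q - h q)"
  proof (rule l2_bounded_mult[OF sq_int_diff[OF g]])
    show "(\<lambda>q. \<sigma> (u q)) \<in> borel_measurable N"
      by (rule measurable_compose[OF measurable_cylM_continuous[OF u] sigma_measurable])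
  qed (use C in auto)
  finally show ?thesis using kb(1) by (simp add: mult_left_mono)
qed

text \<open>The approximate solution sets \<open>C\<close> below are midpoint convex because \<open>src u\<close> is affine in the control.\<close>

theorem variational_limit:
  assumes u: "continuous_on Q u" and h: "\<And>k. sq_int N (h k)" "\<And>k. l2 N (h k) \<le> B"
    and res: "\<And>e. 0 < e \<Longrightarrow> \<exists>K. \<forall>k\<ge>K. \<forall>p\<in>Q. \<bar>u p - Gk (src u (h k)) p\<bar> \<le> e"
  obtains g where "sq_int N g" "is_skeleton_solution T b \<sigma> g u"
    "\<And>e. 0 < e \<Longrightarrow> \<exists>K. \<forall>k\<ge>K. l2 N g - e < l2 N (h k)"
    "(\<lambda>k. l2 N (h k)) \<longlonglongrightarrow> l2 N g \<Longrightarrow> (\<lambda>k. l2 N (\<lambda>q. h k q - g q)) \<longlonglongrightarrow> 0"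
proof -
  \<comment> \<open>Controls that drive \<open>u\<close> up to the error \<open>1 / (M + 1)\<close>.
    The sequence \<open>h\<close> is eventually in each of these sets, so a lower bound for the
    norms in \<open>C M\<close> is eventually one for \<open>h\<close>.\<close>
  define C where "C M = {f. sq_int N f \<and> (\<forall>p\<in>Q. \<bar>u p - Gk (src u f) p\<bar> \<le> inverse (real (Suc M)))}" for M
  have mid: "(\<lambda>q. (f q + g q) / 2) \<in> C M" if fg: "f \<in> C M" "g \<in> C M" for f g M
  proof -
    have f: "sq_int N f" and g: "sq_int N g" using fg by (auto simp: C_def)
    have sq: "sq_int N (\<lambda>q. (f q + g q) / 2)" using sq_int_cmult[OF sq_int_add[OF f g], of "1/2"] by simp
    have "\<bar>u p - Gk (src u (\<lambda>q. (f q + g q) / 2)) p\<bar> \<le> inverse (real (Suc M))" if p: "p \<in> Q" for p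
    proof -
      note i = sq_int_prod[OF gk_sq_int'[OF p] continuous_src_sq_int[OF u f]] sq_int_prod[OF gk_sq_int'[OF p] continuous_src_sq_int[OF u g]]
      have "Gk (src u (\<lambda>q. (f q + g q) / 2)) p = (\<integral>q. (gk p q * src u f q + gk p q * src u g q) / 2 \<partial>N)"
        unfolding Gk_def by (intro Bochner_Integration.integral_cong) (auto simp: src_def field_simps)
      also have "\<dots> = (Gk (src u f) p + Gk (src u g) p) / 2" unfolding Gk_def using i by simp
      finally have e: "Gk (src u (\<lambda>q. (f q + g q) / 2)) p = (Gk (src u f) p + Gk (src u g) p) / 2" .
      have "\<bar>u p - Gk (src u f) p\<bar> \<le> inverse (real (Suc M))" "\<bar>u p - Gk (src u g) p\<bar> \<le> inverse (real (Suc M))"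
        using fg p by (auto simp: C_def)
      then show ?thesis unfolding e by (rule abs_midpoint_le)
    qed
    then show ?thesis using sq by (simp add: C_def)
  qed
  have hC: "\<exists>K. \<forall>k\<ge>K. h k \<in> C M" for M
    using res[of "inverse (real (Suc M))"] h(1) by (auto simp: C_def)
  have sqC: "sq_int N f" if "f \<in> C M" for f M using that by (simp add: C_def)
  have dec: "C (Suc M) \<subseteq> C M" for M
  proof -
    have "inverse (real (Suc (Suc M))) \<le> inverse (real (Suc M))" by (intro le_imp_inverse_le) auto
    then show ?thesis unfolding C_def by (auto intro: order_trans)
  qed
  have bd: "\<exists>f\<in>C M. l2 N f \<le> B" for M using hC[of M] h(2) by blast
  obtain g G where g: "sq_int N g" and GC: "\<And>M. G M \<in> C M" and Gg: "(\<lambda>M. l2 N (\<lambda>q. G M q - g q)) \<longlonglongrightarrow> 0"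
    and low: "\<And>e. 0 < e \<Longrightarrow> \<exists>M. \<forall>f\<in>C M. l2 N g - e < l2 N f"
  proof (rule l2_nested_convex[of C B, OF sqC mid dec bd])
    fix g G assume 1: "sq_int N g" and 2: "\<And>M. G M \<in> C M" and 3: "(\<lambda>M. l2 N (\<lambda>q. G M q - g q)) \<longlonglongrightarrow> 0"
      and 4: "\<And>e. 0 < e \<Longrightarrow> \<exists>M. \<forall>f\<in>C M. l2 N g - e < l2 N f"
    show thesis by (rule that[OF 1 2 3 4])
  qed
  obtain c where c: "0 \<le> c" "\<And>q. q \<in> cyl T \<Longrightarrow> \<bar>\<sigma> (u q)\<bar> \<le> c" using sigma_comp_bound[OF u] by blast
  have sol: "u p = Gk (src u g) p" if p: "p \<in> Q" for p
  proof -
    have "(\<lambda>M. inverse (real (Suc M)) + kb * (c * l2 N (\<lambda>q. G M q - g q))) \<longlonglongrightarrow> 0 + kb * (c * 0)"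
      by (intro tendsto_intros LIMSEQ_inverse_real_of_nat Gg)
    moreover have "\<bar>u p - Gk (src u g) p\<bar> \<le> inverse (real (Suc M)) + kb * (c * l2 N (\<lambda>q. G M q - g q))" for M
    proof -
      have GM: "sq_int N (G M)" "\<bar>u p - Gk (src u (G M)) p\<bar> \<le> inverse (real (Suc M))" using GC[of M] p by (auto simp: C_def)
      show ?thesis using GM(2) Gk_src_diff_le[OF u c GM(1) g p] by linarith
    qed
    ultimately have "\<bar>u p - Gk (src u g) p\<bar> \<le> 0 + kb * (c * 0)" by (intro LIMSEQ_le_const) auto
    then show ?thesis by simp
  qed
  have gC: "g \<in> C M" for M using g sol by (simp add: C_def)
  show ?thesis
  proof (rule that[OF g])
    show "is_skeleton_solution T b \<sigma> g u" using u sol by (simp add: skeleton_iff)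
    fix e :: real assume "0 < e"
    then obtain M where M: "\<forall>f\<in>C M. l2 N g - e < l2 N f" using low by blast
    then show "\<exists>K. \<forall>k\<ge>K. l2 N g - e < l2 N (h k)" using hC[of M] by blast
  next
    assume lim: "(\<lambda>k. l2 N (h k)) \<longlonglongrightarrow> l2 N g"
    have "(\<lambda>k. (l2 N (\<lambda>q. h k q - g q))\<^sup>2) \<longlonglongrightarrow> 0"
    proof (rule LIMSEQ_I)
      fix e :: real assume e: "0 < e"
      \<comment> \<open>Chosen so that \<open>8 * (l2 N g * e1) \<le> e / 2\<close>; the summand 1
        covers vanishing \<open>g\<close>.\<close>
      define e1 where "e1 = e / (16 * (l2 N g + 1))"
      have G0: "0 \<le> l2 N g" by simp
      have e1: "0 < e1" using e by (simp add: e1_def add_nonneg_pos)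
      have e1G: "8 * (l2 N g * e1) \<le> e / 2"
      proof -
        define z where "z = l2 N g + 1"
        have "0 < z" using G0 unfolding z_def by linarith
        then have "z * e1 = e / 16" by (simp add: e1_def z_def[symmetric])
        moreover have "l2 N g * e1 \<le> z * e1" using e1 by (intro mult_right_mono) (auto simp: z_def)
        ultimately show ?thesis by linarith
      qed
      obtain M where M: "\<forall>f\<in>C M. l2 N g - e1 < l2 N f" using low[OF e1] by blast
      obtain K1 where K1: "\<And>k. K1 \<le> k \<Longrightarrow> h k \<in> C M" using hC[of M] by blast
      have "(\<lambda>k. (l2 N (h k))\<^sup>2) \<longlonglongrightarrow> (l2 N g)\<^sup>2" by (intro tendsto_intros lim)
      then have "eventually (\<lambda>k. (l2 N (h k))\<^sup>2 < (l2 N g)\<^sup>2 + e / 4) sequentially"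
        by (rule order_tendstoD(2)) (use e in simp)
      then obtain K2 where K2: "\<And>k. K2 \<le> k \<Longrightarrow> (l2 N (h k))\<^sup>2 < (l2 N g)\<^sup>2 + e / 4"
        by (auto simp: eventually_sequentially)
      have "(l2 N (\<lambda>q. h k q - g q))\<^sup>2 < e" if k: "max K1 K2 \<le> k" for k
      proof -
        let ?m = "l2 N (\<lambda>q. (h k q + g q) / 2)"
        \<comment> \<open>\<open>g\<close> lies in every \<open>C M\<close>, hence so does its
          midpoint with \<open>h k\<close>, which therefore cannot be much shorter than
          \<open>g\<close>; the parallelogram law then bounds the distance.\<close>
        have "l2 N g - e1 < ?m" using M mid[OF K1 gC] k by auto
        then have "(l2 N g)\<^sup>2 - 2 * (l2 N g * e1) \<le> ?m\<^sup>2"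
        proof (cases "e1 \<le> l2 N g")
          case True
          then have "(l2 N g - e1)\<^sup>2 \<le> ?m\<^sup>2" using \<open>l2 N g - e1 < ?m\<close> by (intro power_mono) auto
          moreover have "(l2 N g - e1)\<^sup>2 = (l2 N g)\<^sup>2 - 2 * (l2 N g * e1) + e1\<^sup>2" by (simp add: power2_diff)
          ultimately show ?thesis using zero_le_power2[of e1] by linarith
        next
          case False
          then have "l2 N g * l2 N g \<le> l2 N g * e1" by (intro mult_left_mono) auto
          moreover have "0 \<le> l2 N g * e1" using e1 by simp
          ultimately have "(l2 N g)\<^sup>2 - 2 * (l2 N g * e1) \<le> 0" by (simp add: power2_eq_square)
          then show ?thesis using zero_le_power2[of ?m] by linarith
        qed
        then show ?thesis
          using l2_parallelogram[OF h(1)[of k] g] K2[of k] k e1G by linarith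
      qed
      then show "\<exists>K. \<forall>k\<ge>K. norm ((l2 N (\<lambda>q. h k q - g q))\<^sup>2 - 0) < e"
        by (intro exI[of _ "max K1 K2"]) auto
    qed
    from tendsto_real_sqrt[OF this] show "(\<lambda>k. l2 N (\<lambda>q. h k q - g q)) \<longlonglongrightarrow> 0" by simp
  qed
qed

end

section \<open>Cellwise constant controls and recovery sequences\<close>

context spde begin

definition cellset :: "nat \<Rightarrow> nat \<Rightarrow> ('d \<Rightarrow> nat) \<Rightarrow> (real \<times> (real ^ 'd)) set" where
  "cellset n j k = ({real j * \<tau> n..<real (j + 1) * \<tau> n} \<times> space_cell n k) \<inter> cyl T"

lemma time_floor_eq:
  assumes n: "2 \<le> n" and s: "real j * \<tau> n \<le> s" "s < real (j + 1) * \<tau> n"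
  shows "time_floor T (m n) s = real j * \<tau> n"
proof -
  have "\<lfloor>s / \<tau> n\<rfloor> = int j"
    using s tau_pos[OF n] by (intro floor_unique) (auto simp: pos_le_divide_eq pos_divide_less_eq algebra_simps)
  then show ?thesis by (simp add: time_floor_def mult.commute)
qed

lemma proj_cell:
  assumes n: "2 \<le> n" and q: "q \<in> cellset n j k"
  shows "proj n q = (real j * \<tau> n, grid_pt n k)"
proof -
  have "grid_floor n (snd q $ l) = dx n * real (k l)" for l
    using q by (intro grid_floor_eq n_pos[OF n]) (auto simp: cellset_def space_cell_def)
  then have "kappa n (snd q) = grid_pt n k" by (simp add: vec_eq_iff grid_pt_def)
  then show ?thesis using q time_floor_eq[OF n, of j "fst q"] by (auto simp: proj_def cellset_def)
qed

lemma cell_ex: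
  assumes n: "2 \<le> n" and q: "q \<in> cyl T"
  obtains j k where "j < m n" "k \<in> cell_idx n" "q \<in> cellset n j k"
proof -
  obtain s z where sz: "q = (s, z)" by (cases q)
  then have s: "0 < s" "s < T" and z: "z \<in> cube" using q by (auto simp: mem_cyl)
  have "\<exists>i<n. real i * dx n \<le> z $ l \<and> z $ l < (real i + 1) * dx n" for l
    using z by (intro grid_cell_ex n_pos[OF n]) (auto simp: cube_def less_imp_le)
  then obtain k where k: "\<And>l. k l < n" "\<And>l. real (k l) * dx n \<le> z $ l" "\<And>l. z $ l < (real (k l) + 1) * dx n"
    by metis
  define j where "j = nat \<lfloor>s / \<tau> n\<rfloor>"
  have d: "0 < \<tau> n" by (rule tau_pos[OF n])
  have "0 \<le> s / \<tau> n" using s d by (intro divide_nonneg_pos) auto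
  then have rj: "real j = of_int \<lfloor>s / \<tau> n\<rfloor>" by (simp add: j_def)
  have fl: "of_int \<lfloor>s / \<tau> n\<rfloor> \<le> s / \<tau> n" "s / \<tau> n < of_int \<lfloor>s / \<tau> n\<rfloor> + 1" by linarith+
  have j1: "real j * \<tau> n \<le> s" "s < real (j + 1) * \<tau> n"
    using fl unfolding rj[symmetric] pos_le_divide_eq[OF d] pos_divide_less_eq[OF d] by (auto simp: add.commute)
  have "real j * \<tau> n < real (m n) * \<tau> n" using j1 s m_tau[OF n] by simp
  then have "j < m n" using d by simp
  moreover have "q \<in> cellset n j k" using j1 k z q by (auto simp: cellset_def space_cell_def sz)
  moreover have "k \<in> cell_idx n" using k by (simp add: cell_idx_def)
  ultimately show ?thesis using that by blast
qed

text \<open>Together with \<open>X_spaceD\<close>: cellwise constant functions are those that factor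
  through \<open>proj n\<close>, which is the form in which they meet the discrete equation.\<close>

lemma X_spaceI:
  assumes n: "2 \<le> n" and h: "sq_int N h" and \<phi>: "\<And>q. q \<in> cyl T \<Longrightarrow> h q = \<phi> (proj n q)"
  shows "h \<in> X_space T (m n) n"
  unfolding X_space_def
proof (intro CollectI conjI allI impI ballI)
  show "h \<in> L2_cyl T" using h by (simp add: L2_cyl_iff)
  fix j and k :: "'d \<Rightarrow> nat" assume "j < m n" "k \<in> cell_idx n"
  have "h q = \<phi> (real j * \<tau> n, grid_pt n k)" if "q \<in> cellset n j k" for q
    using \<phi>[of q] proj_cell[OF n that] that by (auto simp: cellset_def)
  then show "h constant_on {real j * \<tau> n..<real (j + 1) * \<tau> n} \<times> space_cell n k \<inter> cyl T"
    unfolding constant_on_def cellset_def by blast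
qed

lemma X_space_sq_int: "h \<in> X_space T (m n) n \<Longrightarrow> sq_int N h"
  by (simp add: X_space_def L2_cyl_iff)

lemma grid_pt_inj: "0 < n \<Longrightarrow> grid_pt n k = grid_pt n k' \<Longrightarrow> k = k'"
  by (auto simp: grid_pt_def vec_eq_iff dx_def fun_eq_iff)

lemma X_space_cell:
  assumes h: "h \<in> X_space T (m n) n" and jk: "j < m n" "k \<in> cell_idx n"
  obtains c where "\<And>q. q \<in> cellset n j k \<Longrightarrow> h q = c"
  using h jk unfolding X_space_def constant_on_def cellset_def by blast

lemma X_spaceD:
  assumes n: "2 \<le> n" and h: "h \<in> X_space T (m n) n"
  obtains \<phi> where "\<And>q. q \<in> cyl T \<Longrightarrow> h q = \<phi> (proj n q)"
proof -
  have eq: "h q = h q'" if q: "q \<in> cyl T" "q' \<in> cyl T" "proj n q = proj n q'" for q q'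
  proof -
    obtain j k where jk: "j < m n" "k \<in> cell_idx n" "q \<in> cellset n j k" using cell_ex[OF n q(1)] .
    obtain j' k' where jk': "j' < m n" "k' \<in> cell_idx n" "q' \<in> cellset n j' k'" using cell_ex[OF n q(2)] .
    have e: "(real j * \<tau> n, grid_pt n k) = (real j' * \<tau> n, grid_pt n k')"
      using trans[OF trans[OF proj_cell[OF n jk(3), symmetric] q(3)] proj_cell[OF n jk'(3)]] .
    have "\<tau> n \<noteq> 0" using tau_pos[OF n] by simp
    then have "j = j'" using e by auto
    moreover have "k = k'" using e grid_pt_inj[OF n_pos[OF n]] by blast
    ultimately show ?thesis using X_space_cell[OF h jk(1,2)] jk(3) jk'(3) by metis
  qed
  show ?thesis
  \<comment> \<open>An arbitrary point over \<open>p\<close> represents the value on its cell;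
    \<open>eq\<close> makes the choice immaterial.\<close>
  proof (rule that[of "\<lambda>p. h (SOME q. q \<in> cyl T \<and> proj n q = p)"])
    fix q :: "real \<times> (real ^ 'd)" assume q: "q \<in> cyl T"
    then have "\<exists>q'. q' \<in> cyl T \<and> proj n q' = proj n q" by blast
    from someI_ex[OF this] show "h q = h (SOME q'. q' \<in> cyl T \<and> proj n q' = proj n q)"
      by (intro eq q) auto
  qed
qed

text \<open>Sampling a continuous approximation of \<open>f\<close> at the grid points gives
  elements of the discrete spaces. Working with the distance \<open>D n\<close> of \<open>f\<close>
  to the space avoids a diagonal choice of the approximation along \<open>n\<close>.\<close>

lemma X_dense:
  assumes f: "sq_int N f"
  obtains F where "\<And>n. 2 \<le> n \<Longrightarrow> F n \<in> X_space T (m n) n" "(\<lambda>n. l2 N (\<lambda>q. F n q - f q)) \<longlonglongrightarrow> 0"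
proof -
  define D where "D n = (INF F\<in>X_space T (m n) n. l2 N (\<lambda>q. F q - f q))" for n
  have bb: "bdd_below ((\<lambda>F. l2 N (\<lambda>q. F q - f q)) ` X_space T (m n) n)" for n
    by (rule bdd_belowI[of _ 0]) auto
  have zero: "(\<lambda>_::real \<times> (real ^ 'd). 0) \<in> X_space T (m n) n" if "2 \<le> n" for n
    by (rule X_spaceI[OF that, where h = "\<lambda>_. 0" and \<phi> = "\<lambda>_. 0"]) (auto intro: sq_int_const)
  have D0: "D \<longlonglongrightarrow> 0"
  proof (rule LIMSEQ_I)
    fix e :: real assume e: "0 < e"
    obtain g where g: "continuous_on UNIV g" "sq_int N g" "l2 N (\<lambda>q. f q - g q) < e / 2"
      using l2_dense_continuous[OF f, of "e/2"] e by auto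
    have gQ: "continuous_on Q g" using g(1) by (rule continuous_on_subset) simp
    define c where "c = l2 N (\<lambda>_. 1) + 1"
    have c: "0 < c" unfolding c_def by (rule add_nonneg_pos) auto
    define e1 where "e1 = e / (2 * c)"
    have e1: "0 < e1" using e c by (simp add: e1_def)
    have "eventually (\<lambda>n. (\<forall>q\<in>cyl T. \<bar>g (proj n q) - g q\<bar> < e1) \<and> 2 \<le> n) sequentially"
      by (intro eventually_conj comp_proj_uniform[where \<rho> = "\<lambda>n. n" and U = "\<lambda>_. g"] filterlim_ident gQ uniform_limit_const e1 eventually_ge_at_top)
    then obtain K where K: "\<And>n. K \<le> n \<Longrightarrow> (\<forall>q\<in>cyl T. \<bar>g (proj n q) - g q\<bar> < e1) \<and> 2 \<le> n"
      unfolding eventually_sequentially by blast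
    have "norm (D n - 0) < e" if "K \<le> n" for n
    proof -
      have n: "2 \<le> n" and close: "\<And>q. q \<in> cyl T \<Longrightarrow> \<bar>g (proj n q) - g q\<bar> < e1" using K[OF that] by auto
      have gm: "(g \<circ> proj n) \<in> borel_measurable N" by (rule comp_proj_measurable[OF n gQ])
      obtain R where R: "0 \<le> R" "\<And>p. p \<in> Q \<Longrightarrow> \<bar>g p\<bar> \<le> R" using bounded_continuous_closed_cyl[OF gQ] by blast
      have sq: "sq_int N (g \<circ> proj n)" by (rule sq_int_bounded[OF gm, of R]) (use R proj_in_Q[OF n] in auto)
      have X: "g \<circ> proj n \<in> X_space T (m n) n" by (rule X_spaceI[OF n sq, of g]) simp
      have "l2 N (\<lambda>q. (g \<circ> proj n) q - g q) \<le> l2 N (\<lambda>_. e1)"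
      proof (rule l2_mono[OF sq_int_const])
        show "(\<lambda>q. (g \<circ> proj n) q - g q) \<in> borel_measurable N" using gm sq_int_measurable[OF g(2)] by (rule borel_measurable_diff)
        show "AE q in N. \<bar>(g \<circ> proj n) q - g q\<bar> \<le> \<bar>e1\<bar>"
          by (rule AE_I2) (use close e1 in \<open>auto intro: less_imp_le\<close>)
      qed
      also have "\<dots> = e1 * (c - 1)" using e1 by (simp add: c_def l2_const)
      also have "\<dots> < e1 * c" using e1 by simp
      also have "\<dots> = e / 2" using c by (simp add: e1_def)
      finally have "l2 N (\<lambda>q. (g \<circ> proj n) q - f q) < e"
        using l2_triangle_diff[OF sq g(2) f] g(3) l2_commute[of N f g] by linarith
      moreover have "D n \<le> l2 N (\<lambda>q. (g \<circ> proj n) q - f q)"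
        unfolding D_def by (rule cINF_lower[OF bb X])
      moreover have "0 \<le> D n" unfolding D_def by (rule cINF_greatest) (use zero[OF n] in auto)
      ultimately show ?thesis by simp
    qed
    then show "\<exists>K. \<forall>n\<ge>K. norm (D n - 0) < e" by blast
  qed
  have "\<exists>F. F \<in> X_space T (m n) n \<and> l2 N (\<lambda>q. F q - f q) < D n + inverse (real (Suc n))" if n: "2 \<le> n" for n
    using cINF_less_iff[OF _ bb[of n], of "D n + inverse (real (Suc n))"] zero[OF n] by (auto simp: D_def)
  then obtain F where F: "\<And>n. 2 \<le> n \<Longrightarrow> F n \<in> X_space T (m n) n"
      "\<And>n. 2 \<le> n \<Longrightarrow> l2 N (\<lambda>q. F n q - f q) < D n + inverse (real (Suc n))"
    by metis
  have "(\<lambda>n. D n + inverse (real (Suc n))) \<longlonglongrightarrow> 0 + 0" by (intro tendsto_intros D0 LIMSEQ_inverse_real_of_nat)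
  then have l: "(\<lambda>n. D n + inverse (real (Suc n))) \<longlonglongrightarrow> 0" by simp
  have "(\<lambda>n. l2 N (\<lambda>q. F n q - f q)) \<longlonglongrightarrow> 0"
  proof (rule Lim_null_comparison[OF _ l])
    show "\<forall>\<^sub>F n in sequentially. norm (l2 N (\<lambda>q. F n q - f q)) \<le> D n + inverse (real (Suc n))"
      using eventually_ge_at_top[of 2] by eventually_elim (use F(2) less_imp_le in force)
  qed
  then show ?thesis using F(1) that by blast
qed

lemma top_in_Q: "(T, x0) \<in> Q"
  using T_pos x0 by (auto simp: mem_closed_cyl cube_def less_imp_le)

text \<open>The lowest mode is positive on the cube and contributes a norm \<open>c > 0\<close>. A
  finite set containing it has norm at least \<open>c\<close>, and the remaining tail can be made at
  most \<open>c / 2\<close>. This positivity is what allows division in the endpoint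
  correction.\<close>

lemma gk_norm_pos: "0 < l2 N (gk (T, x0))"
proof -
  define k1 where "k1 = (\<lambda>_::'d. 1::nat)"
  have k1: "k1 \<in> modes" by (simp add: k1_def modes_def)
  have T: "0 \<le> fst (T, x0)" "fst (T, x0) \<le> T" using T_pos by auto
  define c where "c = l2 N (gkS {k1} (T, x0))"
  have sq1: "sq_int N (gkS {k1} (T, x0))" by (rule gkS_l2(1)) (use k1 T in auto)
  have "c \<noteq> 0"
  proof
    assume "c = 0"
    then have "(\<integral>q. (gkS {k1} (T, x0) q)\<^sup>2 \<partial>N) = 0" using l2_sq[of N "gkS {k1} (T, x0)"] by (simp add: c_def)
    then have "AE q in N. (gkS {k1} (T, x0) q)\<^sup>2 = 0"
      using sq_int_integrable_sq[OF sq1] by (subst (asm) integral_nonneg_eq_0_iff_AE) auto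
    then have "AE q in lborel. q \<in> cyl T \<longrightarrow> gkS {k1} (T, x0) q = 0" by (simp add: AE_cylM)
    moreover have "gkS {k1} (T, x0) q \<noteq> 0" if q: "q \<in> cyl T" for q
    proof -
      have pos: "0 < eigfun k1 x" if "x \<in> cube" for x :: "real ^ 'd"
        unfolding eigfun_amp using that amp_bounds(1)[where 'd='d]
        by (intro mult_pos_pos prod_pos) (auto simp: k1_def cube_def intro: sin_gt_zero)
      have "snd q \<in> cube" "fst q < T" using q by (auto simp: cyl_def)
      then show ?thesis using pos[of "snd q"] pos[OF x0] by (simp add: gkS_def)
    qed
    ultimately have "AE q in lborel. q \<notin> (cyl T :: (real \<times> (real ^ 'd)) set)" by (auto elim: eventually_mono)
    then have "(cyl T :: (real \<times> (real ^ 'd)) set) \<in> null_sets lborel" by (subst AE_iff_null_sets) auto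
    then have neg: "negligible (cyl T :: (real \<times> (real ^ 'd)) set)"
      by (simp add: negligible_iff_null_sets null_sets_completionI)
    have "open (cyl T :: (real \<times> (real ^ 'd)) set)"
      unfolding cyl_def cube_eq_box by (intro open_Times open_box open_greaterThanLessThan)
    moreover have "(T / 2, x0) \<in> cyl T" using T_pos x0 by (simp add: mem_cyl)
    ultimately show False using open_not_negligible[of "cyl T :: (real \<times> (real ^ 'd)) set"] neg by blast
  qed
  moreover have "0 \<le> c" by (simp add: c_def)
  ultimately have c: "0 < c" by simp
  define e where "e = (c / 2)\<^sup>2"
  have e: "0 < e" "sqrt e = c / 2" using c by (auto simp: e_def)
  obtain F where F: "finite F" "F \<subseteq> (modes :: ('d \<Rightarrow> nat) set)" "\<And>S. finite S \<Longrightarrow> S \<subseteq> modes - F \<Longrightarrow> (\<Sum>k\<in>S. 1 / wt k) \<le> e"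
    using sum_inverse_wt_tail[OF dim e(1)] by auto
  let ?F = "insert k1 F"
  have F': "finite ?F" "?F \<subseteq> modes" using F k1 by auto
  have "l2 N (\<lambda>q. gk (T, x0) q - gkS ?F (T, x0) q) \<le> c / 2"
    using gk_tail(2)[OF dim T F', of e] F(3) e by auto
  moreover have "c \<le> l2 N (gkS ?F (T, x0))" unfolding c_def by (rule gkS_l2_mono[OF _ F' T]) simp
  moreover have "\<bar>l2 N (gk (T, x0)) - l2 N (gkS ?F (T, x0))\<bar> \<le> l2 N (\<lambda>q. gk (T, x0) q - gkS ?F (T, x0) q)"
    by (rule l2_diff_abs_le[OF gk_sq_int'[OF top_in_Q] gkS_l2(1)[OF F' T]])
  ultimately show ?thesis using c by linarith
qed

lemma Gd_converges_uniform:
  assumes f: "\<And>n. 2 \<le> n \<Longrightarrow> sq_int N (f n)" and g: "sq_int N g" and lim: "(\<lambda>n. l2 N (\<lambda>q. f n q - g q)) \<longlonglongrightarrow> 0"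
  shows "uniform_limit Q (\<lambda>n. Gd n (f n)) (Gk g) sequentially"
proof (rule uniform_limitI)
  fix e :: real assume e: "0 < e"
  then have e2: "0 < e / 2" by simp
  have ev1: "eventually (\<lambda>n. 2 \<le> n \<and> (\<forall>p\<in>Q. \<bar>Gd n g p - Gk g p\<bar> < e / 2)) sequentially"
    using Gd_uniform[of "\<lambda>n. n" "\<lambda>_. g" "l2 N g", OF filterlim_ident g order_refl e2] .
  have "(\<lambda>n. kb * l2 N (\<lambda>q. f n q - g q)) \<longlonglongrightarrow> kb * 0" by (intro tendsto_intros lim)
  then have ev2: "eventually (\<lambda>n. kb * l2 N (\<lambda>q. f n q - g q) < e / 2) sequentially"
    by (rule order_tendstoD(2)) (use e in simp)
  show "\<forall>\<^sub>F n in sequentially. \<forall>p\<in>Q. dist (Gd n (f n) p) (Gk g p) < e"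
    using ev1 ev2
  proof eventually_elim
    case (elim n)
    show ?case
    proof
      fix p assume p: "p \<in> Q"
      have "\<bar>Gd n (f n) p - Gd n g p\<bar> \<le> kb * l2 N (\<lambda>q. f n q - g q)"
        using elim by (intro Gd_diff_le p f g) auto
      moreover have "\<bar>Gd n g p - Gk g p\<bar> < e / 2" using elim p by blast
      ultimately show "dist (Gd n (f n) p) (Gk g p) < e" using elim unfolding dist_real_def by linarith
    qed
  qed
qed

lemma sigma_lower_bound:
  obtains s where "0 < s" "\<And>y. \<bar>y\<bar> \<le> R \<Longrightarrow> s \<le> \<bar>\<sigma> y\<bar>"
proof (cases "0 \<le> R")
  case True
  have "compact {-R..R}" "{-R..R} \<noteq> {}" "continuous_on {-R..R} (\<lambda>y. \<bar>\<sigma> y\<bar>)"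
    using True by (auto intro!: continuous_intros continuous_on_subset[OF sigma_cont])
  then obtain z where "\<And>y. y \<in> {-R..R} \<Longrightarrow> \<bar>\<sigma> z\<bar> \<le> \<bar>\<sigma> y\<bar>"
    using continuous_attains_inf by metis
  then have "\<bar>\<sigma> z\<bar> \<le> \<bar>\<sigma> y\<bar>" if "\<bar>y\<bar> \<le> R" for y
    using that by (simp add: abs_le_iff minus_le_iff)
  then show ?thesis by (intro that[of "\<bar>\<sigma> z\<bar>"]) (auto simp: sigma_nz)
next
  case False
  then show ?thesis by (intro that[of 1]) auto
qed

text \<open>Since \<open>\<sigma>\<close> has no zeros, the control can be recovered from the source \<open>f = b(u) + \<sigma>(u) h\<close>, on which the
  solution depends linearly.  The endpoint constraint is therefore met exactly by adding a small multiple of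
  one fixed source to the discretized one.\<close>

theorem recovery:
  assumes h: "sq_int N h" and y: "Uk h (T, x0) = y"
  obtains H where "(\<lambda>n. l2 N (H n)) \<longlonglongrightarrow> l2 N h"
    "eventually (\<lambda>n. 2 \<le> n \<and> H n \<in> X_space T (m n) n \<and> Ud n (H n) (T, x0) = y) sequentially"
proof -
  define u where "u = Uk h"
  have u: "is_skeleton_solution T b \<sigma> h u" unfolding u_def by (rule Upsilon_solution[OF h])
  have uc: "continuous_on Q u" and ue: "\<And>p. p \<in> Q \<Longrightarrow> u p = Gk (src u h) p" using u unfolding skeleton_iff by blast+
  define f where "f = src u h"
  have f: "sq_int N f" unfolding f_def by (rule continuous_src_sq_int[OF uc h])
  \<comment> \<open>The kernel at the endpoint represents the evaluation of \<open>Gk\<close> there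
    as an inner product; taken as a source it moves the endpoint by its own squared norm, which is
    positive.\<close>
  define g where "g = gk (T, x0)"
  have g: "sq_int N g" unfolding g_def by (rule gk_sq_int'[OF top_in_Q])
  obtain F where FX: "\<And>n. 2 \<le> n \<Longrightarrow> F n \<in> X_space T (m n) n" and Ff: "(\<lambda>n. l2 N (\<lambda>q. F n q - f q)) \<longlonglongrightarrow> 0"
    using X_dense[OF f] by blast
  obtain E where EX: "\<And>n. 2 \<le> n \<Longrightarrow> E n \<in> X_space T (m n) n" and Eg: "(\<lambda>n. l2 N (\<lambda>q. E n q - g q)) \<longlonglongrightarrow> 0"
    using X_dense[OF g] by blast
  have Fs: "sq_int N (F n)" and Es: "sq_int N (E n)" if "2 \<le> n" for n
    using FX[OF that] EX[OF that] X_space_sq_int by auto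
  define \<alpha> where "\<alpha> n = Gd n (E n) (T, x0)" for n
  define \<beta> where "\<beta> n = Gd n (F n) (T, x0)" for n
  have "(\<lambda>n. \<alpha> n) \<longlonglongrightarrow> Gk g (T, x0)" unfolding \<alpha>_def
    by (rule tendsto_uniform_limitI[OF Gd_converges_uniform[OF Es g Eg] top_in_Q])
  moreover have "Gk g (T, x0) = (l2 N g)\<^sup>2" unfolding l2_sq Gk_def g_def by (simp only: power2_eq_square)
  ultimately have \<alpha>: "\<alpha> \<longlonglongrightarrow> (l2 N g)\<^sup>2" by simp
  have gpos: "0 < (l2 N g)\<^sup>2" using gk_norm_pos by (simp add: g_def)
  have "(\<lambda>n. \<beta> n) \<longlonglongrightarrow> Gk f (T, x0)" unfolding \<beta>_def
    by (rule tendsto_uniform_limitI[OF Gd_converges_uniform[OF Fs f Ff] top_in_Q])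
  then have \<beta>: "\<beta> \<longlonglongrightarrow> y" using ue[OF top_in_Q] y by (simp add: f_def u_def)
  \<comment> \<open>Solves \<open>\<beta> n + cc n * \<alpha> n = y\<close>, the endpoint condition
    for the source \<open>F n + cc n * E n\<close>; it tends to zero because
    \<open>\<beta> n\<close> tends to \<open>y\<close>.\<close>
  define cc where "cc n = (y - \<beta> n) / \<alpha> n" for n
  have "(\<lambda>n. (y - \<beta> n) / \<alpha> n) \<longlonglongrightarrow> (y - y) / (l2 N g)\<^sup>2"
    using gpos by (intro tendsto_intros \<alpha> \<beta>) auto
  then have lam: "cc \<longlonglongrightarrow> 0" by (simp add: cc_def[abs_def])
  define f' where "f' n q = F n q + cc n * E n q" for n q
  have f': "sq_int N (f' n)" if "2 \<le> n" for n
    unfolding f'_def[abs_def] by (intro sq_int_add sq_int_cmult Fs Es that)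
  have f'f: "(\<lambda>n. l2 N (\<lambda>q. f' n q - f q)) \<longlonglongrightarrow> 0"
  proof (rule Lim_null_comparison)
    have "(\<lambda>n. l2 N (\<lambda>q. F n q - f q) + \<bar>cc n\<bar> * (l2 N (\<lambda>q. E n q - g q) + l2 N g)) \<longlonglongrightarrow> 0 + \<bar>0\<bar> * (0 + l2 N g)"
      by (intro tendsto_intros Ff lam Eg)
    then show "(\<lambda>n. l2 N (\<lambda>q. F n q - f q) + \<bar>cc n\<bar> * (l2 N (\<lambda>q. E n q - g q) + l2 N g)) \<longlonglongrightarrow> 0" by simp
    show "\<forall>\<^sub>F n in sequentially. norm (l2 N (\<lambda>q. f' n q - f q)) \<le> l2 N (\<lambda>q. F n q - f q) + \<bar>cc n\<bar> * (l2 N (\<lambda>q. E n q - g q) + l2 N g)"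
      using eventually_ge_at_top[of 2]
    proof eventually_elim
      case (elim n)
      have "l2 N (\<lambda>q. f' n q - f q) = l2 N (\<lambda>q. (F n q - f q) + cc n * E n q)"
        by (simp add: f'_def algebra_simps)
      also have "\<dots> \<le> l2 N (\<lambda>q. F n q - f q) + l2 N (\<lambda>q. cc n * E n q)"
        by (intro l2_triangle sq_int_diff sq_int_cmult Fs Es f elim)
      also have "l2 N (\<lambda>q. cc n * E n q) = \<bar>cc n\<bar> * l2 N (E n)" by (rule l2_cmult)
      also have "\<dots> \<le> \<bar>cc n\<bar> * (l2 N (\<lambda>q. E n q - g q) + l2 N g)"
        using l2_diff_abs_le[OF Es[OF elim] g] by (intro mult_left_mono) auto
      finally show ?case by simp
    qed
  qed
  define v where "v n = Gd n (f' n)" for n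
  have vc: "continuous_on Q (v n)" if "2 \<le> n" for n unfolding v_def by (rule Gd_continuous[OF that f'[OF that]])
  have "uniform_limit Q v (Gk f) sequentially" unfolding v_def[abs_def] by (rule Gd_converges_uniform[OF f' f f'f])
  then have vu: "uniform_limit Q v u sequentially"
    by (rule uniform_limit_cong'[THEN iffD1, rotated 2]) (use ue in \<open>auto simp: f_def\<close>)
  obtain R where R: "0 \<le> R" "\<And>p. p \<in> Q \<Longrightarrow> \<bar>u p\<bar> \<le> R" using bounded_continuous_closed_cyl[OF uc] by blast
  obtain s where s: "0 < s" "\<And>z. \<bar>z\<bar> \<le> R + 1 \<Longrightarrow> s \<le> \<bar>\<sigma> z\<bar>" using sigma_lower_bound by blast
  \<comment> \<open>The source relation solved for the control. Since
    \<open>v n = Gd n (f' n)\<close> and the sampled path \<open>v n\<close> with control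
    \<open>H n\<close> has again the source \<open>f' n\<close>, the path solves the discrete
    equation with this control.\<close>
  define H where "H n q = (f' n q - b (v n (proj n q))) / \<sigma> (v n (proj n q))" for n q
  have cancel: "\<sigma> z * ((a - c) / \<sigma> z) = a - c" for a c z using sigma_nz[of z] by simp
  have srcH: "src (v n \<circ> proj n) (H n) = f' n" for n
    by (simp add: src_def H_def fun_eq_iff cancel del: times_divide_eq_right)
  \<comment> \<open>Within distance 1 of \<open>u\<close> the sampled path stays in a fixed bounded
    interval, where \<open>\<sigma>\<close> is bounded away from zero.\<close>
  have ev_one: "eventually (\<lambda>n. 2 \<le> n \<and> (\<forall>q\<in>cyl T. \<bar>v n (proj n q) - u q\<bar> < 1)) sequentially"
    by (intro eventually_conj eventually_ge_at_top comp_proj_uniform[where \<rho> = "\<lambda>n. n"] filterlim_ident uc vu) simp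
  have sig: "s \<le> \<bar>\<sigma> (v n (proj n q))\<bar>" if "\<forall>q\<in>cyl T. \<bar>v n (proj n q) - u q\<bar> < 1" "q \<in> cyl T" for n q
  proof -
    have "\<bar>v n (proj n q) - u q\<bar> < 1" using that by blast
    moreover have "\<bar>u q\<bar> \<le> R" using R(2) that(2) cyl_subset_closed_cyl by blast
    ultimately show ?thesis by (intro s(2)) linarith
  qed
  have vm: "(\<lambda>q. v n (proj n q)) \<in> borel_measurable N" if "2 \<le> n" for n
    using comp_proj_measurable[OF that vc[OF that]] by (simp add: comp_def)
  have Hm: "H n \<in> borel_measurable N" if "2 \<le> n" for n
  proof -
    note [measurable] = vm[OF that] sq_int_measurable[OF f'[OF that]]
    show ?thesis unfolding H_def[abs_def] by measurable
  qed
  have Hdiff: "\<bar>H n q - h q\<bar> \<le> (1 / s) * (\<bar>f' n q - f q\<bar> + lip * (\<bar>v n (proj n q) - u q\<bar> * (1 + \<bar>h q\<bar>)))"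
    if "s \<le> \<bar>\<sigma> (v n (proj n q))\<bar>" for n q
  proof -
    \<comment> \<open>Comparing the sources at the same control \<open>h\<close> isolates the error
      of the path in the second bracket, where \<open>src\<close> is Lipschitz.\<close>
    have "\<sigma> (v n (proj n q)) * (H n q - h q) = (f' n q - f q) + (src u h q - src (v n \<circ> proj n) h q)"
    proof -
      have "\<sigma> (v n (proj n q)) * H n q = f' n q - b (v n (proj n q))" unfolding H_def by (rule cancel)
      then show ?thesis by (simp add: f_def src_def right_diff_distrib)
    qed
    then have "\<bar>\<sigma> (v n (proj n q))\<bar> * \<bar>H n q - h q\<bar> \<le> \<bar>f' n q - f q\<bar> + \<bar>src u h q - src (v n \<circ> proj n) h q\<bar>"
      unfolding abs_mult[symmetric] using abs_triangle_ineq by simp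
    also have "\<dots> \<le> \<bar>f' n q - f q\<bar> + lip * (\<bar>v n (proj n q) - u q\<bar> * (1 + \<bar>h q\<bar>))"
      using src_lipschitz[of u h q "v n \<circ> proj n"] by (simp add: abs_minus_commute)
    finally have "s * \<bar>H n q - h q\<bar> \<le> \<bar>f' n q - f q\<bar> + lip * (\<bar>v n (proj n q) - u q\<bar> * (1 + \<bar>h q\<bar>))"
      using mult_right_mono[OF that, of "\<bar>H n q - h q\<bar>"] by simp
    then show ?thesis using s(1) by (simp add: field_simps)
  qed
  have bd_sq: "sq_int N (\<lambda>q. (1 / s) * (\<bar>f' n q - f q\<bar> + (lip * e) * (1 + \<bar>h q\<bar>)))" if "2 \<le> n" for n e
    by (intro sq_int_cmult sq_int_add sq_int_abs sq_int_diff f' f that sq_int_const h)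
  have Hclose: "sq_int N (\<lambda>q. H n q - h q) \<and> l2 N (\<lambda>q. H n q - h q) \<le> (1 / s) * (l2 N (\<lambda>q. f' n q - f q) + (lip * e) * (l2 N (\<lambda>_. 1) + l2 N h))"
    if n: "2 \<le> n" and one: "\<forall>q\<in>cyl T. \<bar>v n (proj n q) - u q\<bar> < 1" and ee: "\<forall>q\<in>cyl T. \<bar>v n (proj n q) - u q\<bar> < e" and e: "0 < e" for n e
  proof -
    let ?G = "\<lambda>q. (1 / s) * (\<bar>f' n q - f q\<bar> + (lip * e) * (1 + \<bar>h q\<bar>))"
    have ae: "AE q in N. \<bar>H n q - h q\<bar> \<le> \<bar>?G q\<bar>"
    proof (rule AE_I2)
      fix q assume "q \<in> space N"
      then have q: "q \<in> cyl T" by simp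
      have "\<bar>v n (proj n q) - u q\<bar> \<le> e" using ee q by (auto intro: less_imp_le)
      then have "lip * (\<bar>v n (proj n q) - u q\<bar> * (1 + \<bar>h q\<bar>)) \<le> lip * (e * (1 + \<bar>h q\<bar>))"
        using lip(1) by (intro mult_left_mono mult_right_mono) auto
      then have "(1 / s) * (\<bar>f' n q - f q\<bar> + lip * (\<bar>v n (proj n q) - u q\<bar> * (1 + \<bar>h q\<bar>))) \<le> ?G q"
        using s(1) by (intro mult_left_mono add_left_mono) (auto simp: mult.assoc)
      then show "\<bar>H n q - h q\<bar> \<le> \<bar>?G q\<bar>" using Hdiff[OF sig[OF one q]] by linarith
    qed
    have m: "(\<lambda>q. H n q - h q) \<in> borel_measurable N" by (rule borel_measurable_diff[OF Hm[OF n] sq_int_measurable[OF h]])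
    have "l2 N (\<lambda>q. H n q - h q) \<le> l2 N ?G" by (rule l2_mono[OF bd_sq[OF n] m ae])
    also have "\<dots> = (1 / s) * l2 N (\<lambda>q. \<bar>f' n q - f q\<bar> + (lip * e) * (1 + \<bar>h q\<bar>))"
      using s(1) by (subst l2_cmult) auto
    also have "\<dots> \<le> (1 / s) * (l2 N (\<lambda>q. \<bar>f' n q - f q\<bar>) + l2 N (\<lambda>q. (lip * e) * (1 + \<bar>h q\<bar>)))"
      using s(1) by (intro mult_left_mono l2_triangle sq_int_cmult sq_int_add sq_int_abs sq_int_diff f' f n sq_int_const h) auto
    also have "l2 N (\<lambda>q. \<bar>f' n q - f q\<bar>) = l2 N (\<lambda>q. f' n q - f q)" by (simp add: l2_def)
    also have "l2 N (\<lambda>q. (lip * e) * (1 + \<bar>h q\<bar>)) = (lip * e) * l2 N (\<lambda>q. 1 + \<bar>h q\<bar>)"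
      using lip(1) e by (subst l2_cmult) auto
    also have "\<dots> \<le> (lip * e) * (l2 N (\<lambda>_. 1) + l2 N h)"
      using lip(1) e one_plus_abs_l2[OF h] by (intro mult_left_mono) auto
    finally have "l2 N (\<lambda>q. H n q - h q) \<le> (1 / s) * (l2 N (\<lambda>q. f' n q - f q) + (lip * e) * (l2 N (\<lambda>_. 1) + l2 N h))"
      using s(1) by (simp add: mult_left_mono divide_right_mono)
    then show ?thesis using sq_int_bound[OF bd_sq[OF n] m ae] by simp
  qed
  have Hsq: "sq_int N (H n)" if n: "2 \<le> n" and one: "\<forall>q\<in>cyl T. \<bar>v n (proj n q) - u q\<bar> < 1" for n
  proof -
    have "sq_int N (\<lambda>q. (H n q - h q) + h q)" using Hclose[OF n one one] by (intro sq_int_add h) auto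
    then show ?thesis by simp
  qed
  have Hlim: "(\<lambda>n. l2 N (H n)) \<longlonglongrightarrow> l2 N h"
  proof (rule LIMSEQ_I)
    fix e :: real assume e: "0 < e"
    define c where "c = (1 / s) * (lip * (l2 N (\<lambda>_. 1) + l2 N h)) + 1"
    have c: "0 < c" unfolding c_def using s(1) lip(1) by (intro add_nonneg_pos mult_nonneg_nonneg add_nonneg_nonneg) auto
    define e1 where "e1 = e / (2 * c)"
    have e1: "0 < e1" using e c by (simp add: e1_def)
    have "(\<lambda>n. (1 / s) * l2 N (\<lambda>q. f' n q - f q)) \<longlonglongrightarrow> (1 / s) * 0" by (intro tendsto_intros f'f)
    then have "eventually (\<lambda>n. (1 / s) * l2 N (\<lambda>q. f' n q - f q) < e / 2) sequentially"
      by (rule order_tendstoD(2)) (use e in simp)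
    then have "eventually (\<lambda>n. norm (l2 N (H n) - l2 N h) < e) sequentially"
      using ev_one comp_proj_uniform[where \<rho> = "\<lambda>n. n", OF filterlim_ident uc vu e1]
    proof eventually_elim
      case (elim n)
      have n: "2 \<le> n" and one: "\<forall>q\<in>cyl T. \<bar>v n (proj n q) - u q\<bar> < 1" using elim by auto
      have "\<bar>l2 N (H n) - l2 N h\<bar> \<le> l2 N (\<lambda>q. H n q - h q)" by (rule l2_diff_abs_le[OF Hsq[OF n one] h])
      also have "\<dots> \<le> (1 / s) * (l2 N (\<lambda>q. f' n q - f q) + (lip * e1) * (l2 N (\<lambda>_. 1) + l2 N h))"
        using Hclose[OF n one elim(3) e1] by simp
      also have "\<dots> = (1 / s) * l2 N (\<lambda>q. f' n q - f q) + e1 * (c - 1)" by (simp add: c_def algebra_simps)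
      also have "\<dots> < e / 2 + e1 * c" using elim(1) e1 by (intro add_strict_mono) auto
      also have "\<dots> = e" using c by (simp add: e1_def)
      finally show ?case by simp
    qed
    then show "\<exists>K. \<forall>n\<ge>K. norm (l2 N (H n) - l2 N h) < e" by (simp add: eventually_sequentially)
  qed
  have "eventually (\<lambda>n. \<alpha> n \<noteq> 0) sequentially"
    using order_tendstoD(1)[OF \<alpha> gpos] by eventually_elim simp
  then have feas: "eventually (\<lambda>n. 2 \<le> n \<and> H n \<in> X_space T (m n) n \<and> Ud n (H n) (T, x0) = y) sequentially"
    using ev_one
  proof eventually_elim
    case (elim n)
    have n: "2 \<le> n" and one: "\<forall>q\<in>cyl T. \<bar>v n (proj n q) - u q\<bar> < 1" using elim by auto
    have sq: "sq_int N (H n)" by (rule Hsq[OF n one])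
    obtain \<phi>1 where p1: "\<And>q. q \<in> cyl T \<Longrightarrow> F n q = \<phi>1 (proj n q)" using X_spaceD[OF n FX[OF n]] by blast
    obtain \<phi>2 where p2: "\<And>q. q \<in> cyl T \<Longrightarrow> E n q = \<phi>2 (proj n q)" using X_spaceD[OF n EX[OF n]] by blast
    have HX: "H n \<in> X_space T (m n) n"
      by (rule X_spaceI[OF n sq, of "\<lambda>p. (\<phi>1 p + cc n * \<phi>2 p - b (v n p)) / \<sigma> (v n p)"])
         (simp add: H_def f'_def p1 p2)
    have sol: "is_disc_skeleton_solution T b \<sigma> (m n) n (H n) (v n)"
      unfolding disc_skeleton_iff srcH using vc[OF n] by (simp add: v_def)
    have "Ud n (H n) (T, x0) = v n (T, x0)" by (rule Upsilon_disc_eq[OF n sq sol top_in_Q])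
    also have "\<dots> = \<beta> n + cc n * \<alpha> n"
    proof -
      note i = sq_int_prod[OF kd_sq_int[OF n top_in_Q] Fs[OF n]] sq_int_prod[OF kd_sq_int[OF n top_in_Q] Es[OF n]]
      have "v n (T, x0) = (\<integral>q. kd n (T, x0) q * F n q + cc n * (kd n (T, x0) q * E n q) \<partial>N)"
        unfolding v_def Gd_def f'_def by (intro Bochner_Integration.integral_cong) (auto simp: algebra_simps)
      then show ?thesis using i by (simp add: \<alpha>_def \<beta>_def Gd_def)
    qed
    also have "\<dots> = y" using elim(1) by (simp add: cc_def)
    finally show ?case using n HX by simp
  qed
  show ?thesis by (rule that[OF Hlim feas])
qed

end

section \<open>Convergence of the rate functions and of minimizers\<close>

context spde begin

lemma rate_disc_lower:
  assumes "h \<in> X_space T (m n) n" "Ud n h (T, x0) = y"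
  shows "rate_disc T b \<sigma> (m n) n x0 y \<le> ereal (energy T h)"
  unfolding rate_disc_def by (rule Inf_lower) (use assms in blast)

lemma rate_lower:
  assumes "sq_int N h" "Uk h (T, x0) = y"
  shows "rate T b \<sigma> x0 y \<le> ereal (energy T h)"
  unfolding rate_def by (rule Inf_lower) (use assms L2_cyl_iff in blast)

lemma energy_nonneg: "0 \<le> energy T h" by (simp add: energy_def)

lemma rate_nonneg: "0 \<le> rate T b \<sigma> x0 y"
  unfolding rate_def by (rule Inf_greatest) (auto simp: energy_nonneg)

lemma Uk_continuous: "sq_int N h \<Longrightarrow> continuous_on Q (Uk h)"
  using Upsilon_solution[of h] unfolding skeleton_iff by blast

text \<open>Joins \<open>compactness\<close> with \<open>variational_limit\<close>; the endpoint
  condition survives by uniform convergence. The same statement serves the lower bound for the rates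
  and the convergence of minimizers.\<close>

lemma near_minimizers:
  assumes \<rho>: "filterlim \<rho> at_top sequentially" "\<And>k. 2 \<le> \<rho> k"
    and h: "\<And>k. h k \<in> X_space T (m (\<rho> k)) (\<rho> k)" "\<And>k. Ud (\<rho> k) (h k) (T, x0) = y"
    and B: "\<And>k. l2 N (h k) \<le> B"
  obtains r g where "strict_mono (r :: nat \<Rightarrow> nat)" "sq_int N g" "Uk g (T, x0) = y"
    "uniform_limit Q (\<lambda>k. Ud (\<rho> (r k)) (h (r k))) (Uk g) sequentially"
    "\<And>e. 0 < e \<Longrightarrow> \<exists>K. \<forall>k\<ge>K. l2 N g - e < l2 N (h (r k))"
    "(\<lambda>k. l2 N (h (r k))) \<longlonglongrightarrow> l2 N g \<Longrightarrow> (\<lambda>k. l2 N (\<lambda>q. h (r k) q - g q)) \<longlonglongrightarrow> 0"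
proof -
  have hs: "sq_int N (h k)" for k by (rule X_space_sq_int[OF h(1)])
  obtain r u where r: "strict_mono (r :: nat \<Rightarrow> nat)" and u: "continuous_on Q u"
    and lim: "uniform_limit Q (\<lambda>k. Ud (\<rho> (r k)) (h (r k))) u sequentially"
    and res: "\<And>e. 0 < e \<Longrightarrow> \<exists>K. \<forall>k\<ge>K. \<forall>p\<in>Q. \<bar>u p - Gk (src u (h (r k))) p\<bar> \<le> e"
  proof (rule compactness[OF \<rho> hs B])
    fix r :: "nat \<Rightarrow> nat" and u
    assume 1: "strict_mono r" and 2: "continuous_on Q u"
      and 3: "uniform_limit Q (\<lambda>k. Ud (\<rho> (r k)) (h (r k))) u sequentially"
      and 4: "\<And>e. 0 < e \<Longrightarrow> \<exists>K. \<forall>k\<ge>K. \<forall>p\<in>Q. \<bar>u p - Gk (src u (h (r k))) p\<bar> \<le> e"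
    show thesis by (rule that[OF 1 2 3 4])
  qed
  obtain g where g: "sq_int N g" "is_skeleton_solution T b \<sigma> g u"
    and low: "\<And>e. 0 < e \<Longrightarrow> \<exists>K. \<forall>k\<ge>K. l2 N g - e < l2 N (h (r k))"
    and strong: "(\<lambda>k. l2 N (h (r k))) \<longlonglongrightarrow> l2 N g \<Longrightarrow> (\<lambda>k. l2 N (\<lambda>q. h (r k) q - g q)) \<longlonglongrightarrow> 0"
  proof (rule variational_limit[OF u hs B res])
    fix g assume 1: "sq_int N g" and 2: "is_skeleton_solution T b \<sigma> g u"
      and 3: "\<And>e. 0 < e \<Longrightarrow> \<exists>K. \<forall>k\<ge>K. l2 N g - e < l2 N (h (r k))"
      and 4: "(\<lambda>k. l2 N (h (r k))) \<longlonglongrightarrow> l2 N g \<Longrightarrow> (\<lambda>k. l2 N (\<lambda>q. h (r k) q - g q)) \<longlonglongrightarrow> 0"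
    show thesis by (rule that[OF 1 2 3 4])
  qed
  have eq: "Uk g p = u p" if "p \<in> Q" for p by (rule Upsilon_eq[OF g that])
  have "(\<lambda>k. Ud (\<rho> (r k)) (h (r k)) (T, x0)) \<longlonglongrightarrow> u (T, x0)"
    by (rule tendsto_uniform_limitI[OF lim top_in_Q])
  then have "u (T, x0) = y" by (simp add: h(2) tendsto_const_iff)
  then have y: "Uk g (T, x0) = y" using eq[OF top_in_Q] by simp
  have ul: "uniform_limit Q (\<lambda>k. Ud (\<rho> (r k)) (h (r k))) (Uk g) sequentially"
    by (rule uniform_limit_cong'[THEN iffD1, OF _ _ lim]) (use eq in auto)
  show ?thesis by (rule that[OF r g(1) y ul low strong])
qed

lemma l2_le_of_eventually_lower:
  assumes low: "\<And>e. 0 < e \<Longrightarrow> \<exists>K. \<forall>k\<ge>K. G - e < a (k::nat)" and le: "\<And>k. a k \<le> (c::real)"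
  shows "G \<le> c"
proof (rule field_le_epsilon)
  fix e :: real assume "0 < e"
  then obtain K where "\<forall>k\<ge>K. G - e < a k" using low by blast
  then have "G - e < a K" by blast
  then show "G \<le> c + e" using le[of K] by linarith
qed

text \<open>The order form of the limit treats finite and infinite rates together: the upper
  estimate comes from a recovery sequence, the lower one from the compactness of controls with
  bounded energy.\<close>

theorem rate_converges: "(\<lambda>n. rate_disc T b \<sigma> (m n) n x0 y) \<longlonglongrightarrow> rate T b \<sigma> x0 y"
proof (rule order_tendstoI)
  fix a assume "rate T b \<sigma> x0 y < a"
  then obtain h where h: "sq_int N h" "Uk h (T, x0) = y" "ereal (energy T h) < a"
    unfolding rate_def Inf_less_iff L2_cyl_iff by blast
  obtain H where lim: "(\<lambda>n. l2 N (H n)) \<longlonglongrightarrow> l2 N h"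
    and ev: "eventually (\<lambda>n. 2 \<le> n \<and> H n \<in> X_space T (m n) n \<and> Ud n (H n) (T, x0) = y) sequentially"
    using recovery[OF h(1,2)] by blast
  have "(\<lambda>n. ereal (energy T (H n))) \<longlonglongrightarrow> ereal (energy T h)"
    unfolding energy_eq by (intro tendsto_intros lim) simp
  then have "eventually (\<lambda>n. ereal (energy T (H n)) < a) sequentially" by (rule order_tendstoD(2)[OF _ h(3)])
  then show "\<forall>\<^sub>F n in sequentially. rate_disc T b \<sigma> (m n) n x0 y < a"
    using ev by eventually_elim (use rate_disc_lower le_less_trans in blast)
next
  fix a assume a: "a < rate T b \<sigma> x0 y"
  show "\<forall>\<^sub>F n in sequentially. a < rate_disc T b \<sigma> (m n) n x0 y"
  proof (rule ccontr)
    assume "\<not> ?thesis"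
    then have ex: "\<exists>n\<ge>K. rate_disc T b \<sigma> (m n) n x0 y \<le> a" for K
      unfolding eventually_sequentially by (metis not_le)
    \<comment> \<open>A real \<open>c\<close> strictly in between exists even if the rate is
      infinite; it bounds the energies, hence the norms, of the offending controls.\<close>
    obtain c where c: "a < ereal c" "ereal c < rate T b \<sigma> x0 y" using ereal_dense2[OF a] by blast
    have "\<exists>n h. max 2 k \<le> n \<and> h \<in> X_space T (m n) n \<and> Ud n h (T, x0) = y \<and> energy T h < c" for k
    proof -
      obtain n where n: "max 2 k \<le> n" "rate_disc T b \<sigma> (m n) n x0 y < ereal c"
        using ex[of "max 2 k"] c(1) le_less_trans by blast
      then obtain h where "h \<in> X_space T (m n) n" "Ud n h (T, x0) = y" "ereal (energy T h) < ereal c"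
        unfolding rate_disc_def Inf_less_iff by blast
      then show ?thesis using n by auto
    qed
    then obtain \<rho> h where \<rho>: "\<And>k. max 2 k \<le> \<rho> k" and h: "\<And>k. h k \<in> X_space T (m (\<rho> k)) (\<rho> k)"
      "\<And>k. Ud (\<rho> k) (h k) (T, x0) = y" and en: "\<And>k. energy T (h k) < c" by metis
    have \<rho>2: "2 \<le> \<rho> k" for k using \<rho>[of k] by simp
    have \<rho>lim: "filterlim \<rho> at_top sequentially"
      by (rule filterlim_at_top_mono[OF filterlim_ident]) (use \<rho> in auto)
    have B: "l2 N (h k) \<le> sqrt (2 * c)" for k
      using en[of k] by (intro real_le_rsqrt) (simp add: energy_eq)
    obtain r :: "nat \<Rightarrow> nat" and g where g: "sq_int N g" "Uk g (T, x0) = y"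
      and low: "\<And>e. 0 < e \<Longrightarrow> \<exists>K. \<forall>k\<ge>K. l2 N g - e < l2 N (h (r k))"
      proof (rule near_minimizers[OF \<rho>lim \<rho>2 h B])
      fix r :: "nat \<Rightarrow> nat" and g assume 1: "sq_int N g" and 2: "Uk g (T, x0) = y"
        and 3: "\<And>e. 0 < e \<Longrightarrow> \<exists>K. \<forall>k\<ge>K. l2 N g - e < l2 N (h (r k))"
      show thesis by (rule that[OF 1 2 3])
    qed
    have "l2 N g \<le> sqrt (2 * c)" by (rule l2_le_of_eventually_lower[OF low B])
    then have "(l2 N g)\<^sup>2 \<le> (sqrt (2 * c))\<^sup>2" by (intro power_mono) auto
    moreover have "0 \<le> c" using en[of 0] energy_nonneg[of "h 0"] by linarith
    ultimately have "energy T g \<le> c" by (simp add: energy_eq)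
    then have "rate T b \<sigma> x0 y \<le> ereal c" using rate_lower[OF g] by (meson ereal_less_eq(3) order_trans)
    then show False using c(2) by simp
  qed
qed

text \<open>The energies are squeezed between the discrete rates and the discrete rates plus
  \<open>\<epsilon>\<close>, so the norms converge. The limit control has no larger energy and is
  admissible, so its norm is exactly the limit, and norm convergence of the controls
  follows.\<close>

theorem minimizers_converge:
  assumes \<rho>: "filterlim \<rho> at_top sequentially" "\<And>k. 2 \<le> \<rho> k"
    and fin: "rate T b \<sigma> x0 y < \<infinity>"
    and h: "\<And>k. h k \<in> X_space T (m (\<rho> k)) (\<rho> k)" "\<And>k. Ud (\<rho> k) (h k) (T, x0) = y"
    and e: "\<epsilon> \<longlonglongrightarrow> 0"
    and near: "\<And>k. ereal (energy T (h k)) \<le> rate_disc T b \<sigma> (m (\<rho> k)) (\<rho> k) x0 y + ereal (\<epsilon> k)"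
  obtains r g where "strict_mono (r :: nat \<Rightarrow> nat)" "sq_int N g"
    "(\<lambda>k. l2 N (\<lambda>q. h (r k) q - g q)) \<longlonglongrightarrow> 0"
    "uniform_limit Q (\<lambda>k. Ud (\<rho> (r k)) (h (r k))) (Uk g) sequentially"
    "Uk g (T, x0) = y" "ereal (energy T g) = rate T b \<sigma> x0 y"
proof -
  obtain c where c: "rate T b \<sigma> x0 y = ereal c" "0 \<le> c"
    using fin rate_nonneg[of y] by (cases "rate T b \<sigma> x0 y") auto
  have rl: "(\<lambda>k. rate_disc T b \<sigma> (m (\<rho> k)) (\<rho> k) x0 y) \<longlonglongrightarrow> ereal c"
    using filterlim_compose[OF rate_converges[of y] \<rho>(1)] unfolding c(1) .
  have "(\<lambda>k. ereal (energy T (h k))) \<longlonglongrightarrow> ereal c"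
  proof (rule tendsto_sandwich[OF _ _ rl])
    show "(\<lambda>k. rate_disc T b \<sigma> (m (\<rho> k)) (\<rho> k) x0 y + ereal (\<epsilon> k)) \<longlonglongrightarrow> ereal c"
      using tendsto_add_ereal[OF _ _ rl, of "ereal 0" "\<lambda>k. ereal (\<epsilon> k)"] e by simp
  qed (use rate_disc_lower[OF h] near in auto)
  then have en: "(\<lambda>k. energy T (h k)) \<longlonglongrightarrow> c" by simp
  have "(\<lambda>k. sqrt (2 * energy T (h k))) \<longlonglongrightarrow> sqrt (2 * c)" by (intro tendsto_intros en)
  then have ln: "(\<lambda>k. l2 N (h k)) \<longlonglongrightarrow> sqrt (2 * c)" by (simp add: energy_eq)
  obtain B where B: "\<And>k. l2 N (h k) \<le> B"
    using Bseq_conv_Bfun convergent_imp_Bseq[OF convergentI[OF ln]] unfolding Bseq_def by force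
  obtain r g where r: "strict_mono (r :: nat \<Rightarrow> nat)" and g: "sq_int N g" "Uk g (T, x0) = y"
    and ul: "uniform_limit Q (\<lambda>k. Ud (\<rho> (r k)) (h (r k))) (Uk g) sequentially"
    and low: "\<And>e. 0 < e \<Longrightarrow> \<exists>K. \<forall>k\<ge>K. l2 N g - e < l2 N (h (r k))"
    and strong: "(\<lambda>k. l2 N (h (r k))) \<longlonglongrightarrow> l2 N g \<Longrightarrow> (\<lambda>k. l2 N (\<lambda>q. h (r k) q - g q)) \<longlonglongrightarrow> 0"
  proof (rule near_minimizers[OF \<rho> h B])
    fix r :: "nat \<Rightarrow> nat" and g assume 1: "strict_mono r" and 2: "sq_int N g" and 3: "Uk g (T, x0) = y"
      and 4: "uniform_limit Q (\<lambda>k. Ud (\<rho> (r k)) (h (r k))) (Uk g) sequentially"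
      and 5: "\<And>e. 0 < e \<Longrightarrow> \<exists>K. \<forall>k\<ge>K. l2 N g - e < l2 N (h (r k))"
      and 6: "(\<lambda>k. l2 N (h (r k))) \<longlonglongrightarrow> l2 N g \<Longrightarrow> (\<lambda>k. l2 N (\<lambda>q. h (r k) q - g q)) \<longlonglongrightarrow> 0"
    show thesis by (rule that[OF 1 2 3 4 5 6])
  qed
  have lr: "(\<lambda>k. l2 N (h (r k))) \<longlonglongrightarrow> sqrt (2 * c)" using LIMSEQ_subseq_LIMSEQ[OF ln r] by (simp add: o_def)
  have "l2 N g \<le> sqrt (2 * c)"
  proof (rule field_le_epsilon)
    fix e :: real assume "0 < e"
    then have e2: "0 < e / 2" by simp
    have "eventually (\<lambda>k. l2 N (h (r k)) < sqrt (2 * c) + e / 2) sequentially"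
      by (rule order_tendstoD(2)[OF lr]) (use e2 in simp)
    then obtain K1 where K1: "\<And>k. K1 \<le> k \<Longrightarrow> l2 N (h (r k)) < sqrt (2 * c) + e / 2" by (auto simp: eventually_sequentially)
    obtain K2 where K2: "\<forall>k\<ge>K2. l2 N g - e / 2 < l2 N (h (r k))" using low[OF e2] by blast
    have "l2 N g - e / 2 < l2 N (h (r (max K1 K2)))" using K2 by simp
    then show "l2 N g \<le> sqrt (2 * c) + e" using K1[of "max K1 K2"] by simp
  qed
  then have "(l2 N g)\<^sup>2 \<le> (sqrt (2 * c))\<^sup>2" by (intro power_mono) auto
  then have "energy T g \<le> c" using c by (simp add: energy_eq)
  moreover have "c \<le> energy T g" using rate_lower[OF g] c by simp
  ultimately have eg: "energy T g = c" by simp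
  then have "l2 N g = sqrt (2 * c)" using real_sqrt_unique[of "l2 N g" "2 * c"] by (simp add: energy_eq)
  then have "(\<lambda>k. l2 N (\<lambda>q. h (r k) q - g q)) \<longlonglongrightarrow> 0" using strong lr by simp
  then show ?thesis using that[OF r g(1) _ ul g(2)] eg c by simp
qed

text \<open>Uniqueness of the minimizer is a statement up to null sets, whereas the solution map
  takes functions. The integrals in the equation agree, so the solution for one control solves the
  equation for the other.\<close>

lemma Upsilon_AE_cong:
  assumes g: "sq_int N g" "sq_int N h" and ae: "AE q in N. g q = h q" and p: "p \<in> Q"
  shows "Uk g p = Uk h p"
proof -
  have u: "is_skeleton_solution T b \<sigma> h (Uk h)" by (rule Upsilon_solution[OF g(2)])
  have "Gk (src (Uk h) g) p = Gk (src (Uk h) h) p" if p: "p \<in> Q" for p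
    unfolding Gk_def
  proof (rule integral_cong_AE)
    show "(\<lambda>q. gk p q * src (Uk h) g q) \<in> borel_measurable N" "(\<lambda>q. gk p q * src (Uk h) h q) \<in> borel_measurable N"
      by (intro borel_measurable_times sq_int_measurable[OF gk_sq_int'[OF p]] src_measurable measurable_cylM_continuous Uk_continuous g)+
    show "AE q in N. gk p q * src (Uk h) g q = gk p q * src (Uk h) h q"
      using ae by eventually_elim (simp add: src_def)
  qed
  then have "is_skeleton_solution T b \<sigma> g (Uk h)" using u unfolding skeleton_iff by metis
  then show ?thesis by (rule Upsilon_eq[OF g(1) _ p])
qed

text \<open>Every control that produces a path \<open>f\<close> with endpoint \<open>y\<close>
  competes in the definition of the rate, so no path can cost less than the rate.\<close>

lemma path_cost_minimal:
  assumes g: "sq_int N g" "Uk g (T, x0) = y" "ereal (energy T g) = rate T b \<sigma> x0 y"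
  shows "path_cost T b \<sigma> x0 y (Uk g) \<le> path_cost T b \<sigma> x0 y f"
proof -
  have "path_cost T b \<sigma> x0 y (Uk g) \<le> ereal (energy T g)"
    unfolding path_cost_def by (rule Inf_lower) (use g in \<open>auto simp: L2_cyl_iff intro!: exI[of _ g]\<close>)
  also have "\<dots> \<le> path_cost T b \<sigma> x0 y f"
    unfolding path_cost_def
  proof (rule Inf_greatest)
    fix z assume "z \<in> {ereal (energy T h) |h. h \<in> L2_cyl T \<and> (\<forall>p\<in>closed_cyl T. Uk h p = f p) \<and> f (T, x0) = y}"
    then obtain h where h: "z = ereal (energy T h)" "sq_int N h" "\<forall>p\<in>Q. Uk h p = f p" "f (T, x0) = y"
      by (auto simp: L2_cyl_iff)
    then show "ereal (energy T g) \<le> z" using rate_lower[OF h(2)] top_in_Q g(3) by auto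
  qed
  finally show ?thesis .
qed

text \<open>For the full sequence: if convergence to \<open>g\<close> failed along some indices,
  these would have a further subsequence converging to a minimizer, which by uniqueness is
  \<open>g\<close> almost everywhere and has the same path.\<close>

theorem minimizing_sequence:
  assumes fin: "rate T b \<sigma> x0 y < \<infinity>"
    and e: "\<epsilon> \<longlonglongrightarrow> 0"
    and h: "\<And>n. 2 \<le> n \<Longrightarrow> h n \<in> X_space T (m n) n" "\<And>n. 2 \<le> n \<Longrightarrow> Ud n (h n) (T, x0) = y"
      "\<And>n. 2 \<le> n \<Longrightarrow> ereal (energy T (h n)) \<le> rate_disc T b \<sigma> (m n) n x0 y + ereal (\<epsilon> n)"
  shows "\<exists>r hs.
           strict_mono r \<and> (\<forall>k. 2 \<le> r k) \<and> hs \<in> L2_cyl T \<and>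
           (\<lambda>k. L2_norm_cyl T (\<lambda>p. h (r k) p - hs p)) \<longlonglongrightarrow> 0 \<and>
           uniform_limit Q (\<lambda>k. Ud (r k) (h (r k))) (Uk hs) sequentially \<and>
           Uk hs (T, x0) = y \<and>
           ereal (energy T hs) = rate T b \<sigma> x0 y \<and>
           is_rate_minimizer T b \<sigma> x0 y hs \<and>
           continuous_on Q (Uk hs) \<and>
           (\<forall>f. continuous_on Q f \<longrightarrow> path_cost T b \<sigma> x0 y (Uk hs) \<le> path_cost T b \<sigma> x0 y f) \<and>
           ((\<forall>h1 h2. is_rate_minimizer T b \<sigma> x0 y h1 \<and> is_rate_minimizer T b \<sigma> x0 y h2 \<longrightarrow>
                (AE p in lborel. p \<in> cyl T \<longrightarrow> h1 p = h2 p)) \<longrightarrow>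
            (\<lambda>n. L2_norm_cyl T (\<lambda>p. h n p - hs p)) \<longlonglongrightarrow> 0 \<and>
            uniform_limit Q (\<lambda>n. Ud n (h n)) (Uk hs) sequentially)"
proof -
  have sub: "\<exists>r g. strict_mono (r :: nat \<Rightarrow> nat) \<and> sq_int N g \<and> (\<lambda>k. l2 N (\<lambda>q. h (\<rho> (r k)) q - g q)) \<longlonglongrightarrow> 0 \<and>
      uniform_limit Q (\<lambda>k. Ud (\<rho> (r k)) (h (\<rho> (r k)))) (Uk g) sequentially \<and> Uk g (T, x0) = y \<and> ereal (energy T g) = rate T b \<sigma> x0 y"
    if \<rho>: "filterlim \<rho> at_top sequentially" "\<And>k. 2 \<le> \<rho> k" for \<rho> :: "nat \<Rightarrow> nat"
  proof -
    have e\<rho>: "(\<lambda>k. \<epsilon> (\<rho> k)) \<longlonglongrightarrow> 0" by (rule filterlim_compose[OF e \<rho>(1)])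
    show ?thesis
      by (rule minimizers_converge[of \<rho> y "\<lambda>k. h (\<rho> k)" "\<lambda>k. \<epsilon> (\<rho> k)", OF \<rho> fin h(1)[OF \<rho>(2)] h(2)[OF \<rho>(2)] e\<rho> h(3)[OF \<rho>(2)]]) blast
  qed
  obtain r g where r: "strict_mono (r :: nat \<Rightarrow> nat)" and g: "sq_int N g"
    and lim: "(\<lambda>k. l2 N (\<lambda>q. h (r k + 2) q - g q)) \<longlonglongrightarrow> 0"
    and ul: "uniform_limit Q (\<lambda>k. Ud (r k + 2) (h (r k + 2))) (Uk g) sequentially"
    and gy: "Uk g (T, x0) = y" and ge: "ereal (energy T g) = rate T b \<sigma> x0 y"
    \<comment> \<open>The shift by 2 keeps all indices in the range where the controls are assumed
      to be near minimizers.\<close>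
    using sub[of "\<lambda>k. k + 2"] filterlim_add_const_nat_at_top[of 2] by auto
  have full: "(\<lambda>n. L2_norm_cyl T (\<lambda>p. h n p - g p)) \<longlonglongrightarrow> 0 \<and> uniform_limit Q (\<lambda>n. Ud n (h n)) (Uk g) sequentially"
    if uniq: "\<forall>h1 h2. is_rate_minimizer T b \<sigma> x0 y h1 \<and> is_rate_minimizer T b \<sigma> x0 y h2 \<longrightarrow>
                (AE p in lborel. p \<in> cyl T \<longrightarrow> h1 p = h2 p)"
  proof -
    \<comment> \<open>Closeness of controls and of paths in one predicate, so that a single
      extraction of a subsequence refutes the failure of either.\<close>
    define P where "P d n \<longleftrightarrow> l2 N (\<lambda>q. h n q - g q) < d \<and> (\<forall>p\<in>Q. dist (Ud n (h n) p) (Uk g p) < d)" for d n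
    have evP: "eventually (P d) sequentially" if d: "0 < d" for d
    proof (rule ccontr)
      assume "\<not> eventually (P d) sequentially"
      then have "\<forall>K. \<exists>n\<ge>K. \<not> P d n" unfolding eventually_sequentially by blast
      then have "\<forall>k. \<exists>n. max 2 k \<le> n \<and> \<not> P d n" by blast
      then obtain \<rho> where \<rho>: "\<And>k. max 2 k \<le> \<rho> k" "\<And>k. \<not> P d (\<rho> k)" by metis
      have \<rho>lim: "filterlim \<rho> at_top sequentially"
        by (rule filterlim_at_top_mono[OF filterlim_ident]) (use \<rho>(1) in auto)
      have \<rho>2: "2 \<le> \<rho> k" for k using \<rho>(1)[of k] by simp
      obtain s f where f: "sq_int N f" and fl: "(\<lambda>k. l2 N (\<lambda>q. h (\<rho> (s k)) q - f q)) \<longlonglongrightarrow> 0"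
        and fu: "uniform_limit Q (\<lambda>k. Ud (\<rho> (s k)) (h (\<rho> (s k)))) (Uk f) sequentially"
        and fy: "Uk f (T, x0) = y" and fe: "ereal (energy T f) = rate T b \<sigma> x0 y"
        using sub[OF \<rho>lim \<rho>2] by blast
      have "is_rate_minimizer T b \<sigma> x0 y f" "is_rate_minimizer T b \<sigma> x0 y g"
        using f g fy gy fe ge by (auto simp: is_rate_minimizer_def L2_cyl_iff)
      then have ae: "AE q in N. f q = g q" using uniq unfolding AE_cylM by blast
      have eq: "Uk f p = Uk g p" if "p \<in> Q" for p by (rule Upsilon_AE_cong[OF f g ae that])
      have l2eq: "l2 N (\<lambda>q. h n q - f q) = l2 N (\<lambda>q. h n q - g q)" if "2 \<le> n" for n
        unfolding l2_def
      proof (rule arg_cong[where f = sqrt], rule integral_cong_AE)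
        note hm = sq_int_measurable[OF X_space_sq_int[OF h(1)[OF that]]] sq_int_measurable[OF f] sq_int_measurable[OF g]
        show "(\<lambda>q. (h n q - f q)\<^sup>2) \<in> borel_measurable N" "(\<lambda>q. (h n q - g q)\<^sup>2) \<in> borel_measurable N"
          by (intro borel_measurable_power borel_measurable_diff hm)+
        show "AE q in N. (h n q - f q)\<^sup>2 = (h n q - g q)\<^sup>2" using ae by eventually_elim simp
      qed
      have "eventually (\<lambda>k. l2 N (\<lambda>q. h (\<rho> (s k)) q - f q) < d) sequentially"
        by (rule order_tendstoD(2)[OF fl d])
      then have "eventually (\<lambda>k. P d (\<rho> (s k))) sequentially"
        using uniform_limitD[OF fu d] by eventually_elim (simp add: P_def l2eq[OF \<rho>2] eq)
      then show False using \<rho>(2) by (auto simp: eventually_sequentially)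
    qed
    have "eventually (\<lambda>n. norm (l2 N (\<lambda>q. h n q - g q) - 0) < d) sequentially"
      "eventually (\<lambda>n. \<forall>p\<in>Q. dist (Ud n (h n) p) (Uk g p) < d) sequentially" if "0 < d" for d
      by (rule eventually_mono[OF evP[OF that]], simp add: P_def)+
    then show ?thesis
      by (auto intro!: uniform_limitI tendstoI simp: L2_norm_cyl_eq dist_norm)
  qed
  show ?thesis
  proof (intro exI[of _ "\<lambda>k. r k + 2"] exI[of _ g] conjI impI allI)
    show "strict_mono (\<lambda>k. r k + 2)" using r by (simp add: strict_mono_def)
    show "g \<in> L2_cyl T" using g by (simp add: L2_cyl_iff)
    show "(\<lambda>k. L2_norm_cyl T (\<lambda>p. h (r k + 2) p - g p)) \<longlonglongrightarrow> 0" using lim by (simp add: L2_norm_cyl_eq)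
    show "is_rate_minimizer T b \<sigma> x0 y g" using g gy ge by (simp add: is_rate_minimizer_def L2_cyl_iff)
    show "path_cost T b \<sigma> x0 y (Uk g) \<le> path_cost T b \<sigma> x0 y f" for f by (rule path_cost_minimal[OF g gy ge])
  qed (use ul gy ge Uk_continuous[OF g] full in auto)
qed

end

section \<open>Gaussian tails\<close>

text \<open>Formulated through linear combinations, in the manner of Cramer and Wold: the sheet
  provides Gaussianity in this form, and the tail bounds below work with one-dimensional
  projections.\<close>

definition standard_gaussian :: "'w measure \<Rightarrow> 'i set \<Rightarrow> ('i \<Rightarrow> 'w \<Rightarrow> real) \<Rightarrow> bool" where
  "standard_gaussian M I \<xi> \<longleftrightarrow> prob_space M \<and> (\<forall>\<theta>. gaussian_rv M (\<lambda>w. \<Sum>i\<in>I. \<theta> i * \<xi> i w) \<and>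
     (\<integral>w. (\<Sum>i\<in>I. \<theta> i * \<xi> i w) \<partial>M) = 0 \<and> (\<integral>w. (\<Sum>i\<in>I. \<theta> i * \<xi> i w)\<^sup>2 \<partial>M) = (\<Sum>i\<in>I. (\<theta> i)\<^sup>2))"

lemma centered_gaussian_cases:
  assumes M: "prob_space M" and X: "gaussian_rv M X" and mean: "(\<integral>w. X w \<partial>M) = 0" and var: "(\<integral>w. (X w)\<^sup>2 \<partial>M) = v"
  obtains "v = 0" "AE w in M. X w = 0" | "0 < v" "distributed M lborel X (\<lambda>r. ennreal (normal_density 0 (sqrt v) r))"
proof -
  interpret prob_space M by (rule M)
  have Xm: "X \<in> borel_measurable M" using X by (simp add: gaussian_rv_def)
  obtain \<mu> s where ms: "(s = 0 \<and> (AE w in M. X w = \<mu>)) \<or> (s > 0 \<and> distributed M lborel X (\<lambda>r. ennreal (normal_density \<mu> s r)))"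
    using X by (auto simp: gaussian_rv_def)
  then show ?thesis
  proof (elim disjE conjE)
    assume ae: "AE w in M. X w = \<mu>"
    have "(\<integral>w. X w \<partial>M) = (\<integral>w. \<mu> \<partial>M)" by (rule integral_cong_AE) (use Xm ae in auto)
    then have "\<mu> = 0" using mean prob_space by simp
    moreover have "(\<integral>w. (X w)\<^sup>2 \<partial>M) = (\<integral>w. \<mu>\<^sup>2 \<partial>M)" by (rule integral_cong_AE) (use Xm ae in auto)
    ultimately show ?thesis using ae var by (intro that(1)) auto
  next
    assume s: "0 < s" and D: "distributed M lborel X (\<lambda>r. ennreal (normal_density \<mu> s r))"
    have "\<mu> = 0" using normal_distributed_expectation[OF s D] mean by simp
    moreover have "s\<^sup>2 = v" using normal_distributed_variance[OF s D] mean var by simp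
    then have "s = sqrt v" "0 < v" using s by auto
    ultimately show ?thesis using D by (intro that(2)) auto
  qed
qed

lemma nn_integral_normal_density: "0 < s \<Longrightarrow> (\<integral>\<^sup>+x. ennreal (normal_density \<mu> s x) \<partial>lborel) = 1"
  by (subst nn_integral_eq_integral) (auto simp: integrable_normal_density integral_normal_density)

text \<open>For \<open>r \<le> x\<close> one has \<open>r^2 + (x - r)^2 \<le> x^2\<close>, so the
  density is below \<open>exp (- (r^2 / 2))\<close> times the density shifted to mean
  \<open>r\<close>, which integrates to one. The variance enters through
  \<open>r^2 / 2 \<le> r^2 / (2 * v)\<close>.\<close>

lemma gaussian_upper_tail:
  assumes M: "prob_space M" and X: "gaussian_rv M X" and mean: "(\<integral>w. X w \<partial>M) = 0" and var: "(\<integral>w. (X w)\<^sup>2 \<partial>M) = v"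
    and v: "v \<le> 1" and r: "0 < r"
  shows "measure M {w \<in> space M. r \<le> X w} \<le> exp (- (r\<^sup>2 / 2))"
proof -
  interpret prob_space M by (rule M)
  have Xm [measurable]: "X \<in> borel_measurable M" using X by (simp add: gaussian_rv_def)
  show ?thesis using M X mean var
  proof (cases rule: centered_gaussian_cases)
    case 1
    have "prob {w \<in> space M. r \<le> X w} = 0"
    proof (rule prob_eq_0_AE)
      show "AE w in M. \<not> r \<le> X w" using 1(2) by eventually_elim (use r in auto)
    qed
    then show ?thesis by simp
  next
    case 2
    let ?s = "sqrt v"
    have s: "0 < ?s" using 2 by simp
    have "emeasure M {w \<in> space M. r \<le> X w} = emeasure M (X -` {r..} \<inter> space M)"
      by (rule arg_cong[where f = "emeasure M"]) auto
    also have "\<dots> = (\<integral>\<^sup>+x. ennreal (normal_density 0 ?s x) * indicator {r..} x \<partial>lborel)"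
      by (rule distributed_emeasure[OF 2(2)]) simp
    also have "\<dots> \<le> (\<integral>\<^sup>+x. ennreal (exp (- (r\<^sup>2 / 2))) * ennreal (normal_density r ?s x) \<partial>lborel)"
    proof (rule nn_integral_mono)
      fix x
      show "ennreal (normal_density 0 ?s x) * indicator {r..} x \<le> ennreal (exp (- (r\<^sup>2 / 2))) * ennreal (normal_density r ?s x)"
      proof (cases "r \<le> x")
        case True
        have "0 \<le> 2 * r * (x - r)" using True r by simp
        then have "r\<^sup>2 + (x - r)\<^sup>2 \<le> x\<^sup>2" by (simp add: power2_eq_square algebra_simps)
        then have "(r\<^sup>2 + (x - r)\<^sup>2) / (2 * v) \<le> x\<^sup>2 / (2 * v)" using 2(1) by (intro divide_right_mono) auto
        moreover have "r\<^sup>2 / 2 \<le> r\<^sup>2 / (2 * v)" using v 2(1) by (intro divide_left_mono) auto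
        ultimately have le: "- (x\<^sup>2) / (2 * v) \<le> - (r\<^sup>2 / 2) + - ((x - r)\<^sup>2) / (2 * v)" by (simp add: add_divide_distrib)
        have "normal_density 0 ?s x = 1 / sqrt (2 * pi * v) * exp (- (x\<^sup>2) / (2 * v))"
          using 2(1) by (simp add: normal_density_def)
        also have "\<dots> \<le> 1 / sqrt (2 * pi * v) * exp (- (r\<^sup>2 / 2) + - ((x - r)\<^sup>2) / (2 * v))"
          using le 2(1) by (intro mult_left_mono) auto
        also have "\<dots> = exp (- (r\<^sup>2 / 2)) * normal_density r ?s x"
          unfolding exp_add using 2(1) by (simp add: normal_density_def)
        finally show ?thesis using True by (simp add: ennreal_mult'[symmetric] ennreal_leI)
      qed simp
    qed
    also have "\<dots> = ennreal (exp (- (r\<^sup>2 / 2)))"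
      by (subst nn_integral_cmult) (auto simp: nn_integral_normal_density[OF s])
    finally have "ennreal (prob {w \<in> space M. r \<le> X w}) \<le> ennreal (exp (- (r\<^sup>2 / 2)))"
      by (simp add: emeasure_eq_measure)
    then show ?thesis by (simp add: ennreal_le_iff)
  qed
qed

text \<open>On \<open>{r..r + 1}\<close>, an interval of length one, the density is smallest at the
  right end; this crude bound has the right exponential order.\<close>

lemma gaussian_lower_tail:
  assumes M: "prob_space M" and X: "gaussian_rv M X" and mean: "(\<integral>w. X w \<partial>M) = 0" and var: "(\<integral>w. (X w)\<^sup>2 \<partial>M) = 1"
    and r: "0 \<le> r"
  shows "1 / sqrt (2 * pi) * exp (- ((r + 1)\<^sup>2 / 2)) \<le> measure M {w \<in> space M. r \<le> X w}"
proof -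
  interpret prob_space M by (rule M)
  have Xm [measurable]: "X \<in> borel_measurable M" using X by (simp add: gaussian_rv_def)
  have D: "distributed M lborel X (\<lambda>r. ennreal (normal_density 0 1 r))"
    using M X mean var by (cases rule: centered_gaussian_cases) auto
  let ?c = "1 / sqrt (2 * pi) * exp (- ((r + 1)\<^sup>2 / 2))"
  have "ennreal ?c = (\<integral>\<^sup>+x. ennreal ?c * indicator {r..r + 1} x \<partial>lborel)"
    by (subst nn_integral_cmult_indicator) auto
  also have "\<dots> \<le> (\<integral>\<^sup>+x. ennreal (normal_density 0 1 x) * indicator {r..} x \<partial>lborel)"
  proof (rule nn_integral_mono)
    fix x
    show "ennreal ?c * indicator {r..r + 1} x \<le> ennreal (normal_density 0 1 x) * indicator {r..} x"
    proof (cases "x \<in> {r..r + 1}")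
      case True
      then have "x\<^sup>2 \<le> (r + 1)\<^sup>2" using r by (intro power_mono) auto
      then have "?c \<le> normal_density 0 1 x" by (simp add: std_normal_density_def divide_right_mono)
      then show ?thesis using True by (simp add: ennreal_leI)
    qed simp
  qed
  also have "\<dots> = emeasure M (X -` {r..} \<inter> space M)"
    by (rule distributed_emeasure[OF D, symmetric]) simp
  also have "X -` {r..} \<inter> space M = {w \<in> space M. r \<le> X w}" by auto
  finally have "ennreal ?c \<le> ennreal (prob {w \<in> space M. r \<le> X w})" by (simp add: emeasure_eq_measure)
  then show ?thesis by (simp add: ennreal_le_iff)
qed

text \<open>A finite set of directions in the unit ball such that every vector is almost aligned with one of
  them: the normalized coordinates are rounded towards zero on a grid of mesh \<open>1 / n\<close>.\<close>

lemma finite_directions: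
  fixes I :: "'i set"
  assumes I: "finite I" and \<delta>: "0 < \<delta>"
  obtains \<Theta> :: "('i \<Rightarrow> real) set" where "finite \<Theta>" "\<And>\<theta>. \<theta> \<in> \<Theta> \<Longrightarrow> (\<Sum>i\<in>I. (\<theta> i)\<^sup>2) \<le> 1"
    "\<And>x. \<exists>\<theta>\<in>\<Theta>. (1 - \<delta>) * sqrt (\<Sum>i\<in>I. (x i)\<^sup>2) \<le> (\<Sum>i\<in>I. \<theta> i * x i)"
proof -
  \<comment> \<open>Each normalized coordinate loses at most \<open>1 / n\<close> by rounding, so
    the total loss \<open>card I / n\<close> has to stay below \<open>\<delta>\<close>.\<close>
  obtain n :: nat where n0: "real (card I) / \<delta> < real n" using reals_Archimedean2 by blast
  have npos: "0 < real n" using n0 \<delta> by (meson divide_nonneg_pos le_less_trans of_nat_0_le_iff)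
  have n: "real (card I) / real n \<le> \<delta>" using n0 \<delta> npos by (simp add: field_simps)
  define Z where "Z = (\<lambda>z::int. of_int z / real n) ` {- int n..int n}"
  define \<Theta> where "\<Theta> = {\<theta> \<in> PiE I (\<lambda>_. Z). (\<Sum>i\<in>I. (\<theta> i)\<^sup>2) \<le> 1}"
  have fin: "finite \<Theta>" unfolding \<Theta>_def Z_def using I by (intro finite_subset[OF Collect_restrict] finite_PiE) auto
  have "\<exists>\<theta>\<in>\<Theta>. (1 - \<delta>) * sqrt (\<Sum>i\<in>I. (x i)\<^sup>2) \<le> (\<Sum>i\<in>I. \<theta> i * x i)" for x :: "'i \<Rightarrow> real"
  proof -
    define \<rho> where "\<rho> = sqrt (\<Sum>i\<in>I. (x i)\<^sup>2)"
    have \<rho>0: "0 \<le> \<rho>" unfolding \<rho>_def by (simp add: sum_nonneg)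
    have \<rho>2: "\<rho>\<^sup>2 = (\<Sum>i\<in>I. (x i)\<^sup>2)" by (simp add: \<rho>_def sum_nonneg)
    have xi: "\<bar>x i\<bar> \<le> \<rho>" if "i \<in> I" for i
    proof -
      have "(x i)\<^sup>2 \<le> \<rho>\<^sup>2" unfolding \<rho>2 using I that by (intro member_le_sum) auto
      then show ?thesis using \<rho>0 by (simp add: abs_le_square_iff[symmetric])
    qed
    show ?thesis
    proof (cases "\<rho> = 0")
      case True
      have "restrict (\<lambda>_. 0) I \<in> \<Theta>" using npos by (auto simp: \<Theta>_def Z_def image_iff intro!: bexI[of _ 0])
      then show ?thesis using True by (intro bexI[of _ "restrict (\<lambda>_. 0) I"]) (auto simp: \<rho>_def[symmetric])
    next
      case False
      then have \<rho>: "0 < \<rho>" using \<rho>0 by simp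
      define a where "a i = of_int \<lfloor>real n * \<bar>x i\<bar> / \<rho>\<rfloor> / real n" for i
      have a0: "0 \<le> a i" for i using npos \<rho> by (simp add: a_def)
      have a1: "a i \<le> \<bar>x i\<bar> / \<rho>" for i
      proof -
        have "of_int \<lfloor>real n * \<bar>x i\<bar> / \<rho>\<rfloor> \<le> real n * \<bar>x i\<bar> / \<rho>" by linarith
        then have "a i \<le> (real n * \<bar>x i\<bar> / \<rho>) / real n" unfolding a_def using npos by (intro divide_right_mono) auto
        then show ?thesis using npos by simp
      qed
      have a2: "\<bar>x i\<bar> / \<rho> - 1 / real n \<le> a i" for i
      proof -
        have "real n * \<bar>x i\<bar> / \<rho> - 1 \<le> of_int \<lfloor>real n * \<bar>x i\<bar> / \<rho>\<rfloor>" by linarith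
        then have "(real n * \<bar>x i\<bar> / \<rho> - 1) / real n \<le> a i" unfolding a_def using npos by (intro divide_right_mono) auto
        then show ?thesis using npos by (simp add: diff_divide_distrib)
      qed
      define \<theta> where "\<theta> = restrict (\<lambda>i. sgn (x i) * a i) I"
      have aZ: "sgn (x i) * a i \<in> Z" if i: "i \<in> I" for i
      proof -
        have "\<bar>x i\<bar> / \<rho> \<le> 1" using xi[OF i] \<rho> by simp
        then have "real n * (\<bar>x i\<bar> / \<rho>) \<le> real n * 1" using npos by (intro mult_left_mono) auto
        moreover define z where "z = \<lfloor>real n * \<bar>x i\<bar> / \<rho>\<rfloor>"
        ultimately have f: "z \<le> int n" by (simp add: floor_le_iff)
        have f0: "0 \<le> z" using npos \<rho> by (simp add: z_def)
        have az: "a i = of_int z / real n" by (simp add: a_def z_def)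
        consider "x i = 0" | "0 < x i" | "x i < 0" by linarith
        then show ?thesis
        proof cases
          case 1
          then show ?thesis unfolding Z_def by (intro image_eqI[of _ _ 0]) auto
        next
          case 2
          then show ?thesis unfolding Z_def az using f f0 by (intro image_eqI[of _ _ z]) auto
        next
          case 3
          then show ?thesis unfolding Z_def az using f f0 by (intro image_eqI[of _ _ "- z"]) auto
        qed
      qed
      have sq: "(sgn (x i) * a i)\<^sup>2 \<le> (x i)\<^sup>2 / \<rho>\<^sup>2" for i
      proof -
        have "(a i)\<^sup>2 \<le> (\<bar>x i\<bar> / \<rho>)\<^sup>2" using a0 a1 by (intro power_mono)
        moreover have "(sgn (x i))\<^sup>2 \<le> 1" by (simp add: sgn_if)
        ultimately have "(sgn (x i))\<^sup>2 * (a i)\<^sup>2 \<le> 1 * (\<bar>x i\<bar> / \<rho>)\<^sup>2" by (intro mult_mono) auto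
        then show ?thesis by (simp add: power_mult_distrib power_divide)
      qed
      have "(\<Sum>i\<in>I. (\<theta> i)\<^sup>2) \<le> (\<Sum>i\<in>I. (x i)\<^sup>2 / \<rho>\<^sup>2)" unfolding \<theta>_def using sq by (intro sum_mono) simp
      also have "\<dots> = 1" using \<rho> by (simp add: sum_divide_distrib[symmetric] \<rho>2[symmetric])
      finally have "\<theta> \<in> \<Theta>" using aZ by (auto simp: \<Theta>_def \<theta>_def)
      moreover have "(1 - \<delta>) * \<rho> \<le> (\<Sum>i\<in>I. \<theta> i * x i)"
      proof -
        have "(x i)\<^sup>2 / \<rho> - \<rho> / real n \<le> \<theta> i * x i" if i: "i \<in> I" for i
        proof -
          have "(\<bar>x i\<bar> / \<rho> - 1 / real n) * \<bar>x i\<bar> \<le> a i * \<bar>x i\<bar>" using a2 by (intro mult_right_mono) auto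
          also have "\<dots> = \<theta> i * x i" using i by (simp add: \<theta>_def abs_sgn mult_ac)
          finally have "(x i)\<^sup>2 / \<rho> - \<bar>x i\<bar> / real n \<le> \<theta> i * x i"
            by (simp add: left_diff_distrib power2_eq_square)
          moreover have "\<bar>x i\<bar> / real n \<le> \<rho> / real n" using xi[OF i] npos by (intro divide_right_mono) auto
          ultimately show ?thesis by linarith
        qed
        then have "(\<Sum>i\<in>I. (x i)\<^sup>2 / \<rho> - \<rho> / real n) \<le> (\<Sum>i\<in>I. \<theta> i * x i)" by (rule sum_mono)
        moreover have "(\<Sum>i\<in>I. (x i)\<^sup>2 / \<rho> - \<rho> / real n) = \<rho> - real (card I) / real n * \<rho>"
          using \<rho> by (simp add: sum_subtractf sum_divide_distrib[symmetric] \<rho>2[symmetric]) (simp add: power2_eq_square)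
        moreover have "real (card I) / real n * \<rho> \<le> \<delta> * \<rho>" using n \<rho> by (intro mult_right_mono) auto
        ultimately show ?thesis by (simp add: left_diff_distrib)
      qed
      ultimately show ?thesis by (auto simp: \<rho>_def)
    qed
  qed
  then show ?thesis by (intro that[of \<Theta>] fin) (auto simp: \<Theta>_def)
qed

lemma standard_gaussian_measurable:
  assumes G: "standard_gaussian M I \<xi>"
  shows "(\<lambda>w. \<Sum>i\<in>I. \<theta> i * \<xi> i w) \<in> borel_measurable M"
  using G by (auto simp: standard_gaussian_def gaussian_rv_def)

text \<open>If the vector is long, one of the finitely many directions sees almost its whole length,
  so a union bound over one-dimensional tails suffices. The constant depends on
  \<open>\<delta>\<close> and \<open>I\<close> but not on \<open>R\<close>, hence disappears on the
  exponential scale.\<close>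

lemma standard_gaussian_ball_tail:
  fixes I :: "'i set"
  assumes G: "standard_gaussian M I \<xi>" and I: "finite I" and \<delta>: "0 < \<delta>" "\<delta> < 1"
  obtains C where "1 \<le> C" "\<And>R A. 0 < R \<Longrightarrow> A \<in> sets M \<Longrightarrow> (\<And>w. w \<in> A \<Longrightarrow> R\<^sup>2 \<le> (\<Sum>i\<in>I. (\<xi> i w)\<^sup>2)) \<Longrightarrow>
      measure M A \<le> C * exp (- (((1 - \<delta>) * R)\<^sup>2 / 2))"
proof -
  interpret prob_space M using G by (simp add: standard_gaussian_def)
  obtain \<Theta> :: "('i \<Rightarrow> real) set" where T: "finite \<Theta>" "\<And>\<theta>. \<theta> \<in> \<Theta> \<Longrightarrow> (\<Sum>i\<in>I. (\<theta> i)\<^sup>2) \<le> 1"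
    "\<And>x. \<exists>\<theta>\<in>\<Theta>. (1 - \<delta>) * sqrt (\<Sum>i\<in>I. (x i)\<^sup>2) \<le> (\<Sum>i\<in>I. \<theta> i * x i)"
    using finite_directions[OF I \<delta>(1)] by metis
  show ?thesis
  proof (rule that[of "real (card \<Theta>) + 1"])
    fix R A assume R: "0 < R" and A: "A \<in> sets M" and RA: "\<And>w. w \<in> A \<Longrightarrow> R\<^sup>2 \<le> (\<Sum>i\<in>I. (\<xi> i w)\<^sup>2)"
    let ?r = "(1 - \<delta>) * R"
    let ?E = "\<lambda>\<theta>. {w \<in> space M. ?r \<le> (\<Sum>i\<in>I. \<theta> i * \<xi> i w)}"
    have r: "0 < ?r" using R \<delta> by simp
    have Em: "?E \<theta> \<in> sets M" for \<theta>
      using standard_gaussian_measurable[OF G, of \<theta>] by measurable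
    have "A \<subseteq> (\<Union>\<theta>\<in>\<Theta>. ?E \<theta>)"
    proof
      fix w assume w: "w \<in> A"
      obtain \<theta> where \<theta>: "\<theta> \<in> \<Theta>" "(1 - \<delta>) * sqrt (\<Sum>i\<in>I. (\<xi> i w)\<^sup>2) \<le> (\<Sum>i\<in>I. \<theta> i * \<xi> i w)"
        using T(3)[of "\<lambda>i. \<xi> i w"] by blast
      have "R \<le> sqrt (\<Sum>i\<in>I. (\<xi> i w)\<^sup>2)" using RA[OF w] by (intro real_le_rsqrt)
      then have "?r \<le> (1 - \<delta>) * sqrt (\<Sum>i\<in>I. (\<xi> i w)\<^sup>2)" using \<delta> by (intro mult_left_mono) auto
      also note \<theta>(2)
      finally show "w \<in> (\<Union>\<theta>\<in>\<Theta>. ?E \<theta>)" using \<theta>(1) w sets.sets_into_space[OF A] by auto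
    qed
    then have "prob A \<le> prob (\<Union>\<theta>\<in>\<Theta>. ?E \<theta>)" using Em T(1) by (intro finite_measure_mono) auto
    also have "\<dots> \<le> (\<Sum>\<theta>\<in>\<Theta>. prob (?E \<theta>))" using Em T(1) by (intro finite_measure_subadditive_finite) auto
    also have "\<dots> \<le> (\<Sum>\<theta>\<in>\<Theta>. exp (- (?r\<^sup>2 / 2)))"
    proof (rule sum_mono)
      fix \<theta> assume "\<theta> \<in> \<Theta>"
      have "gaussian_rv M (\<lambda>w. \<Sum>i\<in>I. \<theta> i * \<xi> i w)" "(\<integral>w. (\<Sum>i\<in>I. \<theta> i * \<xi> i w) \<partial>M) = 0"
        "(\<integral>w. (\<Sum>i\<in>I. \<theta> i * \<xi> i w)\<^sup>2 \<partial>M) = (\<Sum>i\<in>I. (\<theta> i)\<^sup>2)"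
        using G by (auto simp: standard_gaussian_def)
      from gaussian_upper_tail[OF prob_space_axioms this T(2)[OF \<open>\<theta> \<in> \<Theta>\<close>] r]
      show "prob (?E \<theta>) \<le> exp (- (?r\<^sup>2 / 2))" .
    qed
    also have "\<dots> \<le> (real (card \<Theta>) + 1) * exp (- (?r\<^sup>2 / 2))" by (simp add: distrib_right)
    finally show "prob A \<le> (real (card \<Theta>) + 1) * exp (- (?r\<^sup>2 / 2))" .
  qed simp
qed

text \<open>With \<open>e = sqrt \<epsilon>\<close> and \<open>c\<close> nonzero on
  \<open>I\<close>, this is the event that the scaled vector lies on or beyond the plane through
  \<open>c\<close> orthogonal to \<open>c\<close>; its probability is a one-dimensional tail in the
  direction of \<open>c\<close>. If \<open>c\<close> vanishes on \<open>I\<close> the event is the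
  whole space.\<close>

lemma standard_gaussian_half_space:
  assumes G: "standard_gaussian M I \<xi>" and I: "finite I" and r: "0 < e"
  shows "1 / sqrt (2 * pi) * exp (- ((sqrt (\<Sum>i\<in>I. (c i)\<^sup>2) / e + 1)\<^sup>2 / 2))
     \<le> measure M {w \<in> space M. (\<Sum>i\<in>I. (c i)\<^sup>2) \<le> e * (\<Sum>i\<in>I. c i * \<xi> i w)}"
proof -
  interpret prob_space M using G by (simp add: standard_gaussian_def)
  define n where "n = sqrt (\<Sum>i\<in>I. (c i)\<^sup>2)"
  have n0: "0 \<le> n" by (simp add: n_def sum_nonneg)
  have n2: "(\<Sum>i\<in>I. (c i)\<^sup>2) = n\<^sup>2" by (simp add: n_def sum_nonneg)
  show ?thesis
  proof (cases "n = 0")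
    case True
    then have "c i = 0" if "i \<in> I" for i
      using n2 I that by (simp add: sum_nonneg_eq_0_iff)
    then have "{w \<in> space M. (\<Sum>i\<in>I. (c i)\<^sup>2) \<le> e * (\<Sum>i\<in>I. c i * \<xi> i w)} = space M" by auto
    moreover have "1 / sqrt (2 * pi) * exp (- ((n / e + 1)\<^sup>2 / 2)) \<le> 1 * 1"
    proof (rule mult_mono)
      have "1 \<le> sqrt (2 * pi)" using pi_gt3 by (intro real_le_rsqrt) simp
      then show "1 / sqrt (2 * pi) \<le> 1" by simp
    qed auto
    ultimately show ?thesis using prob_space by (simp add: n_def)
  next
    case False
    then have n: "0 < n" using n0 by simp
    define \<theta> where "\<theta> i = c i / n" for i
    have "(\<Sum>i\<in>I. (\<theta> i)\<^sup>2) = 1"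
      using n n2 by (simp add: \<theta>_def power_divide sum_divide_distrib[symmetric])
    then have g: "gaussian_rv M (\<lambda>w. \<Sum>i\<in>I. \<theta> i * \<xi> i w)" "(\<integral>w. (\<Sum>i\<in>I. \<theta> i * \<xi> i w) \<partial>M) = 0"
        "(\<integral>w. (\<Sum>i\<in>I. \<theta> i * \<xi> i w)\<^sup>2 \<partial>M) = 1"
      using G by (auto simp: standard_gaussian_def)
    have "{w \<in> space M. (\<Sum>i\<in>I. (c i)\<^sup>2) \<le> e * (\<Sum>i\<in>I. c i * \<xi> i w)} = {w \<in> space M. n / e \<le> (\<Sum>i\<in>I. \<theta> i * \<xi> i w)}"
    proof (rule Collect_cong, rule conj_cong[OF refl])
      fix w
      let ?s = "\<Sum>i\<in>I. \<theta> i * \<xi> i w"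
      have S: "(\<Sum>i\<in>I. c i * \<xi> i w) = n * ?s" using n by (simp add: \<theta>_def sum_distrib_left)
      have "n\<^sup>2 \<le> e * (n * ?s) \<longleftrightarrow> n * n \<le> n * (e * ?s)" by (simp add: power2_eq_square mult_ac)
      also have "\<dots> \<longleftrightarrow> n \<le> e * ?s" using n by simp
      also have "\<dots> \<longleftrightarrow> n / e \<le> ?s" using r by (simp add: pos_divide_le_eq mult.commute)
      finally show "(\<Sum>i\<in>I. (c i)\<^sup>2) \<le> e * (\<Sum>i\<in>I. c i * \<xi> i w) \<longleftrightarrow> n / e \<le> ?s"
        unfolding n2 S .
    qed
    then show ?thesis using gaussian_lower_tail[OF prob_space_axioms g, of "n / e"] n r by (simp add: n_def)
  qed
qed

section \<open>Large deviations for functions of a Gaussian vector\<close>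

definition quad_rate :: "'i set \<Rightarrow> (('i \<Rightarrow> real) \<Rightarrow> real) \<Rightarrow> real \<Rightarrow> ereal" where
  "quad_rate I F y = Inf {ereal ((\<Sum>i\<in>I. (c i)\<^sup>2) / 2) | c. F c = y}"

text \<open>Sequential continuity in the coordinates from \<open>I\<close>, for families over a
  larger index type. Constant sequences show that such an \<open>F\<close> depends only on these
  coordinates, which \<open>rate_disc_eq_quad_rate\<close> exploits.\<close>

definition coord_continuous :: "'i set \<Rightarrow> (('i \<Rightarrow> real) \<Rightarrow> real) \<Rightarrow> bool" where
  "coord_continuous I F \<longleftrightarrow>
     (\<forall>c l. (\<forall>i\<in>I. (\<lambda>n::nat. c n i) \<longlonglongrightarrow> l i) \<longrightarrow> (\<lambda>n. F (c n)) \<longlonglongrightarrow> F l)"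

lemma coord_continuousD:
  "coord_continuous I F \<Longrightarrow> (\<And>i. i \<in> I \<Longrightarrow> (\<lambda>n. c n i) \<longlonglongrightarrow> l i) \<Longrightarrow> (\<lambda>n. F (c n)) \<longlonglongrightarrow> F l"
  by (simp add: coord_continuous_def)

lemma quad_rate_le: "quad_rate I F (F c) \<le> ereal ((\<Sum>i\<in>I. (c i)\<^sup>2) / 2)"
  unfolding quad_rate_def by (rule Inf_lower) blast

lemma finite_family_subsequence:
  fixes c :: "nat \<Rightarrow> 'i \<Rightarrow> real"
  assumes "finite I" and "\<And>n i. i \<in> I \<Longrightarrow> \<bar>c n i\<bar> \<le> R"
  shows "\<exists>r l. strict_mono (r :: nat \<Rightarrow> nat) \<and> (\<forall>i\<in>I. (\<lambda>n. c (r n) i) \<longlonglongrightarrow> l i)"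
  using assms
proof (induction I rule: finite_induct)
  case empty
  then show ?case by (intro exI[of _ id]) (auto simp: strict_mono_def)
next
  case (insert j I)
  then obtain r l where r: "strict_mono (r :: nat \<Rightarrow> nat)" "\<forall>i\<in>I. (\<lambda>n. c (r n) i) \<longlonglongrightarrow> l i"
    by (metis insertI2)
  have "bounded (range (\<lambda>n. c (r n) j))" using insert.prems by (auto simp: bounded_iff)
  then obtain a s where s: "strict_mono (s :: nat \<Rightarrow> nat)" "((\<lambda>n. c (r n) j) \<circ> s) \<longlonglongrightarrow> a"
    using bounded_imp_convergent_subsequence by blast
  have "(\<lambda>n. c ((r \<circ> s) n) i) \<longlonglongrightarrow> (l(j := a)) i" if "i \<in> insert j I" for i
  proof (cases "i = j")
    case False
    then have "(\<lambda>n. c (r n) i) \<longlonglongrightarrow> l i" using r(2) that by auto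
    from LIMSEQ_subseq_LIMSEQ[OF this s(1)] show ?thesis using False by (simp add: comp_def)
  qed (use s(2) in \<open>simp add: comp_def\<close>)
  then show ?case using strict_mono_o[OF r(1) s(1)] by blast
qed

text \<open>Near-minimizing preimages \<open>c n\<close> of points in a sublevel set are bounded;
  the limit of a subsequence is a preimage of the limit point, and the slack
  \<open>1 / Suc n\<close> disappears in the limit of the energies.\<close>

lemma good_rate_quad:
  assumes I: "finite I" and F: "coord_continuous I F"
  shows "good_rate_function (quad_rate I F)"
  unfolding good_rate_function_def
proof (intro conjI allI)
  fix y show "0 \<le> quad_rate I F y"
    unfolding quad_rate_def by (intro Inf_greatest) (auto simp: sum_nonneg)
next
  fix a :: real
  show "compact {y. quad_rate I F y \<le> ereal a}"
    unfolding compact_eq_seq_compact_metric seq_compact_def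
  proof (intro allI impI)
    fix f :: "nat \<Rightarrow> real" assume f: "\<forall>n. f n \<in> {y. quad_rate I F y \<le> ereal a}"
    have "\<exists>c. F c = f n \<and> (\<Sum>i\<in>I. (c i)\<^sup>2) / 2 < a + 1 / real (Suc n)" for n
    proof -
      have "quad_rate I F (f n) \<le> ereal a" using f by simp
      also have "\<dots> < ereal (a + 1 / real (Suc n))" by simp
      finally have "quad_rate I F (f n) < ereal (a + 1 / real (Suc n))" .
      then show ?thesis unfolding quad_rate_def Inf_less_iff by auto
    qed
    then obtain c where c: "\<And>n. F (c n) = f n" "\<And>n. (\<Sum>i\<in>I. (c n i)\<^sup>2) / 2 < a + 1 / real (Suc n)" by metis
    \<comment> \<open>The inequality \<open>2 * z \<le> z^2 + 1\<close> gives a bound that is linear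
      in \<open>a\<close>, without square roots.\<close>
    have "\<bar>c n i\<bar> \<le> 2 * a + 3" if "i \<in> I" for n i
    proof -
      have "(c n i)\<^sup>2 \<le> (\<Sum>i\<in>I. (c n i)\<^sup>2)" using I that by (intro member_le_sum) auto
      moreover have "(\<Sum>i\<in>I. (c n i)\<^sup>2) / 2 < a + 1"
        using c(2)[of n] by (rule less_le_trans) simp
      then have "(\<Sum>i\<in>I. (c n i)\<^sup>2) < 2 * a + 2" by simp
      moreover have "0 \<le> (\<bar>c n i\<bar> - 1)\<^sup>2" by simp
      then have "2 * \<bar>c n i\<bar> \<le> (c n i)\<^sup>2 + 1" by (simp add: power2_diff)
      ultimately show ?thesis using zero_le_power2[of "c n i"] by linarith
    qed
    from finite_family_subsequence[of I c "2 * a + 3", OF I this] obtain r l where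
      r: "strict_mono (r :: nat \<Rightarrow> nat)" and "\<forall>i\<in>I. (\<lambda>n. c (r n) i) \<longlonglongrightarrow> l i" by blast
    then have l: "\<And>i. i \<in> I \<Longrightarrow> (\<lambda>n. c (r n) i) \<longlonglongrightarrow> l i" by blast
    have lim: "(\<lambda>n. F (c (r n))) \<longlonglongrightarrow> F l" by (rule coord_continuousD[OF F l])
    have "(\<lambda>n. (\<Sum>i\<in>I. (c (r n) i)\<^sup>2) / 2) \<longlonglongrightarrow> (\<Sum>i\<in>I. (l i)\<^sup>2) / 2"
      by (intro tendsto_intros l) auto
    moreover have "(\<lambda>n. a + 1 / real (Suc (r n))) \<longlonglongrightarrow> a + 0"
      using LIMSEQ_subseq_LIMSEQ[OF LIMSEQ_inverse_real_of_nat r]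
      by (intro tendsto_add tendsto_const) (simp add: comp_def inverse_eq_divide)
    ultimately have "(\<Sum>i\<in>I. (l i)\<^sup>2) / 2 \<le> a + 0"
      by (rule LIMSEQ_le) (use c(2) in \<open>auto intro: less_imp_le\<close>)
    then have "quad_rate I F (F l) \<le> ereal a"
      by (intro order_trans[OF quad_rate_le]) simp
    moreover have "(f \<circ> r) \<longlonglongrightarrow> F l" using lim by (simp add: comp_def c(1))
    ultimately show "\<exists>l\<in>{y. quad_rate I F y \<le> ereal a}. \<exists>r. strict_mono r \<and> (f \<circ> r) \<longlonglongrightarrow> l"
      using r by blast
  qed
qed

lemma scaled_elog_le:
  assumes "0 \<le> p" "p \<le> C * exp (- (K / e))" "0 < C" "0 < e"
  shows "ereal e * elog p \<le> ereal (e * ln C - K)"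
proof (cases "p = 0")
  case True
  then show ?thesis using assms by (simp add: elog_def)
next
  case False
  then have "ln p \<le> ln (C * exp (- (K / e)))" using assms by simp
  also have "\<dots> = ln C - K / e" using assms by (simp add: ln_mult)
  finally have "e * ln p \<le> e * (ln C - K / e)" using assms by (intro mult_left_mono) auto
  also have "\<dots> = e * ln C - K" using assms by (simp add: right_diff_distrib)
  finally show ?thesis using False by (simp add: elog_def)
qed

lemma scaled_elog_ge:
  assumes "C * exp (- K) \<le> p" "0 < C" "0 < e"
  shows "ereal (e * (ln C - K)) \<le> ereal e * elog p"
proof -
  have p: "0 < p" using assms by (smt (verit) exp_gt_zero mult_pos_pos)
  have "ln C - K = ln (C * exp (- K))" using assms by (simp add: ln_mult)
  also have "\<dots> \<le> ln p" using assms p by (subst ln_le_cancel_iff) auto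
  finally have "e * (ln C - K) \<le> e * ln p" using assms by (intro mult_left_mono) auto
  then show ?thesis using p by (simp add: elog_def)
qed

lemma square_ge_linear: "1 - 2 * \<delta> \<le> (1 - \<delta>)\<^sup>2" for \<delta> :: real
  by (simp add: power2_diff)

text \<open>Any family whose image under \<open>F\<close> lies in \<open>A\<close> has at least the
  energy given by the infimum of the rate over \<open>A\<close>. The event thus forces the scaled
  Gaussian vector out of a ball, and the ball tail applies.\<close>

lemma gaussian_LDP_upper:
  assumes G: "standard_gaussian M I \<xi>" and I: "finite I"
    and meas: "\<And>\<epsilon>. 0 < \<epsilon> \<Longrightarrow> (\<lambda>w. F (\<lambda>i. sqrt \<epsilon> * \<xi> i w)) \<in> borel_measurable M"
    and A: "closed A"
  shows "Limsup (at_right 0) (\<lambda>\<epsilon>. ereal \<epsilon> * elog (measure M {w \<in> space M. F (\<lambda>i. sqrt \<epsilon> * \<xi> i w) \<in> A}))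
     \<le> - (INF y\<in>A. quad_rate I F y)"
proof (rule dense_ge)
  interpret prob_space M using G by (simp add: standard_gaussian_def)
  let ?L = "INF y\<in>A. quad_rate I F y"
  let ?P = "\<lambda>\<epsilon>. prob {w \<in> space M. F (\<lambda>i. sqrt \<epsilon> * \<xi> i w) \<in> A}"
  have pos: "\<forall>\<^sub>F \<epsilon>::real in at_right 0. 0 < \<epsilon>" by (rule eventually_at_right_less)
  fix x assume x: "- ?L < x"
  obtain q where q: "- ?L < ereal q" "ereal q < x" using ereal_dense2[OF x] by blast
  obtain q1 where q1: "- ?L < ereal q1" "ereal q1 < ereal q" using ereal_dense2[OF q(1)] by blast
  have "\<forall>\<^sub>F \<epsilon> in at_right 0. ereal \<epsilon> * elog (?P \<epsilon>) \<le> x"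
  \<comment> \<open>For \<open>0 \<le> q\<close> it suffices that a probability is at most one;
    otherwise the infimum of the rate is positive and there is a ball to leave.\<close>
  proof (cases "0 \<le> q")
    case True
    show ?thesis using pos
    proof eventually_elim
      case (elim \<epsilon>)
      have "ereal \<epsilon> * elog (?P \<epsilon>) \<le> ereal (\<epsilon> * ln 1 - 0)" by (rule scaled_elog_le) (use elim in auto)
      also have "\<dots> \<le> x" using True q(2) by (auto intro: order_trans[of _ "ereal q"] less_imp_le)
      finally show ?case .
    qed
  next
    case False
    define c where "c = - q1"
    \<comment> \<open>Makes \<open>(1 - 2 * \<delta>) * c = - q\<close>: the gap between
      \<open>q1\<close> and \<open>q\<close> pays for the loss in the ball tail.\<close>
    define \<delta> where "\<delta> = (q - q1) / (2 * c)"
    have c: "0 < c" "- q < c" using False q1(2) by (auto simp: c_def)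
    have \<delta>: "0 < \<delta>" "\<delta> < 1" using c q1(2) False by (auto simp: \<delta>_def c_def field_simps)
    have "2 * \<delta> * c = q - q1" using c by (simp add: \<delta>_def)
    then have "(1 - 2 * \<delta>) * c = - q" by (simp add: left_diff_distrib c_def)
    then have K: "- q \<le> (1 - \<delta>)\<^sup>2 * c" using mult_right_mono[OF square_ge_linear[of \<delta>], of c] c by simp
    obtain C where C: "1 \<le> C" "\<And>R A. 0 < R \<Longrightarrow> A \<in> sets M \<Longrightarrow> (\<And>w. w \<in> A \<Longrightarrow> R\<^sup>2 \<le> (\<Sum>i\<in>I. (\<xi> i w)\<^sup>2)) \<Longrightarrow>
      measure M A \<le> C * exp (- (((1 - \<delta>) * R)\<^sup>2 / 2))"
      using standard_gaussian_ball_tail[OF G I \<delta>] by metis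
    have bound: "ereal \<epsilon> * elog (?P \<epsilon>) \<le> ereal (\<epsilon> * ln C + q)" if \<epsilon>: "0 < \<epsilon>" for \<epsilon>
    proof -
      let ?E = "{w \<in> space M. F (\<lambda>i. sqrt \<epsilon> * \<xi> i w) \<in> A}"
      have E: "?E \<in> sets M"
        using measurable_sets[OF meas[OF \<epsilon>] borel_closed[OF A]] by (simp add: vimage_def Int_def conj_commute)
      have R: "(sqrt (2 * c / \<epsilon>))\<^sup>2 \<le> (\<Sum>i\<in>I. (\<xi> i w)\<^sup>2)" if w: "w \<in> ?E" for w
      proof -
        have "ereal c < ?L" using q1(1) by (simp add: c_def ereal_uminus_less_reorder)
        also have "?L \<le> quad_rate I F (F (\<lambda>i. sqrt \<epsilon> * \<xi> i w))" using w by (intro INF_lower) auto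
        also have "\<dots> \<le> ereal ((\<Sum>i\<in>I. (sqrt \<epsilon> * \<xi> i w)\<^sup>2) / 2)" by (rule quad_rate_le)
        finally have "c < (\<Sum>i\<in>I. (sqrt \<epsilon> * \<xi> i w)\<^sup>2) / 2" by simp
        also have "(\<Sum>i\<in>I. (sqrt \<epsilon> * \<xi> i w)\<^sup>2) = \<epsilon> * (\<Sum>i\<in>I. (\<xi> i w)\<^sup>2)"
          using \<epsilon> by (simp add: power_mult_distrib sum_distrib_left)
        finally show ?thesis using \<epsilon> c by (simp add: field_simps)
      qed
      have "?P \<epsilon> \<le> C * exp (- (((1 - \<delta>) * sqrt (2 * c / \<epsilon>))\<^sup>2 / 2))"
        by (rule C(2)[OF _ E R]) (use c \<epsilon> in auto)
      also have "((1 - \<delta>) * sqrt (2 * c / \<epsilon>))\<^sup>2 / 2 = ((1 - \<delta>)\<^sup>2 * c) / \<epsilon>"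
        using c \<epsilon> by (simp add: power_mult_distrib)
      finally have "ereal \<epsilon> * elog (?P \<epsilon>) \<le> ereal (\<epsilon> * ln C - (1 - \<delta>)\<^sup>2 * c)"
        by (intro scaled_elog_le) (use C(1) \<epsilon> in auto)
      also have "\<dots> \<le> ereal (\<epsilon> * ln C + q)" using K by simp
      finally show ?thesis .
    qed
    have "((\<lambda>\<epsilon>. \<epsilon> * ln C + q) \<longlongrightarrow> 0 * ln C + q) (at_right 0)"
      by (intro tendsto_intros)
    then have "((\<lambda>\<epsilon>. ereal (\<epsilon> * ln C + q)) \<longlongrightarrow> ereal q) (at_right 0)" by simp
    from order_tendstoD(2)[OF this q(2)] pos show ?thesis
      by eventually_elim (use bound in \<open>auto intro: order_trans less_imp_le\<close>)
  qed
  then show "Limsup (at_right 0) (\<lambda>\<epsilon>. ereal \<epsilon> * elog (?P \<epsilon>)) \<le> x" by (rule Limsup_bounded)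
qed

lemma coord_continuous_nbhd:
  assumes I: "finite I" and F: "coord_continuous I F" and G: "open G" and c: "F c \<in> G"
  obtains \<delta> where "0 < \<delta>" "\<And>x. (\<Sum>i\<in>I. (x i - c i)\<^sup>2) < \<delta>\<^sup>2 \<Longrightarrow> F x \<in> G"
proof -
  have "\<exists>n::nat. \<forall>x. (\<Sum>i\<in>I. (x i - c i)\<^sup>2) < (inverse (real (Suc n)))\<^sup>2 \<longrightarrow> F x \<in> G"
  proof (rule ccontr)
    assume "\<not> ?thesis"
    then obtain x where x: "\<And>n::nat. (\<Sum>i\<in>I. (x n i - c i)\<^sup>2) < (inverse (real (Suc n)))\<^sup>2" "\<And>n. F (x n) \<notin> G"
      by metis
    have "(\<lambda>n. x n i) \<longlonglongrightarrow> c i" if i: "i \<in> I" for i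
    proof -
      have "\<bar>x n i - c i\<bar> \<le> inverse (real (Suc n))" for n
      proof -
        have "(x n i - c i)\<^sup>2 \<le> (\<Sum>i\<in>I. (x n i - c i)\<^sup>2)" using I i by (intro member_le_sum) auto
        then have "(x n i - c i)\<^sup>2 \<le> (inverse (real (Suc n)))\<^sup>2" using x(1)[of n] by linarith
        then show ?thesis by (simp add: abs_le_square_iff[symmetric] del: of_nat_Suc)
      qed
      then have "(\<lambda>n. x n i - c i) \<longlonglongrightarrow> 0"
        by (intro Lim_null_comparison[OF _ LIMSEQ_inverse_real_of_nat]) auto
      then show ?thesis by (simp add: LIM_zero_iff)
    qed
    then have "(\<lambda>n. F (x n)) \<longlonglongrightarrow> F c" by (rule coord_continuousD[OF F])
    then have "\<forall>\<^sub>F n in sequentially. F (x n) \<in> G" by (rule topological_tendstoD[OF _ G c])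
    then show False using x(2) by simp
  qed
  then obtain n :: nat where "\<forall>x. (\<Sum>i\<in>I. (x i - c i)\<^sup>2) < (inverse (real (Suc n)))\<^sup>2 \<longrightarrow> F x \<in> G" by blast
  then show ?thesis by (intro that[of "inverse (real (Suc n))"]) auto
qed

text \<open>A half-space takes the place of a ball around \<open>c\<close>. If the scaled vector
  \<open>x\<close> has inner product at least \<open>|c|^2\<close> with \<open>c\<close> and
  \<open>|x|^2 < |c|^2 + \<delta>^2\<close>, then \<open>|x - c| < \<delta>\<close>, so
  \<open>F x\<close> lies in \<open>U\<close>. The half-space has the right exponential cost
  \<open>|c|^2 / 2\<close>, and vectors violating the second bound are exponentially rarer.\<close>

lemma gaussian_LDP_lower:
  assumes G: "standard_gaussian M I \<xi>" and I: "finite I" and F: "coord_continuous I F"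
    and meas: "\<And>\<epsilon>. 0 < \<epsilon> \<Longrightarrow> (\<lambda>w. F (\<lambda>i. sqrt \<epsilon> * \<xi> i w)) \<in> borel_measurable M"
    and \<xi>m: "\<And>i. i \<in> I \<Longrightarrow> \<xi> i \<in> borel_measurable M"
    and U: "open U" and c: "F c \<in> U"
  shows "- ereal ((\<Sum>i\<in>I. (c i)\<^sup>2) / 2) \<le>
    Liminf (at_right 0) (\<lambda>\<epsilon>. ereal \<epsilon> * elog (measure M {w \<in> space M. F (\<lambda>i. sqrt \<epsilon> * \<xi> i w) \<in> U}))"
proof (rule dense_le)
  interpret prob_space M using G by (simp add: standard_gaussian_def)
  let ?P = "\<lambda>\<epsilon>. prob {w \<in> space M. F (\<lambda>i. sqrt \<epsilon> * \<xi> i w) \<in> U}"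
  have pos: "\<forall>\<^sub>F \<epsilon>::real in at_right 0. 0 < \<epsilon>" by (rule eventually_at_right_less)
  define e where "e = (\<Sum>i\<in>I. (c i)\<^sup>2)"
  have e0: "0 \<le> e" by (simp add: e_def sum_nonneg)
  obtain \<delta> where \<delta>: "0 < \<delta>" "\<And>x. (\<Sum>i\<in>I. (x i - c i)\<^sup>2) < \<delta>\<^sup>2 \<Longrightarrow> F x \<in> U"
    using coord_continuous_nbhd[OF I F U c] by metis
  define D where "D = e + \<delta>\<^sup>2"
  have D: "0 < D" "e < D" using e0 \<delta> by (auto simp: D_def add_nonneg_pos)
  \<comment> \<open>Gives \<open>(1 - 2 * \<eta>) * D = e + \<delta>^2 / 2\<close>, so the loss in
    the ball tail uses up only half of the advantage \<open>\<delta>^2\<close>.\<close>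
  define \<eta> where "\<eta> = \<delta>\<^sup>2 / (4 * D)"
  have \<eta>: "0 < \<eta>" "\<eta> < 1" using D \<delta> e0 by (auto simp: \<eta>_def D_def field_simps add_nonneg_pos)
  have "(1 - 2 * \<eta>) * D = e + \<delta>\<^sup>2 / 2" using D by (simp add: \<eta>_def left_diff_distrib) (simp add: D_def)
  then have K: "e + \<delta>\<^sup>2 / 2 \<le> (1 - \<eta>)\<^sup>2 * D" using mult_right_mono[OF square_ge_linear[of \<eta>], of D] D by simp
  obtain C where C: "1 \<le> C" "\<And>R A. 0 < R \<Longrightarrow> A \<in> sets M \<Longrightarrow> (\<And>w. w \<in> A \<Longrightarrow> R\<^sup>2 \<le> (\<Sum>i\<in>I. (\<xi> i w)\<^sup>2)) \<Longrightarrow>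
      measure M A \<le> C * exp (- (((1 - \<eta>) * R)\<^sup>2 / 2))"
    using standard_gaussian_ball_tail[OF G I \<eta>] by metis
  define k where "k = 1 / sqrt (2 * pi)"
  have k: "0 < k" by (simp add: k_def)
  \<comment> \<open>The lower-order part of the half-space exponent: \<open>(sqrt e / sqrt
    \<epsilon> + 1)^2 / 2 = (e / 2 + h \<epsilon>) / \<epsilon>\<close>.\<close>
  define h where "h \<epsilon> = sqrt e * sqrt \<epsilon> + \<epsilon> / 2" for \<epsilon>
  \<comment> \<open>Once \<open>\<epsilon>\<close> is small, long vectors take away at most half of
    the lower bound for the half-space, hence the prefactor \<open>k / 2\<close>.\<close>
  have bound: "k / 2 * exp (- ((e / 2 + h \<epsilon>) / \<epsilon>)) \<le> ?P \<epsilon>"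
    if \<epsilon>: "0 < \<epsilon>" and small: "h \<epsilon> + \<epsilon> * (ln C - ln (k / 2)) < \<delta>\<^sup>2 / 4" for \<epsilon>
  proof -
    let ?H = "{w \<in> space M. (\<Sum>i\<in>I. (c i)\<^sup>2) \<le> sqrt \<epsilon> * (\<Sum>i\<in>I. c i * \<xi> i w)}"
    let ?B = "{w \<in> space M. D / \<epsilon> \<le> (\<Sum>i\<in>I. (\<xi> i w)\<^sup>2)}"
    let ?E = "{w \<in> space M. F (\<lambda>i. sqrt \<epsilon> * \<xi> i w) \<in> U}"
    have E: "?E \<in> sets M"
      using measurable_sets[OF meas[OF \<epsilon>] borel_open[OF U]] by (simp add: vimage_def Int_def conj_commute)
    have B: "?B \<in> sets M" using \<xi>m by measurable
    have H: "?H \<in> sets M" using \<xi>m by measurable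
    have "?H \<subseteq> ?E \<union> ?B"
    proof
      fix w assume w: "w \<in> ?H"
      show "w \<in> ?E \<union> ?B"
      proof (cases "w \<in> ?B")
        case False
        then have "(\<Sum>i\<in>I. (\<xi> i w)\<^sup>2) < D / \<epsilon>" using w by auto
        then have 1: "\<epsilon> * (\<Sum>i\<in>I. (\<xi> i w)\<^sup>2) < D" using \<epsilon> by (simp add: pos_less_divide_eq mult.commute)
        have "(\<Sum>i\<in>I. (sqrt \<epsilon> * \<xi> i w - c i)\<^sup>2) = (\<Sum>i\<in>I. \<epsilon> * (\<xi> i w)\<^sup>2 - 2 * (sqrt \<epsilon> * (c i * \<xi> i w)) + (c i)\<^sup>2)"
          using \<epsilon> by (intro sum.cong refl) (simp add: power2_diff power_mult_distrib mult_ac)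
        also have "\<dots> = \<epsilon> * (\<Sum>i\<in>I. (\<xi> i w)\<^sup>2) - 2 * (sqrt \<epsilon> * (\<Sum>i\<in>I. c i * \<xi> i w)) + e"
          by (simp add: sum.distrib sum_subtractf sum_distrib_left e_def)
        finally have "(\<Sum>i\<in>I. (sqrt \<epsilon> * \<xi> i w - c i)\<^sup>2) < \<delta>\<^sup>2" using w 1 by (simp add: D_def e_def)
        then show ?thesis using \<delta>(2) w by auto
      qed simp
    qed
    then have "prob ?H \<le> prob (?E \<union> ?B)" using E B by (intro finite_measure_mono) auto
    also have "\<dots> \<le> prob ?E + prob ?B" using E B by (intro measure_Un_le)
    finally have 1: "prob ?H - prob ?B \<le> ?P \<epsilon>" by simp
    have "k * exp (- ((sqrt e / sqrt \<epsilon> + 1)\<^sup>2 / 2)) \<le> prob ?H"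
      using standard_gaussian_half_space[OF G I, of "sqrt \<epsilon>" c] \<epsilon> by (simp add: e_def k_def)
    also have "(sqrt e / sqrt \<epsilon> + 1)\<^sup>2 / 2 = (e / 2 + h \<epsilon>) / \<epsilon>"
    proof -
      have "sqrt e * sqrt \<epsilon> / \<epsilon> = sqrt e / sqrt \<epsilon>" using \<epsilon> by (simp add: real_div_sqrt field_simps)
      then show ?thesis using \<epsilon> e0 by (simp add: h_def power2_sum power_divide add_divide_distrib)
    qed
    finally have 2: "k * exp (- ((e / 2 + h \<epsilon>) / \<epsilon>)) \<le> prob ?H" .
    have "prob ?B \<le> C * exp (- (((1 - \<eta>) * sqrt (D / \<epsilon>))\<^sup>2 / 2))"
      by (rule C(2)[OF _ B]) (use D \<epsilon> in auto)
    also have "\<dots> \<le> k / 2 * exp (- ((e / 2 + h \<epsilon>) / \<epsilon>))"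
    proof -
      have "(e + \<delta>\<^sup>2 / 2) / \<epsilon> \<le> ((1 - \<eta>)\<^sup>2 * D) / \<epsilon>" using K \<epsilon> by (intro divide_right_mono) auto
      moreover have "((1 - \<eta>) * sqrt (D / \<epsilon>))\<^sup>2 = ((1 - \<eta>)\<^sup>2 * D) / \<epsilon>"
        using D \<epsilon> by (simp add: power_mult_distrib)
      moreover have "(e / 2 + \<delta>\<^sup>2 / 4) / \<epsilon> = (e + \<delta>\<^sup>2 / 2) / \<epsilon> / 2" by (simp add: add_divide_distrib)
      ultimately have a: "(e / 2 + \<delta>\<^sup>2 / 4) / \<epsilon> \<le> ((1 - \<eta>) * sqrt (D / \<epsilon>))\<^sup>2 / 2"
        using divide_right_mono[of "(e + \<delta>\<^sup>2 / 2) / \<epsilon>" "(1 - \<eta>)\<^sup>2 * D / \<epsilon>" 2] by simp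
      have "(h \<epsilon> + \<epsilon> * (ln C - ln (k / 2))) / \<epsilon> \<le> (\<delta>\<^sup>2 / 4) / \<epsilon>"
        using small \<epsilon> by (intro divide_right_mono) auto
      then have b: "ln C - ln (k / 2) \<le> \<delta>\<^sup>2 / 4 / \<epsilon> - h \<epsilon> / \<epsilon>" using \<epsilon> by (simp add: add_divide_distrib)
      have "ln C - ((1 - \<eta>) * sqrt (D / \<epsilon>))\<^sup>2 / 2 \<le> ln (k / 2) - (e / 2 + h \<epsilon>) / \<epsilon>"
        using a b unfolding add_divide_distrib by linarith
      then have "exp (ln C - ((1 - \<eta>) * sqrt (D / \<epsilon>))\<^sup>2 / 2) \<le> exp (ln (k / 2) - (e / 2 + h \<epsilon>) / \<epsilon>)"
        by simp
      also have "exp (ln C - ((1 - \<eta>) * sqrt (D / \<epsilon>))\<^sup>2 / 2) = C * exp (- (((1 - \<eta>) * sqrt (D / \<epsilon>))\<^sup>2 / 2))"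
        unfolding exp_diff exp_ln[OF less_le_trans[OF zero_less_one C(1)]] exp_minus by (simp only: divide_inverse)
      also have "exp (ln (k / 2) - (e / 2 + h \<epsilon>) / \<epsilon>) = k / 2 * exp (- ((e / 2 + h \<epsilon>) / \<epsilon>))"
        unfolding exp_diff exp_ln[OF half_gt_zero[OF k]] exp_minus by (simp only: divide_inverse)
      finally show ?thesis .
    qed
    finally show ?thesis using 1 2 by simp
  qed
  have h0: "(h \<longlongrightarrow> 0) (at_right 0)"
  proof -
    have "((\<lambda>\<epsilon>. sqrt e * sqrt \<epsilon> + \<epsilon> / 2) \<longlongrightarrow> sqrt e * sqrt 0 + 0 / 2) (at_right 0)"
      by (intro tendsto_intros) auto
    then show ?thesis by (simp add: h_def[abs_def])
  qed
  fix x assume x: "x < - ereal ((\<Sum>i\<in>I. (c i)\<^sup>2) / 2)"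
  have "((\<lambda>\<epsilon>. h \<epsilon> + \<epsilon> * (ln C - ln (k / 2))) \<longlongrightarrow> 0 + 0 * (ln C - ln (k / 2))) (at_right 0)"
    by (intro tendsto_intros h0)
  then have ev1: "\<forall>\<^sub>F \<epsilon> in at_right 0. h \<epsilon> + \<epsilon> * (ln C - ln (k / 2)) < \<delta>\<^sup>2 / 4"
    by (rule order_tendstoD) (use \<delta> in simp)
  have "((\<lambda>\<epsilon>. \<epsilon> * ln (k / 2) - (e / 2 + h \<epsilon>)) \<longlongrightarrow> 0 * ln (k / 2) - (e / 2 + 0)) (at_right 0)"
    by (intro tendsto_intros h0)
  then have "((\<lambda>\<epsilon>. ereal (\<epsilon> * ln (k / 2) - (e / 2 + h \<epsilon>))) \<longlongrightarrow> ereal (- (e / 2))) (at_right 0)" by simp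
  then have ev2: "\<forall>\<^sub>F \<epsilon> in at_right 0. x < ereal (\<epsilon> * ln (k / 2) - (e / 2 + h \<epsilon>))"
    by (rule order_tendstoD) (use x in \<open>simp add: e_def\<close>)
  have "\<forall>\<^sub>F \<epsilon> in at_right 0. x \<le> ereal \<epsilon> * elog (?P \<epsilon>)"
    using pos ev1 ev2
  proof eventually_elim
    case (elim \<epsilon>)
    have "x \<le> ereal (\<epsilon> * ln (k / 2) - (e / 2 + h \<epsilon>))" using elim(3) by (rule less_imp_le)
    also have "\<epsilon> * ln (k / 2) - (e / 2 + h \<epsilon>) = \<epsilon> * (ln (k / 2) - (e / 2 + h \<epsilon>) / \<epsilon>)"
      by (simp only: right_diff_distrib times_divide_eq_right nonzero_mult_div_cancel_left[OF less_imp_neq[OF elim(1), symmetric]])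
    also have "ereal (\<epsilon> * (ln (k / 2) - (e / 2 + h \<epsilon>) / \<epsilon>)) \<le> ereal \<epsilon> * elog (?P \<epsilon>)"
      by (rule scaled_elog_ge[OF bound[OF elim(1,2)]]) (use k elim(1) in auto)
    finally show ?case .
  qed
  then show "x \<le> Liminf (at_right 0) (\<lambda>\<epsilon>. ereal \<epsilon> * elog (?P \<epsilon>))" by (rule Liminf_bounded)
qed

lemma standard_gaussian_component:
  assumes G: "standard_gaussian M I \<xi>" and I: "finite I" and i: "i \<in> I"
  shows "\<xi> i \<in> borel_measurable M"
proof -
  have "(\<Sum>j\<in>I. (if j = i then 1 else 0) * \<xi> j w) = \<xi> i w" for w
    using I i by (simp add: if_distrib[of "\<lambda>x. x * _"] cong: if_cong)
  then show ?thesis using standard_gaussian_measurable[OF G, of "\<lambda>j. if j = i then 1 else 0"] by simp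
qed

lemma gaussian_LDP:
  assumes G: "standard_gaussian M I \<xi>" and I: "finite I" and F: "coord_continuous I F"
    and meas: "\<And>\<epsilon>. 0 < \<epsilon> \<Longrightarrow> (\<lambda>w. F (\<lambda>i. sqrt \<epsilon> * \<xi> i w)) \<in> borel_measurable M"
  shows "satisfies_LDP M (\<lambda>\<epsilon> w. F (\<lambda>i. sqrt \<epsilon> * \<xi> i w)) (quad_rate I F)"
  unfolding satisfies_LDP_def
proof (intro conjI allI impI)
  fix U :: "real set" assume U: "open U"
  let ?L = "Liminf (at_right 0) (\<lambda>\<epsilon>. ereal \<epsilon> * elog (measure M {w \<in> space M. F (\<lambda>i. sqrt \<epsilon> * \<xi> i w) \<in> U}))"
  have "- ?L \<le> (INF y\<in>U. quad_rate I F y)"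
  proof (rule INF_greatest)
    fix y assume y: "y \<in> U"
    show "- ?L \<le> quad_rate I F y"
      unfolding quad_rate_def
    proof (rule Inf_greatest)
      fix z assume "z \<in> {ereal ((\<Sum>i\<in>I. (c i)\<^sup>2) / 2) | c. F c = y}"
      then obtain c where "z = ereal ((\<Sum>i\<in>I. (c i)\<^sup>2) / 2)" "F c = y" by blast
      then show "- ?L \<le> z" using gaussian_LDP_lower[OF G I F meas standard_gaussian_component[OF G I] U, of c] y
        by (simp add: ereal_uminus_le_reorder)
    qed
  qed
  then show "- (INF y\<in>U. quad_rate I F y) \<le> ?L" by (simp add: ereal_uminus_le_reorder)
qed (use meas gaussian_LDP_upper[OF G I meas] in auto)

section \<open>The scheme as a function of the cell noises\<close>

lemma emeasure_Ico_Ioo: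
  fixes a b t :: real
  assumes "0 \<le> a" "a \<le> b" "0 \<le> t"
  shows "emeasure lborel ({a..<b} \<inter> {0<..<t}) = ennreal (min b t - min a t)"
proof -
  have "emeasure lborel ({a..<b} \<inter> {0<..<t}) = emeasure lborel {min a t..<min b t}"
  proof (rule emeasure_eq_AE)
    show "AE x in lborel. x \<in> {a..<b} \<inter> {0<..<t} \<longleftrightarrow> x \<in> {min a t..<min b t}"
      using AE_lborel_singleton[of 0] by eventually_elim (use assms in \<open>auto simp: min_def split: if_splits\<close>)
  qed auto
  then show ?thesis using assms by (simp add: min_def)
qed

lemma sets_space_cell [measurable, simp]: "space_cell n k \<in> sets borel"
proof -
  have "space_cell n k = cube \<inter> (\<Inter>l. {z. real (k l) * dx n \<le> z $ l} \<inter> {z. z $ l < (real (k l) + 1) * dx n})"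
    by (auto simp: space_cell_def)
  also have "\<dots> \<in> sets borel"
  proof (intro sets.Int sets_cube sets.finite_INT)
    show "{z. real (k l) * dx n \<le> z $ l} \<in> sets borel" for l
      by (intro borel_closed closed_Collect_le continuous_intros)
    show "{z. z $ l < (real (k l) + 1) * dx n} \<in> sets borel" for l
      by (intro borel_open open_Collect_less continuous_intros)
  qed auto
  finally show ?thesis .
qed

text \<open>Cells are half-open and cut with the open cube, so those at the lower faces have a
  different shape; the open and the closed box enclosing them from inside and outside have the same
  volume.\<close>

lemma emeasure_space_cell:
  fixes k :: "'d::finite \<Rightarrow> nat"
  assumes n: "0 < n" and k: "k \<in> cell_idx n"
  shows "emeasure lborel (space_cell n k) = ennreal (dx n ^ CARD('d))"
proof -
  let ?l = "grid_pt n k" and ?u = "grid_pt n (\<lambda>l. k l + 1)"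
  have d: "0 < dx n" using n by simp
  have "(real (k l) + 1) * dx n \<le> pi" for l
  proof -
    have "real (k l) + 1 \<le> real n" using k by (auto simp: cell_idx_def dest!: spec[of _ l])
    then have "(real (k l) + 1) * dx n \<le> real n * dx n" using less_imp_le[OF d] by (rule mult_right_mono)
    then show ?thesis using n_dx[OF n] by simp
  qed
  note up = this
  have lo: "0 \<le> real (k l) * dx n" for l using d by simp
  have 1: "box ?l ?u \<subseteq> space_cell n k"
  proof
    fix z assume "z \<in> box ?l ?u"
    then have b: "real (k l) * dx n < z $ l" "z $ l < (real (k l) + 1) * dx n" for l
      by (simp_all add: mem_box_cart grid_pt_def mult.commute add.commute)
    have "0 < z $ l \<and> z $ l < pi \<and> real (k l) * dx n \<le> z $ l \<and> z $ l < (real (k l) + 1) * dx n" for l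
      using b[of l] up[of l] lo[of l] by linarith
    then show "z \<in> space_cell n k" by (simp add: space_cell_def cube_def)
  qed
  have 2: "space_cell n k \<subseteq> cbox ?l ?u"
    by (force simp: mem_box_cart grid_pt_def space_cell_def mult.commute add.commute less_le)
  have le: "?l \<bullet> b \<le> ?u \<bullet> b" and diff: "(?u - ?l) \<bullet> b = dx n" if "b \<in> Basis" for b
    using that d by (auto simp: Basis_vec_def grid_pt_def inner_axis inner_diff_left algebra_simps)
  have "(\<Prod>b\<in>Basis. (?u - ?l) \<bullet> b) = dx n ^ CARD('d)"
    using diff by (simp add: inner_diff_left)
  then have "emeasure lborel (box ?l ?u) = ennreal (dx n ^ CARD('d))" "emeasure lborel (cbox ?l ?u) = ennreal (dx n ^ CARD('d))"
    using le by (simp_all add: emeasure_lborel_box emeasure_lborel_cbox)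
  then show ?thesis
    using emeasure_mono[OF 1, of lborel] emeasure_mono[OF 2, of lborel] by (simp add: antisym)
qed

lemma kappa_idem: "0 < n \<Longrightarrow> kappa n (kappa n z) = kappa n z"
  by (simp add: vec_eq_iff grid_floor_def dx_def)

lemma green_disc_kappa: "0 < n \<Longrightarrow> green_disc T M n t s x (kappa n z) = green_disc T M n t s x z"
  by (simp add: green_disc_def kappa_idem)

context spde begin

section \<open>Space-time cells and the equations as finite recursions\<close>

definition idx :: "nat \<Rightarrow> (nat \<times> ('d \<Rightarrow> nat)) set" where
  "idx n = {..<m n} \<times> cell_idx n"

definition gpt :: "nat \<Rightarrow> nat \<times> ('d \<Rightarrow> nat) \<Rightarrow> real \<times> (real ^ 'd)" where
  "gpt n i = (real (fst i) * \<tau> n, grid_pt n (snd i))"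

definition elapsed :: "nat \<Rightarrow> nat \<times> ('d \<Rightarrow> nat) \<Rightarrow> real \<Rightarrow> real" where
  "elapsed n i t = min (real (fst i + 1) * \<tau> n) t - min (real (fst i) * \<tau> n) t"

definition cell_at :: "nat \<Rightarrow> nat \<times> ('d \<Rightarrow> nat) \<Rightarrow> real \<Rightarrow> (real \<times> (real ^ 'd)) set" where
  "cell_at n i t = ({real (fst i) * \<tau> n..<real (fst i + 1) * \<tau> n} \<inter> {0<..<t}) \<times> space_cell n (snd i)"

definition vol :: "nat \<Rightarrow> real" where
  "vol n = \<tau> n * dx n ^ CARD('d)"

lemma finite_idx [simp]: "finite (idx n)"
  by (simp add: idx_def)

lemma vol_pos: "2 \<le> n \<Longrightarrow> 0 < vol n"
  using tau_pos[of n] by (simp add: vol_def)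

lemma gpt_inj: "2 \<le> n \<Longrightarrow> gpt n i = gpt n i' \<longleftrightarrow> i = i'"
  using tau_pos[of n] grid_pt_inj[of n "snd i" "snd i'"] by (auto simp: gpt_def prod_eq_iff)

lemma gpt_in_Q:
  assumes n: "2 \<le> n" and i: "i \<in> idx n"
  shows "gpt n i \<in> Q"
proof -
  have "real (fst i) * \<tau> n \<le> real (m n) * \<tau> n" using i tau_pos[OF n] by (intro mult_right_mono) (auto simp: idx_def)
  moreover have d: "0 \<le> dx n" using dx_pos[OF n_pos[OF n]] by simp
  have "dx n * real (snd i l) \<le> dx n * real n" for l
    using i d by (intro mult_left_mono) (auto simp: idx_def cell_idx_def less_imp_le)
  then have "dx n * real (snd i l) \<le> pi" for l using n_dx[OF n_pos[OF n]] by (simp add: mult.commute)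
  ultimately show ?thesis using tau_pos[OF n] m_tau[OF n] d
    by (auto simp: gpt_def mem_closed_cyl grid_pt_def)
qed

lemma elapsed_zero: "2 \<le> n \<Longrightarrow> t \<le> real (fst i) * \<tau> n \<Longrightarrow> elapsed n i t = 0"
  using tau_pos[of n] by (auto simp: elapsed_def min_def algebra_simps)

lemma elapsed_full: "2 \<le> n \<Longrightarrow> fst i < j \<Longrightarrow> elapsed n i (real j * \<tau> n) = \<tau> n"
proof -
  assume n: "2 \<le> n" and j: "fst i < j"
  have "real (fst i + 1) * \<tau> n \<le> real j * \<tau> n" using j tau_pos[OF n] by (intro mult_right_mono) auto
  moreover have "real (fst i) * \<tau> n \<le> real (fst i + 1) * \<tau> n" using tau_pos[OF n] by (intro mult_right_mono) auto
  ultimately have "min (real (fst i + 1) * \<tau> n) (real j * \<tau> n) = real (fst i + 1) * \<tau> n"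
    "min (real (fst i) * \<tau> n) (real j * \<tau> n) = real (fst i) * \<tau> n" by linarith+
  then show ?thesis unfolding elapsed_def by (simp add: algebra_simps)
qed

lemma elapsed_T: "2 \<le> n \<Longrightarrow> i \<in> idx n \<Longrightarrow> elapsed n i T = \<tau> n"
  using elapsed_full[of n i "m n"] m_tau[of n] by (auto simp: idx_def)

lemma proj_cell_at:
  assumes n: "2 \<le> n" and t: "t \<le> T" and q: "q \<in> cell_at n i t"
  shows "proj n q = gpt n i"
proof -
  have "q \<in> cellset n (fst i) (snd i)"
    using q t by (auto simp: cell_at_def cellset_def cyl_def space_cell_def)
  from proj_cell[OF n this] show ?thesis by (simp add: gpt_def)
qed

lemma cell_at_ex:
  assumes n: "2 \<le> n" and t: "t \<le> T" and q: "q \<in> {0<..<t} \<times> cube"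
  obtains i where "i \<in> idx n" "q \<in> cell_at n i t"
proof -
  have "q \<in> cyl T" using q t by (auto simp: cyl_def)
  then obtain j k where "j < m n" "k \<in> cell_idx n" "q \<in> cellset n j k" using cell_ex[OF n] by blast
  then show ?thesis using q by (intro that[of "(j, k)"]) (auto simp: idx_def cell_at_def cellset_def)
qed

text \<open>Every point of the domain lies in exactly one cell, so the integrand is a finite sum of
  indicators of cells, each cut off at the time \<open>t\<close>.\<close>

lemma grid_integral:
  assumes n: "2 \<le> n" and t: "0 \<le> t" "t \<le> T"
  shows "set_lebesgue_integral lborel ({0<..<t} \<times> cube) (\<lambda>q. g (proj n q)) =
    (\<Sum>i\<in>idx n. g (gpt n i) * (dx n ^ CARD('d) * elapsed n i t))"
proof -
  have eq: "indicator ({0<..<t} \<times> cube) q *\<^sub>R g (proj n q) = (\<Sum>i\<in>idx n. indicator (cell_at n i t) q * g (gpt n i))"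
    (is "?L = ?R") for q :: "real \<times> (real ^ 'd)"
  proof (cases "q \<in> {0<..<t} \<times> cube")
    case True
    then obtain i0 where i0: "i0 \<in> idx n" "q \<in> cell_at n i0 t" using cell_at_ex[OF n t(2)] by blast
    have "?R = (\<Sum>i\<in>idx n. if i = i0 then g (gpt n i0) else 0)"
    proof (rule sum.cong)
      fix i
      show "indicator (cell_at n i t) q * g (gpt n i) = (if i = i0 then g (gpt n i0) else 0)"
      proof (cases "i = i0")
        case False
        have "q \<notin> cell_at n i t"
        proof
          assume "q \<in> cell_at n i t"
          then have "gpt n i = gpt n i0"
            using proj_cell_at[OF n t(2)] proj_cell_at[OF n t(2) i0(2)] by metis
          then show False using False gpt_inj[OF n] by blast
        qed
        then show ?thesis using False by simp
      qed (use i0(2) in simp)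
    qed simp
    also have "\<dots> = ?L" using True i0 proj_cell_at[OF n t(2) i0(2)] by simp
    finally show ?thesis by simp
  next
    case False
    then have "q \<notin> cell_at n i t" for i by (auto simp: cell_at_def space_cell_def)
    then show ?thesis using False by simp
  qed
  have meas: "cell_at n i t \<in> sets borel" for i
    unfolding cell_at_def borel_prod[symmetric] by (intro pair_measureI) auto
  have em: "emeasure lborel (cell_at n i t) = ennreal (dx n ^ CARD('d) * elapsed n i t)" if i: "i \<in> idx n" for i
  proof -
    have k: "snd i \<in> cell_idx n" using i by (auto simp: idx_def)
    have "0 \<le> real (fst i) * \<tau> n" "real (fst i) * \<tau> n \<le> real (fst i + 1) * \<tau> n"
      using tau_pos[OF n] by (auto intro!: mult_right_mono)
    note e = emeasure_Ico_Ioo[OF this t(1)]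
    have "emeasure lborel (cell_at n i t) =
      emeasure lborel ({real (fst i) * \<tau> n..<real (fst i + 1) * \<tau> n} \<inter> {0<..<t}) * emeasure lborel (space_cell n (snd i))"
      unfolding cell_at_def lborel_prod[symmetric] by (rule lborel.emeasure_pair_measure_Times) auto
    also have "\<dots> = ennreal (elapsed n i t) * ennreal (dx n ^ CARD('d))"
      by (simp only: e elapsed_def emeasure_space_cell[OF n_pos[OF n] k])
    finally show ?thesis using n by (subst (asm) ennreal_mult''[symmetric]) (auto simp: mult.commute less_imp_le)
  qed
  have nn: "0 \<le> elapsed n i t" for i using tau_pos[OF n] by (auto simp: elapsed_def min_def algebra_simps)
  have "set_lebesgue_integral lborel ({0<..<t} \<times> cube) (\<lambda>q. g (proj n q)) =
      (\<integral>q. (\<Sum>i\<in>idx n. indicator (cell_at n i t) q * g (gpt n i)) \<partial>lborel)"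
    unfolding set_lebesgue_integral_def eq ..
  also have "\<dots> = (\<Sum>i\<in>idx n. \<integral>q. indicator (cell_at n i t) q * g (gpt n i) \<partial>lborel)"
    by (intro Bochner_Integration.integral_sum integrable_mult_left integrable_real_indicator) (use meas em in auto)
  also have "\<dots> = (\<Sum>i\<in>idx n. g (gpt n i) * (dx n ^ CARD('d) * elapsed n i t))"
    using meas em nn n by (intro sum.cong refl) (simp add: measure_def less_imp_le)
  finally show ?thesis .
qed

text \<open>Both the skeleton equation for a cellwise constant control and the numerical scheme are of the
  form \<open>u = Phi n \<zeta> u\<close>, where \<open>\<zeta> i t\<close> is the amount of control or noise accumulated in cell \<open>i\<close> up to
  time \<open>t\<close>.\<close>

definition Phi :: "nat \<Rightarrow> (nat \<times> ('d \<Rightarrow> nat) \<Rightarrow> real \<Rightarrow> real) \<Rightarrow> (real \<times> (real ^ 'd) \<Rightarrow> real) \<Rightarrow> real \<times> (real ^ 'd) \<Rightarrow> real" where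
  "Phi n \<zeta> v p = (\<Sum>i\<in>idx n. green_disc T (m n) n (fst p) (fst (gpt n i)) (snd p) (snd (gpt n i)) *
     (b (v (gpt n i)) * (dx n ^ CARD('d) * elapsed n i (fst p)) + \<sigma> (v (gpt n i)) * \<zeta> i (fst p)))"

text \<open>Cells that have not started before time \<open>t\<close> carry no noise; with
  \<open>elapsed_zero\<close> this removes all terms of \<open>Phi\<close> that would involve
  present or later values of the path.\<close>

definition adapted :: "nat \<Rightarrow> (nat \<times> ('d \<Rightarrow> nat) \<Rightarrow> real \<Rightarrow> real) \<Rightarrow> bool" where
  "adapted n \<zeta> \<longleftrightarrow> (\<forall>i t. t \<le> real (fst i) * \<tau> n \<longrightarrow> \<zeta> i t = 0)"

lemma Phi_cong:
  assumes n: "2 \<le> n" and \<zeta>: "adapted n \<zeta>" and eq: "\<And>i. i \<in> idx n \<Longrightarrow> \<zeta> i (fst p) = \<zeta>' i (fst p)"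
    and vw: "\<And>i. i \<in> idx n \<Longrightarrow> real (fst i) * \<tau> n < fst p \<Longrightarrow> v (gpt n i) = w (gpt n i)"
  shows "Phi n \<zeta> v p = Phi n \<zeta>' w p"
  unfolding Phi_def
proof (rule sum.cong)
  fix i assume i: "i \<in> idx n"
  show "green_disc T (m n) n (fst p) (fst (gpt n i)) (snd p) (snd (gpt n i)) *
     (b (v (gpt n i)) * (dx n ^ CARD('d) * elapsed n i (fst p)) + \<sigma> (v (gpt n i)) * \<zeta> i (fst p)) =
     green_disc T (m n) n (fst p) (fst (gpt n i)) (snd p) (snd (gpt n i)) *
     (b (w (gpt n i)) * (dx n ^ CARD('d) * elapsed n i (fst p)) + \<sigma> (w (gpt n i)) * \<zeta>' i (fst p))"
  proof (cases "real (fst i) * \<tau> n < fst p")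
    case False
    then have le: "fst p \<le> real (fst i) * \<tau> n" by simp
    have "elapsed n i (fst p) = 0" by (rule elapsed_zero[OF n le])
    moreover have "\<zeta> i (fst p) = 0" using \<zeta> le unfolding adapted_def by blast
    ultimately show ?thesis using eq[OF i] by simp
  qed (use eq[OF i] vw[OF i] in simp)
qed simp

lemma Phi_causal_0:
  assumes n: "2 \<le> n" and \<zeta>: "adapted n \<zeta>" and p: "p \<in> stage n 0"
  shows "Phi n \<zeta> v p = Phi n \<zeta> w p"
proof (rule Phi_cong[OF n \<zeta>])
  fix i :: "nat \<times> ('d \<Rightarrow> nat)" assume "real (fst i) * \<tau> n < fst p"
  then show "v (gpt n i) = w (gpt n i)"
    using p tau_pos[OF n] by (auto simp: stage_def mult_less_0_iff dest: less_le_trans)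
qed simp

lemma Phi_causal_Suc:
  assumes n: "2 \<le> n" and \<zeta>: "adapted n \<zeta>" and vw: "\<And>q. q \<in> stage n j \<Longrightarrow> v q = w q" and p: "p \<in> stage n (Suc j)"
  shows "Phi n \<zeta> v p = Phi n \<zeta> w p"
proof (rule Phi_cong[OF n \<zeta>])
  fix i assume i: "i \<in> idx n" and "real (fst i) * \<tau> n < fst p"
  then have "real (fst i) * \<tau> n < real (Suc j) * \<tau> n" using p by (auto simp: stage_def)
  then have "real (fst i) \<le> real j" using tau_pos[OF n] by simp
  then have "real (fst i) * \<tau> n \<le> real j * \<tau> n" using tau_pos[OF n] by (intro mult_right_mono) auto
  then show "v (gpt n i) = w (gpt n i)" using gpt_in_Q[OF n i] by (intro vw) (simp add: stage_def gpt_def)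
qed simp

text \<open>The control with coefficients \<open>c\<close> in the orthonormal family of normalized
  cell indicators, integrated over the elapsed part of each cell: its value there is
  \<open>c i / sqrt (vol n)\<close>, and the fraction \<open>elapsed n i t / \<tau> n\<close> of the
  volume \<open>vol n\<close> counts.\<close>

definition linear_noise :: "nat \<Rightarrow> (nat \<times> ('d \<Rightarrow> nat) \<Rightarrow> real) \<Rightarrow> nat \<times> ('d \<Rightarrow> nat) \<Rightarrow> real \<Rightarrow> real" where
  "linear_noise n c i t = sqrt (vol n) * (elapsed n i t / \<tau> n) * c i"

text \<open>The function \<open>F\<close> of the overview. For \<open>2 \<le> n\<close>, iterating
  \<open>Suc (m n)\<close> times from zero reaches the exact solution, and continuity and
  measurability in \<open>c\<close> follow by induction over this finite composition.\<close>

definition endpoint :: "nat \<Rightarrow> (nat \<times> ('d \<Rightarrow> nat) \<Rightarrow> real) \<Rightarrow> real" where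
  "endpoint n c = (Phi n (linear_noise n c) ^^ Suc (m n)) (\<lambda>_. 0) (T, x0)"

lemma adapted_linear_noise: "2 \<le> n \<Longrightarrow> adapted n (linear_noise n c)"
  by (simp add: adapted_def linear_noise_def elapsed_zero)

lemma Phi_exists:
  assumes n: "2 \<le> n" and \<zeta>: "adapted n \<zeta>" and p: "p \<in> Q"
  shows "(Phi n \<zeta> ^^ Suc (m n)) v p = Phi n \<zeta> ((Phi n \<zeta> ^^ Suc (m n)) v) p"
  by (rule causal_fixpoint_iterate[where A = "stage n", OF Phi_causal_0[OF n \<zeta>] Phi_causal_Suc[OF n \<zeta>]])
     (use p in \<open>simp_all add: stage_m[OF n]\<close>)

text \<open>Only noise accumulated up to grid times influences the values at grid times, in
  particular at \<open>T\<close>. Hence the sheet, whose increments are not linear in time within a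
  cell, may be replaced by \<open>linear_noise\<close>.\<close>

lemma endpoint_eq:
  assumes n: "2 \<le> n" and u: "\<And>p. p \<in> Q \<Longrightarrow> u p = Phi n \<zeta> u p" and \<zeta>: "adapted n \<zeta>"
    and eq: "\<And>i j. i \<in> idx n \<Longrightarrow> j \<le> m n \<Longrightarrow> \<zeta> i (real j * \<tau> n) = linear_noise n c i (real j * \<tau> n)"
  shows "u (T, x0) = endpoint n c"
proof -
  let ?w = "(Phi n (linear_noise n c) ^^ Suc (m n)) (\<lambda>_. 0)"
  have "j \<le> m n \<Longrightarrow> p \<in> Q \<Longrightarrow> fst p = real j * \<tau> n \<Longrightarrow> u p = ?w p" for j p
  proof (induction j arbitrary: p rule: less_induct)
    case (less j)
    have "Phi n \<zeta> u p = Phi n (linear_noise n c) ?w p"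
    proof (rule Phi_cong[OF n \<zeta>])
      fix i assume i: "i \<in> idx n" "real (fst i) * \<tau> n < fst p"
      then have "fst i < j" using tau_pos[OF n] less.prems(3) by simp
      then show "u (gpt n i) = ?w (gpt n i)"
        using less.prems(1) gpt_in_Q[OF n i(1)] by (intro less.IH[of "fst i"]) (auto simp: gpt_def)
    qed (use eq less.prems in simp)
    then show ?case
      using u[OF less.prems(2)] Phi_exists[OF n adapted_linear_noise[OF n] less.prems(2)] by simp
  qed
  from this[of "m n" "(T, x0)"] show ?thesis using top_in_Q m_tau[OF n] by (simp add: endpoint_def)
qed

lemma endpoint_continuous: "coord_continuous (idx n) (endpoint n)"
proof -
  have "coord_continuous (idx n) (\<lambda>c. (Phi n (linear_noise n c) ^^ j) (\<lambda>_. 0) p)" for j p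
  proof (induction j arbitrary: p)
    case 0
    then show ?case by (simp add: coord_continuous_def)
  next
    case (Suc j)
    have comp: "(\<lambda>k. f (g k)) \<longlonglongrightarrow> f l" if "continuous_on UNIV f" "g \<longlonglongrightarrow> l" for f g and l :: real
      using continuous_on_tendsto_compose[OF that] by simp
    show ?case
      unfolding coord_continuous_def
    proof (intro allI impI)
      fix c :: "nat \<Rightarrow> nat \<times> ('d \<Rightarrow> nat) \<Rightarrow> real" and l assume cl: "\<forall>i\<in>idx n. (\<lambda>k. c k i) \<longlonglongrightarrow> l i"
      have "(\<lambda>k. (Phi n (linear_noise n (c k)) ^^ j) (\<lambda>_. 0) q) \<longlonglongrightarrow> (Phi n (linear_noise n l) ^^ j) (\<lambda>_. 0) q" for q
        using coord_continuousD[OF Suc.IH, of c l q] cl by blast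
      then show "(\<lambda>k. (Phi n (linear_noise n (c k)) ^^ Suc j) (\<lambda>_. 0) p) \<longlonglongrightarrow> (Phi n (linear_noise n l) ^^ Suc j) (\<lambda>_. 0) p"
        unfolding funpow.simps comp_def Phi_def[of n _ _ p] linear_noise_def[of n _ _ "fst p"] using cl
        by (intro tendsto_intros comp[OF b_cont] comp[OF sigma_cont]) auto
    qed
  qed
  then show ?thesis unfolding endpoint_def[abs_def] .
qed

lemma endpoint_measurable:
  assumes X: "\<And>i. i \<in> idx n \<Longrightarrow> X i \<in> borel_measurable M"
  shows "(\<lambda>w. endpoint n (\<lambda>i. X i w)) \<in> borel_measurable M"
proof -
  have "(\<lambda>w. (Phi n (linear_noise n (\<lambda>i. X i w)) ^^ j) (\<lambda>_. 0) p) \<in> borel_measurable M" for j p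
  proof (induction j arbitrary: p)
    case (Suc j)
    show ?case
      unfolding funpow.simps comp_def Phi_def[of n _ _ p] linear_noise_def[of n _ _ "fst p"]
      by (intro borel_measurable_sum borel_measurable_times borel_measurable_add borel_measurable_const X
          measurable_compose[OF Suc.IH b_measurable] measurable_compose[OF Suc.IH sigma_measurable])
  qed simp
  then show ?thesis unfolding endpoint_def .
qed

lemma scheme_integral:
  assumes n: "2 \<le> n" and p: "(t, x) \<in> Q"
  shows "set_lebesgue_integral lborel ({0<..<t} \<times> cube)
     (\<lambda>(s, z). green_disc T (m n) n t (time_floor T (m n) s) x z * f (time_floor T (m n) s, kappa n z)) =
    (\<Sum>i\<in>idx n. green_disc T (m n) n t (fst (gpt n i)) x (snd (gpt n i)) * f (gpt n i) * (dx n ^ CARD('d) * elapsed n i t))"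
proof -
  have "(\<lambda>(s, z). green_disc T (m n) n t (time_floor T (m n) s) x z * f (time_floor T (m n) s, kappa n z)) =
    (\<lambda>q. (\<lambda>r. green_disc T (m n) n t (fst r) x (snd r) * f r) (proj n q))"
    using n by (auto simp: proj_def green_disc_kappa)
  then show ?thesis using grid_integral[OF n, of t "\<lambda>r. green_disc T (m n) n t (fst r) x (snd r) * f r"] Q_time[OF p] by simp
qed

lemma skeleton_Phi:
  assumes n: "2 \<le> n" and \<phi>: "\<And>q. q \<in> cyl T \<Longrightarrow> h q = \<phi> (proj n q)"
    and u: "is_disc_skeleton_solution T b \<sigma> (m n) n h u" and p: "p \<in> Q"
  shows "u p = Phi n (linear_noise n (\<lambda>i. sqrt (vol n) * \<phi> (gpt n i))) u p"
proof -
  obtain t x where tx: "p = (t, x)" by (cases p)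
  have Q: "(t, x) \<in> Q" using p tx by simp
  have noise: "linear_noise n (\<lambda>i. sqrt (vol n) * \<phi> (gpt n i)) i t = \<phi> (gpt n i) * (dx n ^ CARD('d) * elapsed n i t)" for i
  proof -
    have "linear_noise n (\<lambda>i. sqrt (vol n) * \<phi> (gpt n i)) i t =
        (sqrt (vol n) * sqrt (vol n)) * (elapsed n i t / \<tau> n) * \<phi> (gpt n i)"
      unfolding linear_noise_def by (simp only: mult_ac)
    also have "sqrt (vol n) * sqrt (vol n) = vol n" using vol_pos[OF n] by simp
    finally show ?thesis using tau_pos[OF n] by (simp add: vol_def mult_ac)
  qed
  have "u p = set_lebesgue_integral lborel ({0<..<t} \<times> cube)
      (\<lambda>(s, z). green_disc T (m n) n t (time_floor T (m n) s) x z *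
         (b (u (time_floor T (m n) s, kappa n z)) + \<sigma> (u (time_floor T (m n) s, kappa n z)) * h (s, z)))"
    using u Q by (auto simp: is_disc_skeleton_solution_def tx)
  also have "\<dots> = set_lebesgue_integral lborel ({0<..<t} \<times> cube)
      (\<lambda>(s, z). green_disc T (m n) n t (time_floor T (m n) s) x z *
         (\<lambda>r. b (u r) + \<sigma> (u r) * \<phi> r) (time_floor T (m n) s, kappa n z))"
  proof (rule set_lebesgue_integral_cong)
    show "({0<..<t} \<times> cube :: (real \<times> (real ^ 'd)) set) \<in> sets lborel"
      using sets_cyl[of t] by (simp add: cyl_def)
    have "{0<..<t} \<times> cube \<subseteq> (cyl T :: (real \<times> (real ^ 'd)) set)" using Q_time[OF Q] by (auto simp: cyl_def)
    then show "\<forall>q. q \<in> {0<..<t} \<times> cube \<longrightarrow> (\<lambda>(s, z). green_disc T (m n) n t (time_floor T (m n) s) x z *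
         (b (u (time_floor T (m n) s, kappa n z)) + \<sigma> (u (time_floor T (m n) s, kappa n z)) * h (s, z))) q =
       (\<lambda>(s, z). green_disc T (m n) n t (time_floor T (m n) s) x z *
         (\<lambda>r. b (u r) + \<sigma> (u r) * \<phi> r) (time_floor T (m n) s, kappa n z)) q"
      using \<phi> by (fastforce simp: proj_def)
  qed
  also have "\<dots> = Phi n (linear_noise n (\<lambda>i. sqrt (vol n) * \<phi> (gpt n i))) u p"
    unfolding scheme_integral[OF n Q, of "\<lambda>r. b (u r) + \<sigma> (u r) * \<phi> r"] Phi_def tx fst_conv snd_conv noise
    by (intro sum.cong refl) (simp add: algebra_simps)
  finally show ?thesis .
qed

lemma Upsilon_disc_endpoint:
  assumes n: "2 \<le> n" and h: "sq_int N h" and \<phi>: "\<And>q. q \<in> cyl T \<Longrightarrow> h q = \<phi> (proj n q)"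
  shows "Upsilon_disc T b \<sigma> (m n) n h (T, x0) = endpoint n (\<lambda>i. sqrt (vol n) * \<phi> (gpt n i))"
  by (rule endpoint_eq[OF n skeleton_Phi[OF n \<phi> Upsilon_disc_solution[OF n h]] adapted_linear_noise[OF n]]) auto

lemma cellwise_energy:
  assumes n: "2 \<le> n" and h: "sq_int N h" and \<phi>: "\<And>q. q \<in> cyl T \<Longrightarrow> h q = \<phi> (proj n q)"
  shows "energy T h = (\<Sum>i\<in>idx n. (sqrt (vol n) * \<phi> (gpt n i))\<^sup>2) / 2"
proof -
  have "(\<integral>q. (h q)\<^sup>2 \<partial>N) = (\<integral>q. (if fst q < T then (\<phi> (proj n q))\<^sup>2 else 0) \<partial>N)"
    by (rule Bochner_Integration.integral_cong) (use \<phi> in \<open>auto simp: cyl_def\<close>)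
  also have "\<dots> = set_lebesgue_integral lborel ({0<..<T} \<times> cube) (\<lambda>q. (\<phi> (proj n q))\<^sup>2)"
    by (rule set_integral_time[OF order_refl, symmetric])
  also have "\<dots> = (\<Sum>i\<in>idx n. (\<phi> (gpt n i))\<^sup>2 * (dx n ^ CARD('d) * elapsed n i T))"
    by (rule grid_integral[OF n, of T "\<lambda>r. (\<phi> r)\<^sup>2"]) (use T_pos in auto)
  also have "\<dots> = (\<Sum>i\<in>idx n. (sqrt (vol n) * \<phi> (gpt n i))\<^sup>2)"
    using vol_pos[OF n] by (intro sum.cong refl) (simp add: elapsed_T[OF n] power_mult_distrib vol_def mult_ac)
  finally show ?thesis using h by (simp add: energy_eq l2_sq)
qed

text \<open>Cellwise constant controls and coefficient families correspond through
  \<open>c i = sqrt (vol n) * \<phi> (gpt n i)\<close>, and this scaling turns the energy into the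
  Euclidean one.\<close>

lemma rate_disc_eq_quad_rate:
  assumes n: "2 \<le> n"
  shows "rate_disc T b \<sigma> (m n) n x0 = quad_rate (idx n) (endpoint n)"
proof
  fix y
  have v: "0 < sqrt (vol n)" using vol_pos[OF n] by simp
  have "{ereal (energy T h) | h. h \<in> X_space T (m n) n \<and> Upsilon_disc T b \<sigma> (m n) n h (T, x0) = y} =
    {ereal ((\<Sum>i\<in>idx n. (c i)\<^sup>2) / 2) | c. endpoint n c = y}" (is "?A = ?B")
  proof
    show "?A \<subseteq> ?B"
    proof
      fix a assume "a \<in> ?A"
      then obtain h where h: "h \<in> X_space T (m n) n" "Upsilon_disc T b \<sigma> (m n) n h (T, x0) = y" "a = ereal (energy T h)"
        by blast
      show "a \<in> ?B"
      proof (rule X_spaceD[OF n h(1)])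
        fix \<phi> assume \<phi>: "\<And>q. q \<in> cyl T \<Longrightarrow> h q = \<phi> (proj n q)"
        show "a \<in> ?B"
          using Upsilon_disc_endpoint[OF n X_space_sq_int[OF h(1)] \<phi>] cellwise_energy[OF n X_space_sq_int[OF h(1)] \<phi>] h(2,3)
          by (intro CollectI exI[of _ "\<lambda>i. sqrt (vol n) * \<phi> (gpt n i)"]) simp
      qed
    qed
    show "?B \<subseteq> ?A"
    proof
      fix a assume "a \<in> ?B"
      then obtain c where c: "endpoint n c = y" "a = ereal ((\<Sum>i\<in>idx n. (c i)\<^sup>2) / 2)" by blast
      \<comment> \<open>The inverse scaling; by injectivity of \<open>gpt n\<close> at most one
        summand is active at a point.\<close>
      define \<phi> where "\<phi> r = (\<Sum>i\<in>idx n. if r = gpt n i then c i / sqrt (vol n) else 0)" for r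
      define h where "h q = \<phi> (proj n q)" for q
      have \<phi>: "sqrt (vol n) * \<phi> (gpt n i) = c i" if "i \<in> idx n" for i
        using that v by (simp add: \<phi>_def gpt_inj[OF n])
      have pm: "(\<lambda>q. if proj n q = r then z else 0) \<in> borel_measurable borel" for r and z :: real
      proof -
        have "{q \<in> space borel. proj n q = r} \<in> sets borel"
          using measurable_sets[OF proj_measurable[of n] borel_singleton[of "{}" r]] by (simp add: vimage_def)
        then show ?thesis by (intro measurable_If) auto
      qed
      have "h \<in> borel_measurable borel" unfolding h_def[abs_def] \<phi>_def by (intro borel_measurable_sum pm)
      moreover have "\<bar>h q\<bar> \<le> (\<Sum>i\<in>idx n. \<bar>c i / sqrt (vol n)\<bar>)" for q
        unfolding h_def \<phi>_def by (intro order_trans[OF sum_abs] sum_mono) auto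
      ultimately have hs: "sq_int N h" by (intro sq_int_bounded measurable_cylM_restrict) 
      have hX: "h \<in> X_space T (m n) n" by (rule X_spaceI[OF n hs]) (simp add: h_def)
      \<comment> \<open>The two families agree on \<open>idx n\<close> but possibly not elsewhere;
        continuity along a constant sequence identifies their endpoints.\<close>
      have "endpoint n (\<lambda>i. sqrt (vol n) * \<phi> (gpt n i)) = endpoint n c"
        using coord_continuousD[OF endpoint_continuous[of n], of "\<lambda>_. c" "\<lambda>i. sqrt (vol n) * \<phi> (gpt n i)"]
        by (simp add: \<phi> LIMSEQ_const_iff)
      then have "Upsilon_disc T b \<sigma> (m n) n h (T, x0) = y"
        using Upsilon_disc_endpoint[OF n hs, of \<phi>] c(1) by (simp add: h_def)
      moreover have "energy T h = (\<Sum>i\<in>idx n. (c i)\<^sup>2) / 2"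
        using cellwise_energy[OF n hs, of \<phi>] by (simp add: h_def \<phi> cong: sum.cong)
      ultimately show "a \<in> ?A" using hX c(2) by (intro CollectI exI[of _ h]) simp
    qed
  qed
  then show "rate_disc T b \<sigma> (m n) n x0 y = quad_rate (idx n) (endpoint n) y"
    unfolding rate_disc_def quad_rate_def by simp
qed

section \<open>The numerical solution in terms of normalized sheet increments\<close>

definition cell_noise :: "nat \<Rightarrow> (real \<times> (real ^ 'd) \<Rightarrow> 'w \<Rightarrow> real) \<Rightarrow> nat \<times> ('d \<Rightarrow> nat) \<Rightarrow> 'w \<Rightarrow> real" where
  "cell_noise n W i w = sheet_increment W (real (fst i) * \<tau> n) (real (fst i + 1) * \<tau> n)
     (grid_pt n (snd i)) (grid_pt n (\<lambda>l. snd i l + 1)) w / sqrt (vol n)"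

lemma sheet_increment_same [simp]: "sheet_increment W t t p q w = 0"
  by (simp add: sheet_increment_def)

text \<open>A pathwise statement: \<open>\<zeta>\<close> is the scaled increment over a cell,
  stopped at time \<open>t\<close>. It is adapted, and at grid times it is either zero or the full
  increment, which are the values of \<open>linear_noise\<close> there.\<close>

lemma numerical_solution_endpoint:
  assumes n: "2 \<le> n"
  shows "numerical_solution T b \<sigma> (m n) n W \<epsilon> w (T, x0) = endpoint n (\<lambda>i. sqrt \<epsilon> * cell_noise n W i w)"
proof -
  define \<zeta> where "\<zeta> i t = sqrt \<epsilon> * sheet_increment W (min (real (fst i) * \<tau> n) t) (min (real (fst i + 1) * \<tau> n) t)
     (grid_pt n (snd i)) (grid_pt n (\<lambda>l. snd i l + 1)) w" for i t
  have mono: "real (fst i) * \<tau> n \<le> real (fst i + 1) * \<tau> n" for i :: "nat \<times> ('d \<Rightarrow> nat)"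
    using tau_pos[OF n] by (intro mult_right_mono) auto
  have \<zeta>: "adapted n \<zeta>"
    unfolding adapted_def
  proof (intro allI impI)
    fix i :: "nat \<times> ('d \<Rightarrow> nat)" and t assume "t \<le> real (fst i) * \<tau> n"
    then have "min (real (fst i) * \<tau> n) t = t" "min (real (fst i + 1) * \<tau> n) t = t" using mono[of i] by linarith+
    then show "\<zeta> i t = 0" unfolding \<zeta>_def by simp
  qed
  have iff: "is_numerical_solution T b \<sigma> (m n) n W \<epsilon> w u \<longleftrightarrow> (\<forall>p\<in>Q. u p = Phi n \<zeta> u p)" for u
  proof -
    have "set_lebesgue_integral lborel ({0<..<t} \<times> cube)
            (\<lambda>(s, z). green_disc T (m n) n t (time_floor T (m n) s) x z * b (u (time_floor T (m n) s, kappa n z))) +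
          sqrt \<epsilon> * elementary_stoch_integral W T (m n) n t (\<lambda>s z. green_disc T (m n) n t s x z * \<sigma> (u (s, z))) w
       = Phi n \<zeta> u (t, x)" if p: "(t, x) \<in> Q" for t x
    proof -
      have "sqrt \<epsilon> * elementary_stoch_integral W T (m n) n t (\<lambda>s z. green_disc T (m n) n t s x z * \<sigma> (u (s, z))) w =
        (\<Sum>i\<in>idx n. green_disc T (m n) n t (fst (gpt n i)) x (snd (gpt n i)) * \<sigma> (u (gpt n i)) * \<zeta> i t)"
        unfolding elementary_stoch_integral_def sum.cartesian_product idx_def sum_distrib_left
        by (intro sum.cong refl) (auto simp: gpt_def \<zeta>_def)
      then show ?thesis
        using scheme_integral[OF n p, of "\<lambda>r. b (u r)"]
        by (simp add: Phi_def sum.distrib[symmetric] algebra_simps)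
    qed
    then show ?thesis unfolding is_numerical_solution_def by auto
  qed
  have "is_numerical_solution T b \<sigma> (m n) n W \<epsilon> w (numerical_solution T b \<sigma> (m n) n W \<epsilon> w)"
    unfolding numerical_solution_def
  proof (rule the_extensional[where S = "is_numerical_solution T b \<sigma> (m n) n W \<epsilon> w"])
    show "is_numerical_solution T b \<sigma> (m n) n W \<epsilon> w ((Phi n \<zeta> ^^ Suc (m n)) (\<lambda>_. 0))"
      unfolding iff using Phi_exists[OF n \<zeta>] by blast
  next
    fix u v assume uv: "is_numerical_solution T b \<sigma> (m n) n W \<epsilon> w u" "is_numerical_solution T b \<sigma> (m n) n W \<epsilon> w v"
    show "\<forall>p\<in>Q. u p = v p"
    proof
      fix p assume p: "p \<in> Q"
      show "u p = v p"
        by (rule causal_fixpoint_unique[where A = "stage n" and M = "m n" and \<Psi> = "Phi n \<zeta>",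
              OF stage_mono[OF n] Phi_causal_0[OF n \<zeta>] Phi_causal_Suc[OF n \<zeta>]])
           (use uv p in \<open>auto simp: stage_m[OF n] iff\<close>)
    qed
  next
    fix u v assume u: "is_numerical_solution T b \<sigma> (m n) n W \<epsilon> w u" and uv: "\<forall>p\<in>Q. u p = v p"
    have "Phi n \<zeta> u p = Phi n \<zeta> v p" for p
      by (rule Phi_cong[OF n \<zeta>]) (use uv gpt_in_Q[OF n] in auto)
    then show "is_numerical_solution T b \<sigma> (m n) n W \<epsilon> w v" using u uv unfolding iff by metis
  qed
  then have sol: "\<And>p. p \<in> Q \<Longrightarrow> numerical_solution T b \<sigma> (m n) n W \<epsilon> w p = Phi n \<zeta> (numerical_solution T b \<sigma> (m n) n W \<epsilon> w) p"
    unfolding iff by blast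
  show ?thesis
  proof (rule endpoint_eq[OF n sol \<zeta>])
    fix i :: "nat \<times> ('d \<Rightarrow> nat)" and j assume "i \<in> idx n" "j \<le> m n"
    show "\<zeta> i (real j * \<tau> n) = linear_noise n (\<lambda>i. sqrt \<epsilon> * cell_noise n W i w) i (real j * \<tau> n)"
    proof (cases "fst i < j")
      case True
      have "real (fst i + 1) * \<tau> n \<le> real j * \<tau> n" using True tau_pos[OF n] by (intro mult_right_mono) auto
      then have "min (real (fst i) * \<tau> n) (real j * \<tau> n) = real (fst i) * \<tau> n"
        "min (real (fst i + 1) * \<tau> n) (real j * \<tau> n) = real (fst i + 1) * \<tau> n" using mono[of i] by linarith+
      then show ?thesis
        using vol_pos[OF n] tau_pos[OF n] unfolding linear_noise_def elapsed_full[OF n True] cell_noise_def \<zeta>_def by simp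
    next
      case False
      then have "real j * \<tau> n \<le> real (fst i) * \<tau> n" using tau_pos[OF n] by (intro mult_right_mono) auto
      then have "\<zeta> i (real j * \<tau> n) = 0" "linear_noise n (\<lambda>i. sqrt \<epsilon> * cell_noise n W i w) i (real j * \<tau> n) = 0"
        using \<zeta> adapted_linear_noise[OF n] unfolding adapted_def by blast+
      then show ?thesis by simp
    qed
  qed
qed

lemma numerical_solution_LDP:
  assumes n: "2 \<le> n" and G: "standard_gaussian M (idx n) (cell_noise n W)"
  shows "good_rate_function (rate_disc T b \<sigma> (m n) n x0)"
    and "satisfies_LDP M (\<lambda>\<epsilon> w. numerical_solution T b \<sigma> (m n) n W \<epsilon> w (T, x0)) (rate_disc T b \<sigma> (m n) n x0)"
proof -
  show "good_rate_function (rate_disc T b \<sigma> (m n) n x0)"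
    unfolding rate_disc_eq_quad_rate[OF n] by (rule good_rate_quad[OF finite_idx endpoint_continuous])
  show "satisfies_LDP M (\<lambda>\<epsilon> w. numerical_solution T b \<sigma> (m n) n W \<epsilon> w (T, x0)) (rate_disc T b \<sigma> (m n) n x0)"
    unfolding rate_disc_eq_quad_rate[OF n] numerical_solution_endpoint[OF n]
    by (intro gaussian_LDP[OF G finite_idx endpoint_continuous] endpoint_measurable borel_measurable_times borel_measurable_const
        standard_gaussian_component[OF G finite_idx])
qed

end

section \<open>Increments of the Brownian sheet\<close>

lemma gaussian_rv_sq_int:
  assumes M: "prob_space M" and X: "gaussian_rv M X"
  shows "sq_int M X"
proof -
  interpret prob_space M by (rule M)
  have Xm: "X \<in> borel_measurable M" using X by (simp add: gaussian_rv_def)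
  obtain \<mu> s where "(s = 0 \<and> (AE w in M. X w = \<mu>)) \<or> (s > 0 \<and> distributed M lborel X (\<lambda>r. ennreal (normal_density \<mu> s r)))"
    using X by (auto simp: gaussian_rv_def)
  then show ?thesis
  proof (elim disjE conjE)
    assume ae: "AE w in M. X w = \<mu>"
    show ?thesis
    proof (rule sq_int_bound[OF sq_int_const[of \<mu>] Xm])
      show "AE w in M. \<bar>X w\<bar> \<le> \<bar>\<mu>\<bar>" using ae by eventually_elim simp
    qed
  next
    assume s: "0 < s" and D: "distributed M lborel X (\<lambda>r. ennreal (normal_density \<mu> s r))"
    have "integrable M (\<lambda>w. (X w - \<mu>)\<^sup>2)"
      using distributed_integrable[OF D, of "\<lambda>x. (x - \<mu>)\<^sup>2"] integrable_normal_moment[OF s, of \<mu> 2] by simp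
    then have "sq_int M (\<lambda>w. X w - \<mu>)" using Xm by (simp add: sq_int_def)
    from sq_int_add[OF this sq_int_const[of \<mu>]] show ?thesis by simp
  qed
qed

text \<open>Neighbouring cells share vertices, whereas Gaussianity of the sheet is stated for sets
  of points; the coefficients of equal points are collected.\<close>

lemma sheet_combination_gaussian:
  assumes W: "brownian_sheet M T W" and L: "finite L" and pt: "\<And>l. l \<in> L \<Longrightarrow> pt l \<in> closed_cyl T"
  shows "gaussian_rv M (\<lambda>w. \<Sum>l\<in>L. \<alpha> l * W (pt l) w)"
proof -
  have "(\<Sum>l\<in>L. \<alpha> l * W (pt l) w) = (\<Sum>p\<in>pt ` L. (\<Sum>l | l \<in> L \<and> pt l = p. \<alpha> l) * W p w)" for w
    using L by (subst sum.image_gen[of L _ pt]) (auto simp: sum_distrib_right intro!: sum.cong)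
  moreover have "gaussian_rv M (\<lambda>w. \<Sum>p\<in>pt ` L. (\<Sum>l | l \<in> L \<and> pt l = p. \<alpha> l) * W p w)"
    using W[unfolded brownian_sheet_def] L pt by (simp add: image_subset_iff)
  ultimately show ?thesis by simp
qed

lemma sheet_sq_int:
  assumes W: "brownian_sheet M T W" and p: "p \<in> closed_cyl T"
  shows "sq_int M (W p)"
proof (rule gaussian_rv_sq_int)
  show "gaussian_rv M (W p)"
    using sheet_combination_gaussian[OF W, of "{()}" "\<lambda>_. p" "\<lambda>_. 1"] p by simp
qed (use W in \<open>simp add: brownian_sheet_def\<close>)

lemma sheet_combination_mean:
  assumes W: "brownian_sheet M T W" and pt: "\<And>l. l \<in> L \<Longrightarrow> pt l \<in> closed_cyl T"
  shows "(\<integral>w. (\<Sum>l\<in>L. \<alpha> l * W (pt l) w) \<partial>M) = 0"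
proof -
  interpret prob_space M using W by (simp add: brownian_sheet_def)
  have "(\<integral>w. (\<Sum>l\<in>L. \<alpha> l * W (pt l) w) \<partial>M) = (\<Sum>l\<in>L. \<integral>w. \<alpha> l * W (pt l) w \<partial>M)"
    by (intro Bochner_Integration.integral_sum integrable_mult_right sq_int_integrable sheet_sq_int[OF W pt])
  also have "\<dots> = 0"
    using W pt by (intro sum.neutral) (auto simp: brownian_sheet_def)
  finally show ?thesis .
qed

lemma integral_product_of_sums:
  fixes X :: "'l \<Rightarrow> 'w \<Rightarrow> real" and Y :: "'r \<Rightarrow> 'w \<Rightarrow> real"
  assumes X: "\<And>l. l \<in> A \<Longrightarrow> sq_int M (X l)" and Y: "\<And>r. r \<in> B \<Longrightarrow> sq_int M (Y r)"
  shows "(\<integral>w. (\<Sum>l\<in>A. a l * X l w) * (\<Sum>r\<in>B. c r * Y r w) \<partial>M) =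
    (\<Sum>l\<in>A. a l * (\<Sum>r\<in>B. c r * (\<integral>w. X l w * Y r w \<partial>M)))"
proof -
  have int: "integrable M (\<lambda>w. (a l * c r) * (X l w * Y r w))" if "l \<in> A" "r \<in> B" for l r
    by (intro integrable_mult_right sq_int_prod X Y that)
  have "(\<integral>w. (\<Sum>l\<in>A. a l * X l w) * (\<Sum>r\<in>B. c r * Y r w) \<partial>M) =
      (\<integral>w. (\<Sum>l\<in>A. \<Sum>r\<in>B. (a l * c r) * (X l w * Y r w)) \<partial>M)"
    by (simp only: sum_product mult_ac)
  also have "\<dots> = (\<Sum>l\<in>A. \<integral>w. (\<Sum>r\<in>B. (a l * c r) * (X l w * Y r w)) \<partial>M)"
    by (intro Bochner_Integration.integral_sum Bochner_Integration.integrable_sum int)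
  also have "\<dots> = (\<Sum>l\<in>A. \<Sum>r\<in>B. \<integral>w. (a l * c r) * (X l w * Y r w) \<partial>M)"
    by (intro sum.cong refl Bochner_Integration.integral_sum int)
  also have "\<dots> = (\<Sum>l\<in>A. a l * (\<Sum>r\<in>B. c r * (\<integral>w. X l w * Y r w \<partial>M)))"
    by (simp add: sum_distrib_left mult.assoc)
  finally show ?thesis .
qed

text \<open>A pair \<open>(S, e)\<close> encodes a vertex of a space-time rectangle: \<open>e\<close> selects the later of the two
  times, \<open>S\<close> the directions in which the vertex agrees with the lower corner.\<close>

definition vertex :: "real \<Rightarrow> real \<Rightarrow> real ^ 'd \<Rightarrow> real ^ 'd \<Rightarrow> 'd::finite set \<times> bool \<Rightarrow> real \<times> (real ^ 'd)" where
  "vertex s t p q l = (if snd l then t else s, \<chi> i. if i \<in> fst l then p $ i else q $ i)"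

definition vertex_sign :: "'d::finite set \<times> bool \<Rightarrow> real" where
  "vertex_sign l = (- 1) ^ card (fst l) * (if snd l then 1 else - 1)"

lemma sheet_increment_vertices:
  "sheet_increment W s t p q w = (\<Sum>l\<in>UNIV. vertex_sign l * W (vertex s t p q l) w)"
proof -
  have "(\<Sum>l\<in>UNIV. vertex_sign l * W (vertex s t p q l) w) =
      (\<Sum>S\<in>UNIV. \<Sum>e\<in>UNIV. vertex_sign (S, e) * W (vertex s t p q (S, e)) w)"
    by (simp add: sum.cartesian_product UNIV_Times_UNIV)
  then show ?thesis
    by (simp add: sheet_increment_def vertex_sign_def vertex_def UNIV_bool algebra_simps)
qed

text \<open>For a product function, inclusion-exclusion over the vertices is the expansion of a
  product of one-dimensional differences over subsets of coordinates, so it factors into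
  increments.\<close>

lemma vertices_product:
  fixes p q :: "real ^ 'd::finite"
  shows "(\<Sum>l\<in>UNIV. vertex_sign l * (a (fst (vertex s t p q l)) * (\<Prod>i\<in>UNIV. g i (snd (vertex s t p q l) $ i)))) =
    (a t - a s) * (\<Prod>i\<in>UNIV. g i (q $ i) - g i (p $ i))"
proof -
  have split: "(\<Prod>i\<in>UNIV. g i (if i \<in> S then p $ i else q $ i)) = (\<Prod>i\<in>S. g i (p $ i)) * (\<Prod>i\<in>UNIV - S. g i (q $ i))"
    for S :: "'d set"
  proof -
    have "(\<Prod>i\<in>UNIV. g i (if i \<in> S then p $ i else q $ i)) =
        (\<Prod>i\<in>S. g i (if i \<in> S then p $ i else q $ i)) * (\<Prod>i\<in>UNIV - S. g i (if i \<in> S then p $ i else q $ i))"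
      by (subst prod.union_disjoint[symmetric]) auto
    then show ?thesis by simp
  qed
  have "(\<Prod>i\<in>UNIV. g i (q $ i) - g i (p $ i)) = (\<Prod>i\<in>UNIV. - g i (p $ i) + g i (q $ i))"
    by simp
  also have "\<dots> = (\<Sum>S\<in>Pow UNIV. (\<Prod>i\<in>S. - g i (p $ i)) * (\<Prod>i\<in>UNIV - S. g i (q $ i)))"
    by (rule prod_add) simp
  also have "\<dots> = (\<Sum>S\<in>UNIV. (- 1) ^ card S * (\<Prod>i\<in>UNIV. g i (if i \<in> S then p $ i else q $ i)))"
    unfolding split by (simp add: prod_uminus mult.assoc)
  finally have prod: "(\<Sum>S\<in>UNIV. (- 1) ^ card S * (\<Prod>i\<in>UNIV. g i (if i \<in> S then p $ i else q $ i))) =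
    (\<Prod>i\<in>UNIV. g i (q $ i) - g i (p $ i))" by simp
  have "(\<Sum>l\<in>UNIV. vertex_sign l * (a (fst (vertex s t p q l)) * (\<Prod>i\<in>UNIV. g i (snd (vertex s t p q l) $ i)))) =
      (\<Sum>S\<in>UNIV. \<Sum>e\<in>UNIV. vertex_sign (S, e) * (a (fst (vertex s t p q (S, e))) * (\<Prod>i\<in>UNIV. g i (snd (vertex s t p q (S, e)) $ i))))"
    by (simp add: sum.cartesian_product UNIV_Times_UNIV)
  also have "\<dots> = (\<Sum>S\<in>UNIV. (a t - a s) * ((- 1) ^ card S * (\<Prod>i\<in>UNIV. g i (if i \<in> S then p $ i else q $ i))))"
    by (intro sum.cong refl) (simp add: vertex_sign_def vertex_def UNIV_bool algebra_simps)
  also have "\<dots> = (a t - a s) * (\<Prod>i\<in>UNIV. g i (q $ i) - g i (p $ i))"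
    unfolding sum_distrib_left[symmetric] prod ..
  finally show ?thesis .
qed

text \<open>The covariance of the sheet is a product of minima, so \<open>vertices_product\<close>
  applies in each of its two arguments in turn and leaves mixed second differences of the
  minimum.\<close>

lemma sheet_increment_covariance:
  fixes p q p' q' :: "real ^ 'd::finite"
  assumes W: "brownian_sheet M T W"
    and pt: "\<And>l. vertex s t p q l \<in> closed_cyl T" "\<And>l. vertex s' t' p' q' l \<in> closed_cyl T"
  shows "(\<integral>w. sheet_increment W s t p q w * sheet_increment W s' t' p' q' w \<partial>M) =
    ((min t t' - min t s') - (min s t' - min s s')) *
    (\<Prod>i\<in>UNIV. (min (q $ i) (q' $ i) - min (q $ i) (p' $ i)) - (min (p $ i) (q' $ i) - min (p $ i) (p' $ i)))"
proof -
  have cov: "(\<integral>w. W r w * W r' w \<partial>M) = min (fst r) (fst r') * (\<Prod>i\<in>UNIV. min (snd r $ i) (snd r' $ i))"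
    if r: "r \<in> closed_cyl T" "r' \<in> closed_cyl T" for r r'
  proof -
    have "\<forall>(s, x)\<in>closed_cyl T. \<forall>(t, y)\<in>closed_cyl T.
        (\<integral>w. W (s, x) w * W (t, y) w \<partial>M) = min s t * (\<Prod>l\<in>UNIV. min (x $ l) (y $ l))"
      using W unfolding brownian_sheet_def by blast
    from bspec[OF this r(1)] have "\<forall>(t, y)\<in>closed_cyl T.
        (\<integral>w. W r w * W (t, y) w \<partial>M) = min (fst r) t * (\<Prod>l\<in>UNIV. min (snd r $ l) (y $ l))"
      by (simp add: split_def)
    from bspec[OF this r(2)] show ?thesis by (simp add: split_def)
  qed
  have inner: "(\<Sum>r\<in>UNIV. vertex_sign r * (min (fst z) (fst (vertex s' t' p' q' r)) *
        (\<Prod>i\<in>UNIV. min (snd z $ i) (snd (vertex s' t' p' q' r) $ i)))) =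
      (min (fst z) t' - min (fst z) s') * (\<Prod>i\<in>UNIV. min (snd z $ i) (q' $ i) - min (snd z $ i) (p' $ i))"
    for z :: "real \<times> (real ^ 'd)"
    by (rule vertices_product[where a = "min (fst z)" and g = "\<lambda>i. min (snd z $ i)"])
  have "(\<integral>w. sheet_increment W s t p q w * sheet_increment W s' t' p' q' w \<partial>M) =
      (\<Sum>l\<in>UNIV. vertex_sign l * (\<Sum>r\<in>UNIV. vertex_sign r *
        (\<integral>w. W (vertex s t p q l) w * W (vertex s' t' p' q' r) w \<partial>M)))"
    unfolding sheet_increment_vertices by (intro integral_product_of_sums sheet_sq_int[OF W] pt)
  also have "\<dots> = (\<Sum>l\<in>UNIV. vertex_sign l * ((min (fst (vertex s t p q l)) t' - min (fst (vertex s t p q l)) s') *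
      (\<Prod>i\<in>UNIV. min (snd (vertex s t p q l) $ i) (q' $ i) - min (snd (vertex s t p q l) $ i) (p' $ i))))"
    unfolding cov[OF pt(1) pt(2)] inner ..
  also have "\<dots> = ((min t t' - min t s') - (min s t' - min s s')) *
    (\<Prod>i\<in>UNIV. (min (q $ i) (q' $ i) - min (q $ i) (p' $ i)) - (min (p $ i) (q' $ i) - min (p $ i) (p' $ i)))"
    by (rule vertices_product[where a = "\<lambda>z. min z t' - min z s'" and g = "\<lambda>i z. min z (q' $ i) - min z (p' $ i)"])
  finally show ?thesis .
qed

text \<open>The mixed second difference of the minimum is the length of the overlap of two
  intervals; two grid intervals coincide or have overlap of length zero.\<close>

lemma grid_min_increment:
  fixes d :: real
  assumes d: "0 \<le> d"
  shows "(min (real (a + 1) * d) (real (b + 1) * d) - min (real (a + 1) * d) (real b * d)) -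
    (min (real a * d) (real (b + 1) * d) - min (real a * d) (real b * d)) = (if a = b then d else 0)"
proof -
  have m: "min (real x * d) (real y * d) = real (min x y) * d" for x y
    using mult_right_mono[OF _ d, of "real x" "real y"] mult_right_mono[OF _ d, of "real y" "real x"]
    by (cases "x \<le> y") (auto simp: min_def)
  consider "a < b" | "a = b" | "b < a" by linarith
  then show ?thesis
  proof cases
    case 1
    then have e: "min (a + 1) (b + 1) = a + 1" "min (a + 1) b = a + 1" "min a (b + 1) = a" "min a b = a" by auto
    show ?thesis unfolding m e using 1 by simp
  next
    case 2
    then have e: "min (a + 1) (b + 1) = a + 1" "min (a + 1) b = a" "min a (b + 1) = a" "min a b = a" by auto
    show ?thesis unfolding m e using 2 by (simp add: algebra_simps)
  next
    case 3
    then have e: "min (a + 1) (b + 1) = b + 1" "min (a + 1) b = b" "min a (b + 1) = b + 1" "min a b = b" by auto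
    show ?thesis unfolding m e using 3 by simp
  qed
qed

context spde begin

lemma cell_vertex_in_Q:
  assumes n: "2 \<le> n" and i: "i \<in> idx n"
  shows "vertex (real (fst i) * \<tau> n) (real (fst i + 1) * \<tau> n) (grid_pt n (snd i)) (grid_pt n (\<lambda>l. snd i l + 1)) l \<in> Q"
proof -
  have d: "0 \<le> dx n" "0 \<le> \<tau> n" using dx_pos[OF n_pos[OF n]] tau_pos[OF n] by auto
  have T: "real a * \<tau> n \<le> T" if "a \<le> m n" for a
    using mult_right_mono[OF _ d(2), of "real a" "real (m n)"] that m_tau[OF n] by simp
  have X: "dx n * real a \<le> pi" if "a \<le> n" for a
    using mult_right_mono[OF _ d(1), of "real a" "real n"] that n_dx[OF n_pos[OF n]] by (simp add: mult.commute)
  have "fst i + 1 \<le> m n" "fst i \<le> m n" "\<And>l. snd i l \<le> n" "\<And>l. snd i l + 1 \<le> n"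
    using i by (auto simp: idx_def cell_idx_def Suc_leI less_imp_le)
  note b = this(1,2)[THEN T] this(3,4)[THEN X]
  show ?thesis
    unfolding vertex_def mem_closed_cyl using b d by (auto simp: grid_pt_def simp del: of_nat_add of_nat_Suc)
qed

text \<open>Two different cells differ in time or in some space direction, and the corresponding
  factor of the covariance is zero; for equal cells the factors multiply to \<open>vol n\<close>,
  which the normalization removes.\<close>

lemma cell_noise_covariance:
  assumes n: "2 \<le> n" and W: "brownian_sheet M T W" and i: "i \<in> idx n" "i' \<in> idx n"
  shows "(\<integral>w. cell_noise n W i w * cell_noise n W i' w \<partial>M) = (if i = i' then 1 else 0)"
proof -
  let ?D = "\<lambda>i. sheet_increment W (real (fst i) * \<tau> n) (real (fst i + 1) * \<tau> n) (grid_pt n (snd i)) (grid_pt n (\<lambda>l. snd i l + 1))"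
  have d: "0 \<le> dx n" "0 \<le> \<tau> n" using dx_pos[OF n_pos[OF n]] tau_pos[OF n] by auto
  have g: "(min (grid_pt n (\<lambda>l. k l + 1) $ l) (grid_pt n (\<lambda>l. k' l + 1) $ l) - min (grid_pt n (\<lambda>l. k l + 1) $ l) (grid_pt n k' $ l)) -
      (min (grid_pt n k $ l) (grid_pt n (\<lambda>l. k' l + 1) $ l) - min (grid_pt n k $ l) (grid_pt n k' $ l)) =
      (if k l = k' l then dx n else 0)" for k k' :: "'d \<Rightarrow> nat" and l
    unfolding grid_pt_def vec_lambda_beta mult.commute[of "dx n"] by (rule grid_min_increment[OF d(1)])
  have "(\<integral>w. ?D i w * ?D i' w \<partial>M) = (if fst i = fst i' then \<tau> n else 0) * (\<Prod>l\<in>UNIV. if snd i l = snd i' l then dx n else 0)"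
    unfolding sheet_increment_covariance[OF W cell_vertex_in_Q[OF n i(1)] cell_vertex_in_Q[OF n i(2)]]
      g grid_min_increment[OF d(2)] ..
  also have "\<dots> = (if i = i' then vol n else 0)"
  proof (cases "snd i = snd i'")
    case False
    then obtain l where "snd i l \<noteq> snd i' l" by (auto simp: fun_eq_iff)
    then have "(\<Prod>l\<in>UNIV. if snd i l = snd i' l then dx n else 0) = 0" by (intro prod_zero) auto
    then show ?thesis using False by auto
  qed (auto simp: vol_def prod_eq_iff)
  finally have "(\<integral>w. ?D i w * ?D i' w \<partial>M) = (if i = i' then vol n else 0)" .
  moreover have "cell_noise n W i w * cell_noise n W i' w = (?D i w * ?D i' w) / vol n" for w
    using vol_pos[OF n] by (simp add: cell_noise_def)
  ultimately show ?thesis using vol_pos[OF n] by simp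
qed

lemma standard_gaussian_cell_noise:
  assumes n: "2 \<le> n" and W: "brownian_sheet M T W"
  shows "standard_gaussian M (idx n) (cell_noise n W)"
  unfolding standard_gaussian_def
proof (intro conjI allI)
  show M: "prob_space M" using W by (simp add: brownian_sheet_def)
  let ?v = "\<lambda>i. vertex (real (fst i) * \<tau> n) (real (fst i + 1) * \<tau> n) (grid_pt n (snd i)) (grid_pt n (\<lambda>l. snd i l + 1))"
  fix \<theta> :: "nat \<times> ('d \<Rightarrow> nat) \<Rightarrow> real"
  have eq: "(\<Sum>i\<in>idx n. \<theta> i * cell_noise n W i w) =
    (\<Sum>r\<in>idx n \<times> UNIV. (\<theta> (fst r) / sqrt (vol n) * vertex_sign (snd r)) * W (?v (fst r) (snd r)) w)" for \<theta> w
  proof -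
    have "(\<Sum>i\<in>idx n. \<theta> i * cell_noise n W i w) =
      (\<Sum>i\<in>idx n. \<Sum>l\<in>UNIV. (\<theta> i / sqrt (vol n) * vertex_sign l) * W (?v i l) w)"
      unfolding cell_noise_def sheet_increment_vertices
      by (intro sum.cong refl) (simp add: sum_distrib_left sum_divide_distrib mult_ac)
    then show ?thesis unfolding sum.cartesian_product split_def .
  qed
  have pt: "?v (fst r) (snd r) \<in> Q" if "r \<in> idx n \<times> UNIV" for r
    using cell_vertex_in_Q[OF n, of "fst r" "snd r"] that by auto
  have g: "gaussian_rv M (\<lambda>w. \<Sum>i\<in>idx n. \<theta> i * cell_noise n W i w)" for \<theta>
    unfolding eq by (rule sheet_combination_gaussian[OF W _ pt]) simp_all
  then show "gaussian_rv M (\<lambda>w. \<Sum>i\<in>idx n. \<theta> i * cell_noise n W i w)" .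
  show "(\<integral>w. (\<Sum>i\<in>idx n. \<theta> i * cell_noise n W i w) \<partial>M) = 0"
    unfolding eq by (rule sheet_combination_mean[OF W pt])
  have sq: "sq_int M (cell_noise n W i)" if "i \<in> idx n" for i
  proof (rule gaussian_rv_sq_int[OF M])
    have "(\<Sum>j\<in>idx n. (if j = i then 1 else 0) * cell_noise n W j w) = cell_noise n W i w" for w
      using that by (simp add: if_distrib[of "\<lambda>x. x * _"] cong: if_cong)
    then show "gaussian_rv M (cell_noise n W i)" using g[of "\<lambda>j. if j = i then 1 else 0"] by simp
  qed
  have "(\<integral>w. (\<Sum>i\<in>idx n. \<theta> i * cell_noise n W i w)\<^sup>2 \<partial>M) =
      (\<Sum>i\<in>idx n. \<theta> i * (\<Sum>i'\<in>idx n. \<theta> i' * (\<integral>w. cell_noise n W i w * cell_noise n W i' w \<partial>M)))"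
    unfolding power2_eq_square by (intro integral_product_of_sums sq)
  also have "\<dots> = (\<Sum>i\<in>idx n. \<theta> i * (\<Sum>i'\<in>idx n. if i = i' then \<theta> i' else 0))"
    using cell_noise_covariance[OF n W] by (intro sum.cong refl arg_cong2[where f = "(*)"]) auto
  also have "\<dots> = (\<Sum>i\<in>idx n. (\<theta> i)\<^sup>2)"
    by (intro sum.cong refl) (simp add: power2_eq_square)
  finally show "(\<integral>w. (\<Sum>i\<in>idx n. \<theta> i * cell_noise n W i w)\<^sup>2 \<partial>M) = (\<Sum>i\<in>idx n. (\<theta> i)\<^sup>2)" .
qed

end


theorem corollary4p6:
  fixes T :: real and b \<sigma> :: "real \<Rightarrow> real" and m :: "nat \<Rightarrow> nat"
    and M :: "'w measure" and W :: "real \<times> (real ^ 'd) \<Rightarrow> 'w \<Rightarrow> real"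
  assumes dim: "CARD('d) \<in> {1, 2, 3}"
    and T_pos: "0 < T"
    and m_pos: "\<And>n. 2 \<le> n \<Longrightarrow> 0 < m n"
    and m_lim: "filterlim m at_top sequentially"
    and b_C1: "C1_bounded_deriv b"
    and sigma_C1: "C1_bounded_deriv \<sigma>"
    and sigma_nz: "\<And>r. \<sigma> r \<noteq> 0"
    and sheet: "brownian_sheet M T W"
  shows
    "(\<forall>x0 \<in> (cube :: (real ^ 'd) set).
        (\<forall>n\<ge>2. good_rate_function (rate_disc T b \<sigma> (m n) n x0) \<and>
                satisfies_LDP M (\<lambda>\<epsilon> w. numerical_solution T b \<sigma> (m n) n W \<epsilon> w (T, x0))
                  (rate_disc T b \<sigma> (m n) n x0)) \<and>
        (\<forall>y. (\<lambda>n. rate_disc T b \<sigma> (m n) n x0 y) \<longlonglongrightarrow> rate T b \<sigma> x0 y)) \<and>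
     (\<forall>x0 \<in> (cube :: (real ^ 'd) set). \<forall>y \<epsilon> h.
        rate T b \<sigma> x0 y < \<infinity> \<longrightarrow>
        (\<forall>n\<ge>2. 0 \<le> \<epsilon> n) \<longrightarrow>
        \<epsilon> \<longlonglongrightarrow> 0 \<longrightarrow>
        (\<forall>n\<ge>2. h n \<in> X_space T (m n) n \<and>
                Upsilon_disc T b \<sigma> (m n) n (h n) (T, x0) = y \<and>
                ereal (energy T (h n)) \<le> rate_disc T b \<sigma> (m n) n x0 y + ereal (\<epsilon> n)) \<longrightarrow>
        (\<exists>r hs.
           strict_mono r \<and> (\<forall>k. 2 \<le> r k) \<and> hs \<in> L2_cyl T \<and>
           (\<lambda>k. L2_norm_cyl T (\<lambda>p. h (r k) p - hs p)) \<longlonglongrightarrow> 0 \<and>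
           uniform_limit (closed_cyl T)
             (\<lambda>k. Upsilon_disc T b \<sigma> (m (r k)) (r k) (h (r k))) (Upsilon T b \<sigma> hs) sequentially \<and>
           Upsilon T b \<sigma> hs (T, x0) = y \<and>
           ereal (energy T hs) = rate T b \<sigma> x0 y \<and>
           is_rate_minimizer T b \<sigma> x0 y hs \<and>
           continuous_on (closed_cyl T) (Upsilon T b \<sigma> hs) \<and>
           (\<forall>f. continuous_on (closed_cyl T) f \<longrightarrow>
                path_cost T b \<sigma> x0 y (Upsilon T b \<sigma> hs) \<le> path_cost T b \<sigma> x0 y f) \<and>
           ((\<forall>h1 h2. is_rate_minimizer T b \<sigma> x0 y h1 \<and> is_rate_minimizer T b \<sigma> x0 y h2 \<longrightarrow>
                (AE p in lborel. p \<in> cyl T \<longrightarrow> h1 p = h2 p)) \<longrightarrow>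
            (\<lambda>n. L2_norm_cyl T (\<lambda>p. h n p - hs p)) \<longlonglongrightarrow> 0 \<and>
            uniform_limit (closed_cyl T)
              (\<lambda>n. Upsilon_disc T b \<sigma> (m n) n (h n)) (Upsilon T b \<sigma> hs) sequentially)))"
proof -
  \<comment> \<open>The endpoint is a parameter of the locale, so one instance is formed for each
    \<open>x0\<close>.\<close>
  have S: "spde T b \<sigma> m x0" if "x0 \<in> cube" for x0 :: "real ^ 'd"
    by (rule spde.intro) (use dim T_pos m_pos m_lim b_C1 sigma_C1 sigma_nz that in auto)
  show ?thesis
  proof (intro conjI ballI allI impI)
    fix x0 :: "real ^ 'd" and n :: nat assume x0: "x0 \<in> cube" and n: "2 \<le> n"
    note LDP = spde.numerical_solution_LDP[OF S[OF x0] n spde.standard_gaussian_cell_noise[OF S[OF x0] n sheet]]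
    show "good_rate_function (rate_disc T b \<sigma> (m n) n x0)"
      "satisfies_LDP M (\<lambda>\<epsilon> w. numerical_solution T b \<sigma> (m n) n W \<epsilon> w (T, x0)) (rate_disc T b \<sigma> (m n) n x0)"
      by (rule LDP)+
  next
    fix x0 :: "real ^ 'd" and y assume "x0 \<in> cube"
    then show "(\<lambda>n. rate_disc T b \<sigma> (m n) n x0 y) \<longlonglongrightarrow> rate T b \<sigma> x0 y"
      by (rule spde.rate_converges[OF S])
  qed (rule spde.minimizing_sequence[OF S]; blast)
qed


end
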